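(* Let $(\Sigma,\sigma)$ be a topologically mixing countable Markov shift and let the potential $\mathcal{F}=\{f_n\}_{n=1}^{\infty}$ on $\Sigma$ be almost-additive and summable with bounded variation. For $t>1$ let $\mu_{t\mathcal{F}}$ be the (unique) equilibrium state for $t\mathcal{F}$, and write $$P(t):=P_G(t\mathcal{F}),\qquad L(t):=\mathcal{F}_*(\mu_{t\mathcal{F}}),\qquad H(t):=h(\mu_{t\mathcal{F}}).$$ Then: (1) $P$ is $C^1$ and strictly convex on $(1,\infty)$. Moreover, $P'(t)=L(t)$ for all $t\in(1,\infty)$. (2) $-L$ and $H$ are continuous and strictly decreasing on $(1,\infty)$. Moreover, the weak limit $\lim_{t\to s}\mu_{t\mathcal{F}}=\mu_{s\mathcal{F}}$ holds for any $s\in(1,\infty)$.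
   Context: Countable Markov shift: the alphabet is $\mathcal{A}=\mathbb{N}=\{1,2,\dots\}$, $\mathbf{M}=(M_{ij})_{\mathcal{A}\times\mathcal{A}}$ is a matrix of zeros and ones with no zero row and no zero column, $\Sigma=\{x=x_1x_2\cdots\in\mathcal{A}^{\mathbb{N}}: M_{x_ix_{i+1}}=1\ \forall i\in\mathbb{N}\}$, and $\sigma:\Sigma\to\Sigma$ is the shift $(\sigma(x))_i=x_{i+1}$. $\Sigma$ has the topology generated by the cylinders $[w]=\{x\in\Sigma: x_1\cdots x_n=w\}$, $w$ an admissible word of length $n$ (i.e. $M_{w_iw_{i+1}}=1$ for $1\le i<n$). $(\Sigma,\sigma)$ is topologically mixing if for all $a,b\in\mathcal{A}$ there is $N_{ab}\in\mathbb{N}$ such that for every $n\ge N_{ab}$ there is an admissible word $w_1\cdots w_n$ with $w_1=a$, $w_n=b$. Potentials: $\mathcal{F}=\{f_n\}_{n=1}^\infty$ is a sequence of continuous functions $f_n:\Sigma\to\mathbb{R}$; $t\mathcal{F}=\{tf_n\}_{n=1}^\infty$. It is almost-additive if there is $C\ge 0$ with $f_n(x)+f_m(\sigma^n x)-C\le f_{n+m}(x)\le f_n(x)+f_m(\sigma^n x)+C$ for all $n,m\in\mathbb{N}$, $x\in\Sigma$. It has bounded variation if there is $C\ge0$ with $\sup_n\sup\{|f_n(x)-f_n(y)|: x,y\in\Sigma,\ x_i=y_i,\ 1\le i\le n\}\le C$. It is summable if $\sum_{i\in\mathbb{N}}\exp(\sup (f_1|_{[i]}))<\infty$. $\mathcal{M}$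 is the set of $\sigma$-invariant Borel probability measures on $\Sigma$, with the weak (weak-star) topology, i.e. convergence against bounded continuous functions. $h(\mu)$ is the Kolmogorov–Sinai entropy of $\mu\in\mathcal{M}$, and $\mathcal{F}_*(\mu)=\lim_{n\to\infty}\frac1n\int f_n\,d\mu\in[-\infty,\infty)$. Gurevich pressure: $P_G(\mathcal{F})=\lim_{n\to\infty}\frac1n\log\big(\sum_{\sigma^nx=x}\exp(f_n(x))\chi_{[a]}(x)\big)$, which is independent of $a\in\mathcal{A}$. An equilibrium state for $t\mathcal{F}$ is a measure $\mu\in\mathcal{M}$ with $P_G(t\mathcal{F})=h(\mu)+t\mathcal{F}_*(\mu)$ (in particular $\mathcal{F}_*(\mu)>-\infty$). Under the stated hypotheses there is exactly one equilibrium state $\mu_{t\mathcal{F}}$ for each $t>1$. *)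

theory Defs
  imports "HOL-Probability.Probability"
begin

section \<open>Kolmogorov--Sinai entropy\<close>

text \<open>Finite partitions into nonempty measurable sets; null atoms are allowed.\<close>

definition finite_measurable_partition :: "'a measure \<Rightarrow> 'a set set \<Rightarrow> bool" where
  "finite_measurable_partition \<mu> \<xi> \<longleftrightarrow>
     finite \<xi> \<and> \<xi> \<subseteq> sets \<mu> \<and> partition_on (space \<mu>) \<xi>"

text \<open>The convention \<open>0 log 0 = 0\<close> holds because of the factor \<open>0\<close>.\<close>

definition partition_entropy :: "'a measure \<Rightarrow> 'a set set \<Rightarrow> real" where
  "partition_entropy \<mu> \<xi> = - (\<Sum>A\<in>\<xi>. measure \<mu> A * ln (measure \<mu> A))"

text \<open>The join of \<open>T\<^sup>-\<^sup>i \<xi>\<close> over \<open>0 \<le> i < n\<close>; only used for \<open>n \<ge> 1\<close>.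
  \<^const>\<open>common_refinement\<close> discards empty intersections.\<close>

definition iterated_join :: "'a measure \<Rightarrow> ('a \<Rightarrow> 'a) \<Rightarrow> 'a set set \<Rightarrow> nat \<Rightarrow> 'a set set" where
  "iterated_join \<mu> T \<xi> n =
     common_refinement ((\<lambda>i. (\<lambda>A. (T ^^ i) -` A \<inter> space \<mu>) ` \<xi>) ` {..<n})"

definition partition_ks_entropy :: "'a measure \<Rightarrow> ('a \<Rightarrow> 'a) \<Rightarrow> 'a set set \<Rightarrow> real" where
  "partition_ks_entropy \<mu> T \<xi> =
     lim (\<lambda>n. partition_entropy \<mu> (iterated_join \<mu> T \<xi> n) / real n)"

definition ks_entropy :: "'a measure \<Rightarrow> ('a \<Rightarrow> 'a) \<Rightarrow> ereal" where
  "ks_entropy \<mu> T =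
     (SUP \<xi> \<in> {\<xi>. finite_measurable_partition \<mu> \<xi>}. ereal (partition_ks_entropy \<mu> T \<xi>))"

section \<open>Countable Markov shifts\<close>

text \<open>The alphabet is the whole type \<^typ>\<open>nat\<close>, and sequences are indexed from \<open>0\<close>: the letter
  \<open>x\<^sub>i\<close> (\<open>i \<ge> 1\<close>) of the usual notation is \<open>x (i - 1)\<close>.\<close>

definition transition_matrix :: "(nat \<Rightarrow> nat \<Rightarrow> nat) \<Rightarrow> bool" where
  "transition_matrix M \<longleftrightarrow>
     (\<forall>i j. M i j \<in> {0, 1}) \<and> (\<forall>i. \<exists>j. M i j \<noteq> 0) \<and> (\<forall>j. \<exists>i. M i j \<noteq> 0)"

definition markov_shift :: "(nat \<Rightarrow> nat \<Rightarrow> nat) \<Rightarrow> (nat \<Rightarrow> nat) set" where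
  "markov_shift M = {x. \<forall>i. M (x i) (x (Suc i)) = 1}"

definition shift :: "(nat \<Rightarrow> nat) \<Rightarrow> nat \<Rightarrow> nat" where
  "shift x = (\<lambda>i. x (Suc i))"

definition admissible :: "(nat \<Rightarrow> nat \<Rightarrow> nat) \<Rightarrow> nat list \<Rightarrow> bool" where
  "admissible M w \<longleftrightarrow> w \<noteq> [] \<and> (\<forall>i. Suc i < length w \<longrightarrow> M (w ! i) (w ! Suc i) = 1)"

definition cylinder :: "(nat \<Rightarrow> nat \<Rightarrow> nat) \<Rightarrow> nat list \<Rightarrow> (nat \<Rightarrow> nat) set" where
  "cylinder M w = {x \<in> markov_shift M. \<forall>i<length w. x i = w ! i}"

definition shift_topology :: "(nat \<Rightarrow> nat \<Rightarrow> nat) \<Rightarrow> (nat \<Rightarrow> nat) topology" where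
  "shift_topology M = topology_generated_by {cylinder M w | w. admissible M w}"

definition topologically_mixing :: "(nat \<Rightarrow> nat \<Rightarrow> nat) \<Rightarrow> bool" where
  "topologically_mixing M \<longleftrightarrow>
     (\<forall>a b. \<exists>N. \<forall>n\<ge>N. \<exists>w. admissible M w \<and> length w = n \<and> hd w = a \<and> last w = b)"

section \<open>Potentials\<close>

text \<open>A potential is a sequence \<open>f 1, f 2, \<dots>\<close>; the value \<open>f 0\<close> is never constrained, nor are
  the values of \<open>f n\<close> outside the shift space.\<close>

type_synonym potential = "nat \<Rightarrow> (nat \<Rightarrow> nat) \<Rightarrow> real"

definition continuous_potential :: "(nat \<Rightarrow> nat \<Rightarrow> nat) \<Rightarrow> potential \<Rightarrow> bool" where
  "continuous_potential M f \<longleftrightarrow> (\<forall>n\<ge>1. continuous_map (shift_topology M) euclideanreal (f n))"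

definition almost_additive :: "(nat \<Rightarrow> nat \<Rightarrow> nat) \<Rightarrow> potential \<Rightarrow> bool" where
  "almost_additive M f \<longleftrightarrow>
     (\<exists>C\<ge>0. \<forall>n\<ge>1. \<forall>m\<ge>1. \<forall>x\<in>markov_shift M.
        f n x + f m ((shift ^^ n) x) - C \<le> f (n + m) x \<and>
        f (n + m) x \<le> f n x + f m ((shift ^^ n) x) + C)"

definition bounded_variation :: "(nat \<Rightarrow> nat \<Rightarrow> nat) \<Rightarrow> potential \<Rightarrow> bool" where
  "bounded_variation M f \<longleftrightarrow>
     (\<exists>C\<ge>0. \<forall>n\<ge>1. \<forall>x\<in>markov_shift M. \<forall>y\<in>markov_shift M.
        (\<forall>i<n. x i = y i) \<longrightarrow> \<bar>f n x - f n y\<bar> \<le> C)"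

text \<open>The real-valued supremum is only meaningful for a function bounded above on the cylinder;
  an infinite supremum would make the sum infinite.\<close>

definition summable_potential :: "(nat \<Rightarrow> nat \<Rightarrow> nat) \<Rightarrow> potential \<Rightarrow> bool" where
  "summable_potential M f \<longleftrightarrow>
     (\<forall>i. bdd_above (f 1 ` cylinder M [i])) \<and>
     summable (\<lambda>i. exp (SUP x\<in>cylinder M [i]. f 1 x))"

definition scale_potential :: "real \<Rightarrow> potential \<Rightarrow> potential" where
  "scale_potential t f = (\<lambda>n x. t * f n x)"

section \<open>Gurevich pressure\<close>

definition ln_ennreal :: "ennreal \<Rightarrow> ereal" where
  "ln_ennreal z = (if z = 0 then -\<infinity> else if z = \<infinity> then \<infinity> else ereal (ln (enn2real z)))"

text \<open>The set of periodic points may be infinite, so the sum lives in \<^typ>\<open>ennreal\<close>.\<close>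

definition partition_function ::
    "(nat \<Rightarrow> nat \<Rightarrow> nat) \<Rightarrow> potential \<Rightarrow> nat \<Rightarrow> nat \<Rightarrow> ennreal" where
  "partition_function M f a n =
     (\<Sum>\<^sub>\<infinity>x\<in>{x \<in> markov_shift M. (shift ^^ n) x = x}. ennreal (exp (f n x) * indicator (cylinder M [a]) x))"

text \<open>The common limit for all letters \<open>a\<close>.\<close>

definition gurevich_pressure :: "(nat \<Rightarrow> nat \<Rightarrow> nat) \<Rightarrow> potential \<Rightarrow> ereal" where
  "gurevich_pressure M f =
     (THE p. \<forall>a. (\<lambda>n. ereal (1 / real n) * ln_ennreal (partition_function M f a n)) \<longlonglongrightarrow> p)"

section \<open>Invariant measures and equilibrium states\<close>

definition shift_borel :: "(nat \<Rightarrow> nat \<Rightarrow> nat) \<Rightarrow> (nat \<Rightarrow> nat) measure" where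
  "shift_borel M = sigma (markov_shift M) {U. openin (shift_topology M) U}"

definition invariant_measures :: "(nat \<Rightarrow> nat \<Rightarrow> nat) \<Rightarrow> (nat \<Rightarrow> nat) measure set" where
  "invariant_measures M =
     {\<mu>. prob_space \<mu> \<and> sets \<mu> = sets (shift_borel M) \<and>
         (\<forall>A\<in>sets \<mu>. emeasure \<mu> (shift -` A \<inter> space \<mu>) = emeasure \<mu> A)}"

text \<open>The integral of a measurable function whose positive part is integrable, with values in
  \<open>[-\<infinity>, \<infinity>)\<close>. The members of a summable almost-additive potential are bounded above.\<close>

definition extended_integral :: "'a measure \<Rightarrow> ('a \<Rightarrow> real) \<Rightarrow> ereal" where
  "extended_integral \<mu> g =
     enn2ereal (\<integral>\<^sup>+ x. ennreal (g x) \<partial>\<mu>) - enn2ereal (\<integral>\<^sup>+ x. ennreal (- g x) \<partial>\<mu>)"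

definition asymptotic_mean :: "potential \<Rightarrow> (nat \<Rightarrow> nat) measure \<Rightarrow> ereal" where
  "asymptotic_mean f \<mu> = lim (\<lambda>n. ereal (1 / real n) * extended_integral \<mu> (f n))"

text \<open>The condition on the mean excludes the undefined sum \<open>\<infinity> + (-\<infinity>)\<close>, which is \<open>\<infinity>\<close> in
  \<^typ>\<open>ereal\<close>.\<close>

definition equilibrium_state ::
    "(nat \<Rightarrow> nat \<Rightarrow> nat) \<Rightarrow> potential \<Rightarrow> real \<Rightarrow> (nat \<Rightarrow> nat) measure \<Rightarrow> bool" where
  "equilibrium_state M f t \<mu> \<longleftrightarrow>
     \<mu> \<in> invariant_measures M \<and> asymptotic_mean f \<mu> > -\<infinity> \<and>
     gurevich_pressure M (scale_potential t f) = ks_entropy \<mu> shift + ereal t * asymptotic_mean f \<mu>"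

definition weak_limit ::
    "(nat \<Rightarrow> nat \<Rightarrow> nat) \<Rightarrow> ('b \<Rightarrow> (nat \<Rightarrow> nat) measure) \<Rightarrow> (nat \<Rightarrow> nat) measure \<Rightarrow> 'b filter \<Rightarrow> bool" where
  "weak_limit M \<mu> \<nu> F \<longleftrightarrow>
     (\<forall>g. continuous_map (shift_topology M) euclideanreal g \<and> bounded (g ` markov_shift M) \<longrightarrow>
        ((\<lambda>t. \<integral>x. g x \<partial>\<mu> t) \<longlongrightarrow> (\<integral>x. g x \<partial>\<nu>)) F)"

section \<open>Strict convexity\<close>

definition strictly_convex_on :: "real set \<Rightarrow> (real \<Rightarrow> real) \<Rightarrow> bool" where
  "strictly_convex_on S f \<longleftrightarrow>
     convex S \<and>
     (\<forall>x\<in>S. \<forall>y\<in>S. \<forall>u v. x \<noteq> y \<and> 0 < u \<and> 0 < v \<and> u + v = 1 \<longrightarrow>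
        f (u * x + v * y) < u * f x + v * f y)"

end

theory Submission
  imports Defs
begin

text \<open>Everything is deduced from finite sums of weights \<open>exp (t f\<^sub>n)\<close> over words. Summability makes
  letters outside a large finite set so light that the normalised word sums \<open>exp (- n P(t)) \<Sum>\<^bsub>|w| = n\<^esub> exp (t f\<^sub>n(w))\<close>
  stay bounded, although the shift need not have the big images and preimages property. Combined with
  the Gibbs inequality this gives a variational inequality for the potential perturbed by an arbitrary
  function of blocks of letters. Without perturbation it says that \<open>L(t)\<close> is a subgradient of \<open>P\<close> at \<open>t\<close>;
  perturbing by the occurrences of a word \<open>u\<close>, it bounds the mass that an equilibrium state gives to
  \<open>[u]\<close> from above and, for end letters in a finite set, from below by multiples of the weight of \<open>u\<close>.

  The two-sided bounds force ergodicity, because the components of an invariant set are again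
  equilibrium states. The ergodic theorem for \<open>\<mu>\<^sub>s\<close>, transported to \<open>\<mu>\<^sub>t\<close> by the two bounds, then gives
  \<open>\<mu>\<^sub>t \<rightarrow> \<mu>\<^sub>s\<close> on cylinders, hence weakly, and uniform integrability (here \<open>t > 1\<close> enters) gives the
  continuity of \<open>L\<close>, so that \<open>P' = L\<close>. If \<open>L\<close> took the same value at two temperatures, one measure
  would be an equilibrium state for both, which excursions to letters of very low potential forbid.\<close>


section \<open>Subadditive sequences and the Gibbs inequality\<close>

text \<open>Entropy is a supremum over finite partitions, whereas the natural generator, the
  partition into letters, is infinite. The variational inequality is therefore proved for one finite
  partition at a time, with cells approximated by sets that depend on finitely many coordinates, and
  an equilibrium state is used only through finite partitions that almost attain the pressure. A
  perturbation is a function \<open>b\<close> of blocks of length \<open>l\<close>: if inserting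
  \<open>exp b\<close> into every block raises the word sums by at most a factor
  \<open>exp \<kappa>\<close> per block, then the integral of \<open>b\<close> is at most
  \<open>\<kappa>\<close>. Each Gibbs bound is one choice of \<open>b\<close>. Words can be joined
  at uniformly bounded cost only through letters of a finite set, whence the condition on the end
  letters in the lower bound; tightness makes the excluded words negligible. Summability concerns
  exponent 1, so at \<open>t > 1\<close> a factor \<open>exp ((t - 1) * word_pot [i])\<close> is
  left over, and it absorbs unbounded functions of a letter uniformly for \<open>t\<close> near a
  given temperature.\<close>

lemma subadditive_multiple:
  fixes a :: "nat \<Rightarrow> real"
  assumes sub: "\<And>m n. m \<ge> n0 \<Longrightarrow> n \<ge> n0 \<Longrightarrow> a (m + n) \<le> a m + a n"
    and m: "m \<ge> n0" and r: "r \<ge> n0"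
  shows "a (q * m + r) \<le> real q * a m + a r"
proof (induction q)
  case (Suc q)
  have "a (Suc q * m + r) = a (m + (q * m + r))" by (simp add: algebra_simps)
  also have "\<dots> \<le> a m + a (q * m + r)" using m r by (intro sub) auto
  finally show ?case using Suc by (simp add: algebra_simps)
qed simp

text \<open>Subadditivity is assumed only from \<open>n0\<close> on, because the loop sums to which
  this is applied may vanish for small lengths, where their logarithms carry no information. The
  limit is the infimum of \<open>a n / n\<close> over \<open>n \<ge> n0\<close>, which gives the
  second conclusion at once.\<close>

lemma fekete:
  fixes a :: "nat \<Rightarrow> real"
  assumes n0: "n0 \<ge> 1"
    and sub: "\<And>m n. m \<ge> n0 \<Longrightarrow> n \<ge> n0 \<Longrightarrow> a (m + n) \<le> a m + a n"
    and lb: "\<And>n. n \<ge> n0 \<Longrightarrow> c * real n \<le> a n"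
  obtains l where "(\<lambda>n. a n / real n) \<longlonglongrightarrow> l" "\<And>n. n \<ge> n0 \<Longrightarrow> l * real n \<le> a n"
proof -
  define S where "S = (\<lambda>n. a n / real n) ` {n0..}"
  define l where "l = Inf S"
  have bdd: "bdd_below S"
    unfolding S_def using lb n0 by (intro bdd_belowI[of _ c]) (auto simp: field_simps)
  have ne: "S \<noteq> {}" unfolding S_def by auto
  have l_le: "l \<le> a n / real n" if "n \<ge> n0" for n
    unfolding l_def using bdd that by (intro cInf_lower) (auto simp: S_def)
  have "(\<lambda>n. a n / real n) \<longlonglongrightarrow> l"
  proof (rule LIMSEQ_I)
    fix e :: real assume e: "0 < e"
    have "\<exists>x\<in>S. x < l + e / 2"
      using cInf_lessD[OF ne, of "l + e/2"] e unfolding l_def by auto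
    then obtain m where m: "m \<ge> n0" "a m / real m < l + e/2" unfolding S_def by auto
    have mpos: "m > 0" using m n0 by simp
    define s where "s = a m / real m"
    define A where "A = Max ((\<lambda>r. \<bar>a r\<bar>) ` {..<n0+m})"
    have A: "\<bar>a r\<bar> \<le> A" if "r < n0 + m" for r
      unfolding A_def using that by (intro Max_ge) auto
    define D where "D = A + real (n0+m) * \<bar>s\<bar>"
    obtain N :: nat where N: "real N > D / (e/2)" using reals_Archimedean2 by blast
    show "\<exists>no. \<forall>n\<ge>no. norm (a n / real n - l) < e"
    proof (intro exI allI impI)
      fix n assume n: "n \<ge> max N (n0 + 1)"
      then have npos: "n > 0" and nn0: "n \<ge> n0" by auto
      \<comment> \<open>The remainder is taken in \<open>{n0..<n0 + m}\<close> rather than in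
        \<open>{..<m}\<close>, so that subadditivity applies to it.\<close>
      define q where "q = (n - n0) div m"
      define r where "r = (n - n0) mod m + n0"
      have nqr: "n = q * m + r" unfolding q_def r_def using nn0 by simp
      have r: "r \<ge> n0" "r < n0 + m" unfolding r_def using mpos by auto
      have "a n \<le> real q * a m + a r" unfolding nqr by (rule subadditive_multiple[OF sub m(1) r(1)])
      also have "real q * a m = real (q * m) * s" unfolding s_def using mpos by simp
      also have "\<dots> = real n * s - real r * s" unfolding nqr by (simp add: algebra_simps)
      finally have "a n \<le> real n * s - real r * s + a r" .
      moreover have "- (real r * s) \<le> real (n0+m) * \<bar>s\<bar>"
      proof -
        have "- (real r * s) \<le> real r * \<bar>s\<bar>" by (metis abs_ge_minus_self mult_minus_right mult_left_mono of_nat_0_le_iff)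
        also have "\<dots> \<le> real (n0+m) * \<bar>s\<bar>" using r by (intro mult_right_mono) auto
        finally show ?thesis .
      qed
      ultimately have "a n \<le> real n * s + D" unfolding D_def using A[OF r(2)] by linarith
      then have "a n / real n \<le> s + D / real n" using npos by (simp add: field_simps)
      moreover have "D / real n < e / 2"
      proof -
        have "D < e/2 * real N" using N e by (simp add: field_simps)
        also have "\<dots> \<le> e/2 * real n" using n e by (intro mult_left_mono) auto
        finally show ?thesis using npos by (simp add: field_simps)
      qed
      ultimately have "a n / real n < l + e" using m(2) unfolding s_def by linarith
      then show "norm (a n / real n - l) < e" using l_le[OF nn0] by (simp add: abs_if)
    qed
  qed
  moreover have "l * real n \<le> a n" if "n \<ge> n0" for n
    using l_le[OF that] that n0 by (simp add: field_simps)
  ultimately show ?thesis using that by blast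
qed

text \<open>Termwise this is \<open>ln x \<le> x - 1\<close>: nonnegativity of relative entropy, for
  weights of arbitrary total mass. The last hypothesis is absolute continuity.\<close>

lemma relative_entropy_le:
  fixes q r :: "'a \<Rightarrow> real"
  assumes "\<And>i. i \<in> I \<Longrightarrow> q i \<ge> 0" "\<And>i. i \<in> I \<Longrightarrow> r i \<ge> 0"
    and "\<And>i. i \<in> I \<Longrightarrow> q i > 0 \<Longrightarrow> r i > 0"
  shows "(\<Sum>i\<in>I. q i * (ln (r i) - ln (q i))) \<le> (\<Sum>i\<in>I. r i) - (\<Sum>i\<in>I. q i)"
proof -
  have "q i * (ln (r i) - ln (q i)) \<le> r i - q i" if i: "i \<in> I" for i
  proof (cases "q i = 0")
    case False
    then have q: "q i > 0" and r: "r i > 0" using assms i by (force simp: less_le)+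
    have "q i * (ln (r i) - ln (q i)) = q i * ln (r i / q i)" using q r by (simp add: ln_div)
    also have "\<dots> \<le> q i * (r i / q i - 1)" using q r by (intro mult_left_mono ln_le_minus_one) auto
    also have "\<dots> = r i - q i" using q by (simp add: field_simps)
    finally show ?thesis .
  qed (use assms(2)[OF i] in simp)
  then show ?thesis by (simp add: sum_subtractf[symmetric] sum_mono)
qed

text \<open>The relative entropy of \<open>q\<close> with respect to the normalised weights
  \<open>exp (G i) / Z\<close>. It is the finite form of the variational principle, through which
  entropy is bounded by word sums.\<close>

lemma gibbs_inequality:
  fixes q G :: "'a \<Rightarrow> real"
  assumes I: "finite I" and q: "\<And>i. i \<in> I \<Longrightarrow> q i \<ge> 0" and q1: "(\<Sum>i\<in>I. q i) = 1"
  shows "(\<Sum>i\<in>I. q i * G i) - (\<Sum>i\<in>I. q i * ln (q i)) \<le> ln (\<Sum>i\<in>I. exp (G i))"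
proof -
  define Z where "Z = (\<Sum>i\<in>I. exp (G i))"
  have ne: "I \<noteq> {}" using q1 by auto
  have Z: "Z > 0" unfolding Z_def using I ne by (intro sum_pos) auto
  have "(\<Sum>i\<in>I. q i * (ln (exp (G i) / Z) - ln (q i))) \<le> (\<Sum>i\<in>I. exp (G i) / Z) - (\<Sum>i\<in>I. q i)"
    using q Z by (intro relative_entropy_le) auto
  also have "\<dots> = 0" using Z q1 by (simp add: sum_divide_distrib[symmetric] Z_def)
  also have "(\<Sum>i\<in>I. q i * (ln (exp (G i) / Z) - ln (q i)))
      = (\<Sum>i\<in>I. q i * G i) - (\<Sum>i\<in>I. q i * ln (q i)) - ln Z * (\<Sum>i\<in>I. q i)"
    using Z by (simp add: ln_div algebra_simps sum.distrib sum_subtractf sum_distrib_left)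
  finally show ?thesis using q1 by (simp add: Z_def)
qed

section \<open>Admissible words and their weights\<close>

definition prefix_word :: "nat \<Rightarrow> (nat \<Rightarrow> nat) \<Rightarrow> nat list" where
  "prefix_word n x = map x [0..<n]"

definition words_over :: "'a set \<Rightarrow> nat \<Rightarrow> 'a list set" where
  "words_over S n = {w. length w = n \<and> set w \<subseteq> S}"

lemma finite_words_over [simp]: "finite S \<Longrightarrow> finite (words_over S n)"
  unfolding words_over_def using finite_lists_length_eq[of S n] by (simp add: conj_commute)

lemma sum_words_over_append:
  fixes g :: "'a list \<Rightarrow> real"
  shows "(\<Sum>w\<in>words_over S (n + m). g w) = (\<Sum>u\<in>words_over S n. \<Sum>v\<in>words_over S m. g (u @ v))"
proof -
  have "bij_betw (\<lambda>(u, v). u @ v) (words_over S n \<times> words_over S m) (words_over S (n + m))"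
  proof (rule bij_betw_byWitness[where f' = "\<lambda>w. (take n w, drop n w)"])
    show "(\<lambda>w. (take n w, drop n w)) ` words_over S (n + m) \<subseteq> words_over S n \<times> words_over S m"
      unfolding words_over_def using set_take_subset set_drop_subset by fastforce
  qed (auto simp: words_over_def)
  from sum.reindex_bij_betw[OF this, of g, symmetric] show ?thesis
    by (simp add: sum.cartesian_product split_def)
qed

lemma sum_words_over_1:
  fixes g :: "'a list \<Rightarrow> real"
  shows "(\<Sum>w\<in>words_over S (Suc 0). g w) = (\<Sum>a\<in>S. g [a])"
proof -
  have "words_over S (Suc 0) = (\<lambda>a. [a]) ` S"
    unfolding words_over_def by (auto simp: length_Suc_conv)
  then show ?thesis by (simp add: sum.reindex inj_on_def)
qed

lemma words_over_0 [simp]: "words_over S 0 = {[]}"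
  unfolding words_over_def by auto

text \<open>Truncating the alphabet keeps all word sums finite; bounds uniform in \<open>N\<close>
  take the place of infinite sums.\<close>

abbreviation bounded_words :: "nat \<Rightarrow> nat \<Rightarrow> nat list set" where
  "bounded_words n N \<equiv> words_over {..<N} n"

lemma bounded_words_mono: "N \<le> N' \<Longrightarrow> bounded_words n N \<subseteq> bounded_words n N'"
  unfolding words_over_def by auto

lemma finite_words_bounded:
  assumes "finite V" "\<And>w. w \<in> V \<Longrightarrow> length w = n"
  obtains N where "N \<ge> N0" "V \<subseteq> bounded_words n N"
proof -
  have "finite (\<Union>w\<in>V. set w)" using assms by auto
  then obtain k where "\<forall>i\<in>(\<Union>w\<in>V. set w). i < k" using finite_nat_set_iff_bounded by auto
  then have "V \<subseteq> bounded_words n (max k N0)" using assms unfolding words_over_def by fastforce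
  then show ?thesis using that[of "max k N0"] by simp
qed

lemma shift_funpow: "(shift ^^ n) x = (\<lambda>i. x (n + i))"
  by (induction n) (auto simp: shift_def)

lemma length_prefix_word [simp]: "length (prefix_word n x) = n"
  by (simp add: prefix_word_def)

lemma nth_prefix_word [simp]: "i < n \<Longrightarrow> prefix_word n x ! i = x i"
  by (simp add: prefix_word_def)

lemma prefix_word_0 [simp]: "prefix_word 0 x = []"
  by (simp add: prefix_word_def)

lemma prefix_word_eq_iff: "prefix_word n x = w \<longleftrightarrow> length w = n \<and> (\<forall>i<n. x i = w ! i)"
  by (auto simp: list_eq_iff_nth_eq)

lemma prefix_word_add: "prefix_word (n + m) x = prefix_word n x @ prefix_word m ((shift ^^ n) x)"
  by (auto simp: list_eq_iff_nth_eq nth_append shift_funpow)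

lemma prefix_word_1: "prefix_word (Suc 0) x = [x 0]"
  by (simp add: prefix_word_def)

lemma take_prefix_word: "n \<le> m \<Longrightarrow> take n (prefix_word m x) = prefix_word n x"
  by (auto simp: list_eq_iff_nth_eq)

lemma drop_prefix_word: "drop n (prefix_word m x) = prefix_word (m - n) ((shift ^^ n) x)"
  by (auto simp: list_eq_iff_nth_eq shift_funpow)

text \<open>The existentially quantified constants are fixed as parameters, so that everything built
  from them, such as \<open>D\<close>, is the same for all measures and all temperatures.\<close>

locale cms_potential =
  fixes M :: "nat \<Rightarrow> nat \<Rightarrow> nat" and f :: potential and C B :: real
  assumes matrix: "transition_matrix M"
    and mixing: "topologically_mixing M"
    and continuous: "continuous_potential M f"
    and C_nonneg: "C \<ge> 0"
    and almost_add: "\<And>n m x. n \<ge> 1 \<Longrightarrow> m \<ge> 1 \<Longrightarrow> x \<in> markov_shift M \<Longrightarrow>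
        \<bar>f (n + m) x - (f n x + f m ((shift ^^ n) x))\<bar> \<le> C"
    and B_nonneg: "B \<ge> 0"
    and bounded_var: "\<And>n x y. n \<ge> 1 \<Longrightarrow> x \<in> markov_shift M \<Longrightarrow> y \<in> markov_shift M \<Longrightarrow>
        (\<forall>i<n. x i = y i) \<Longrightarrow> \<bar>f n x - f n y\<bar> \<le> B"
    and summable: "summable_potential M f"
begin

abbreviation "X \<equiv> markov_shift M"

definition adm :: "nat list \<Rightarrow> bool" where
  "adm w \<longleftrightarrow> successively (\<lambda>i j. M i j = 1) w"

definition rep :: "nat list \<Rightarrow> nat \<Rightarrow> nat" where
  "rep w = (SOME x. x \<in> cylinder M w)"

text \<open>The value at one chosen point of the cylinder replaces the usual supremum over it; for
  nonempty admissible words the two differ by at most \<open>B\<close>.\<close>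

definition word_pot :: "nat list \<Rightarrow> real" where
  "word_pot w = f (length w) (rep w)"

text \<open>The value 1 at the empty word keeps the unconstrained \<open>f 0\<close> out of the sums
  and makes \<open>[]\<close> neutral for concatenation.\<close>

definition wt :: "real \<Rightarrow> nat list \<Rightarrow> real" where
  "wt t w = (if adm w then if w = [] then 1 else exp (t * word_pot w) else 0)"

text \<open>The cost of one concatenation: \<open>C\<close> for splitting the potential, and
  \<open>B\<close> for each of the words \<open>u @ v\<close>, \<open>u\<close> and
  \<open>v\<close>, whose potentials are read at different points.\<close>

definition D :: real where "D = C + 3 * B"

lemma D_nonneg: "D \<ge> 0" using C_nonneg B_nonneg unfolding D_def by simp

lemma adm_Nil [simp]: "adm []" by (simp add: adm_def)

lemma adm_single [simp]: "adm [i]" by (simp add: adm_def)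

lemma adm_nth: "adm w \<longleftrightarrow> (\<forall>i. Suc i < length w \<longrightarrow> M (w ! i) (w ! Suc i) = 1)"
  unfolding adm_def by (simp add: successively_conv_nth)

lemma adm_append: "adm (u @ v) \<longleftrightarrow> adm u \<and> adm v \<and> (u = [] \<or> v = [] \<or> M (last u) (hd v) = 1)"
  unfolding adm_def by (auto simp: successively_append_iff)

lemma shift_closed: "x \<in> X \<Longrightarrow> (shift ^^ n) x \<in> X"
  by (auto simp: markov_shift_def shift_funpow)

lemma shift_closed1: "x \<in> X \<Longrightarrow> shift x \<in> X"
  by (auto simp: markov_shift_def shift_def)

lemma adm_prefix_word: "x \<in> X \<Longrightarrow> adm (prefix_word n x)"
  by (auto simp: adm_nth markov_shift_def)

lemma cylinder_iff: "x \<in> cylinder M w \<longleftrightarrow> x \<in> X \<and> prefix_word (length w) x = w"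
  by (auto simp: cylinder_def prefix_word_eq_iff)

lemma exists_successor: "\<exists>j. M i j = 1"
  using matrix unfolding transition_matrix_def by (metis empty_iff insert_iff)

text \<open>As no row of the matrix vanishes, each letter has a successor, and an admissible word
  can be continued forever; the empty word is continued from the letter 0.\<close>

lemma adm_nonempty:
  assumes "adm w"
  shows "\<exists>x. x \<in> cylinder M w"
proof -
  define v where "v = (if w = [] then [0] else w)"
  have v: "v \<noteq> []" "adm v" "length w \<le> length v" and vw: "take (length w) v = w"
    using assms unfolding v_def by auto
  obtain nxt where nxt: "\<And>i. M i (nxt i) = 1" using exists_successor by metis
  define x where "x = (\<lambda>k. if k < length v then v ! k else (nxt ^^ (k + 1 - length v)) (last v))"
  have "M (x k) (x (Suc k)) = 1" for k
  proof -
    consider "Suc k < length v" | "Suc k = length v" | "length v \<le> k" by linarith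
    then show ?thesis
    proof cases
      case 1 then show ?thesis using v(2) unfolding x_def adm_nth by auto
    next
      case 2
      then have "v ! k = last v" using v(1) by (metis diff_Suc_1 last_conv_nth)
      then show ?thesis unfolding x_def using 2 nxt by auto
    next
      case 3
      then have "Suc k + 1 - length v = Suc (k + 1 - length v)" by simp
      then show ?thesis unfolding x_def using 3 nxt by simp
    qed
  qed
  then have "x \<in> X" unfolding markov_shift_def by auto
  moreover have "x i = w ! i" if "i < length w" for i
  proof -
    have "v ! i = w ! i" using vw that by (metis nth_take)
    then show ?thesis using that v(3) unfolding x_def by auto
  qed
  ultimately have "x \<in> cylinder M w" unfolding cylinder_def by auto
  then show ?thesis by blast
qed

lemma rep: "adm w \<Longrightarrow> rep w \<in> X \<and> prefix_word (length w) (rep w) = w"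
  unfolding rep_def using adm_nonempty[of w] someI_ex[of "\<lambda>x. x \<in> cylinder M w"]
  by (auto simp: cylinder_iff)

lemma word_pot_prefix: "n \<ge> 1 \<Longrightarrow> x \<in> X \<Longrightarrow> \<bar>f n x - word_pot (prefix_word n x)\<bar> \<le> B"
proof -
  assume n: "n \<ge> 1" and x: "x \<in> X"
  let ?w = "prefix_word n x"
  have "rep ?w \<in> X" "prefix_word n (rep ?w) = ?w" using rep[OF adm_prefix_word[OF x, of n]] by auto
  then have "\<forall>i<n. x i = rep ?w i" by (metis nth_prefix_word)
  then show ?thesis unfolding word_pot_def using bounded_var[OF n x \<open>rep ?w \<in> X\<close>] by simp
qed

lemma word_pot_append:
  assumes "adm (u @ v)" "u \<noteq> []" "v \<noteq> []"
  shows "\<bar>word_pot (u @ v) - (word_pot u + word_pot v)\<bar> \<le> D"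
proof -
  define n m where "n = length u" and "m = length v"
  have nm: "n \<ge> 1" "m \<ge> 1" using assms unfolding n_def m_def by (auto simp: Suc_le_eq)
  obtain x where x: "x \<in> X" and px: "prefix_word (n + m) x = u @ v"
    using rep[OF assms(1)] unfolding n_def m_def by auto
  have "prefix_word n x @ prefix_word m ((shift ^^ n) x) = u @ v" using px by (simp add: prefix_word_add)
  then have pu: "prefix_word n x = u" and pv: "prefix_word m ((shift ^^ n) x) = v"
    by (auto simp: n_def)
  have "\<bar>f (n+m) x - word_pot (u @ v)\<bar> \<le> B" using word_pot_prefix[of "n+m" x] nm x px by simp
  moreover have "\<bar>f n x - word_pot u\<bar> \<le> B" using word_pot_prefix[of n x] nm x pu by simp
  moreover have "\<bar>f m ((shift ^^ n) x) - word_pot v\<bar> \<le> B"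
    using word_pot_prefix[of m "(shift ^^ n) x"] nm shift_closed[OF x] pv by simp
  moreover have "\<bar>f (n + m) x - (f n x + f m ((shift ^^ n) x))\<bar> \<le> C" using almost_add nm x by simp
  ultimately show ?thesis unfolding D_def by linarith
qed

lemma wt_nonneg: "wt t w \<ge> 0" by (simp add: wt_def)

lemma wt_pos: "adm w \<Longrightarrow> wt t w > 0" by (simp add: wt_def)

lemma wt_not_adm: "\<not> adm w \<Longrightarrow> wt t w = 0" by (simp add: wt_def)

lemma wt_Nil [simp]: "wt t [] = 1" by (simp add: wt_def)

text \<open>An inadmissible concatenation has weight 0, so this bound covers arbitrary words, while
  the reverse bound is confined to words that can be joined.\<close>

lemma wt_append_le:
  assumes "t \<ge> 0"
  shows "wt t (u @ v) \<le> exp (t * D) * (wt t u * wt t v)"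
proof (cases "adm (u @ v) \<and> u \<noteq> [] \<and> v \<noteq> []")
  case True
  then have uv: "adm u" "adm v" using adm_append by auto
  have "word_pot (u @ v) \<le> D + word_pot u + word_pot v" using word_pot_append[of u v] True by (simp add: abs_le_iff)
  then have "t * word_pot (u @ v) \<le> t * (D + word_pot u + word_pot v)" using assms by (rule mult_left_mono)
  then show ?thesis using True uv by (simp add: wt_def mult_exp_exp algebra_simps)
next
  case False
  have "1 \<le> exp (t * D)" using assms D_nonneg by simp
  then have *: "a \<le> exp (t * D) * a" if "a \<ge> 0" for a :: real
    using that mult_right_mono[of 1 "exp (t * D)" a] by simp
  show ?thesis
  proof (cases "u = [] \<or> v = []")
    case True
    then show ?thesis using *[OF wt_nonneg] by auto
  next
    case nonempty: False
    then have "wt t (u @ v) = 0" using False by (simp add: wt_not_adm)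
    then show ?thesis by (simp add: wt_nonneg)
  qed
qed

lemma wt_append_ge:
  assumes "t \<ge> 0" "adm (u @ v)"
  shows "exp (- (t * D)) * (wt t u * wt t v) \<le> wt t (u @ v)"
proof (cases "u \<noteq> [] \<and> v \<noteq> []")
  case True
  then have uv: "adm u" "adm v" using adm_append assms by auto
  have "word_pot (u @ v) \<ge> - D + word_pot u + word_pot v" using word_pot_append[of u v] True assms by (simp add: abs_le_iff)
  then have "t * (- D + word_pot u + word_pot v) \<le> t * word_pot (u @ v)" using assms(1) by (rule mult_left_mono)
  then show ?thesis using True uv assms by (simp add: wt_def mult_exp_exp algebra_simps)
next
  case False
  have "exp (- (t * D)) \<le> 1" using assms D_nonneg by simp
  then have *: "exp (- (t * D)) * a \<le> a" if "a \<ge> 0" for a :: real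
    using that mult_right_mono[of "exp (- (t * D))" 1 a] by simp
  show ?thesis using False *[OF wt_nonneg] by auto
qed

section \<open>Summability over letters\<close>

lemma letter_pot_le: "word_pot [i] \<le> (SUP x\<in>cylinder M [i]. f 1 x)"
proof -
  have "rep [i] \<in> cylinder M [i]" using rep[of "[i]"] by (simp add: cylinder_iff)
  moreover have "bdd_above (f 1 ` cylinder M [i])"
    using summable unfolding summable_potential_def by (elim conjE allE)
  ultimately have "f 1 (rep [i]) \<le> (SUP x\<in>cylinder M [i]. f 1 x)" by (rule cSUP_upper)
  then show ?thesis unfolding word_pot_def by simp
qed

lemma summable_letters: "summable (\<lambda>i. exp (word_pot [i]))"
proof (rule summable_comparison_test')
  show "summable (\<lambda>i. exp (SUP x\<in>cylinder M [i]. f 1 x))"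
    using summable unfolding summable_potential_def by blast
  show "norm (exp (word_pot [i])) \<le> exp (SUP x\<in>cylinder M [i]. f 1 x)" for i
    using letter_pot_le[of i] by (simp only: real_norm_def abs_exp_cancel exp_le_cancel_iff)
qed

lemma letter_tail:
  assumes "e > 0"
  obtains N where "\<And>n. (\<Sum>i\<in>{N..<n}. exp (word_pot [i])) < e"
proof -
  from summable_letters obtain N where N: "\<forall>m\<ge>N. \<forall>n. norm (\<Sum>i = m..<n. exp (word_pot [i])) < e"
    unfolding summable_Cauchy using assms by blast
  show ?thesis using N that[of N] by (auto simp: sum_nonneg)
qed

text \<open>The terms of the convergent series of \<open>exp (word_pot [i])\<close> tend to 0, so
  the potential of a letter tends to minus infinity.\<close>

lemma letter_pot_neg: obtains N where "\<And>i. i \<ge> N \<Longrightarrow> word_pot [i] \<le> - R"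
proof -
  have "exp (-R) > 0" by simp
  then obtain N where N: "\<And>n. (\<Sum>i\<in>{N..<n}. exp (word_pot [i])) < exp (- R)" using letter_tail by blast
  have "word_pot [i] \<le> - R" if "i \<ge> N" for i
  proof -
    have "exp (word_pot [i]) \<le> (\<Sum>i\<in>{N..<Suc i}. exp (word_pot [i]))"
      using that by (intro member_le_sum) auto
    also have "\<dots> < exp (- R)" by (rule N)
    finally show ?thesis by simp
  qed
  then show ?thesis using that by blast
qed

lemma letter_pot_bounded: obtains S where "S \<ge> 0" "\<And>i. word_pot [i] \<le> S"
proof -
  define T where "T = suminf (\<lambda>i. exp (word_pot [i]))"
  have "exp (word_pot [i]) \<le> T" for i
    unfolding T_def using sum_le_suminf[OF summable_letters, of "{i}"] by simp
  then have "word_pot [i] \<le> ln T" for i by (metis exp_gt_zero ln_exp ln_mono dual_order.strict_trans1)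
  then have "word_pot [i] \<le> \<bar>ln T\<bar>" for i by (meson abs_ge_self order_trans)
  then show ?thesis using that by (metis abs_ge_zero)
qed

lemma connecting_words:
  obtains N where "\<And>n. n \<ge> N \<Longrightarrow> \<exists>w. adm w \<and> length w = n \<and> hd w = a \<and> last w = b"
proof -
  obtain N where N: "\<forall>n\<ge>N. \<exists>w. admissible M w \<and> length w = n \<and> hd w = a \<and> last w = b"
    using mixing unfolding topologically_mixing_def by blast
  have "adm w" if "admissible M w" for w using that unfolding admissible_def adm_nth by auto
  then show ?thesis using that N by meson
qed

end

section \<open>The Gurevich pressure\<close>

definition periodic_seq :: "nat list \<Rightarrow> nat \<Rightarrow> nat" where
  "periodic_seq w = (\<lambda>i. w ! (i mod length w))"

lemma prefix_periodic_seq: "prefix_word (length w) (periodic_seq w) = w"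
  by (simp add: prefix_word_eq_iff periodic_seq_def)

text \<open>A point of period \<open>n\<close> is the repetition of its first \<open>n\<close>
  letters; this makes the passage from periodic points to loops injective.\<close>

lemma periodic_inj:
  assumes "n \<ge> 1" "(shift ^^ n) x = x" "(shift ^^ n) y = y" "prefix_word n x = prefix_word n y"
  shows "x = y"
proof -
  have per: "z i = z (i mod n)" if "(shift ^^ n) z = z" for z :: "nat \<Rightarrow> nat" and i
  proof -
    have "z (q * n + j) = z j" for q j
    proof (induction q)
      case (Suc q)
      have "z (n + (q * n + j)) = z (q * n + j)" using that by (metis shift_funpow)
      then show ?case using Suc by (simp add: algebra_simps)
    qed simp
    from this[of "i div n" "i mod n"] show ?thesis by simp
  qed
  have "x j = y j" if "j < n" for j using assms(4) that by (metis nth_prefix_word)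
  then have "x (i mod n) = y (i mod n)" for i using assms(1) by simp
  then show ?thesis using per[OF assms(2)] per[OF assms(3)] by (metis ext)
qed

context cms_potential
begin

text \<open>These words are the first periods of the points counted by the partition function at
  \<open>a\<close>, over a truncated alphabet.\<close>

definition loops :: "nat \<Rightarrow> nat \<Rightarrow> nat \<Rightarrow> nat list set" where
  "loops a n N = {w \<in> bounded_words n N. w \<noteq> [] \<and> hd w = a \<and> adm w \<and> M (last w) a = 1}"

definition loop_sum :: "real \<Rightarrow> nat \<Rightarrow> nat \<Rightarrow> nat \<Rightarrow> real" where
  "loop_sum t a n N = (\<Sum>w\<in>loops a n N. wt t w)"

text \<open>The limit of the truncated sums along increasing alphabets; it agrees with the partition
  function up to the factor \<open>exp (t * B)\<close> in either direction.\<close>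

definition loop_total :: "real \<Rightarrow> nat \<Rightarrow> nat \<Rightarrow> real" where
  "loop_total t a n = (SUP N. loop_sum t a n N)"

text \<open>The conversion to a real number loses nothing for \<open>t \<ge> 1\<close>, where the
  pressure turns out to be finite.\<close>

definition press :: "real \<Rightarrow> real" where
  "press t = real_of_ereal (gurevich_pressure M (scale_potential t f))"

lemma finite_loops [simp]: "finite (loops a n N)"
  unfolding loops_def by simp

lemma loop_sum_mono: "N \<le> N' \<Longrightarrow> loop_sum t a n N \<le> loop_sum t a n N'"
  unfolding loop_sum_def using bounded_words_mono[of N N' n]
  by (intro sum_mono2) (auto simp: loops_def wt_nonneg)

text \<open>Splitting off the first letter reduces the sum to one-letter sums. These converge for
  \<open>t \<ge> 1\<close>: the potential of a letter is bounded above, so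
  \<open>exp (t * word_pot [i])\<close> is at most a constant times
  \<open>exp (word_pot [i])\<close>.\<close>

lemma sum_wt_le_power:
  assumes "t \<ge> 1"
  obtains T where "T \<ge> 1" "\<And>n N. (\<Sum>w\<in>bounded_words n N. wt t w) \<le> T ^ n"
proof -
  obtain S where S: "S \<ge> 0" "\<And>i. word_pot [i] \<le> S" by (fact letter_pot_bounded)
  define Q where "Q = exp ((t - 1) * S) * suminf (\<lambda>i. exp (word_pot [i]))"
  have Q: "(\<Sum>i<N. wt t [i]) \<le> Q" for N
  proof -
    have "(\<Sum>i<N. wt t [i]) \<le> (\<Sum>i<N. exp ((t - 1) * S) * exp (word_pot [i]))"
    proof (rule sum_mono)
      fix i
      have "(t - 1) * word_pot [i] \<le> (t - 1) * S" using S assms by (intro mult_left_mono) auto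
      then have "t * word_pot [i] \<le> (t - 1) * S + word_pot [i]" by (simp add: algebra_simps)
      then show "wt t [i] \<le> exp ((t - 1) * S) * exp (word_pot [i])"
        by (simp add: wt_def mult_exp_exp)
    qed
    also have "\<dots> \<le> Q" unfolding Q_def sum_distrib_left[symmetric]
      by (intro mult_left_mono sum_le_suminf summable_letters) auto
    finally show ?thesis .
  qed
  define T where "T = max 1 (exp (t * D) * Q)"
  have step: "exp (t * D) * (\<Sum>i<N. wt t [i]) \<le> T" for N
    using Q[of N] unfolding T_def le_max_iff_disj by (intro disjI2 mult_left_mono) auto
  have "(\<Sum>w\<in>bounded_words n N. wt t w) \<le> T ^ n" for n N
  proof (induction n)
    case (Suc n)
    have "(\<Sum>w\<in>bounded_words (Suc n) N. wt t w)
      = (\<Sum>u\<in>bounded_words (Suc 0) N. \<Sum>v\<in>bounded_words n N. wt t (u @ v))"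
      using sum_words_over_append[of "wt t" "{..<N}" "Suc 0" n] by simp
    also have "\<dots> \<le> (\<Sum>u\<in>bounded_words (Suc 0) N. \<Sum>v\<in>bounded_words n N. exp (t * D) * (wt t u * wt t v))"
      using assms by (intro sum_mono wt_append_le) simp
    also have "\<dots> = exp (t * D) * (\<Sum>i<N. wt t [i]) * (\<Sum>v\<in>bounded_words n N. wt t v)"
      unfolding mult.assoc sum_words_over_1[symmetric] sum_product unfolding sum_distrib_left ..
    also have "\<dots> \<le> T * T ^ n" using Suc step
      by (intro mult_mono) (auto simp: T_def intro!: sum_nonneg wt_nonneg)
    finally show ?case by simp
  qed simp
  then show ?thesis using that[of T] unfolding T_def by simp
qed

lemma loop_sum_bdd:
  assumes "t \<ge> 1"
  shows "bdd_above (range (loop_sum t a n))"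
proof -
  obtain T where "T \<ge> 1" and T: "\<And>n N. (\<Sum>w\<in>bounded_words n N. wt t w) \<le> T ^ n"
    by (fact sum_wt_le_power[OF assms])
  have "loop_sum t a n N \<le> T ^ n" for N
  proof -
    have "loop_sum t a n N \<le> (\<Sum>w\<in>bounded_words n N. wt t w)"
      unfolding loop_sum_def by (intro sum_mono2) (auto simp: loops_def wt_nonneg)
    then show ?thesis using T[of N n] by simp
  qed
  then show ?thesis by (intro bdd_aboveI) auto
qed

lemma loop_sum_le_total: "t \<ge> 1 \<Longrightarrow> loop_sum t a n N \<le> loop_total t a n"
  unfolding loop_total_def using loop_sum_bdd by (intro cSUP_upper) auto

lemma loop_total_le: "(\<And>N. loop_sum t a n N \<le> c) \<Longrightarrow> loop_total t a n \<le> c"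
  unfolding loop_total_def by (intro cSUP_least) auto

lemma loop_total_upper:
  assumes "t \<ge> 1"
  obtains T where "T \<ge> 1" "\<And>a n. loop_total t a n \<le> T ^ n"
proof -
  obtain T where T: "T \<ge> 1" "\<And>n N. (\<Sum>w\<in>bounded_words n N. wt t w) \<le> T ^ n"
    by (fact sum_wt_le_power[OF assms])
  have "loop_total t a n \<le> T ^ n" for a n
  proof (rule loop_total_le)
    fix N
    have "loop_sum t a n N \<le> (\<Sum>w\<in>bounded_words n N. wt t w)"
      unfolding loop_sum_def by (intro sum_mono2) (auto simp: loops_def wt_nonneg)
    then show "loop_sum t a n N \<le> T ^ n" using T(2)[of N n] by simp
  qed
  then show ?thesis using that T by blast
qed

lemma loop_sum_tendsto: "t \<ge> 1 \<Longrightarrow> loop_sum t a n \<longlonglongrightarrow> loop_total t a n"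
  unfolding loop_total_def
  by (intro LIMSEQ_incseq_SUP loop_sum_bdd) (auto simp: incseq_def intro: loop_sum_mono)

lemma loop_append:
  assumes "u \<in> loops a n N" "v \<in> loops a m N"
  shows "u @ v \<in> loops a (n + m) N"
  using assms unfolding loops_def words_over_def by (auto simp: adm_append)

text \<open>Two loops at \<open>a\<close> concatenate to a loop at \<open>a\<close>, injectively
  once the lengths are fixed. This is the supermultiplicativity that Fekete's lemma needs, up to the
  cost of one concatenation.\<close>

lemma loop_sum_mult:
  assumes "t \<ge> 0"
  shows "loop_sum t a n N * loop_sum t a m N \<le> exp (t * D) * loop_sum t a (n + m) N"
proof -
  let ?L = "loops a n N \<times> loops a m N"
  have inj: "inj_on (\<lambda>(u, v). u @ v) ?L" unfolding inj_on_def loops_def words_over_def by auto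
  have "loop_sum t a n N * loop_sum t a m N = (\<Sum>(u, v)\<in>?L. wt t u * wt t v)"
    unfolding loop_sum_def by (simp add: sum_product sum.cartesian_product)
  also have "\<dots> \<le> (\<Sum>(u, v)\<in>?L. exp (t * D) * wt t (u @ v))"
  proof (rule sum_mono, clarify)
    fix u v assume "u \<in> loops a n N" "v \<in> loops a m N"
    then have "adm (u @ v)" using loop_append by (auto simp: loops_def)
    from wt_append_ge[OF assms this]
    have "exp (t * D) * (exp (- (t * D)) * (wt t u * wt t v)) \<le> exp (t * D) * wt t (u @ v)" by simp
    then show "wt t u * wt t v \<le> exp (t * D) * wt t (u @ v)" by (simp add: exp_minus field_simps)
  qed
  also have "\<dots> = exp (t * D) * (\<Sum>w\<in>(\<lambda>(u, v). u @ v) ` ?L. wt t w)"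
    using sum.reindex[OF inj, of "wt t"] by (simp add: sum_distrib_left split_def)
  also have "\<dots> \<le> exp (t * D) * loop_sum t a (n + m) N"
    unfolding loop_sum_def using loop_append
    by (intro mult_left_mono sum_mono2) (auto simp: wt_nonneg)
  finally show ?thesis .
qed

lemma loop_total_mult:
  assumes "t \<ge> 1"
  shows "loop_total t a n * loop_total t a m \<le> exp (t * D) * loop_total t a (n + m)"
  using assms
  by (intro LIMSEQ_le[OF tendsto_mult[OF loop_sum_tendsto[of t a n] loop_sum_tendsto[of t a m]]
        tendsto_mult_left[OF loop_sum_tendsto[of t a "n + m"], of "exp (t * D)"]])
     (auto intro!: loop_sum_mult)

text \<open>A connecting word with its last letter dropped. In this form it can be put in front of a
  word starting with \<open>b\<close> without repeating that letter.\<close>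

lemma connecting_path:
  obtains n0 where "\<And>n. n \<ge> n0 \<Longrightarrow> \<exists>w. adm w \<and> w \<noteq> [] \<and> length w = n \<and> hd w = a \<and> M (last w) b = 1"
proof -
  obtain N where N: "\<And>n. n \<ge> N \<Longrightarrow> \<exists>w. adm w \<and> length w = n \<and> hd w = a \<and> last w = b"
    by (fact connecting_words)
  have "\<exists>w. adm w \<and> w \<noteq> [] \<and> length w = n \<and> hd w = a \<and> M (last w) b = 1" if n: "n \<ge> max N 1" for n
  proof -
    obtain v where v: "adm v" "length v = Suc n" "hd v = a" "last v = b" using N[of "Suc n"] n by auto
    have vne: "v \<noteq> []" "butlast v \<noteq> []" using v(2) n by (auto simp: butlast_conv_take)
    have veq: "v = butlast v @ [b]" using vne v(4) by (metis append_butlast_last_id)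
    have "adm (butlast v)" "M (last (butlast v)) b = 1" using v(1) vne adm_append[of "butlast v" "[b]"] veq by auto
    moreover have "hd (butlast v) = a" using v(3) vne veq by (metis hd_append2)
    moreover have "length (butlast v) = n" using v(2) by simp
    ultimately show ?thesis using vne by blast
  qed
  then show ?thesis using that by blast
qed

text \<open>A single loop of each large length suffices, so the threshold is dictated by the matrix
  and is the same for all \<open>t\<close>.\<close>

lemma loop_total_pos:
  obtains n0 where "n0 \<ge> 1" "\<And>t n. t \<ge> 1 \<Longrightarrow> n \<ge> n0 \<Longrightarrow> loop_total t a n > 0"
proof -
  obtain n0 where n0: "\<And>n. n \<ge> n0 \<Longrightarrow> \<exists>w. adm w \<and> w \<noteq> [] \<and> length w = n \<and> hd w = a \<and> M (last w) a = 1"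
    by (fact connecting_path)
  have "loop_total t a n > 0" if t: "t \<ge> 1" and n: "n \<ge> max n0 1" for t n
  proof -
    obtain w where w: "adm w" "w \<noteq> []" "length w = n" "hd w = a" "M (last w) a = 1" using n0[of n] n by auto
    obtain N where N: "{w} \<subseteq> bounded_words n N" using finite_words_bounded[of "{w}" n 0] w(3) by auto
    have "w \<in> loops a n N" using w N by (auto simp: loops_def)
    then have "wt t w \<le> loop_sum t a n N" unfolding loop_sum_def
      by (intro member_le_sum) (auto simp: wt_nonneg)
    then show ?thesis using wt_pos[OF w(1), of t] loop_sum_le_total[OF t, of a n N] by linarith
  qed
  then show ?thesis using that[of "max n0 1"] by simp
qed

text \<open>Enclosing a loop at \<open>b\<close> between a fixed path from \<open>a\<close> to
  \<open>b\<close> and a fixed path back yields a loop at \<open>a\<close>. Hence the growth rate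
  does not depend on the base letter.\<close>

lemma loop_total_compare:
  obtains c m where "\<And>t. t \<ge> 1 \<Longrightarrow> c t > (0::real)"
    "\<And>t n. t \<ge> 1 \<Longrightarrow> c t * loop_total t b n \<le> loop_total t a (n + m)"
proof -
  obtain ku where "\<And>n. n \<ge> ku \<Longrightarrow> \<exists>w. adm w \<and> w \<noteq> [] \<and> length w = n \<and> hd w = a \<and> M (last w) b = 1"
    by (fact connecting_path)
  from this[OF order_refl] obtain u where u: "adm u" "u \<noteq> []" "hd u = a" "M (last u) b = 1" by auto
  obtain kv where "\<And>n. n \<ge> kv \<Longrightarrow> \<exists>w. adm w \<and> w \<noteq> [] \<and> length w = n \<and> hd w = b \<and> M (last w) a = 1"
    by (fact connecting_path)
  from this[OF order_refl] obtain v where v: "adm v" "v \<noteq> []" "hd v = b" "M (last v) a = 1" by auto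
  define m where "m = length u + length v"
  define c where "c = (\<lambda>t. exp (- (t * D)) * exp (- (t * D)) * wt t u * wt t v)"
  obtain N1 where N1: "{u} \<subseteq> bounded_words (length u) N1" using finite_words_bounded[of "{u}" "length u" 0] by auto
  obtain N2 where N2: "{v} \<subseteq> bounded_words (length v) N2" using finite_words_bounded[of "{v}" "length v" 0] by auto
  have "c t * loop_total t b n \<le> loop_total t a (n + m)" if t: "t \<ge> 1" for t n
  proof -
    have *: "c t * loop_sum t b n N \<le> loop_total t a (n + m)" for N
    proof -
      define N' where "N' = max N (max N1 N2)"
      have mem: "u @ w @ v \<in> loops a (n + m) N'" if "w \<in> loops b n N" for w
        using that u v N1 N2 unfolding N'_def m_def loops_def words_over_def
        by (auto simp: adm_append)
      have inj: "inj_on (\<lambda>w. u @ w @ v) (loops b n N)" by (auto simp: inj_on_def)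
      have "c t * loop_sum t b n N = (\<Sum>w\<in>loops b n N. c t * wt t w)" by (simp add: loop_sum_def sum_distrib_left)
      also have "\<dots> \<le> (\<Sum>w\<in>loops b n N. wt t (u @ w @ v))"
      proof (rule sum_mono)
        fix w assume "w \<in> loops b n N"
        then have ad: "adm (u @ (w @ v))" using mem by (auto simp: loops_def)
        then have ad2: "adm (w @ v)" using adm_append by blast
        have "c t * wt t w = exp (- (t * D)) * (wt t u * (exp (- (t * D)) * (wt t w * wt t v)))"
          unfolding c_def by (simp add: algebra_simps)
        also have "\<dots> \<le> exp (- (t * D)) * (wt t u * wt t (w @ v))"
          using wt_append_ge[OF _ ad2, of t] t by (intro mult_left_mono) (auto simp: wt_nonneg)
        also have "\<dots> \<le> wt t (u @ w @ v)" using wt_append_ge[OF _ ad, of t] t by simp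
        finally show "c t * wt t w \<le> wt t (u @ w @ v)" .
      qed
      also have "\<dots> = (\<Sum>w\<in>(\<lambda>w. u @ w @ v) ` loops b n N. wt t w)"
        using sum.reindex[OF inj, of "wt t"] by simp
      also have "\<dots> \<le> loop_sum t a (n + m) N'" unfolding loop_sum_def
        using mem by (intro sum_mono2) (auto simp: wt_nonneg)
      also have "\<dots> \<le> loop_total t a (n + m)" by (rule loop_sum_le_total[OF t])
      finally show ?thesis .
    qed
    show ?thesis
      by (rule LIMSEQ_le_const2[OF tendsto_mult_left[OF loop_sum_tendsto[OF t]]]) (use * in auto)
  qed
  moreover have "c t > 0" for t unfolding c_def using wt_pos u v by simp
  ultimately show ?thesis using that by blast
qed

text \<open>Periodic points and loops determine each other, and bounded variation replaces
  \<open>f n\<close> by \<open>word_pot\<close> at the cost of \<open>B\<close>. Both quantities are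
  suprema of finite sums, so it is enough to compare a finite set of periodic points with a
  truncated set of loops and conversely.\<close>

lemma partition_function_bounds:
  assumes t: "t \<ge> 1" and n: "n \<ge> 1"
  shows "partition_function M (scale_potential t f) a n \<le> ennreal (exp (t * B) * loop_total t a n)"
    and "ennreal (exp (- (t * B)) * loop_total t a n) \<le> partition_function M (scale_potential t f) a n"
proof -
  define h where "h = (\<lambda>x. ennreal (exp (scale_potential t f n x) * indicator (cylinder M [a]) x))"
  define A where "A = {x \<in> X. (shift ^^ n) x = x}"
  have PF: "partition_function M (scale_potential t f) a n = (SUP F\<in>{F. finite F \<and> F \<subseteq> A}. sum h F)"
    unfolding partition_function_def h_def A_def by (rule nonneg_infsum_complete) simp
  have close: "exp (t * f n x) \<le> exp (t * B) * wt t (prefix_word n x)"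
    "exp (- (t * B)) * wt t (prefix_word n x) \<le> exp (t * f n x)" if "x \<in> X" for x
  proof -
    have wtx: "wt t (prefix_word n x) = exp (t * word_pot (prefix_word n x))"
      using adm_prefix_word[OF that, of n] n by (auto simp: wt_def prefix_word_def)
    have "\<bar>f n x - word_pot (prefix_word n x)\<bar> \<le> B" using word_pot_prefix n that by blast
    then have "f n x \<le> B + word_pot (prefix_word n x)" "- B + word_pot (prefix_word n x) \<le> f n x"
      by (auto simp: abs_le_iff)
    then have "t * f n x \<le> t * (B + word_pot (prefix_word n x))" "t * (- B + word_pot (prefix_word n x)) \<le> t * f n x"
      using t by (auto intro!: mult_left_mono)
    then show "exp (t * f n x) \<le> exp (t * B) * wt t (prefix_word n x)"
      "exp (- (t * B)) * wt t (prefix_word n x) \<le> exp (t * f n x)"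
      unfolding wtx by (auto simp: mult_exp_exp algebra_simps)
  qed
  have cyl: "x \<in> cylinder M [a] \<longleftrightarrow> x 0 = a" if "x \<in> X" for x using that by (auto simp: cylinder_def)
  show "partition_function M (scale_potential t f) a n \<le> ennreal (exp (t * B) * loop_total t a n)"
    unfolding PF
  proof (rule SUP_least, clarify)
    fix F assume F: "finite F" "F \<subseteq> A"
    define G where "G = {x \<in> F. x 0 = a}"
    have G: "finite G" "G \<subseteq> A" "G \<subseteq> X" using F unfolding G_def A_def by auto
    have "sum h F = sum h G"
      unfolding G_def using F by (intro sum.mono_neutral_right) (auto simp: h_def cyl A_def indicator_eq_0_iff)
    also have "\<dots> = (\<Sum>x\<in>G. ennreal (exp (t * f n x)))"
    proof (rule sum.cong[OF refl])
      fix x assume x: "x \<in> G"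
      then have "x \<in> X" "x 0 = a" using G(3) unfolding G_def by auto
      then show "h x = ennreal (exp (t * f n x))" using cyl by (simp add: h_def scale_potential_def)
    qed
    also have "\<dots> = ennreal (\<Sum>x\<in>G. exp (t * f n x))" by (simp add: sum_ennreal)
    also have "\<dots> \<le> ennreal (exp (t * B) * loop_total t a n)"
    proof (rule ennreal_leI)
      have inj: "inj_on (prefix_word n) G"
      proof (rule inj_onI)
        fix x y assume "x \<in> G" "y \<in> G" and eq: "prefix_word n x = prefix_word n y"
        then have "(shift ^^ n) x = x" "(shift ^^ n) y = y" using G(2) unfolding A_def by auto
        then show "x = y" using periodic_inj[OF n] eq by blast
      qed
      obtain N where N: "prefix_word n ` G \<subseteq> bounded_words n N"
        by (rule finite_words_bounded[of "prefix_word n ` G" n 0]) (use G(1) in auto)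
      have sub: "prefix_word n ` G \<subseteq> loops a n N"
      proof
        fix w assume "w \<in> prefix_word n ` G"
        then obtain x where x: "x \<in> G" "w = prefix_word n x" by auto
        have xX: "x \<in> X" and per: "(shift ^^ n) x = x" and x0: "x 0 = a" using x G unfolding A_def G_def by auto
        have ne: "w \<noteq> []" using x n by (auto simp: prefix_word_def)
        have "last w = x (n - 1)" using ne x n by (simp add: last_conv_nth)
        moreover have "x n = a" using fun_cong[OF per, of 0] x0 by (simp add: shift_funpow)
        moreover have "M (x (n - 1)) (x n) = 1"
        proof -
          have "M (x (n - 1)) (x (Suc (n - 1))) = 1" using xX unfolding markov_shift_def by blast
          then show ?thesis using n by simp
        qed
        moreover have "hd w = a" using x n x0 ne by (simp add: hd_conv_nth)
        ultimately show "w \<in> loops a n N" using ne N x adm_prefix_word[OF xX] unfolding loops_def by auto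
      qed
      have "(\<Sum>x\<in>G. exp (t * f n x)) \<le> (\<Sum>x\<in>G. exp (t * B) * wt t (prefix_word n x))"
        using G close by (intro sum_mono) auto
      also have "\<dots> = exp (t * B) * (\<Sum>w\<in>prefix_word n ` G. wt t w)"
        using sum.reindex[OF inj, of "wt t"] by (simp add: sum_distrib_left)
      also have "\<dots> \<le> exp (t * B) * loop_sum t a n N" unfolding loop_sum_def using sub
        by (intro mult_left_mono sum_mono2) (auto simp: wt_nonneg)
      also have "\<dots> \<le> exp (t * B) * loop_total t a n" using loop_sum_le_total[OF t] by simp
      finally show "(\<Sum>x\<in>G. exp (t * f n x)) \<le> exp (t * B) * loop_total t a n" .
    qed
    finally show "sum h F \<le> ennreal (exp (t * B) * loop_total t a n)" .
  qed
  have fin: "ennreal (exp (- (t * B)) * loop_sum t a n N) \<le> partition_function M (scale_potential t f) a n" for N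
  proof -
    let ?L = "loops a n N"
    have pre_eq: "prefix_word n (periodic_seq w) = w" if "w \<in> ?L" for w
      using prefix_periodic_seq[of w] that by (auto simp: loops_def words_over_def)
    have inj: "inj_on periodic_seq ?L" by (metis inj_onI pre_eq)
    have inA: "periodic_seq w \<in> A \<and> periodic_seq w 0 = a" if w: "w \<in> ?L" for w
    proof -
      have len: "length w = n" and ne: "w \<noteq> []" and ad: "adm w" and la: "M (last w) a = 1" and hd: "hd w = a"
        using w by (auto simp: loops_def words_over_def)
      have "M (w ! (i mod n)) (w ! (Suc i mod n)) = 1" for i
      proof (cases "Suc (i mod n) = n")
        case True
        then have "Suc i mod n = 0" by (simp add: mod_Suc)
        moreover have "w ! (i mod n) = last w" using True len ne by (metis diff_Suc_1 last_conv_nth)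
        ultimately show ?thesis using la hd ne by (simp add: hd_conv_nth)
      next
        case False
        then have "Suc (i mod n) < n" using n by (metis Suc_lessI less_le_trans mod_less_divisor zero_less_one)
        then show ?thesis using ad len False by (simp add: mod_Suc adm_nth)
      qed
      then have "periodic_seq w \<in> X" using len by (auto simp: markov_shift_def periodic_seq_def)
      moreover have "(shift ^^ n) (periodic_seq w) = periodic_seq w"
        using len by (auto simp: shift_funpow periodic_seq_def)
      ultimately show ?thesis using hd ne by (auto simp: A_def periodic_seq_def hd_conv_nth)
    qed
    have "exp (- (t * B)) * loop_sum t a n N = (\<Sum>w\<in>?L. exp (- (t * B)) * wt t w)"
      by (simp add: loop_sum_def sum_distrib_left)
    also have "\<dots> \<le> (\<Sum>w\<in>?L. exp (t * f n (periodic_seq w)))"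
    proof (rule sum_mono)
      fix w assume w: "w \<in> ?L"
      then have "periodic_seq w \<in> X" using inA unfolding A_def by auto
      from close(2)[OF this] show "exp (- (t * B)) * wt t w \<le> exp (t * f n (periodic_seq w))"
        using pre_eq[OF w] by simp
    qed
    finally have "ennreal (exp (- (t * B)) * loop_sum t a n N) \<le> ennreal (\<Sum>w\<in>?L. exp (t * f n (periodic_seq w)))"
      by (rule ennreal_leI)
    also have "\<dots> = (\<Sum>w\<in>?L. h (periodic_seq w))"
      unfolding h_def using inA
      by (subst sum_ennreal[symmetric]) (auto simp: scale_potential_def cyl A_def intro!: sum.cong)
    also have "\<dots> = sum h (periodic_seq ` ?L)" using sum.reindex[OF inj, of h] by simp
    also have "\<dots> \<le> partition_function M (scale_potential t f) a n"
      unfolding PF using inA by (intro SUP_upper) auto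
    finally show ?thesis .
  qed
  show "ennreal (exp (- (t * B)) * loop_total t a n) \<le> partition_function M (scale_potential t f) a n"
    by (rule LIMSEQ_le_const2[OF tendsto_ennrealI[OF tendsto_mult_left[OF loop_sum_tendsto[OF t]]]]) (use fin in auto)
qed

text \<open>Fekete's lemma for \<open>t * D - ln (loop_total t a n)\<close>, which is subadditive by
  \<open>loop_total_mult\<close> wherever the totals are positive. Allowing any such starting index
  in the second conclusion makes a threshold common to all \<open>t\<close> possible.\<close>

lemma loop_total_growth:
  assumes t: "t \<ge> 1"
  obtains p where "(\<lambda>n. ln (loop_total t a n) / real n) \<longlonglongrightarrow> p"
    "\<And>n. (\<forall>m\<ge>n. loop_total t a m > 0) \<Longrightarrow> n \<ge> 1 \<Longrightarrow> loop_total t a n \<le> exp (t * D + real n * p)"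
proof -
  obtain T where T: "T \<ge> 1" "\<And>a n. loop_total t a n \<le> T ^ n" by (fact loop_total_upper[OF t])
  have main: "\<exists>p. (\<lambda>n. ln (loop_total t a n) / real n) \<longlonglongrightarrow> p \<and> (\<forall>n\<ge>n0. loop_total t a n \<le> exp (t * D + real n * p))"
    if n0: "n0 \<ge> 1" "\<And>n. n \<ge> n0 \<Longrightarrow> loop_total t a n > 0" for n0
  proof -
    define b where "b = (\<lambda>n. t * D - ln (loop_total t a n))"
    have sub: "b (m + n) \<le> b m + b n" if mn: "m \<ge> n0" "n \<ge> n0" for m n
    proof -
      have pos: "loop_total t a m > 0" "loop_total t a n > 0" "loop_total t a (m + n) > 0" using n0 mn by auto
      have "ln (loop_total t a m * loop_total t a n) \<le> ln (exp (t * D) * loop_total t a (m + n))"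
        using loop_total_mult[OF t, of a m n] pos by (intro ln_mono) auto
      then show ?thesis unfolding b_def using pos by (simp add: ln_mult)
    qed
    have lb: "- ln T * real n \<le> b n" if "n \<ge> n0" for n
    proof -
      have "ln (loop_total t a n) \<le> ln (T ^ n)" using T n0(2)[OF that] by (intro ln_mono) auto
      then have "ln (loop_total t a n) \<le> real n * ln T" using T by (simp add: ln_realpow)
      moreover have "t * D \<ge> 0" using t D_nonneg by simp
      ultimately show ?thesis unfolding b_def by (simp add: algebra_simps)
    qed
    have "\<exists>l. (\<lambda>n. b n / real n) \<longlonglongrightarrow> l \<and> (\<forall>n\<ge>n0. l * real n \<le> b n)"
      by (rule fekete[of n0 b "- ln T"]) (use n0(1) sub lb in auto)
    then obtain l where l: "(\<lambda>n. b n / real n) \<longlonglongrightarrow> l" "\<And>n. n \<ge> n0 \<Longrightarrow> l * real n \<le> b n"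
      by blast
    have "(\<lambda>n. t * D / real n - b n / real n) \<longlonglongrightarrow> 0 - l"
      by (intro tendsto_diff l(1) lim_const_over_n)
    then have "(\<lambda>n. ln (loop_total t a n) / real n) \<longlonglongrightarrow> - l"
      by (simp add: b_def diff_divide_distrib)
    moreover have "loop_total t a n \<le> exp (t * D + real n * (- l))" if "n \<ge> n0" for n
    proof -
      have "ln (loop_total t a n) \<le> t * D + real n * (- l)" using l(2)[OF that] unfolding b_def by (simp add: algebra_simps)
      then have "exp (ln (loop_total t a n)) \<le> exp (t * D + real n * (- l))" by simp
      then show ?thesis using n0(2)[OF that] by simp
    qed
    ultimately show ?thesis by blast
  qed
  obtain n0 where "n0 \<ge> 1" "\<And>t n. t \<ge> 1 \<Longrightarrow> n \<ge> n0 \<Longrightarrow> loop_total t a n > 0"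
    by (fact loop_total_pos)
  then have n0: "n0 \<ge> 1" "\<And>n. n \<ge> n0 \<Longrightarrow> loop_total t a n > 0" using t by auto
  obtain p where p: "(\<lambda>n. ln (loop_total t a n) / real n) \<longlonglongrightarrow> p" using main[OF n0] by blast
  have "loop_total t a n \<le> exp (t * D + real n * p)" if n: "\<forall>m\<ge>n. loop_total t a m > 0" "n \<ge> 1" for n
  proof -
    obtain p' where "(\<lambda>n. ln (loop_total t a n) / real n) \<longlonglongrightarrow> p'" "loop_total t a n \<le> exp (t * D + real n * p')"
      using main[of n] n by auto
    then show ?thesis using LIMSEQ_unique[OF p] by blast
  qed
  then show ?thesis using that p by blast
qed

lemma ln_partition_function_tendsto:
  assumes t: "t \<ge> 1" and p: "(\<lambda>n. ln (loop_total t a n) / real n) \<longlonglongrightarrow> p"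
  shows "(\<lambda>n. ereal (1 / real n) * ln_ennreal (partition_function M (scale_potential t f) a n)) \<longlonglongrightarrow> ereal p"
proof -
  obtain n0 where "n0 \<ge> 1" "\<And>t n. t \<ge> 1 \<Longrightarrow> n \<ge> n0 \<Longrightarrow> loop_total t a n > 0"
    by (fact loop_total_pos)
  then have n0: "n0 \<ge> 1" "\<And>n. n \<ge> n0 \<Longrightarrow> loop_total t a n > 0" using t by auto
  let ?PF = "\<lambda>n. partition_function M (scale_potential t f) a n"
  define z where "z = (\<lambda>n. enn2real (?PF n))"
  have z: "ereal (1 / real n) * ln_ennreal (?PF n) = ereal (ln (z n) / real n)"
    "- (t * B) + ln (loop_total t a n) \<le> ln (z n)" "ln (z n) \<le> t * B + ln (loop_total t a n)" if n: "n \<ge> n0" for n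
  proof -
    have n1: "n \<ge> 1" and pos: "loop_total t a n > 0" using n n0 by auto
    note b = partition_function_bounds[OF t n1, of a]
    have fin: "?PF n < \<infinity>" using b(1) by (simp add: le_less_trans)
    have ez: "?PF n = ennreal (z n)" unfolding z_def using fin by (simp add: ennreal_enn2real)
    have lo: "exp (- (t * B)) * loop_total t a n \<le> z n"
      using b(2) unfolding ez by (subst (asm) ennreal_le_iff) (auto simp: z_def)
    have hi: "z n \<le> exp (t * B) * loop_total t a n"
      using b(1) pos unfolding ez by (subst (asm) ennreal_le_iff) auto
    have zpos: "z n > 0" using lo pos by (meson exp_gt_zero less_le_trans mult_pos_pos)
    show "ereal (1 / real n) * ln_ennreal (?PF n) = ereal (ln (z n) / real n)"
      using zpos unfolding ez ln_ennreal_def by (simp add: ennreal_eq_0_iff)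
    have "ln (exp (- (t * B)) * loop_total t a n) \<le> ln (z n)" using lo pos zpos by (intro ln_mono) auto
    then show "- (t * B) + ln (loop_total t a n) \<le> ln (z n)" using pos by (simp add: ln_mult)
    have "ln (z n) \<le> ln (exp (t * B) * loop_total t a n)" using hi pos zpos by (intro ln_mono) auto
    then show "ln (z n) \<le> t * B + ln (loop_total t a n)" using pos by (simp add: ln_mult)
  qed
  have "(\<lambda>n. ln (z n) / real n) \<longlonglongrightarrow> p"
  proof (rule real_tendsto_sandwich)
    show "(\<lambda>n. - (t * B) / real n + ln (loop_total t a n) / real n) \<longlonglongrightarrow> p"
      using tendsto_add[OF lim_const_over_n p] by (simp only: add_0)
    show "(\<lambda>n. t * B / real n + ln (loop_total t a n) / real n) \<longlonglongrightarrow> p"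
      using tendsto_add[OF lim_const_over_n p] by (simp only: add_0)
    show "\<forall>\<^sub>F n in sequentially. - (t * B) / real n + ln (loop_total t a n) / real n \<le> ln (z n) / real n"
      using eventually_ge_at_top[of n0]
    proof eventually_elim
      case (elim n)
      then have "n > 0" using n0 by simp
      then show ?case using z(2)[OF elim] by (simp only: add_divide_distrib[symmetric]) (simp add: divide_right_mono)
    qed
    show "\<forall>\<^sub>F n in sequentially. ln (z n) / real n \<le> t * B / real n + ln (loop_total t a n) / real n"
      using eventually_ge_at_top[of n0]
    proof eventually_elim
      case (elim n)
      then have "n > 0" using n0 by simp
      then show ?case using z(3)[OF elim] by (simp only: add_divide_distrib[symmetric]) (simp add: divide_right_mono)
    qed
  qed
  then have "(\<lambda>n. ereal (ln (z n) / real n)) \<longlonglongrightarrow> ereal p" by (intro tendsto_ereal)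
  moreover have "\<forall>\<^sub>F n in sequentially. ereal (ln (z n) / real n) = ereal (1 / real n) * ln_ennreal (?PF n)"
    using eventually_ge_at_top[of n0] by eventually_elim (use z(1) in simp)
  ultimately show ?thesis by (rule Lim_transform_eventually)
qed

lemma growth_le:
  assumes t: "t \<ge> 1" and pa: "(\<lambda>n. ln (loop_total t a n) / real n) \<longlonglongrightarrow> pa"
    and pb: "(\<lambda>n. ln (loop_total t b n) / real n) \<longlonglongrightarrow> pb"
  shows "pb \<le> pa"
proof -
  obtain cf m where cf: "\<And>t. t \<ge> 1 \<Longrightarrow> cf t > (0::real)"
    "\<And>t n. t \<ge> 1 \<Longrightarrow> cf t * loop_total t b n \<le> loop_total t a (n + m)"
    by (fact loop_total_compare)
  define c where "c = cf t"
  have c: "c > 0" and cmp: "\<And>n. c * loop_total t b n \<le> loop_total t a (n + m)"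
    using cf t unfolding c_def by auto
  obtain n0 where "n0 \<ge> 1" "\<And>t n. t \<ge> 1 \<Longrightarrow> n \<ge> n0 \<Longrightarrow> loop_total t b n > 0"
    by (fact loop_total_pos)
  then have n0: "n0 \<ge> 1" "\<And>n. n \<ge> n0 \<Longrightarrow> loop_total t b n > 0" using t by auto
  have "(\<lambda>n. ln c / real n + ln (loop_total t b n) / real n) \<longlonglongrightarrow> 0 + pb"
    by (intro tendsto_add lim_const_over_n pb)
  moreover have "(\<lambda>n. ln (loop_total t a (n + m)) / real (n + m) * (real (n + m) / real n)) \<longlonglongrightarrow> pa * 1"
  proof (rule tendsto_mult)
    show "(\<lambda>n. ln (loop_total t a (n + m)) / real (n + m)) \<longlonglongrightarrow> pa" using pa by (rule LIMSEQ_ignore_initial_segment)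
    have "(\<lambda>n. 1 + real m / real n) \<longlonglongrightarrow> 1 + 0" by (intro tendsto_add tendsto_const lim_const_over_n)
    moreover have "\<forall>\<^sub>F n in sequentially. 1 + real m / real n = real (n + m) / real n"
      using eventually_gt_at_top[of 0] by eventually_elim (simp add: field_simps)
    ultimately show "(\<lambda>n. real (n + m) / real n) \<longlonglongrightarrow> 1" using Lim_transform_eventually by fastforce
  qed
  moreover have "\<exists>N. \<forall>n\<ge>N. ln c / real n + ln (loop_total t b n) / real n
      \<le> ln (loop_total t a (n + m)) / real (n + m) * (real (n + m) / real n)"
  proof (intro exI allI impI)
    fix n assume n: "n \<ge> n0"
    then have "n > 0" and pos: "loop_total t b n > 0" using n0 by auto
    have "ln (c * loop_total t b n) \<le> ln (loop_total t a (n + m))"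
      using cmp[of n] c pos by (intro ln_mono) auto
    then have "ln c + ln (loop_total t b n) \<le> ln (loop_total t a (n + m))" using c pos by (simp add: ln_mult)
    then show "ln c / real n + ln (loop_total t b n) / real n
      \<le> ln (loop_total t a (n + m)) / real (n + m) * (real (n + m) / real n)"
      using \<open>n > 0\<close> by (simp add: divide_right_mono add_divide_distrib[symmetric])
  qed
  ultimately show ?thesis using LIMSEQ_le by fastforce
qed

text \<open>The definite description of the pressure asks for one limit common to all letters;
  comparing the growth rates at two letters in both directions provides it.\<close>

lemma pressure:
  assumes t: "t \<ge> 1"
  shows "gurevich_pressure M (scale_potential t f) = ereal (press t)"
    and "(\<lambda>n. ln (loop_total t a n) / real n) \<longlonglongrightarrow> press t"
proof -
  obtain p where p: "(\<lambda>n. ln (loop_total t a n) / real n) \<longlonglongrightarrow> p"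
    "\<And>n. (\<forall>m\<ge>n. loop_total t a m > 0) \<Longrightarrow> n \<ge> 1 \<Longrightarrow> loop_total t a n \<le> exp (t * D + real n * p)"
    by (fact loop_total_growth[OF t])
  have pb: "(\<lambda>n. ln (loop_total t b n) / real n) \<longlonglongrightarrow> p" for b
  proof -
    obtain q where q: "(\<lambda>n. ln (loop_total t b n) / real n) \<longlonglongrightarrow> q"
    "\<And>n. (\<forall>m\<ge>n. loop_total t b m > 0) \<Longrightarrow> n \<ge> 1 \<Longrightarrow> loop_total t b n \<le> exp (t * D + real n * q)"
    by (fact loop_total_growth[OF t])
    have "q = p" using growth_le[OF t p(1) q(1)] growth_le[OF t q(1) p(1)] by simp
    then show ?thesis using q(1) by simp
  qed
  have "gurevich_pressure M (scale_potential t f) = ereal p"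
    unfolding gurevich_pressure_def
  proof (rule the_equality)
    show "\<forall>a. (\<lambda>n. ereal (1 / real n) * ln_ennreal (partition_function M (scale_potential t f) a n)) \<longlonglongrightarrow> ereal p"
      using ln_partition_function_tendsto[OF t pb] by blast
    fix p' assume "\<forall>a. (\<lambda>n. ereal (1 / real n) * ln_ennreal (partition_function M (scale_potential t f) a n)) \<longlonglongrightarrow> p'"
    then show "p' = ereal p" using ln_partition_function_tendsto[OF t p(1)] LIMSEQ_unique by blast
  qed
  then show "gurevich_pressure M (scale_potential t f) = ereal (press t)"
    and "(\<lambda>n. ln (loop_total t a n) / real n) \<longlonglongrightarrow> press t" using pb by (auto simp: press_def)
qed

text \<open>That \<open>n0\<close> is chosen before \<open>t\<close> is what later allows word sum
  bounds uniform over an interval of temperatures.\<close>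

lemma loop_sum_le_press:
  obtains n0 where "n0 \<ge> 1" "\<And>t n N. t \<ge> 1 \<Longrightarrow> n \<ge> n0 \<Longrightarrow> loop_sum t a n N \<le> exp (t * D + real n * press t)"
proof -
  obtain n0 where n0: "n0 \<ge> 1" "\<And>t n. t \<ge> 1 \<Longrightarrow> n \<ge> n0 \<Longrightarrow> loop_total t a n > 0" by (fact loop_total_pos)
  have "loop_sum t a n N \<le> exp (t * D + real n * press t)" if t: "t \<ge> 1" and n: "n \<ge> n0" for t n N
  proof -
    obtain p where p: "(\<lambda>n. ln (loop_total t a n) / real n) \<longlonglongrightarrow> p"
      "\<And>n. (\<forall>m\<ge>n. loop_total t a m > 0) \<Longrightarrow> n \<ge> 1 \<Longrightarrow> loop_total t a n \<le> exp (t * D + real n * p)"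
      by (fact loop_total_growth[OF t])
    have "p = press t" using LIMSEQ_unique[OF p(1) pressure(2)[OF t]] .
    then show ?thesis using p(2)[of n] n0 n t loop_sum_le_total[OF t, of a n N] by fastforce
  qed
  then show ?thesis using that n0 by blast
qed

end

section \<open>Normalised word sums\<close>

text \<open>The sum of \<open>b\<close> over the first \<open>k\<close> consecutive disjoint blocks
  of length \<open>l\<close>, a Birkhoff sum for the \<open>l\<close>-th power of the shift.\<close>

fun block_sum :: "(nat list \<Rightarrow> real) \<Rightarrow> nat \<Rightarrow> nat \<Rightarrow> nat list \<Rightarrow> real" where
  "block_sum b l 0 w = 0"
| "block_sum b l (Suc k) w = b (take l w) + block_sum b l k (drop l w)"

context cms_potential
begin

text \<open>Up to constant factors, the mass that a Gibbs state at \<open>t\<close> is expected to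
  give to the cylinder of \<open>w\<close>.\<close>

definition nw :: "real \<Rightarrow> nat list \<Rightarrow> real" where
  "nw t w = wt t w * exp (- (real (length w) * press t))"

lemma nw_nonneg: "nw t w \<ge> 0" by (simp add: nw_def wt_nonneg)

lemma nw_pos: "adm w \<Longrightarrow> nw t w > 0" by (simp add: nw_def wt_pos)

lemma nw_not_adm: "\<not> adm w \<Longrightarrow> nw t w = 0" by (simp add: nw_def wt_not_adm)

lemma nw_Nil [simp]: "nw t [] = 1" by (simp add: nw_def)

lemma nw_eq: "adm w \<Longrightarrow> w \<noteq> [] \<Longrightarrow> nw t w = exp (t * word_pot w - real (length w) * press t)"
  by (simp add: nw_def wt_def mult_exp_exp)

lemma nw_length: "exp (- (real (length (u @ v)) * p))
    = exp (- (real (length u) * p)) * exp (- (real (length v) * p))"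
  by (simp add: mult_exp_exp algebra_simps)

lemma nw_append_le:
  assumes "t \<ge> 0"
  shows "nw t (u @ v) \<le> exp (t * D) * (nw t u * nw t v)"
proof -
  have "nw t (u @ v) \<le> (exp (t * D) * (wt t u * wt t v)) * exp (- (real (length (u @ v)) * press t))"
    unfolding nw_def by (intro mult_right_mono wt_append_le assms) simp
  also have "\<dots> = exp (t * D) * (nw t u * nw t v)"
    unfolding nw_def nw_length by (simp only: mult_ac)
  finally show ?thesis .
qed

lemma nw_append_ge:
  assumes "t \<ge> 0" "adm (u @ v)"
  shows "exp (- (t * D)) * (nw t u * nw t v) \<le> nw t (u @ v)"
proof -
  have "exp (- (t * D)) * (nw t u * nw t v)
    = (exp (- (t * D)) * (wt t u * wt t v)) * exp (- (real (length (u @ v)) * press t))"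
    unfolding nw_def nw_length by (simp only: mult_ac)
  also have "\<dots> \<le> nw t (u @ v)"
    unfolding nw_def by (intro mult_right_mono wt_append_ge assms) simp
  finally show ?thesis .
qed

lemma nw_append3_le:
  assumes "t \<ge> 0"
  shows "nw t (u @ v @ w) \<le> exp (2 * (t * D)) * (nw t u * nw t v * nw t w)"
proof -
  have "nw t (u @ v @ w) \<le> exp (t * D) * (nw t u * nw t (v @ w))" by (rule nw_append_le[OF assms])
  also have "\<dots> \<le> exp (t * D) * (nw t u * (exp (t * D) * (nw t v * nw t w)))"
    by (intro mult_left_mono nw_append_le assms) (auto simp: nw_nonneg)
  also have "\<dots> = exp (2 * (t * D)) * (nw t u * nw t v * nw t w)"
    unfolding exp_double power2_eq_square by (simp only: mult_ac)
  finally show ?thesis .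
qed

lemma nw_append3_ge:
  assumes "t \<ge> 0" "adm (u @ v @ w)"
  shows "exp (- (2 * (t * D))) * (nw t u * nw t v * nw t w) \<le> nw t (u @ v @ w)"
proof -
  have vw: "adm (v @ w)" using assms adm_append by blast
  have "exp (- (2 * (t * D))) * (nw t u * nw t v * nw t w)
     = exp (- (t * D)) * (nw t u * (exp (- (t * D)) * (nw t v * nw t w)))"
    unfolding mult_minus_right[symmetric, of 2] exp_double power2_eq_square by (simp only: mult_ac)
  also have "\<dots> \<le> exp (- (t * D)) * (nw t u * nw t (v @ w))"
    by (intro mult_left_mono nw_append_ge assms vw) (auto simp: nw_nonneg)
  also have "\<dots> \<le> nw t (u @ v @ w)" by (rule nw_append_ge[OF assms])
  finally show ?thesis .
qed

lemma connecting_paths: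
  assumes "finite E" "finite E'"
  obtains n0 where "\<And>n e e'. n \<ge> n0 \<Longrightarrow> e \<in> E \<Longrightarrow> e' \<in> E' \<Longrightarrow>
    \<exists>w. adm w \<and> w \<noteq> [] \<and> length w = n \<and> hd w = e \<and> M (last w) e' = 1"
proof -
  have "\<exists>n0. \<forall>n\<ge>n0. \<exists>w. adm w \<and> w \<noteq> [] \<and> length w = n \<and> hd w = a \<and> M (last w) b = 1" for a b
    by (rule connecting_path[of a b]) blast
  then obtain g where g: "\<And>a b n. n \<ge> g a b \<Longrightarrow> \<exists>w. adm w \<and> w \<noteq> [] \<and> length w = n \<and> hd w = a \<and> M (last w) b = 1"
    by metis
  define n0 where "n0 = Max (insert 0 ((\<lambda>(a, b). g a b) ` (E \<times> E')))"
  have "g e e' \<le> n0" if "e \<in> E" "e' \<in> E'" for e e'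
    unfolding n0_def using assms that by (intro Max_ge) (auto intro!: image_eqI[of _ _ "(e, e')"])
  then have "\<exists>w. adm w \<and> w \<noteq> [] \<and> length w = n \<and> hd w = e \<and> M (last w) e' = 1"
    if "n \<ge> n0" "e \<in> E" "e' \<in> E'" for n e e' using that g[of e e' n] order_trans by blast
  then show ?thesis using that by blast
qed

text \<open>Words with both end letters in the finite set \<open>E\<close> are completed to loops at
  0 by connecting words of one common length \<open>k\<close>, and normalised loop sums are at most
  \<open>exp (t * D)\<close>. The temperature enters the bound only through \<open>t1\<close> and
  the upper bound \<open>PM\<close> for the pressure.\<close>

lemma inner_word_sum_bound:
  assumes t1: "t1 \<ge> 1" and E: "finite E"
  obtains K where "K \<ge> 0" "\<And>t n N. 1 \<le> t \<Longrightarrow> t \<le> t1 \<Longrightarrow> press t \<le> PM \<Longrightarrow> n \<ge> 1 \<Longrightarrow>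
     (\<Sum>w\<in>{w \<in> bounded_words n N. hd w \<in> E \<and> last w \<in> E}. nw t w) \<le> K"
proof -
  obtain n1 where n1: "n1 \<ge> 1" "\<And>t n N. t \<ge> 1 \<Longrightarrow> n \<ge> n1 \<Longrightarrow> loop_sum t 0 n N \<le> exp (t * D + real n * press t)"
    by (fact loop_sum_le_press)
  obtain n2 where n2: "\<And>n e e'. n \<ge> n2 \<Longrightarrow> e \<in> {0} \<Longrightarrow> e' \<in> E \<Longrightarrow>
    \<exists>w. adm w \<and> w \<noteq> [] \<and> length w = n \<and> hd w = e \<and> M (last w) e' = 1"
    by (fact connecting_paths[OF _ E, of "{0}", simplified finite.emptyI finite_insert, OF TrueI])
  obtain n3 where n3: "\<And>n e e'. n \<ge> n3 \<Longrightarrow> e \<in> E \<Longrightarrow> e' \<in> {0} \<Longrightarrow>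
    \<exists>w. adm w \<and> w \<noteq> [] \<and> length w = n \<and> hd w = e \<and> M (last w) e' = 1"
    by (fact connecting_paths[OF E, of "{0}", simplified finite.emptyI finite_insert, OF TrueI])
  define k where "k = Max {n1, n2, n3}"
  have k: "k \<ge> n1" "k \<ge> n2" "k \<ge> n3" unfolding k_def by auto
  have "\<forall>e\<in>E. \<exists>w. adm w \<and> w \<noteq> [] \<and> length w = k \<and> hd w = 0 \<and> M (last w) e = 1"
    using n2[OF k(2)] by blast
  then obtain u where u: "\<And>e. e \<in> E \<Longrightarrow> adm (u e) \<and> u e \<noteq> [] \<and> length (u e) = k \<and> hd (u e) = 0 \<and> M (last (u e)) e = 1"
    by metis
  have "\<exists>v. adm v \<and> v \<noteq> [] \<and> length v = k \<and> M e (hd v) = 1 \<and> M (last v) 0 = 1" if e: "e \<in> E" for e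
  proof -
    \<comment> \<open>The path found starts with \<open>e\<close> itself, which the word to be
      completed already contains; it is taken one letter longer and its first letter is
      removed.\<close>
    obtain w where w: "adm w" "w \<noteq> []" "length w = Suc k" "hd w = e" "M (last w) 0 = 1"
      using n3[of "Suc k" e 0] k e by auto
    have ne: "tl w \<noteq> []" using w(3) k n1 by (cases w) auto
    have "w = [e] @ tl w" using w by (cases w) auto
    then have "adm ([e] @ tl w)" using w(1) by simp
    then have "adm (tl w)" "M e (hd (tl w)) = 1" using ne adm_append[of "[e]" "tl w"] by auto
    moreover have "last (tl w) = last w" using ne by (simp add: last_tl)
    ultimately show ?thesis using ne w by (intro exI[of _ "tl w"]) auto
  qed
  then obtain v where v: "\<And>e. e \<in> E \<Longrightarrow> adm (v e) \<and> v e \<noteq> [] \<and> length (v e) = k \<and> M e (hd (v e)) = 1 \<and> M (last (v e)) 0 = 1"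
    by metis
  define A where "A = Max (insert 0 ((\<lambda>e. \<bar>word_pot (u e)\<bar>) ` E \<union> (\<lambda>e. \<bar>word_pot (v e)\<bar>) ` E))"
  have A0: "A \<ge> 0" unfolding A_def using E by (intro Max_ge) auto
  have Au: "\<bar>word_pot (u e)\<bar> \<le> A" "\<bar>word_pot (v e)\<bar> \<le> A" if "e \<in> E" for e
    unfolding A_def using E that by (auto intro!: Max_ge)
  \<comment> \<open>A lower bound for the normalised weight of every connecting word, valid for all
    \<open>t\<close> in \<open>[1, t1]\<close> with \<open>press t \<le> PM\<close>. Removing two
    such words costs \<open>c\<close> twice and two concatenations.\<close>
  define c where "c = exp (- (t1 * A + real k * \<bar>PM\<bar>))"
  define K where "K = exp (2 * (t1 * D)) / c\<^sup>2 * exp (t1 * D)"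
  have cpos: "c > 0" unfolding c_def by simp
  have "(\<Sum>w\<in>{w \<in> bounded_words n N. hd w \<in> E \<and> last w \<in> E}. nw t w) \<le> K"
    if t: "1 \<le> t" "t \<le> t1" and P: "press t \<le> PM" and n: "n \<ge> 1" for t n N
  proof -
    let ?W = "{w \<in> bounded_words n N. hd w \<in> E \<and> last w \<in> E \<and> adm w}"
    have cle: "c \<le> nw t z" if "adm z" "z \<noteq> []" "length z = k" "\<bar>word_pot z\<bar> \<le> A" for z
    proof -
      have "t * word_pot z \<ge> - (t1 * A)"
      proof -
        have "t * (- word_pot z) \<le> t * A" using that t by (intro mult_left_mono) auto
        also have "\<dots> \<le> t1 * A" using t A0 by (intro mult_right_mono) auto
        finally show ?thesis by simp
      qed
      moreover have "real k * press t \<le> real k * \<bar>PM\<bar>" using P by (intro mult_left_mono) auto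
      ultimately show ?thesis unfolding c_def nw_eq[OF that(1,2)] that(3) by simp
    qed
    define g where "g = (\<lambda>w. u (hd w) @ w @ v (last w))"
    have finU: "finite (g ` ?W)" by simp
    have len: "length (g w) = n + 2 * k" if "w \<in> ?W" for w
      using u[of "hd w"] v[of "last w"] that by (auto simp: g_def words_over_def)
    obtain N' where N': "g ` ?W \<subseteq> bounded_words (n + 2 * k) N'"
      by (rule finite_words_bounded[of "g ` ?W" "n + 2 * k" 0]) (use finU len in auto)
    have gl: "g w \<in> loops 0 (n + 2 * k) N'" if "w \<in> ?W" for w
    proof -
      have "g w \<in> bounded_words (n + 2 * k) N'" using N' that by blast
      moreover have "w \<noteq> []" using that n by (auto simp: words_over_def)
      ultimately show ?thesis using u[of "hd w"] v[of "last w"] that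
        by (auto simp: g_def loops_def adm_append)
    qed
    have inj: "inj_on g ?W"
    proof (rule inj_onI)
      fix x y assume xy: "x \<in> ?W" "y \<in> ?W" "g x = g y"
      have inv: "take n (drop k (g z)) = z" if "z \<in> ?W" for z
      proof -
        have "length (u (hd z)) = k" "length z = n" using u[of "hd z"] that unfolding words_over_def by blast+
        then show ?thesis unfolding g_def by simp
      qed
      have "x = take n (drop k (g x))" by (rule inv[OF xy(1), symmetric])
      also have "\<dots> = y" unfolding xy(3) by (rule inv[OF xy(2)])
      finally show "x = y" .
    qed
    have le: "nw t w \<le> exp (2 * (t * D)) / c\<^sup>2 * nw t (g w)" if w: "w \<in> ?W" for w
    proof -
      have "adm (u (hd w) @ w @ v (last w))" using gl[OF w] by (auto simp: loops_def g_def)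
      then have 1: "exp (- (2 * (t * D))) * (nw t (u (hd w)) * nw t w * nw t (v (last w))) \<le> nw t (g w)"
        unfolding g_def using t by (intro nw_append3_ge) auto
      have "c * nw t w * c \<le> nw t (u (hd w)) * nw t w * nw t (v (last w))"
        using u[of "hd w"] v[of "last w"] w cpos Au
        by (intro mult_mono cle) (auto simp: nw_nonneg)
      then have "exp (- (2 * (t * D))) * (c * nw t w * c) \<le> nw t (g w)" using 1
        by (meson exp_ge_zero mult_left_mono order_trans)
      then show ?thesis using cpos by (simp add: exp_minus field_simps power2_eq_square)
    qed
    have "(\<Sum>w\<in>{w \<in> bounded_words n N. hd w \<in> E \<and> last w \<in> E}. nw t w) = (\<Sum>w\<in>?W. nw t w)"
      by (intro sum.mono_neutral_right) (auto simp: nw_not_adm)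
    also have "\<dots> \<le> (\<Sum>w\<in>?W. exp (2 * (t * D)) / c\<^sup>2 * nw t (g w))" by (intro sum_mono le)
    also have "\<dots> = exp (2 * (t * D)) / c\<^sup>2 * (\<Sum>w\<in>g ` ?W. nw t w)"
      using sum.reindex[OF inj, of "nw t"] by (simp add: sum_distrib_left)
    also have "(\<Sum>w\<in>g ` ?W. nw t w) \<le> (\<Sum>w\<in>loops 0 (n + 2 * k) N'. nw t w)"
      using gl by (intro sum_mono2) (auto simp: nw_nonneg)
    also have "\<dots> = loop_sum t 0 (n + 2 * k) N' * exp (- (real (n + 2 * k) * press t))"
      unfolding loop_sum_def sum_distrib_right by (intro sum.cong) (auto simp: nw_def loops_def words_over_def)
    also have "\<dots> \<le> exp (t * D + real (n + 2 * k) * press t) * exp (- (real (n + 2 * k) * press t))"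
      using n1(2)[of t "n + 2 * k" N'] t k by (intro mult_right_mono) auto
    also have "\<dots> = exp (t * D)" by (simp add: mult_exp_exp)
    finally have "(\<Sum>w\<in>{w \<in> bounded_words n N. hd w \<in> E \<and> last w \<in> E}. nw t w)
       \<le> exp (2 * (t * D)) / c\<^sup>2 * exp (t * D)" by (simp add: mult_left_mono divide_right_mono)
    also have "\<dots> \<le> K"
    proof -
      have "t * D \<le> t1 * D" using t D_nonneg by (intro mult_right_mono) auto
      then show ?thesis unfolding K_def by (intro mult_mono divide_right_mono) auto
    qed
    finally show ?thesis .
  qed
  moreover have "K \<ge> 0" unfolding K_def by simp
  ultimately show ?thesis using that[of K] by blast
qed

text \<open>Letters outside a large finite set carry total weight below one half, so excursions
  away from it cost a convergent geometric series, and what remains closes up to loops.\<close>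

lemma word_sum_bound:
  assumes t1: "t1 \<ge> 1"
  obtains K where "K \<ge> 1" "\<And>t n N. 1 \<le> t \<Longrightarrow> t \<le> t1 \<Longrightarrow> Pm \<le> press t \<Longrightarrow> press t \<le> PM \<Longrightarrow>
     (\<Sum>w\<in>bounded_words n N. nw t w) \<le> K"
proof -
  \<comment> \<open>The tail is made so small that after normalisation, which costs at most
    \<open>exp (- Pm)\<close>, and one concatenation, which costs at most
    \<open>exp (t1 * D)\<close>, the remaining letters have total weight at most
    \<open>1 / 2\<close>.\<close>
  have "exp (Pm - t1 * D) / 2 > 0" by simp
  then obtain N1 where N1: "\<And>n. (\<Sum>i\<in>{N1..<n}. exp (word_pot [i])) < exp (Pm - t1 * D) / 2"
    using letter_tail by blast
  \<comment> \<open>Where the potential of a letter is nonpositive, raising the exponent from 1 to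
    \<open>t\<close> can only lower its weight.\<close>
  obtain N2 where N2: "\<And>i. i \<ge> N2 \<Longrightarrow> word_pot [i] \<le> - 0" by (fact letter_pot_neg)
  define m where "m = max N1 N2"
  have fin: "finite {..<m}" by simp
  obtain Y where Y: "Y \<ge> 0" "\<And>t n N. 1 \<le> t \<Longrightarrow> t \<le> t1 \<Longrightarrow> press t \<le> PM \<Longrightarrow> n \<ge> 1 \<Longrightarrow>
     (\<Sum>w\<in>{w \<in> bounded_words n N. hd w \<in> {..<m} \<and> last w \<in> {..<m}}. nw t w) \<le> Y"
    by (fact inner_word_sum_bound[OF t1 fin])
  have "(\<Sum>w\<in>bounded_words n N. nw t w) \<le> 4 * Y + 1"
    if t: "1 \<le> t" "t \<le> t1" and P: "Pm \<le> press t" "press t \<le> PM" for t n N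
  proof -
    have half: "exp (t * D) * (\<Sum>i<N. if i < m then 0 else nw t [i]) \<le> 1 / 2"
    proof -
      have "(\<Sum>i<N. if i < m then 0 else nw t [i]) = (\<Sum>i\<in>{m..<N}. nw t [i])"
        by (intro sum.mono_neutral_cong_right) auto
      also have "\<dots> \<le> (\<Sum>i\<in>{m..<N}. exp (- Pm) * exp (word_pot [i]))"
      proof (rule sum_mono)
        fix i assume i: "i \<in> {m..<N}"
        then have "word_pot [i] \<le> 0" using N2[of i] unfolding m_def by simp
        then have "(t - 1) * word_pot [i] \<le> 0" using t by (simp add: mult_nonneg_nonpos)
        then have "t * word_pot [i] - press t \<le> - Pm + word_pot [i]" using P by (simp add: algebra_simps)
        then show "nw t [i] \<le> exp (- Pm) * exp (word_pot [i])" by (simp add: nw_eq mult_exp_exp)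
      qed
      also have "\<dots> = exp (- Pm) * (\<Sum>i\<in>{m..<N}. exp (word_pot [i]))" by (simp add: sum_distrib_left)
      also have "(\<Sum>i\<in>{m..<N}. exp (word_pot [i])) \<le> (\<Sum>i\<in>{N1..<N}. exp (word_pot [i]))"
        unfolding m_def by (intro sum_mono2) auto
      also have "\<dots> \<le> exp (Pm - t1 * D) / 2" using N1[of N] by simp
      finally have "(\<Sum>i<N. if i < m then 0 else nw t [i]) \<le> exp (- Pm) * (exp (Pm - t1 * D) / 2)" by simp
      also have "\<dots> = exp (- (t1 * D)) / 2" by (simp add: mult_exp_exp)
      also have "\<dots> \<le> exp (- (t * D)) / 2" using t D_nonneg by (simp add: mult_right_mono)
      finally show ?thesis by (simp add: exp_minus field_simps)
    qed
    \<comment> \<open>\<open>V\<close> sums over all words and \<open>U\<close> over those that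
      begin in the finite set. Removing a last letter outside that set gives
      \<open>U (n + 1) \<le> Y + U n / 2\<close> for \<open>n \<ge> 1\<close>, and removing such a
      first letter gives \<open>V (n + 1) \<le> U (n + 1) + V n / 2\<close>; hence the bounds
      \<open>2 * Y\<close> and \<open>4 * Y + 1\<close>.\<close>
    define V where "V = (\<lambda>n. \<Sum>w\<in>bounded_words n N. nw t w)"
    define U where "U = (\<lambda>n. \<Sum>w\<in>bounded_words n N. if hd w < m then nw t w else 0)"
    have V0: "V n \<ge> 0" for n unfolding V_def by (intro sum_nonneg nw_nonneg)
    have U0: "U n \<ge> 0" for n unfolding U_def by (intro sum_nonneg) (auto simp: nw_nonneg)
    have last_step: "(if hd w < m \<and> \<not> i < m then nw t (w @ [i]) else 0)
        \<le> exp (t * D) * ((if hd w < m then nw t w else 0) * (if i < m then 0 else nw t [i]))" for w i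
      using nw_append_le[of t w "[i]"] t by (simp add: nw_nonneg)
    have first_step: "(if i < m then 0 else nw t ([i] @ w))
        \<le> exp (t * D) * ((if i < m then 0 else nw t [i]) * nw t w)" for w i
      using nw_append_le[of t "[i]" w] t by simp
    have Ub: "U (Suc n) \<le> 2 * Y" for n
    proof (induction n)
      case 0
      have "U (Suc 0) \<le> Y"
      proof -
        have "U (Suc 0) = (\<Sum>w\<in>{w \<in> bounded_words (Suc 0) N. hd w \<in> {..<m} \<and> last w \<in> {..<m}}. nw t w)"
          unfolding U_def by (intro sum.mono_neutral_cong_right finite_words_over finite_lessThan) (auto simp: words_over_def length_Suc_conv)
        then show ?thesis using Y(2)[OF t P(2), of "Suc 0" N] by simp
      qed
      then show ?case using Y(1) by simp
    next
      case (Suc n)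
      let ?T = "\<Sum>w\<in>bounded_words (Suc n + Suc 0) N. if hd w < m \<and> \<not> last w < m then nw t w else 0"
      have "U (Suc (Suc n)) = (\<Sum>w\<in>bounded_words (Suc (Suc n)) N. (if hd w < m \<and> last w < m then nw t w else 0)
          + (if hd w < m \<and> \<not> last w < m then nw t w else 0))"
        unfolding U_def by (intro sum.cong) auto
      also have "\<dots> = (\<Sum>w\<in>{w \<in> bounded_words (Suc (Suc n)) N. hd w \<in> {..<m} \<and> last w \<in> {..<m}}. nw t w) + ?T"
        unfolding sum.distrib by (intro arg_cong2[where f = "(+)"] sum.mono_neutral_cong_right sum.cong) auto
      finally have "U (Suc (Suc n)) =
        (\<Sum>w\<in>{w \<in> bounded_words (Suc (Suc n)) N. hd w \<in> {..<m} \<and> last w \<in> {..<m}}. nw t w) + ?T" .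
      moreover have "?T \<le> 1 / 2 * U (Suc n)"
      proof -
        have "?T = (\<Sum>w\<in>bounded_words (Suc n) N. \<Sum>i<N. if hd w < m \<and> \<not> i < m then nw t (w @ [i]) else 0)"
          unfolding sum_words_over_append sum_words_over_1
          by (intro sum.cong refl) (auto simp: words_over_def length_Suc_conv)
        also have "\<dots> \<le> (\<Sum>w\<in>bounded_words (Suc n) N. \<Sum>i<N. exp (t * D) *
            ((if hd w < m then nw t w else 0) * (if i < m then 0 else nw t [i])))"
          by (intro sum_mono last_step)
        also have "\<dots> = exp (t * D) * (U (Suc n) * (\<Sum>i<N. if i < m then 0 else nw t [i]))"
          unfolding U_def sum_product unfolding sum_distrib_left ..
        also have "\<dots> = (exp (t * D) * (\<Sum>i<N. if i < m then 0 else nw t [i])) * U (Suc n)" by simp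
        also have "\<dots> \<le> 1 / 2 * U (Suc n)" using half U0 by (intro mult_right_mono) auto
        finally show ?thesis .
      qed
      ultimately show ?case using Y(2)[OF t P(2), of "Suc (Suc n)" N] Suc by simp
    qed
    have "V n \<le> 4 * Y + 1" for n
    proof (induction n)
      case 0
      then show ?case using Y(1) by (simp add: V_def)
    next
      case (Suc n)
      let ?T = "\<Sum>w\<in>bounded_words (Suc 0 + n) N. if hd w < m then 0 else nw t w"
      have "V (Suc n) = U (Suc n) + ?T"
        unfolding V_def U_def by (simp add: sum.distrib[symmetric]) (intro sum.cong, auto)
      moreover have "?T \<le> 1 / 2 * V n"
      proof -
        have "?T = (\<Sum>i<N. \<Sum>w\<in>bounded_words n N. if i < m then 0 else nw t ([i] @ w))"
          unfolding sum_words_over_append sum_words_over_1 by (intro sum.cong refl) auto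
        also have "\<dots> \<le> (\<Sum>i<N. \<Sum>w\<in>bounded_words n N. exp (t * D) * ((if i < m then 0 else nw t [i]) * nw t w))"
          by (intro sum_mono first_step)
        also have "\<dots> = exp (t * D) * ((\<Sum>i<N. if i < m then 0 else nw t [i]) * V n)"
          unfolding V_def sum_product unfolding sum_distrib_left ..
        also have "\<dots> = (exp (t * D) * (\<Sum>i<N. if i < m then 0 else nw t [i])) * V n" by simp
        also have "\<dots> \<le> 1 / 2 * V n" using half V0 by (intro mult_right_mono) auto
        finally show ?thesis .
      qed
      ultimately show ?case using Suc Ub[of n] by simp
    qed
    then show ?thesis unfolding V_def .
  qed
  then show ?thesis using that[of "4 * Y + 1"] Y(1) by simp
qed

text \<open>One block is stripped at a time: replacing \<open>exp (b y)\<close> by 1 leaves an error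
  in which the words before and after the block decouple. With \<open>R j k\<close> denoting the sum
  over a free prefix of length \<open>j\<close> followed by \<open>k\<close> weighted blocks, this
  reads \<open>R j (Suc k) \<le> R (j + l) k + q * K * R 0 k\<close>, whence a factor
  \<open>1 + q * K\<close> for each block.\<close>

lemma block_word_sum_bound:
  assumes q: "q \<ge> 0" and K: "K \<ge> 0" "\<And>n. (\<Sum>w\<in>bounded_words n N. nw t w) \<le> K"
    and step: "\<And>x z. set x \<subseteq> {..<N} \<Longrightarrow> set z \<subseteq> {..<N} \<Longrightarrow>
      (\<Sum>y\<in>bounded_words l N. nw t (x @ y @ z) * exp (b y))
        \<le> (\<Sum>y\<in>bounded_words l N. nw t (x @ y @ z)) + q * (nw t x * nw t z)"
  shows "(\<Sum>w\<in>bounded_words (k * l) N. nw t w * exp (block_sum b l k w)) \<le> K * (1 + q * K) ^ k"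
proof -
  define R where "R = (\<lambda>j k. \<Sum>x\<in>bounded_words j N. \<Sum>w\<in>bounded_words (k * l) N. nw t (x @ w) * exp (block_sum b l k w))"
  have R0: "R 0 k = (\<Sum>w\<in>bounded_words (k * l) N. nw t w * exp (block_sum b l k w))" for k
    unfolding R_def by simp
  have pos: "R j k \<ge> 0" for j k unfolding R_def by (intro sum_nonneg) (auto simp: nw_nonneg)
  have "R j k \<le> K * (1 + q * K) ^ k" for j
  proof (induction k arbitrary: j)
    case 0
    then show ?case using K(2)[of j] by (simp add: R_def)
  next
    case (Suc k)
    let ?e = "\<lambda>z. exp (block_sum b l k z)"
    have "R j (Suc k) = (\<Sum>x\<in>bounded_words j N. \<Sum>y\<in>bounded_words l N. \<Sum>z\<in>bounded_words (k * l) N.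
        ?e z * (nw t (x @ y @ z) * exp (b y)))"
      unfolding R_def mult_Suc sum_words_over_append
      by (intro sum.cong refl) (auto simp: words_over_def exp_add mult_ac)
    also have "\<dots> = (\<Sum>x\<in>bounded_words j N. \<Sum>z\<in>bounded_words (k * l) N.
        ?e z * (\<Sum>y\<in>bounded_words l N. nw t (x @ y @ z) * exp (b y)))"
      by (subst sum.swap) (simp add: sum_distrib_left)
    also have "\<dots> \<le> (\<Sum>x\<in>bounded_words j N. \<Sum>z\<in>bounded_words (k * l) N.
        ?e z * ((\<Sum>y\<in>bounded_words l N. nw t (x @ y @ z)) + q * (nw t x * nw t z)))"
      using step by (intro sum_mono mult_left_mono) (auto simp: words_over_def)
    also have "\<dots> = (\<Sum>x\<in>bounded_words j N. \<Sum>z\<in>bounded_words (k * l) N. \<Sum>y\<in>bounded_words l N. nw t (x @ y @ z) * ?e z)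
        + q * (\<Sum>x\<in>bounded_words j N. \<Sum>z\<in>bounded_words (k * l) N. nw t x * (nw t z * ?e z))"
      by (simp add: ring_distribs sum.distrib sum_distrib_left mult_ac)
    also have "(\<Sum>x\<in>bounded_words j N. \<Sum>z\<in>bounded_words (k * l) N. \<Sum>y\<in>bounded_words l N. nw t (x @ y @ z) * ?e z)
        = R (j + l) k"
      unfolding R_def sum_words_over_append by (subst (2) sum.swap) simp
    also have "(\<Sum>x\<in>bounded_words j N. \<Sum>z\<in>bounded_words (k * l) N. nw t x * (nw t z * ?e z))
        = (\<Sum>x\<in>bounded_words j N. nw t x) * R 0 k"
      unfolding R0 sum_product ..
    also have "R (j + l) k + q * ((\<Sum>x\<in>bounded_words j N. nw t x) * R 0 k)
        \<le> K * (1 + q * K) ^ k + q * (K * (K * (1 + q * K) ^ k))"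
      using Suc[of "j + l"] Suc[of 0] K(2)[of j] pos[of 0 k] q K(1)
      by (intro add_mono mult_left_mono mult_mono) auto
    also have "\<dots> = K * (1 + q * K) ^ Suc k" by (simp add: algebra_simps)
    finally show ?case .
  qed
  from this[of 0] show ?thesis unfolding R0 .
qed

end

text \<open>Both \<open>a n + C\<close> and \<open>C - a n\<close> are subadditive. Fekete's lemma
  gives each a limit together with a one-sided bound, and the two limits are opposite.\<close>

lemma almost_additive_sequence:
  fixes a :: "nat \<Rightarrow> real"
  assumes C: "C \<ge> 0" and a: "\<And>m n. m \<ge> 1 \<Longrightarrow> n \<ge> 1 \<Longrightarrow> \<bar>a (m + n) - (a m + a n)\<bar> \<le> C"
  obtains l where "(\<lambda>n. a n / real n) \<longlonglongrightarrow> l" "\<And>n. n \<ge> 1 \<Longrightarrow> \<bar>a n - real n * l\<bar> \<le> C"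
proof -
  have lin: "\<bar>a (Suc n) - real (Suc n) * a 1\<bar> \<le> real n * C" for n
  proof (induction n)
    case (Suc n)
    have "\<bar>a (Suc n + 1) - (a (Suc n) + a 1)\<bar> \<le> C" by (intro a) auto
    then show ?case using Suc by (simp add: algebra_simps abs_le_iff)
  qed simp
  have lin': "\<bar>a n - real n * a 1\<bar> \<le> real n * C" if "n \<ge> 1" for n
    using lin[of "n - 1"] that C by (simp add: algebra_simps of_nat_diff)
  have "\<exists>l. (\<lambda>n. (a n + C) / real n) \<longlonglongrightarrow> l \<and> (\<forall>n\<ge>1. l * real n \<le> a n + C)"
  proof (rule fekete[of 1 "\<lambda>n. a n + C" "a 1 - C"])
    show "(a 1 - C) * real n \<le> a n + C" if "1 \<le> n" for n
      using lin'[OF that] C by (simp add: abs_le_iff algebra_simps)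
    show "a (m + n) + C \<le> a m + C + (a n + C)" if "1 \<le> m" "1 \<le> n" for m n
      using a[OF that] by (simp add: abs_le_iff)
  qed auto
  then obtain l where l: "(\<lambda>n. (a n + C) / real n) \<longlonglongrightarrow> l" "\<And>n. n \<ge> 1 \<Longrightarrow> l * real n \<le> a n + C" by blast
  have "\<exists>l. (\<lambda>n. (C - a n) / real n) \<longlonglongrightarrow> l \<and> (\<forall>n\<ge>1. l * real n \<le> C - a n)"
  proof (rule fekete[of 1 "\<lambda>n. C - a n" "- a 1 - C"])
    show "(- a 1 - C) * real n \<le> C - a n" if "1 \<le> n" for n
      using lin'[OF that] C by (simp add: abs_le_iff algebra_simps)
    show "C - a (m + n) \<le> C - a m + (C - a n)" if "1 \<le> m" "1 \<le> n" for m n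
      using a[OF that] by (simp add: abs_le_iff)
  qed auto
  then obtain l' where l': "(\<lambda>n. (C - a n) / real n) \<longlonglongrightarrow> l'" "\<And>n. n \<ge> 1 \<Longrightarrow> l' * real n \<le> C - a n" by blast
  have lim: "(\<lambda>n. a n / real n) \<longlonglongrightarrow> l"
    using tendsto_diff[OF l(1) lim_const_over_n[of C]] by (simp add: add_divide_distrib)
  have "(\<lambda>n. a n / real n) \<longlonglongrightarrow> - l'"
    using tendsto_diff[OF lim_const_over_n[of C] l'(1)] by (simp add: diff_divide_distrib)
  then have "l' = - l" using LIMSEQ_unique[OF lim] by force
  then have "\<bar>a n - real n * l\<bar> \<le> C" if "n \<ge> 1" for n
    using l(2)[OF that] l'(2)[OF that] by (simp add: abs_le_iff algebra_simps)
  then show ?thesis using that lim by blast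
qed

section \<open>Measurability on the shift space\<close>

text \<open>Unions of arbitrarily many cylinders of length \<open>n\<close>. As there are only
  countably many words, such sets are measurable, and unlike finite unions of cylinders they form an
  algebra when \<open>n\<close> varies.\<close>

definition determined :: "(nat \<Rightarrow> nat \<Rightarrow> nat) \<Rightarrow> nat \<Rightarrow> (nat \<Rightarrow> nat) set \<Rightarrow> bool" where
  "determined M n U \<longleftrightarrow> U \<subseteq> markov_shift M \<and>
     (\<forall>x\<in>markov_shift M. \<forall>y\<in>markov_shift M. prefix_word n x = prefix_word n y \<longrightarrow> (x \<in> U \<longleftrightarrow> y \<in> U))"

lemma prefix_word_eq_mono: "prefix_word m x = prefix_word m y \<Longrightarrow> n \<le> m \<Longrightarrow> prefix_word n x = prefix_word n y"
  by (metis take_prefix_word)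

lemma determined_mono: "determined M n U \<Longrightarrow> n \<le> m \<Longrightarrow> determined M m U"
  unfolding determined_def using prefix_word_eq_mono by metis

lemma determined_cylinder: "determined M (length w) (cylinder M w)"
  unfolding determined_def cylinder_def
  by (auto simp: list_eq_iff_nth_eq)

section \<open>Cylinders as a base of the topology and a generator of the Borel sets\<close>

context cms_potential
begin

lemma cylinder_Nil [simp]: "cylinder M [] = X"
  by (auto simp: cylinder_def)

lemma cylinder_empty: "\<not> adm w \<Longrightarrow> cylinder M w = {}"
  by (auto simp: cylinder_iff) (metis adm_prefix_word)

lemma openin_cylinder: "adm w \<Longrightarrow> w \<noteq> [] \<Longrightarrow> openin (shift_topology M) (cylinder M w)"
  unfolding shift_topology_def by (rule topology_generated_by_Basis) (auto simp: admissible_def adm_nth)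

lemma topspace_shift [simp]: "topspace (shift_topology M) = X"
proof -
  have "x \<in> \<Union>{cylinder M w |w. admissible M w}" if "x \<in> X" for x
  proof -
    have "x \<in> cylinder M [x 0]" using that by (simp add: cylinder_def)
    moreover have "admissible M [x 0]" by (simp add: admissible_def)
    ultimately show ?thesis by blast
  qed
  then show ?thesis unfolding shift_topology_def topology_generated_by_topspace by (auto simp: cylinder_def)
qed

lemma openin_contains_cylinder:
  assumes "openin (shift_topology M) U" "x \<in> U"
  shows "\<exists>n\<ge>1. cylinder M (prefix_word n x) \<subseteq> U"
proof -
  have "generate_topology_on {cylinder M w |w. admissible M w} U"
    using assms(1) unfolding shift_topology_def openin_topology_generated_by_iff .
  then show ?thesis using assms(2)
  proof (induction)
    case (Int a b)
    then obtain n m where n: "n \<ge> 1" "cylinder M (prefix_word n x) \<subseteq> a" and m: "m \<ge> 1" "cylinder M (prefix_word m x) \<subseteq> b" by auto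
    have mono: "cylinder M (prefix_word (max n m) x) \<subseteq> cylinder M (prefix_word k x)" if "k \<le> max n m" for k
    proof
      fix y assume "y \<in> cylinder M (prefix_word (max n m) x)"
      then have "y \<in> X" "prefix_word (max n m) y = prefix_word (max n m) x" by (auto simp: cylinder_iff)
      then show "y \<in> cylinder M (prefix_word k x)"
        using prefix_word_eq_mono[OF _ that, of y x] by (simp add: cylinder_iff)
    qed
    have "cylinder M (prefix_word (max n m) x) \<subseteq> a \<inter> b" using mono[of n] mono[of m] n(2) m(2) by simp blast
    then show ?case using n by (intro exI[of _ "max n m"]) simp
  next
    case (UN K)
    then show ?case by blast
  next
    case (Basis s)
    then obtain w where w: "s = cylinder M w" "admissible M w" by auto
    then have "prefix_word (length w) x = w" using Basis by (simp add: cylinder_iff)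
    then show ?case using w by (intro exI[of _ "length w"]) (auto simp: admissible_def Suc_le_eq)
  qed simp
qed

text \<open>An open set is the union of the cylinders contained in it, and there are only countably
  many words.\<close>

lemma sets_shift_borel: "sets (shift_borel M) = sigma_sets X (range (cylinder M))"
proof -
  have sub: "{U. openin (shift_topology M) U} \<subseteq> Pow X" using openin_subset by fastforce
  have eq: "sets (shift_borel M) = sigma_sets X {U. openin (shift_topology M) U}"
    unfolding shift_borel_def by (rule sets_measure_of[OF sub])
  show ?thesis unfolding eq
  proof (intro equalityI sigma_sets_mono subsetI)
    fix U assume "U \<in> {U. openin (shift_topology M) U}"
    then have U: "openin (shift_topology M) U" by simp
    define V where "V = {w. cylinder M w \<subseteq> U}"
    have "U = (\<Union>w\<in>V. cylinder M w)"
    proof (intro equalityI subsetI)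
      fix x assume x: "x \<in> U"
      then obtain n where "cylinder M (prefix_word n x) \<subseteq> U" using openin_contains_cylinder[OF U] by blast
      moreover have "x \<in> X" using x U openin_subset by fastforce
      then have "x \<in> cylinder M (prefix_word n x)" by (simp add: cylinder_iff)
      ultimately show "x \<in> (\<Union>w\<in>V. cylinder M w)" unfolding V_def by blast
    qed (auto simp: V_def)
    moreover have "(\<Union>w\<in>V. cylinder M w) \<in> sigma_sets X (range (cylinder M))"
    proof -
      interpret s: sigma_algebra X "sigma_sets X (range (cylinder M))"
        by (rule sigma_algebra_sigma_sets) (auto simp: cylinder_def)
      show ?thesis by (intro s.countable_UN') auto
    qed
    ultimately show "U \<in> sigma_sets X (range (cylinder M))" by simp
  next
    fix A assume "A \<in> range (cylinder M)"
    then obtain w where A: "A = cylinder M w" by auto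
    have "openin (shift_topology M) A"
    proof (cases "adm w")
      case True
      then show ?thesis using openin_cylinder[of w] openin_topspace[of "shift_topology M"] unfolding A
        by (cases "w = []") auto
    next
      case False
      then show ?thesis using cylinder_empty unfolding A by simp
    qed
    then show "A \<in> sigma_sets X {U. openin (shift_topology M) U}" by (intro sigma_sets.Basic) simp
  qed
qed

lemma space_shift_borel [simp]: "space (shift_borel M) = X"
  unfolding shift_borel_def by (rule space_measure_of) (use openin_subset in fastforce)

lemma cylinder_sets: "cylinder M w \<in> sets (shift_borel M)"
  unfolding sets_shift_borel by (intro sigma_sets.Basic) auto

lemma prefix_word_measurable: "prefix_word n \<in> measurable (shift_borel M) (count_space UNIV)"
proof -
  have "prefix_word n -` {w} \<inter> X \<in> sets (shift_borel M)" for w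
  proof (cases "length w = n")
    case True
    then have "prefix_word n -` {w} \<inter> X = cylinder M w" by (auto simp: cylinder_iff)
    then show ?thesis using cylinder_sets by simp
  next
    case False
    then have "prefix_word n -` {w} \<inter> X = {}" by auto
    then show ?thesis by simp
  qed
  then show ?thesis by (simp add: measurable_count_space_eq2_countable)
qed

lemma determined_sets: "determined M n U \<Longrightarrow> U \<in> sets (shift_borel M)"
proof -
  assume U: "determined M n U"
  have "U = prefix_word n -` (prefix_word n ` U) \<inter> space (shift_borel M)"
    using U unfolding determined_def by auto
  moreover have "prefix_word n -` (prefix_word n ` U) \<inter> space (shift_borel M) \<in> sets (shift_borel M)"
    by (rule measurable_sets[OF prefix_word_measurable]) simp
  ultimately show ?thesis by simp
qed

lemma shift_measurable: "shift \<in> measurable (shift_borel M) (shift_borel M)"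
proof (rule measurable_sigma_sets)
  show "sets (shift_borel M) = sigma_sets X (range (cylinder M))" by (rule sets_shift_borel)
  show "range (cylinder M) \<subseteq> Pow X" by (auto simp: cylinder_def)
  show "shift \<in> space (shift_borel M) \<rightarrow> X" using shift_closed1 by simp
  fix A assume "A \<in> range (cylinder M)"
  then obtain w where A: "A = cylinder M w" by auto
  have "determined M (Suc (length w)) (shift -` A \<inter> space (shift_borel M))"
  proof -
    have "prefix_word (length w) (shift x) = tl (prefix_word (Suc (length w)) x)" for x
      by (auto simp: list_eq_iff_nth_eq nth_tl shift_def)
    then show ?thesis unfolding determined_def A using shift_closed1 by (auto simp: cylinder_iff)
  qed
  then show "shift -` A \<inter> space (shift_borel M) \<in> sets (shift_borel M)" by (rule determined_sets)
qed

lemma continuous_map_measurable: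
  assumes "continuous_map (shift_topology M) euclideanreal g"
  shows "g \<in> borel_measurable (shift_borel M)"
proof (rule borel_measurableI)
  fix S :: "real set" assume "open S"
  then have "openin (shift_topology M) {x \<in> X. g x \<in> S}"
    using assms unfolding continuous_map_def by auto
  moreover have "g -` S \<inter> space (shift_borel M) = {x \<in> X. g x \<in> S}" by auto
  moreover have "{U. openin (shift_topology M) U} \<subseteq> sets (shift_borel M)"
    unfolding shift_borel_def by (subst sets_measure_of) (use openin_subset in \<open>fastforce+\<close>)
  ultimately show "g -` S \<inter> space (shift_borel M) \<in> sets (shift_borel M)" by auto
qed

lemma potential_measurable: "n \<ge> 1 \<Longrightarrow> f n \<in> borel_measurable (shift_borel M)"
  using continuous continuous_map_measurable unfolding continuous_potential_def by blast

text \<open>Summability bounds \<open>f 1\<close> from above, and almost additivity carries this on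
  to all \<open>f n\<close>. Hence only the negative parts can have infinite integrals.\<close>

lemma potential_upper_bound: "\<exists>c. \<forall>x\<in>X. f (Suc n) x \<le> c"
proof (induction n)
  case 0
  obtain S where S: "S \<ge> 0" "\<And>i. word_pot [i] \<le> S" by (fact letter_pot_bounded)
  have "f (Suc 0) x \<le> S + B" if "x \<in> X" for x
    using word_pot_prefix[of "Suc 0" x] that S(2)[of "x 0"] by (simp add: prefix_word_1 abs_le_iff)
  then show ?case by blast
next
  case (Suc n)
  obtain S where S: "S \<ge> 0" "\<And>i. word_pot [i] \<le> S" by (fact letter_pot_bounded)
  obtain c where c: "\<forall>x\<in>X. f (Suc n) x \<le> c" using Suc by blast
  have "f (Suc (Suc n)) x \<le> S + B + c + C" if x: "x \<in> X" for x
  proof -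
    have "\<bar>f (1 + Suc n) x - (f 1 x + f (Suc n) ((shift ^^ 1) x))\<bar> \<le> C" using x by (intro almost_add) auto
    moreover have "f 1 x \<le> S + B"
      using word_pot_prefix[of 1 x] x S(2)[of "x 0"] by (simp add: prefix_word_1 abs_le_iff)
    moreover have "f (Suc n) ((shift ^^ 1) x) \<le> c" using c shift_closed[OF x] by blast
    ultimately show ?thesis by (simp add: abs_le_iff)
  qed
  then show ?case by blast
qed

end

locale invariant_measure = cms_potential +
  fixes \<nu> :: "(nat \<Rightarrow> nat) measure"
  assumes invariant: "\<nu> \<in> invariant_measures M"

sublocale invariant_measure \<subseteq> prob_space \<nu>
  using invariant unfolding invariant_measures_def by simp

section \<open>Integrals along the shift and approximation by finitely many coordinates\<close>

context invariant_measure
begin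

lemma sets_nu [measurable_cong]: "sets \<nu> = sets (shift_borel M)"
  using invariant unfolding invariant_measures_def by simp

lemma space_nu [simp]: "space \<nu> = X"
  using sets_eq_imp_space_eq[OF sets_nu] by simp

lemma prob_X [simp]: "prob X = 1" "emeasure \<nu> X = 1"
  using prob_space emeasure_space_1 by simp_all

lemma measurable_nu: "g \<in> measurable (shift_borel M) N \<Longrightarrow> g \<in> measurable \<nu> N"
  by (simp add: measurable_cong_sets[OF sets_nu refl])

lemma shift_measurable_nu: "shift \<in> measurable \<nu> \<nu>"
  using shift_measurable by (simp add: measurable_cong_sets[OF sets_nu sets_nu])

lemma funpow_shift_measurable_nu: "shift ^^ n \<in> measurable \<nu> \<nu>"
proof (induction n)
  case (Suc n)
  show ?case unfolding funpow.simps by (rule measurable_comp[OF Suc shift_measurable_nu])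
qed (simp add: id_def)

lemma distr_shift: "distr \<nu> \<nu> shift = \<nu>"
proof (rule measure_eqI)
  show "emeasure (distr \<nu> \<nu> shift) A = emeasure \<nu> A" if "A \<in> sets (distr \<nu> \<nu> shift)" for A
    using that invariant emeasure_distr[OF shift_measurable_nu] unfolding invariant_measures_def by simp
qed simp

lemma distr_funpow_shift: "distr \<nu> \<nu> (shift ^^ n) = \<nu>"
proof (induction n)
  case 0
  then show ?case by (simp add: distr_id2)
next
  case (Suc n)
  have "distr \<nu> \<nu> (shift ^^ Suc n) = distr (distr \<nu> \<nu> (shift ^^ n)) \<nu> shift"
    unfolding funpow.simps by (rule distr_distr[OF shift_measurable_nu funpow_shift_measurable_nu, symmetric])
  then show ?case unfolding Suc distr_shift .
qed

lemma integral_shift: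
  fixes g :: "(nat \<Rightarrow> nat) \<Rightarrow> real"
  assumes "g \<in> borel_measurable \<nu>"
  shows "(\<integral>x. g ((shift ^^ n) x) \<partial>\<nu>) = (\<integral>x. g x \<partial>\<nu>)"
  using integral_distr[OF funpow_shift_measurable_nu assms, of n] by (simp add: distr_funpow_shift)

lemma integrable_shift:
  fixes g :: "(nat \<Rightarrow> nat) \<Rightarrow> real"
  assumes "integrable \<nu> g"
  shows "integrable \<nu> (\<lambda>x. g ((shift ^^ n) x))"
  by (rule integrable_distr[OF funpow_shift_measurable_nu]) (simp add: distr_funpow_shift assms)

lemma measure_shift:
  assumes "A \<in> sets \<nu>"
  shows "measure \<nu> ((shift ^^ n) -` A \<inter> X) = measure \<nu> A"
  using measure_distr[OF funpow_shift_measurable_nu assms, of n] by (simp add: distr_funpow_shift)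

lemma potential_measurable_nu: "n \<ge> 1 \<Longrightarrow> f n \<in> borel_measurable \<nu>"
  using potential_measurable measurable_nu by blast

lemma prefix_word_measurable_nu: "prefix_word n \<in> measurable \<nu> (count_space UNIV)"
  by (rule measurable_nu[OF prefix_word_measurable])

lemma prefix_fun_borel: "(\<lambda>x. g (prefix_word n x) :: real) \<in> borel_measurable \<nu>"
  by (rule measurable_compose[OF prefix_word_measurable_nu]) simp

lemma determined_sets_nu: "determined M n U \<Longrightarrow> U \<in> sets \<nu>"
  using determined_sets sets_nu by simp

lemma cylinder_sets_nu: "cylinder M w \<in> sets \<nu>"
  using cylinder_sets sets_nu by simp

text \<open>Induction over the generated sigma-algebra. In a countable union, finitely many members
  carry all but \<open>e / 2\<close> of the mass, and each of them is approximated within a share of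
  the other \<open>e / 2\<close>.\<close>

lemma approx_determined:
  assumes "A \<in> sets \<nu>" "e > 0"
  shows "\<exists>n U. determined M n U \<and> measure \<nu> ((A - U) \<union> (U - A)) < e"
proof -
  have "A \<in> sigma_sets X (range (cylinder M))" using assms sets_nu sets_shift_borel by simp
  then show ?thesis using assms(2)
  proof (induction arbitrary: e)
    case (Basic a)
    then obtain w where "a = cylinder M w" by auto
    then show ?case using determined_cylinder[of M w] Basic by (intro exI[of _ "length w"] exI[of _ a]) simp
  next
    case Empty
    then show ?case by (intro exI[of _ 0] exI[of _ "{}"]) (simp add: determined_def)
  next
    case (Compl a)
    then obtain n U where U: "determined M n U" "measure \<nu> ((a - U) \<union> (U - a)) < e" by blast
    have "a \<subseteq> X" using Compl(1) sigma_sets_into_sp[of "range (cylinder M)" X a] by (auto simp: cylinder_def)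
    then have "(X - a - (X - U)) \<union> (X - U - (X - a)) = (a - U) \<union> (U - a)"
      using U(1) unfolding determined_def by auto
    moreover have "determined M n (X - U)" using U(1) unfolding determined_def by blast
    ultimately show ?case using U(2) by (intro exI[of _ n] exI[of _ "X - U"]) simp
  next
    case (Union a)
    have a_sets: "a i \<in> sets \<nu>" for i using Union(1) sets_nu sets_shift_borel by simp
    have "(\<lambda>N. measure \<nu> (\<Union>i<N. a i)) \<longlonglongrightarrow> measure \<nu> (\<Union>N. \<Union>i<N. a i)"
    proof (rule finite_Lim_measure_incseq)
      show "range (\<lambda>N. \<Union>i<N. a i) \<subseteq> sets \<nu>" using a_sets by (auto intro: sets.finite_UN)
      show "incseq (\<lambda>N. \<Union>i<N. a i)" by (intro incseq_SucI UN_mono) auto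
    qed
    also have "(\<Union>N. \<Union>i<N. a i) = (\<Union>i. a i)" by auto
    finally have lim: "(\<lambda>N. measure \<nu> (\<Union>i<N. a i)) \<longlonglongrightarrow> measure \<nu> (\<Union>i. a i)" .
    have "measure \<nu> (\<Union>i. a i) - e / 2 < measure \<nu> (\<Union>i. a i)" using Union(3) by simp
    from order_tendstoD(1)[OF lim this] obtain N where N: "measure \<nu> (\<Union>i<N. a i) > measure \<nu> (\<Union>i. a i) - e / 2"
      by (auto simp: eventually_sequentially)
    define d where "d = e / (2 * (real N + 1))"
    have d: "d > 0" unfolding d_def using Union(3) by simp
    have "\<forall>i. \<exists>n U. determined M n U \<and> measure \<nu> ((a i - U) \<union> (U - a i)) < d" using Union(2)[OF d] by blast
    then obtain n U where nU: "\<And>i. determined M (n i) (U i)" "\<And>i. measure \<nu> ((a i - U i) \<union> (U i - a i)) < d" by metis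
    define m where "m = Max (insert 0 (n ` {..<N}))"
    have m: "n i \<le> m" if "i < N" for i unfolding m_def using that by (intro Max_ge) auto
    have U_sets: "U i \<in> sets \<nu>" for i using determined_sets_nu[OF nU(1)] .
    let ?V = "\<Union>i<N. U i"
    have det: "determined M m ?V"
    proof -
      have *: "determined M m (U i)" if "i < N" for i using determined_mono[OF nU(1) m[OF that]] .
      have "?V \<subseteq> X" using * unfolding determined_def by blast
      moreover have "x \<in> ?V \<longleftrightarrow> y \<in> ?V" if "x \<in> X" "y \<in> X" "prefix_word m x = prefix_word m y" for x y
      proof -
        have "x \<in> U i \<longleftrightarrow> y \<in> U i" if "i < N" for i
          using *[OF that] \<open>x \<in> X\<close> \<open>y \<in> X\<close> \<open>prefix_word m x = prefix_word m y\<close> unfolding determined_def by blast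
        then show ?thesis by auto
      qed
      ultimately show ?thesis unfolding determined_def by blast
    qed
    have "measure \<nu> (((\<Union>i. a i) - ?V) \<union> (?V - (\<Union>i. a i)))
        \<le> measure \<nu> (((\<Union>i. a i) - (\<Union>i<N. a i)) \<union> (\<Union>i<N. (a i - U i) \<union> (U i - a i)))"
      using a_sets U_sets by (intro finite_measure_mono sets.Un sets.Diff sets.finite_UN sets.countable_UN) auto
    also have "\<dots> \<le> measure \<nu> ((\<Union>i. a i) - (\<Union>i<N. a i)) + measure \<nu> (\<Union>i<N. (a i - U i) \<union> (U i - a i))"
      using a_sets U_sets by (intro measure_Un_le sets.Un sets.Diff sets.finite_UN sets.countable_UN) auto
    also have "measure \<nu> ((\<Union>i. a i) - (\<Union>i<N. a i)) = measure \<nu> (\<Union>i. a i) - measure \<nu> (\<Union>i<N. a i)"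
      using a_sets by (intro finite_measure_Diff sets.finite_UN sets.countable_UN) auto
    also have "measure \<nu> (\<Union>i<N. (a i - U i) \<union> (U i - a i)) \<le> (\<Sum>i<N. measure \<nu> ((a i - U i) \<union> (U i - a i)))"
      using a_sets U_sets by (intro finite_measure_subadditive_finite) auto
    also have "\<dots> \<le> (\<Sum>i<N. d)" using nU(2) by (intro sum_mono less_imp_le)
    also have "\<dots> \<le> e / 2" unfolding d_def using Union(3) by (simp add: field_simps)
    finally have "measure \<nu> (((\<Union>i. a i) - ?V) \<union> (?V - (\<Union>i. a i))) < e" using N by simp
    then show ?case using det by blast
  qed
qed

section \<open>The asymptotic mean\<close>

definition mean :: real where "mean = real_of_ereal (asymptotic_mean f \<nu>)"

lemma integrable_potential:
  assumes "integrable \<nu> (f 1)" "n \<ge> 1"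
  shows "integrable \<nu> (f n)"
  using assms(2)
proof (induction n rule: nat_induct_at_least)
  case base
  then show ?case using assms by simp
next
  case (Suc n)
  let ?g = "\<lambda>x. \<bar>f n x\<bar> + \<bar>f 1 ((shift ^^ n) x)\<bar> + C"
  have g: "integrable \<nu> ?g" using Suc integrable_shift[OF assms(1), of n] by auto
  show ?case
  proof (rule Bochner_Integration.integrable_bound[OF g])
    show "f (Suc n) \<in> borel_measurable \<nu>" by (rule potential_measurable_nu) simp
    show "AE x in \<nu>. norm (f (Suc n) x) \<le> norm (?g x)"
    proof (rule AE_I2)
      fix x assume "x \<in> space \<nu>"
      then have "\<bar>f (n + 1) x - (f n x + f 1 ((shift ^^ n) x))\<bar> \<le> C" using Suc by (intro almost_add) auto
      then show "norm (f (Suc n) x) \<le> norm (?g x)" by simp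
    qed
  qed
qed

lemma integral_potential_add:
  assumes "integrable \<nu> (f 1)" "n \<ge> 1" "m \<ge> 1"
  shows "\<bar>(\<integral>x. f (n + m) x \<partial>\<nu>) - ((\<integral>x. f n x \<partial>\<nu>) + (\<integral>x. f m x \<partial>\<nu>))\<bar> \<le> C"
proof -
  have I: "integrable \<nu> (f n)" "integrable \<nu> (f m)" "integrable \<nu> (f (n + m))"
    using integrable_potential[OF assms(1)] assms by auto
  note I2 = integrable_shift[OF I(2), of n]
  have eq: "(\<integral>x. f (n + m) x \<partial>\<nu>) - ((\<integral>x. f n x \<partial>\<nu>) + (\<integral>x. f m x \<partial>\<nu>))
    = (\<integral>x. f (n + m) x - (f n x + f m ((shift ^^ n) x)) \<partial>\<nu>)"
    using I I2 integral_shift[OF potential_measurable_nu[OF assms(3)], of n] by simp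
  have "\<bar>\<integral>x. f (n + m) x - (f n x + f m ((shift ^^ n) x)) \<partial>\<nu>\<bar>
      \<le> (\<integral>x. \<bar>f (n + m) x - (f n x + f m ((shift ^^ n) x))\<bar> \<partial>\<nu>)"
    by (rule integral_abs_bound)
  also have "\<dots> \<le> (\<integral>x. C \<partial>\<nu>)"
    using almost_add assms I I2 by (intro integral_mono) auto
  also have "\<dots> = C" by (simp add: prob_space)
  finally show ?thesis using eq by simp
qed

lemma extended_integral_eq:
  assumes "integrable \<nu> g"
  shows "extended_integral \<nu> g = ereal (\<integral>x. g x \<partial>\<nu>)"
proof -
  obtain r q where r: "0 \<le> r" "0 \<le> q" "(\<integral>\<^sup>+ x. ennreal (g x) \<partial>\<nu>) = ennreal r"
    "(\<integral>\<^sup>+ x. ennreal (- g x) \<partial>\<nu>) = ennreal q" "(\<integral>x. g x \<partial>\<nu>) = r - q"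
    using assms by (rule integrableE)
  then show ?thesis unfolding extended_integral_def by (simp add: enn2ereal_ennreal)
qed

text \<open>By invariance the integrals of \<open>f n\<close> inherit almost additivity with the
  same \<open>C\<close>. The error bound at each fixed \<open>n\<close> is what later turns
  continuity of integrals into continuity of the mean.\<close>

lemma asymptotic_mean_eq:
  assumes "integrable \<nu> (f 1)"
  shows "asymptotic_mean f \<nu> = ereal mean"
    and "n \<ge> 1 \<Longrightarrow> \<bar>(\<integral>x. f n x \<partial>\<nu>) - real n * mean\<bar> \<le> C"
proof -
  define a where "a = (\<lambda>n. \<integral>x. f n x \<partial>\<nu>)"
  have "\<exists>l. (\<lambda>n. a n / real n) \<longlonglongrightarrow> l \<and> (\<forall>n\<ge>1. \<bar>a n - real n * l\<bar> \<le> C)"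
    by (rule almost_additive_sequence[of C a]) (use C_nonneg integral_potential_add[OF assms] in \<open>auto simp: a_def\<close>)
  then obtain l where l: "(\<lambda>n. a n / real n) \<longlonglongrightarrow> l" "\<And>n. n \<ge> 1 \<Longrightarrow> \<bar>a n - real n * l\<bar> \<le> C" by blast
  have "(\<lambda>n. ereal (1 / real n) * extended_integral \<nu> (f n)) \<longlonglongrightarrow> ereal l"
  proof (rule Lim_transform_eventually)
    show "(\<lambda>n. ereal (a n / real n)) \<longlonglongrightarrow> ereal l" using l(1) by (rule tendsto_ereal)
    show "\<forall>\<^sub>F n in sequentially. ereal (a n / real n) = ereal (1 / real n) * extended_integral \<nu> (f n)"
      using eventually_ge_at_top[of 1]
      by eventually_elim (simp add: extended_integral_eq[OF integrable_potential[OF assms]] a_def)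
  qed
  then have am: "asymptotic_mean f \<nu> = ereal l" unfolding asymptotic_mean_def by (rule limI)
  then have "mean = l" unfolding mean_def by simp
  then show "asymptotic_mean f \<nu> = ereal mean" "n \<ge> 1 \<Longrightarrow> \<bar>(\<integral>x. f n x \<partial>\<nu>) - real n * mean\<bar> \<le> C"
    using am l(2) unfolding a_def by auto
qed

text \<open>Each \<open>f n\<close> is at most \<open>f 1\<close> plus a constant, since the
  remaining part of the potential is bounded above. If \<open>f 1\<close> were not integrable, its
  integral would be minus infinity, then so would that of every \<open>f n\<close>, and so would the
  mean.\<close>

lemma integrable_of_asymptotic_mean:
  assumes "asymptotic_mean f \<nu> > - \<infinity>"
  shows "integrable \<nu> (f 1)"
proof (rule ccontr)
  assume not: "\<not> integrable \<nu> (f 1)"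
  have pos: "(\<integral>\<^sup>+ x. ennreal (f (Suc n) x) \<partial>\<nu>) < \<infinity>" for n
  proof -
    obtain c where c: "\<forall>x\<in>X. f (Suc n) x \<le> c" using potential_upper_bound by blast
    have "(\<integral>\<^sup>+ x. ennreal (f (Suc n) x) \<partial>\<nu>) \<le> (\<integral>\<^sup>+ x. ennreal c \<partial>\<nu>)"
      using c by (intro nn_integral_mono ennreal_leI) auto
    also have "\<dots> < \<infinity>" by (simp add: emeasure_space_1)
    finally show ?thesis .
  qed
  have neg1: "(\<integral>\<^sup>+ x. ennreal (- f 1 x) \<partial>\<nu>) = \<infinity>"
    using not pos[of 0] potential_measurable_nu[of 1] unfolding real_integrable_def
    by auto
  have neg: "(\<integral>\<^sup>+ x. ennreal (- f (Suc n) x) \<partial>\<nu>) = \<infinity>" for n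
  proof (cases n)
    case 0
    then show ?thesis using neg1 by simp
  next
    case (Suc k)
    obtain c where c: "\<forall>x\<in>X. f (Suc k) x \<le> c" using potential_upper_bound by blast
    have "(\<integral>\<^sup>+ x. ennreal (- f 1 x) \<partial>\<nu>) \<le> (\<integral>\<^sup>+ x. ennreal (- f (Suc n) x) + ennreal \<bar>c + C\<bar> \<partial>\<nu>)"
    proof (rule nn_integral_mono)
      fix x assume "x \<in> space \<nu>"
      then have x: "x \<in> X" by simp
      have "\<bar>f (1 + Suc k) x - (f 1 x + f (Suc k) ((shift ^^ 1) x))\<bar> \<le> C" using x by (intro almost_add) auto
      moreover have "f (Suc k) ((shift ^^ 1) x) \<le> c" using c shift_closed[OF x] by blast
      ultimately have le: "- f 1 x \<le> - f (Suc n) x + \<bar>c + C\<bar>"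
        using Suc abs_ge_self[of "c + C"] by (simp add: abs_le_iff)
      have "- f 1 x \<le> max 0 (- f (Suc n) x) + \<bar>c + C\<bar>" using le by simp
      then have "ennreal (- f 1 x) \<le> ennreal (max 0 (- f (Suc n) x) + \<bar>c + C\<bar>)" by (rule ennreal_leI)
      also have "\<dots> = ennreal (max 0 (- f (Suc n) x)) + ennreal \<bar>c + C\<bar>" by (rule ennreal_plus) auto
      also have "ennreal (max 0 (- f (Suc n) x)) = ennreal (- f (Suc n) x)" by (simp add: ennreal_max_0)
      finally show "ennreal (- f 1 x) \<le> ennreal (- f (Suc n) x) + ennreal \<bar>c + C\<bar>" .
    qed
    also have "\<dots> = (\<integral>\<^sup>+ x. ennreal (- f (Suc n) x) \<partial>\<nu>) + ennreal \<bar>c + C\<bar>"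
      using potential_measurable_nu[of "Suc n"] by (subst nn_integral_add) (auto simp: emeasure_space_1)
    finally have "(\<integral>\<^sup>+ x. ennreal (- f (Suc n) x) \<partial>\<nu>) + ennreal \<bar>c + C\<bar> = \<infinity>" using neg1 by (simp add: top_unique)
    then show ?thesis by simp
  qed
  have "ereal (1 / real n) * extended_integral \<nu> (f n) = - \<infinity>" if "n \<ge> 1" for n
  proof -
    obtain k where k: "n = Suc k" using \<open>n \<ge> 1\<close> by (cases n) auto
    obtain r where r: "r \<ge> 0" "(\<integral>\<^sup>+ x. ennreal (f n x) \<partial>\<nu>) = ennreal r"
      using pos[of k] unfolding k by (metis ennreal_cases infinity_ennreal_def less_irrefl)
    have "extended_integral \<nu> (f n) = - \<infinity>"
      using neg[of k] r unfolding extended_integral_def k by (simp add: enn2ereal_ennreal)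
    then show ?thesis using that by simp
  qed
  then have "(\<lambda>n. ereal (1 / real n) * extended_integral \<nu> (f n)) \<longlonglongrightarrow> - \<infinity>"
    by (intro tendsto_eventually eventually_sequentiallyI[of 1])
  then have "asymptotic_mean f \<nu> = - \<infinity>" unfolding asymptotic_mean_def by (rule limI)
  then show False using assms by simp
qed

end

section \<open>Entropy of finite partitions\<close>

lemma sum_words_over_prod:
  fixes g :: "nat \<Rightarrow> 'a \<Rightarrow> real"
  shows "(\<Sum>c\<in>words_over S n. \<Prod>i<n. g i (c ! i)) = (\<Prod>i<n. \<Sum>a\<in>S. g i a)"
proof (induction n)
  case (Suc n)
  have "(\<Sum>c\<in>words_over S (n + Suc 0). \<Prod>i<Suc n. g i (c ! i))
      = (\<Sum>u\<in>words_over S n. \<Sum>a\<in>S. (\<Prod>i<n. g i (u ! i)) * g n a)"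
    unfolding sum_words_over_append sum_words_over_1
    by (intro sum.cong refl) (auto simp: words_over_def nth_append)
  also have "\<dots> = (\<Sum>u\<in>words_over S n. \<Prod>i<n. g i (u ! i)) * (\<Sum>a\<in>S. g n a)" by (simp add: sum_product)
  finally show ?case using Suc by simp
qed simp

text \<open>The exponent is \<open>- \<beta>\<close> times the Hamming distance to \<open>d\<close>,
  so the sum is a product over positions, each factor being at most
  \<open>1 + card S * exp (- \<beta>)\<close>. For large \<open>\<beta>\<close> the number of label
  sequences costs almost nothing per letter.\<close>

lemma sum_words_over_mismatch:
  assumes S: "finite S" and d: "d \<in> words_over S n"
  shows "(\<Sum>c\<in>words_over S n. exp (- (\<beta> * (\<Sum>i<n. if c ! i = d ! i then 0 else 1))))
     \<le> exp (real n * (real (card S) * exp (- \<beta>)))"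
proof -
  have "(\<Sum>c\<in>words_over S n. exp (- (\<beta> * (\<Sum>i<n. if c ! i = d ! i then 0 else 1))))
      = (\<Sum>c\<in>words_over S n. \<Prod>i<n. (\<lambda>i a. if a = d ! i then 1 else exp (- \<beta>)) i (c ! i))"
    by (intro sum.cong refl)
      (auto simp: sum_distrib_left sum_negf[symmetric] exp_sum intro!: prod.cong)
  also have "\<dots> = (\<Prod>i<n. \<Sum>a\<in>S. if a = d ! i then 1 else exp (- \<beta>))"
    by (rule sum_words_over_prod)
  also have "\<dots> \<le> (\<Prod>i<n. exp (real (card S) * exp (- \<beta>)))"
  proof (rule prod_mono, intro conjI)
    fix i assume "i \<in> {..<n}"
    then have "d ! i \<in> S" using d by (auto simp: words_over_def subset_iff)
    have "(\<Sum>a\<in>S. if a = d ! i then 1 else exp (- \<beta>)) \<le> (\<Sum>a\<in>S. (if a = d ! i then 1 else 0) + exp (- \<beta>))"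
      by (intro sum_mono) auto
    also have "\<dots> = 1 + real (card S) * exp (- \<beta>)"
      using S \<open>d ! i \<in> S\<close> by (simp add: sum.distrib)
    also have "\<dots> \<le> exp (real (card S) * exp (- \<beta>))" by (rule exp_ge_add_one_self)
    finally show "(\<Sum>a\<in>S. if a = d ! i then 1 else exp (- \<beta>)) \<le> exp (real (card S) * exp (- \<beta>))" .
  qed (auto intro!: sum_nonneg)
  finally show ?thesis by (simp add: exp_of_nat_mult)
qed

locale partitioned_measure = invariant_measure +
  fixes \<xi> :: "(nat \<Rightarrow> nat) set set"
  assumes partition: "finite_measurable_partition \<nu> \<xi>"
begin

definition cell :: "(nat \<Rightarrow> nat) \<Rightarrow> (nat \<Rightarrow> nat) set" where
  "cell x = (THE A. A \<in> \<xi> \<and> x \<in> A)"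

text \<open>The itinerary of \<open>x\<close> through the cells of \<open>\<xi>\<close>. Words over
  \<open>\<xi>\<close> serve as indices for the cells of the iterated join, so that the machinery
  for word sums applies to them.\<close>

definition label :: "nat \<Rightarrow> (nat \<Rightarrow> nat) \<Rightarrow> (nat \<Rightarrow> nat) set list" where
  "label n x = map (\<lambda>i. cell ((shift ^^ i) x)) [0..<n]"

definition label_set :: "(nat \<Rightarrow> nat) set list \<Rightarrow> (nat \<Rightarrow> nat) set" where
  "label_set c = {x \<in> X. label (length c) x = c}"

definition label_prob :: "(nat \<Rightarrow> nat) set list \<Rightarrow> real" where
  "label_prob c = measure \<nu> (label_set c)"

text \<open>The entropy of the \<open>n\<close>-fold join. Words without any point are kept in the
  index set, since they contribute 0.\<close>

definition label_entropy :: "nat \<Rightarrow> real" where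
  "label_entropy n = - (\<Sum>c\<in>words_over \<xi> n. label_prob c * ln (label_prob c))"

lemma finite_xi: "finite \<xi>" and xi_sets: "A \<in> \<xi> \<Longrightarrow> A \<in> sets \<nu>" and xi_partition: "partition_on X \<xi>"
  using partition unfolding finite_measurable_partition_def by auto

lemma cell_unique: "A \<in> \<xi> \<Longrightarrow> x \<in> A \<Longrightarrow> cell x = A"
  unfolding cell_def using xi_partition partition_onD2[OF xi_partition]
  by (intro the_equality) (auto simp: disjoint_def)

lemma cell_mem: "x \<in> X \<Longrightarrow> cell x \<in> \<xi> \<and> x \<in> cell x"
  using partition_onD1[OF xi_partition] cell_unique by blast

lemma cell_iff: "x \<in> X \<Longrightarrow> A \<in> \<xi> \<Longrightarrow> cell x = A \<longleftrightarrow> x \<in> A"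
  using cell_mem cell_unique by blast

lemma length_label [simp]: "length (label n x) = n"
  by (simp add: label_def)

lemma nth_label [simp]: "i < n \<Longrightarrow> label n x ! i = cell ((shift ^^ i) x)"
  by (simp add: label_def)

lemma label_words: "x \<in> X \<Longrightarrow> label n x \<in> words_over \<xi> n"
  using cell_mem shift_closed by (auto simp: words_over_def label_def)

lemma label_add: "label (n + m) x = label n x @ label m ((shift ^^ n) x)"
  by (rule nth_equalityI) (auto simp: nth_append shift_funpow add.assoc[symmetric])

lemma label_set_sets: "c \<in> words_over \<xi> n \<Longrightarrow> label_set c \<in> sets \<nu>"
proof -
  assume c: "c \<in> words_over \<xi> n"
  then have len: "length c = n" and cx: "\<And>i. i < n \<Longrightarrow> c ! i \<in> \<xi>" by (auto simp: words_over_def)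
  have "label_set c = X \<inter> (\<Inter>i\<in>{..<n}. (shift ^^ i) -` (c ! i) \<inter> X)"
  proof (intro equalityI subsetI)
    fix x assume "x \<in> label_set c"
    then have x: "x \<in> X" "label n x = c" by (auto simp: label_set_def len)
    have "(shift ^^ i) x \<in> c ! i" if "i < n" for i
      using cell_mem[OF shift_closed[OF x(1), of i]] x(2) that by (metis nth_label)
    then show "x \<in> X \<inter> (\<Inter>i\<in>{..<n}. (shift ^^ i) -` (c ! i) \<inter> X)" using x by auto
  next
    fix x assume x: "x \<in> X \<inter> (\<Inter>i\<in>{..<n}. (shift ^^ i) -` (c ! i) \<inter> X)"
    then have xi: "(shift ^^ i) x \<in> c ! i" if "i < n" for i using that by blast
    have "label n x = c"
    proof (rule nth_equalityI)
      fix i assume "i < length (label n x)"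
      then have i: "i < n" by simp
      then show "label n x ! i = c ! i" using cell_unique[OF cx[OF i] xi[OF i]] by simp
    qed (simp add: len)
    then show "x \<in> label_set c" using x by (auto simp: label_set_def len)
  qed
  moreover have "(\<Inter>i\<in>{..<n}. (shift ^^ i) -` (c ! i) \<inter> X) \<in> sets \<nu>" if "n > 0"
  proof (intro sets.finite_INT)
    show "(shift ^^ i) -` (c ! i) \<inter> X \<in> sets \<nu>" if "i \<in> {..<n}" for i
      using measurable_sets[OF funpow_shift_measurable_nu xi_sets[OF cx]] that by simp
  qed (use that in auto)
  ultimately show ?thesis
    using sets.top[of \<nu>] by (cases "n = 0") auto
qed

lemma label_set_disjoint: "length c = length d \<Longrightarrow> c \<noteq> d \<Longrightarrow> label_set c \<inter> label_set d = {}"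
  by (auto simp: label_set_def)

lemma label_set_Un: "(\<Union>c\<in>words_over \<xi> n. label_set c) = X"
  using label_words by (force simp: label_set_def words_over_def)

lemma label_prob_nonneg: "label_prob c \<ge> 0" by (simp add: label_prob_def)

lemma label_prob_le_1: "label_prob c \<le> 1" by (simp add: label_prob_def)

lemma sum_label_prob_inter:
  assumes "A \<in> sets \<nu>"
  shows "(\<Sum>c\<in>words_over \<xi> n. measure \<nu> (label_set c \<inter> A)) = measure \<nu> A"
proof -
  have "(\<Sum>c\<in>words_over \<xi> n. measure \<nu> (label_set c \<inter> A)) = measure \<nu> (\<Union>c\<in>words_over \<xi> n. label_set c \<inter> A)"
  proof (rule finite_measure_finite_Union[symmetric])
    show "(\<lambda>c. label_set c \<inter> A) ` words_over \<xi> n \<subseteq> sets \<nu>" using assms label_set_sets by blast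
    show "disjoint_family_on (\<lambda>c. label_set c \<inter> A) (words_over \<xi> n)"
      unfolding disjoint_family_on_def words_over_def using label_set_disjoint by blast
  qed (use finite_xi in simp)
  also have "(\<Union>c\<in>words_over \<xi> n. label_set c \<inter> A) = A"
    using label_set_Un[of n] sets.sets_into_space[OF assms] by auto
  finally show ?thesis .
qed

lemma sum_label_prob: "(\<Sum>c\<in>words_over \<xi> n. label_prob c) = 1"
proof -
  have "label_set c \<inter> X = label_set c" for c by (auto simp: label_set_def)
  then show ?thesis using sum_label_prob_inter[of X n] sets.top[of \<nu>] by (simp add: label_prob_def)
qed

lemma label_set_append: "label_set (c @ d) = label_set c \<inter> ((shift ^^ length c) -` label_set d \<inter> X)"
  using shift_closed by (auto simp: label_set_def label_add)

lemma sum_label_prob_append: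
  assumes "c \<in> words_over \<xi> n"
  shows "(\<Sum>d\<in>words_over \<xi> m. label_prob (c @ d)) = label_prob c"
proof -
  have "(\<Sum>d\<in>words_over \<xi> m. label_prob (c @ d)) = measure \<nu> (\<Union>d\<in>words_over \<xi> m. label_set (c @ d))"
    unfolding label_prob_def
  proof (rule finite_measure_finite_Union[symmetric])
    show "(\<lambda>d. label_set (c @ d)) ` words_over \<xi> m \<subseteq> sets \<nu>"
    proof clarify
      fix d assume "d \<in> words_over \<xi> m"
      then have "c @ d \<in> words_over \<xi> (n + m)" using assms by (auto simp: words_over_def)
      then show "label_set (c @ d) \<in> sets \<nu>" by (rule label_set_sets)
    qed
    show "disjoint_family_on (\<lambda>d. label_set (c @ d)) (words_over \<xi> m)"
      unfolding disjoint_family_on_def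
    proof (intro ballI impI)
      fix d d' assume "d \<in> words_over \<xi> m" "d' \<in> words_over \<xi> m" "d \<noteq> d'"
      then show "label_set (c @ d) \<inter> label_set (c @ d') = {}"
        by (intro label_set_disjoint) (auto simp: words_over_def)
    qed
  qed (use finite_xi in simp)
  also have "(\<Union>d\<in>words_over \<xi> m. label_set (c @ d)) = label_set c"
    using label_set_Un[of m] shift_closed unfolding label_set_append by (auto simp: label_set_def)
  finally show ?thesis by (simp add: label_prob_def)
qed

lemma sum_label_prob_append':
  assumes "d \<in> words_over \<xi> m"
  shows "(\<Sum>c\<in>words_over \<xi> n. label_prob (c @ d)) = label_prob d"
proof -
  have A: "(shift ^^ n) -` label_set d \<inter> X \<in> sets \<nu>"
    using measurable_sets[OF funpow_shift_measurable_nu label_set_sets[OF assms], of n] by simp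
  have "(\<Sum>c\<in>words_over \<xi> n. label_prob (c @ d)) = (\<Sum>c\<in>words_over \<xi> n. measure \<nu> (label_set c \<inter> ((shift ^^ n) -` label_set d \<inter> X)))"
    by (intro sum.cong refl) (auto simp: label_prob_def label_set_append words_over_def)
  also have "\<dots> = label_prob d"
    unfolding label_prob_def using sum_label_prob_inter[OF A] measure_shift[OF label_set_sets[OF assms], of n] by simp
  finally show ?thesis .
qed

text \<open>Relative entropy of the joint distribution of two successive stretches of labels with
  respect to the product of its marginals. By invariance the second marginal is the distribution of
  the first \<open>m\<close> labels.\<close>

lemma label_entropy_subadditive: "label_entropy (n + m) \<le> label_entropy n + label_entropy m"
proof -
  let ?I = "words_over \<xi> n \<times> words_over \<xi> m"
  let ?q = "\<lambda>(c, d). label_prob (c @ d)" and ?r = "\<lambda>(c, d). label_prob c * label_prob d"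
  have le: "label_prob (c @ d) \<le> label_prob c" "label_prob (c @ d) \<le> label_prob d"
    if "c \<in> words_over \<xi> n" "d \<in> words_over \<xi> m" for c d
  proof -
    have "label_prob (c @ d) \<le> (\<Sum>d\<in>words_over \<xi> m. label_prob (c @ d))"
      using that finite_xi by (intro member_le_sum) (auto simp: label_prob_nonneg)
    then show "label_prob (c @ d) \<le> label_prob c" using sum_label_prob_append[OF that(1)] by simp
    have "label_prob (c @ d) \<le> (\<Sum>c\<in>words_over \<xi> n. label_prob (c @ d))"
      using that finite_xi by (intro member_le_sum) (auto simp: label_prob_nonneg)
    then show "label_prob (c @ d) \<le> label_prob d" using sum_label_prob_append'[OF that(2)] by simp
  qed
  have "(\<Sum>i\<in>?I. ?q i * (ln (?r i) - ln (?q i))) \<le> (\<Sum>i\<in>?I. ?r i) - (\<Sum>i\<in>?I. ?q i)"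
  proof (rule relative_entropy_le)
    fix i assume "i \<in> ?I" "0 < ?q i"
    then show "0 < ?r i" using le by (cases i) (fastforce intro!: mult_pos_pos)
  qed (auto simp: label_prob_nonneg)
  also have "(\<Sum>i\<in>?I. ?r i) = 1"
    using sum_label_prob by (simp add: sum.cartesian_product[symmetric] sum_product[symmetric])
  also have "(\<Sum>i\<in>?I. ?q i) = 1"
    using sum_label_prob_append sum_label_prob by (simp add: sum.cartesian_product[symmetric])
  finally have 1: "(\<Sum>i\<in>?I. ?q i * (ln (?r i) - ln (?q i))) \<le> 0" by simp
  have "?q i * (ln (?r i) - ln (?q i)) = (\<lambda>(c, d). label_prob (c @ d) * ln (label_prob c)
      + label_prob (c @ d) * ln (label_prob d) - label_prob (c @ d) * ln (label_prob (c @ d))) i" if "i \<in> ?I" for i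
  proof (cases "?q i = 0")
    case True
    then show ?thesis by (cases i) auto
  next
    case False
    obtain c d where i: "i = (c, d)" by (cases i)
    have "label_prob (c @ d) > 0" using False label_prob_nonneg[of "c @ d"] i by auto
    then have "label_prob c > 0" "label_prob d > 0" using le[of c d] that i by auto
    then show ?thesis unfolding i by (simp add: ln_mult algebra_simps)
  qed
  then have "(\<Sum>i\<in>?I. ?q i * (ln (?r i) - ln (?q i)))
     = (\<Sum>(c, d)\<in>?I. label_prob (c @ d) * ln (label_prob c)
      + label_prob (c @ d) * ln (label_prob d) - label_prob (c @ d) * ln (label_prob (c @ d)))" by (rule sum.cong[OF refl])
  also have "\<dots> = (\<Sum>c\<in>words_over \<xi> n. \<Sum>d\<in>words_over \<xi> m. label_prob (c @ d) * ln (label_prob c))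
     + (\<Sum>c\<in>words_over \<xi> n. \<Sum>d\<in>words_over \<xi> m. label_prob (c @ d) * ln (label_prob d))
     - (\<Sum>c\<in>words_over \<xi> n. \<Sum>d\<in>words_over \<xi> m. label_prob (c @ d) * ln (label_prob (c @ d)))"
    by (simp add: sum.cartesian_product[symmetric] sum.distrib sum_subtractf)
  also have "(\<Sum>c\<in>words_over \<xi> n. \<Sum>d\<in>words_over \<xi> m. label_prob (c @ d) * ln (label_prob c)) = - label_entropy n"
    using sum_label_prob_append by (simp add: label_entropy_def sum_distrib_right[symmetric])
  also have "(\<Sum>c\<in>words_over \<xi> n. \<Sum>d\<in>words_over \<xi> m. label_prob (c @ d) * ln (label_prob d)) = - label_entropy m"
    using sum_label_prob_append' by (subst sum.swap) (simp add: label_entropy_def sum_distrib_right[symmetric])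
  also have "(\<Sum>c\<in>words_over \<xi> n. \<Sum>d\<in>words_over \<xi> m. label_prob (c @ d) * ln (label_prob (c @ d))) = - label_entropy (n + m)"
    by (simp add: label_entropy_def sum_words_over_append)
  finally show ?thesis using 1 by simp
qed

lemma label_entropy_nonneg: "label_entropy n \<ge> 0"
proof -
  have "label_prob c * ln (label_prob c) \<le> 0" for c
    using label_prob_nonneg[of c] label_prob_le_1[of c]
    by (cases "label_prob c = 0") (auto intro!: mult_nonneg_nonpos)
  then show ?thesis unfolding label_entropy_def by (simp add: sum_nonpos)
qed

text \<open>\<open>common_refinement\<close> ranges over choice functions on a set of partitions, in
  which equal preimages of \<open>\<xi>\<close> coincide, not over words. The descriptions agree
  because a nonempty intersection contains some point \<open>x\<close>, and the chosen sets are then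
  the cells visited by the orbit of \<open>x\<close>.\<close>

lemma iterated_join_eq:
  assumes n: "n \<ge> 1"
  shows "iterated_join \<nu> shift \<xi> n = label_set ` words_over \<xi> n - {{}}"
proof -
  let ?Q = "\<lambda>i. (\<lambda>A. (shift ^^ i) -` A \<inter> X) ` \<xi>"
  let ?P = "?Q ` {..<n}"
  have cells: "\<Inter> (F ` ?P) = label_set (label n x)"
    if F: "F \<in> (\<Pi> P\<in>?P. P)" and x: "x \<in> \<Inter> (F ` ?P)" for F x
  proof -
    have FQ: "F (?Q i) = (shift ^^ i) -` (cell ((shift ^^ i) x)) \<inter> X" and xX: "x \<in> X" if i: "i < n" for i
    proof -
      have "F (?Q i) \<in> ?Q i" using F i by (auto simp: Pi_iff)
      then obtain A where A: "A \<in> \<xi>" "F (?Q i) = (shift ^^ i) -` A \<inter> X" by auto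
      have "x \<in> F (?Q i)" using x i by auto
      then show "x \<in> X" "F (?Q i) = (shift ^^ i) -` (cell ((shift ^^ i) x)) \<inter> X"
        using A cell_unique[OF A(1), of "(shift ^^ i) x"] by auto
    qed
    have xX: "x \<in> X" using xX[of 0] n by simp
    have "\<Inter> (F ` ?P) = (\<Inter>i\<in>{..<n}. (shift ^^ i) -` (cell ((shift ^^ i) x)) \<inter> X)"
      using FQ by auto
    also have "\<dots> = label_set (label n x)"
    proof (intro equalityI subsetI)
      fix y assume y: "y \<in> (\<Inter>i\<in>{..<n}. (shift ^^ i) -` (cell ((shift ^^ i) x)) \<inter> X)"
      then have "y \<in> X" using INT_D[OF y, of 0] n by simp
      moreover have "label n y = label n x"
      proof (rule nth_equalityI)
        fix i assume "i < length (label n y)"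
        then have i: "i < n" by simp
        then have "(shift ^^ i) y \<in> cell ((shift ^^ i) x)" using INT_D[OF y, of i] by simp
        then show "label n y ! i = label n x ! i" using i cell_unique cell_mem[OF shift_closed[OF xX]] by simp
      qed simp
      ultimately show "y \<in> label_set (label n x)" by (simp add: label_set_def)
    next
      fix y assume "y \<in> label_set (label n x)"
      then have y: "y \<in> X" "label n y = label n x" by (auto simp: label_set_def)
      have "(shift ^^ i) y \<in> cell ((shift ^^ i) x)" if "i < n" for i
        using cell_mem[OF shift_closed[OF y(1), of i]] y(2) that by (metis nth_label)
      then show "y \<in> (\<Inter>i\<in>{..<n}. (shift ^^ i) -` (cell ((shift ^^ i) x)) \<inter> X)" using y by auto
    qed
    finally show ?thesis .
  qed
  have "common_refinement ?P = label_set ` words_over \<xi> n - {{}}"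
  proof (intro equalityI subsetI)
    fix S assume "S \<in> common_refinement ?P"
    then obtain F where F: "F \<in> (\<Pi> P\<in>?P. P)" "S = \<Inter> (F ` ?P)" "S \<noteq> {}"
      unfolding common_refinement by auto
    then obtain x where x: "x \<in> \<Inter> (F ` ?P)" by blast
    have S: "S = label_set (label n x)" using cells[OF F(1) x] F(2) by simp
    have Q0: "?Q 0 \<in> ?P" using n by (intro imageI) simp
    have "F (?Q 0) \<in> ?Q 0" using Pi_mem[OF F(1) Q0] .
    then have "F (?Q 0) \<subseteq> X" by blast
    moreover have "x \<in> F (?Q 0)" by (rule InterD[OF x imageI[OF Q0]])
    ultimately have "x \<in> X" by blast
    then show "S \<in> label_set ` words_over \<xi> n - {{}}" using S F(3) label_words by blast
  next
    fix S assume "S \<in> label_set ` words_over \<xi> n - {{}}"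
    then obtain c where c: "c \<in> words_over \<xi> n" "S = label_set c" "S \<noteq> {}" by auto
    then obtain x where x: "x \<in> S" by auto
    have xX: "x \<in> X" and lab: "label n x = c" using x c by (auto simp: label_set_def words_over_def)
    define F where "F = (\<lambda>P. SOME S. S \<in> P \<and> x \<in> (S :: (nat \<Rightarrow> nat) set))"
    have FP: "F P \<in> P \<and> x \<in> F P" if P: "P \<in> ?P" for P
    proof -
      obtain i where i: "P = ?Q i" using P by auto
      have "\<exists>S. S \<in> P \<and> x \<in> S" using cell_mem[OF shift_closed[OF xX, of i]] xX
        unfolding i by (intro exI[of _ "(shift ^^ i) -` (cell ((shift ^^ i) x)) \<inter> X"]) auto
      then show ?thesis unfolding F_def by (rule someI_ex)
    qed
    then have F: "F \<in> (\<Pi> P\<in>?P. P)" by auto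
    have "x \<in> \<Inter> (F ` ?P)" using FP by blast
    from cells[OF F this] have "S = \<Inter> (F ` ?P)" using lab c(2) by simp
    then show "S \<in> common_refinement ?P" unfolding common_refinement using F c(3) by blast
  qed
  then show ?thesis unfolding iterated_join_def by simp
qed

lemma partition_entropy_join:
  assumes "n \<ge> 1"
  shows "partition_entropy \<nu> (iterated_join \<nu> shift \<xi> n) = label_entropy n"
proof -
  let ?V = "{c \<in> words_over \<xi> n. label_set c \<noteq> {}}"
  have inj: "inj_on label_set ?V"
  proof (rule inj_onI)
    fix c d assume "c \<in> ?V" "d \<in> ?V" "label_set c = label_set d"
    then show "c = d" using label_set_disjoint[of c d] by (auto simp: words_over_def)
  qed
  have "label_set ` words_over \<xi> n - {{}} = label_set ` ?V" by auto
  then have "partition_entropy \<nu> (iterated_join \<nu> shift \<xi> n) = - (\<Sum>A\<in>label_set ` ?V. measure \<nu> A * ln (measure \<nu> A))"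
    unfolding partition_entropy_def iterated_join_eq[OF assms] by simp
  also have "\<dots> = - (\<Sum>c\<in>?V. label_prob c * ln (label_prob c))"
    by (subst sum.reindex[OF inj]) (simp add: label_prob_def)
  also have "(\<Sum>c\<in>?V. label_prob c * ln (label_prob c)) = (\<Sum>c\<in>words_over \<xi> n. label_prob c * ln (label_prob c))"
    using finite_xi by (intro sum.mono_neutral_left) (auto simp: label_prob_def)
  finally show ?thesis by (simp add: label_entropy_def)
qed

lemma label_entropy_tendsto: "(\<lambda>n. label_entropy n / real n) \<longlonglongrightarrow> partition_ks_entropy \<nu> shift \<xi>"
proof -
  have "\<exists>l. (\<lambda>n. label_entropy n / real n) \<longlonglongrightarrow> l"
    by (rule fekete[of 1 label_entropy 0]) (use label_entropy_nonneg label_entropy_subadditive in auto)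
  then obtain l where l: "(\<lambda>n. label_entropy n / real n) \<longlonglongrightarrow> l" by blast
  have "\<forall>\<^sub>F n in sequentially. label_entropy n / real n = partition_entropy \<nu> (iterated_join \<nu> shift \<xi> n) / real n"
    using eventually_ge_at_top[of 1] by eventually_elim (simp add: partition_entropy_join)
  from Lim_transform_eventually[OF l this]
  have "partition_ks_entropy \<nu> shift \<xi> = l" unfolding partition_ks_entropy_def by (rule limI)
  then show ?thesis using l by simp
qed

end

section \<open>The variational inequality with block functions\<close>

lemma block_sum_prefix_word:
  "block_sum b l k (prefix_word (k * l) x) = (\<Sum>j<k. b (prefix_word l ((shift ^^ (j * l)) x)))"
proof (induction k arbitrary: x)
  case (Suc k)
  have "block_sum b l (Suc k) (prefix_word (Suc k * l) x)
      = b (prefix_word l x) + block_sum b l k (prefix_word (k * l) ((shift ^^ l) x))"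
    by (simp add: prefix_word_add)
  also have "block_sum b l k (prefix_word (k * l) ((shift ^^ l) x))
      = (\<Sum>j<k. b (prefix_word l ((shift ^^ (Suc j * l)) x)))"
    unfolding Suc by (simp add: shift_funpow add_ac)
  finally show ?case unfolding sum.lessThan_Suc_shift by simp
qed simp

lemma abs_block_sum_le:
  assumes "\<And>w. \<bar>b w\<bar> \<le> (R::real)"
  shows "\<bar>block_sum b l k w\<bar> \<le> real k * R"
proof (induction k arbitrary: w)
  case (Suc k)
  have "\<bar>block_sum b l (Suc k) w\<bar> \<le> \<bar>b (take l w)\<bar> + \<bar>block_sum b l k (drop l w)\<bar>" by simp
  also have "\<dots> \<le> R + real k * R" by (intro add_mono assms Suc)
  finally show ?case by (simp add: algebra_simps)
qed simp

context invariant_measure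
begin

lemma integrable_prefix_fun:
  assumes "\<And>w. \<bar>b w\<bar> \<le> (R::real)"
  shows "integrable \<nu> (\<lambda>x. b (prefix_word n x))"
  by (rule integrable_const_bound[of _ R]) (use assms prefix_fun_borel in auto)

lemma integral_block_sum:
  assumes "\<And>w. \<bar>b w\<bar> \<le> (R::real)"
  shows "(\<integral>x. block_sum b l k (prefix_word (k * l) x) \<partial>\<nu>) = real k * (\<integral>x. b (prefix_word l x) \<partial>\<nu>)"
proof -
  have int: "integrable \<nu> (\<lambda>x. b (prefix_word l ((shift ^^ (j * l)) x)))" for j
    by (rule integrable_shift[OF integrable_prefix_fun[OF assms]])
  have "(\<integral>x. block_sum b l k (prefix_word (k * l) x) \<partial>\<nu>)
      = (\<Sum>j<k. \<integral>x. b (prefix_word l ((shift ^^ (j * l)) x)) \<partial>\<nu>)"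
    unfolding block_sum_prefix_word using int by (intro Bochner_Integration.integral_sum)
  also have "\<dots> = (\<Sum>j<k. \<integral>x. b (prefix_word l x) \<partial>\<nu>)"
    by (intro sum.cong refl integral_shift prefix_fun_borel)
  finally show ?thesis by simp
qed

end

context partitioned_measure
begin

lemma X_nonempty: "X \<noteq> {}"
  using not_empty by simp

lemma xi_nonempty: "\<xi> \<noteq> {}"
  using X_nonempty cell_mem by blast

text \<open>Each cell is approximated within \<open>e / (2 * card \<xi>)\<close> by a set depending
  on finitely many coordinates, and \<open>\<psi>\<close> selects a cell whose approximant contains
  the point. A point that receives the wrong cell lies in one of the symmetric differences.\<close>

lemma cell_approx:
  assumes "e > 0"
  shows "\<exists>m \<psi>. (\<forall>x\<in>X. \<psi> x \<in> \<xi>) \<and>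
    (\<forall>x\<in>X. \<forall>y\<in>X. prefix_word m x = prefix_word m y \<longrightarrow> \<psi> x = \<psi> y) \<and>
    {x \<in> X. cell x \<noteq> \<psi> x} \<in> sets \<nu> \<and> measure \<nu> {x \<in> X. cell x \<noteq> \<psi> x} < e"
proof -
  define r where "r = real (card \<xi>)"
  have r: "r > 0" unfolding r_def using finite_xi xi_nonempty by (simp add: card_gt_0_iff)
  have "\<exists>n U. determined M n U \<and> measure \<nu> ((A - U) \<union> (U - A)) < e / (2 * r)" if "A \<in> \<xi>" for A
    using approx_determined[OF xi_sets[OF that], of "e / (2 * r)"] assms r by simp
  then obtain n U where nU: "\<And>A. A \<in> \<xi> \<Longrightarrow> determined M (n A) (U A)"
    "\<And>A. A \<in> \<xi> \<Longrightarrow> measure \<nu> ((A - U A) \<union> (U A - A)) < e / (2 * r)" by metis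
  define m where "m = Max (n ` \<xi>)"
  have det: "determined M m (U A)" if "A \<in> \<xi>" for A
    using determined_mono[OF nU(1)[OF that]] finite_xi that unfolding m_def by simp
  have U_sets: "U A \<in> sets \<nu>" if "A \<in> \<xi>" for A using determined_sets_nu[OF nU(1)[OF that]] .
  obtain A0 where A0: "A0 \<in> \<xi>" using xi_nonempty by blast
  define \<psi> where "\<psi> x = (if \<exists>A\<in>\<xi>. x \<in> U A then SOME A. A \<in> \<xi> \<and> x \<in> U A else A0)" for x
  have psi: "\<psi> x \<in> \<xi>" for x
  proof (cases "\<exists>A\<in>\<xi>. x \<in> U A")
    case True
    then have "\<exists>A. A \<in> \<xi> \<and> x \<in> U A" by blast
    from someI_ex[OF this] show ?thesis using True unfolding \<psi>_def by simp
  qed (use A0 in \<open>simp add: \<psi>_def\<close>)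
  have psi_eq: "\<psi> x = \<psi> y" if "x \<in> X" "y \<in> X" "prefix_word m x = prefix_word m y" for x y
  proof -
    have "(A \<in> \<xi> \<and> x \<in> U A) = (A \<in> \<xi> \<and> y \<in> U A)" for A
      using det[of A] that unfolding determined_def by blast
    then show ?thesis by (simp only: \<psi>_def Bex_def)
  qed
  have bad: "{x \<in> X. cell x \<noteq> \<psi> x} \<subseteq> (\<Union>A\<in>\<xi>. (A - U A) \<union> (U A - A))"
  proof
    fix x assume x: "x \<in> {x \<in> X. cell x \<noteq> \<psi> x}"
    show "x \<in> (\<Union>A\<in>\<xi>. (A - U A) \<union> (U A - A))"
    proof (rule ccontr)
      assume not: "x \<notin> (\<Union>A\<in>\<xi>. (A - U A) \<union> (U A - A))"
      then have iff: "x \<in> A \<longleftrightarrow> x \<in> U A" if "A \<in> \<xi>" for A using that by blast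
      have ex: "\<exists>A. A \<in> \<xi> \<and> x \<in> U A" using iff cell_mem x by blast
      then have "\<psi> x = (SOME A. A \<in> \<xi> \<and> x \<in> U A)" unfolding \<psi>_def Bex_def by (rule if_P)
      then have "\<psi> x \<in> \<xi> \<and> x \<in> U (\<psi> x)" using someI_ex[OF ex] by simp
      then have "cell x = \<psi> x" using iff cell_unique by blast
      then show False using x by simp
    qed
  qed
  have "determined M m {x \<in> X. \<psi> x = A}" for A
    unfolding determined_def
  proof (intro conjI ballI impI)
    fix x y assume "x \<in> X" "y \<in> X" "prefix_word m x = prefix_word m y"
    then show "(x \<in> {x \<in> X. \<psi> x = A}) = (y \<in> {x \<in> X. \<psi> x = A})" using psi_eq[of x y] by simp
  qed simp
  then have "(\<Union>A\<in>\<xi>. A \<inter> {x \<in> X. \<psi> x = A}) \<in> sets \<nu>"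
    using finite_xi xi_sets determined_sets_nu by (intro sets.finite_UN sets.Int) auto
  then have "X - (\<Union>A\<in>\<xi>. A \<inter> {x \<in> X. \<psi> x = A}) \<in> sets \<nu>" using sets.top[of \<nu>] by auto
  also have "X - (\<Union>A\<in>\<xi>. A \<inter> {x \<in> X. \<psi> x = A}) = {x \<in> X. cell x \<noteq> \<psi> x}"
    using cell_iff psi cell_mem by auto
  finally have meas: "{x \<in> X. cell x \<noteq> \<psi> x} \<in> sets \<nu>" .
  have "measure \<nu> {x \<in> X. cell x \<noteq> \<psi> x} \<le> measure \<nu> (\<Union>A\<in>\<xi>. (A - U A) \<union> (U A - A))"
    using bad finite_xi xi_sets U_sets by (intro finite_measure_mono sets.finite_UN) auto
  also have "\<dots> \<le> (\<Sum>A\<in>\<xi>. measure \<nu> ((A - U A) \<union> (U A - A)))"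
    using finite_xi xi_sets U_sets by (intro finite_measure_subadditive_finite) auto
  also have "\<dots> \<le> (\<Sum>A\<in>\<xi>. e / (2 * r))" using nU(2) by (intro sum_mono less_imp_le)
  also have "\<dots> = e / 2" using r by (simp add: r_def)
  also have "\<dots> < e" using assms by simp
  finally show ?thesis using psi psi_eq meas by blast
qed

text \<open>The Gibbs inequality is applied to the cells of the \<open>n\<close>-fold join of \<open>\<xi>\<close>, each represented by one
  of its points. As \<open>\<xi>\<close> agrees up to measure \<open>\<delta>\<close> with a function \<open>\<psi>\<close> of \<open>m\<close> coordinates, penalising each
  mismatch by \<open>\<beta>\<close> leaves, for every word, a total weight of at most \<open>exp (n * card \<xi> * exp (- \<beta>))\<close> for
  all label sequences.\<close>

lemma block_variational_step:
  assumes int: "integrable \<nu> (f 1)" and t: "t \<ge> 0" and l: "l \<ge> 1" and b: "\<And>w. \<bar>b w\<bar> \<le> R"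
    and K: "K > 0" and N0: "\<And>N. N \<ge> N0 \<Longrightarrow> (\<Sum>w\<in>bounded_words (k * l) N. nw t w * exp (block_sum b l k w)) \<le> K * exp (real k * \<kappa>)"
    and psi: "\<And>x. x \<in> X \<Longrightarrow> \<psi> x \<in> \<xi>"
      "\<And>x y. x \<in> X \<Longrightarrow> y \<in> X \<Longrightarrow> prefix_word m x = prefix_word m y \<Longrightarrow> \<psi> x = \<psi> y"
    and bad_sets: "{x \<in> X. cell x \<noteq> \<psi> x} \<in> sets \<nu>" and bad: "measure \<nu> {x \<in> X. cell x \<noteq> \<psi> x} \<le> \<delta>"
    and \<beta>: "\<beta> \<ge> 0" and k: "m < k * l"
  shows "label_entropy (k * l - m) \<le> 1 + t * B + ln K + t * C + real k * \<kappa>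
     - real k * (\<integral>x. b (prefix_word l x) \<partial>\<nu>) - real (k * l) * (t * mean - press t)
     + real (k * l - m) * (\<beta> * \<delta> + real (card \<xi>) * exp (- \<beta>))"
proof -
  \<comment> \<open>Only the first \<open>N - m\<close> labels are used, so that the
    \<open>m\<close> coordinates which \<open>\<psi>\<close> reads at each of these times lie within
    the first \<open>N\<close> letters.\<close>
  define N n where "N = k * l" and "n = N - m"
  have "m < N" using k unfolding N_def .
  then have Nn: "N \<ge> 1" "n + m = N" unfolding n_def by auto
  define E where "E = {x \<in> X. cell x \<noteq> \<psi> x}"
  define \<gamma> where "\<gamma> = (\<integral>x. b (prefix_word l x) \<partial>\<nu>)"
  define mis where "mis x = (\<Sum>i<n. indicator E ((shift ^^ i) x) :: real)" for x
  define g where "g x = t * f N x - real N * press t + block_sum b l k (prefix_word N x) - \<beta> * mis x" for x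
  have E: "E \<in> sets \<nu>" unfolding E_def by (rule bad_sets)
  have intE: "integrable \<nu> (indicator E :: _ \<Rightarrow> real)" using E sets.Int_space_eq2[OF E] by (simp add: integrable_indicator_iff less_top[symmetric])
  have intEi: "integrable \<nu> (\<lambda>x. indicator E ((shift ^^ i) x) :: real)" for i
    by (rule integrable_shift[OF intE])
  have int_mis: "integrable \<nu> mis" unfolding mis_def using intEi by (intro Bochner_Integration.integrable_sum)
  have integral_mis: "(\<integral>x. mis x \<partial>\<nu>) = real n * measure \<nu> E"
  proof -
    have "(\<integral>x. mis x \<partial>\<nu>) = (\<Sum>i<n. \<integral>x. indicator E ((shift ^^ i) x) \<partial>\<nu>)"
      unfolding mis_def using intEi by (intro Bochner_Integration.integral_sum)
    also have "\<dots> = (\<Sum>i<n. measure \<nu> E)"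
      using integral_shift[of "indicator E"] intE E sets.Int_space_eq2[OF E] by (intro sum.cong refl) simp
    finally show ?thesis by simp
  qed
  note intf = integrable_potential[OF int Nn(1)]
  have intb: "integrable \<nu> (\<lambda>x. block_sum b l k (prefix_word N x))"
    by (rule integrable_prefix_fun) (rule abs_block_sum_le[OF b])
  have intg: "integrable \<nu> g" unfolding g_def using intf intb int_mis by simp
  have integral_g: "(\<integral>x. g x \<partial>\<nu>) = t * (\<integral>x. f N x \<partial>\<nu>) - real N * press t + real k * \<gamma> - \<beta> * (real n * measure \<nu> E)"
    unfolding g_def using intf intb int_mis integral_mis integral_block_sum[OF b, where k = k and l = l]
    by (simp add: \<gamma>_def N_def prob_space)
  have g_bdd: "\<exists>G. \<forall>x\<in>X. g x \<le> G"
  proof -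
    obtain c where c: "\<forall>x\<in>X. f (Suc (N - 1)) x \<le> c" using potential_upper_bound by blast
    have "g x \<le> t * c - real N * press t + real k * R" if x: "x \<in> X" for x
    proof -
      have "t * f N x \<le> t * c" using c x Nn t by (intro mult_left_mono) auto
      moreover have "block_sum b l k (prefix_word N x) \<le> real k * R"
        using abs_block_sum_le[OF b, where l = l and k = k and w = "prefix_word N x"] by (simp add: abs_le_iff)
      moreover have "\<beta> * mis x \<ge> 0" unfolding mis_def using \<beta> by (intro mult_nonneg_nonneg sum_nonneg) auto
      ultimately show ?thesis unfolding g_def by linarith
    qed
    then show ?thesis by blast
  qed
  \<comment> \<open>The supremum of \<open>g\<close> over a cell need not be attained; a point
    within 1 of it represents the cell, whence the summand 1 in the final bound.\<close>
  have "\<exists>y. label_set c \<noteq> {} \<longrightarrow> y \<in> label_set c \<and> (\<forall>x\<in>label_set c. g x \<le> g y + 1)" for c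
  proof (cases "label_set c = {}")
    case False
    have bdd: "bdd_above (g ` label_set c)" using g_bdd by (auto simp: label_set_def bdd_above_def)
    have "Sup (g ` label_set c) - 1 < Sup (g ` label_set c)" by simp
    then obtain y where y: "y \<in> label_set c" "Sup (g ` label_set c) - 1 < g y"
      using less_cSUP_iff[OF False bdd] by blast
    have "g x \<le> g y + 1" if "x \<in> label_set c" for x
      using cSUP_upper[OF that bdd] y(2) by simp
    then show ?thesis using y(1) by blast
  qed simp
  then obtain y where y: "\<And>c. label_set c \<noteq> {} \<Longrightarrow> y c \<in> label_set c"
    "\<And>c x. x \<in> label_set c \<Longrightarrow> g x \<le> g (y c) + 1" by (metis empty_iff)
  let ?L = "words_over \<xi> n"
  define I where "I = {c \<in> ?L. label_set c \<noteq> {}}"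
  have finL: "finite ?L" using finite_xi by simp
  have finI: "finite I" unfolding I_def using finL by simp
  have to_I: "(\<Sum>c\<in>I. label_prob c * h c) = (\<Sum>c\<in>?L. label_prob c * h c)" for h
    unfolding I_def using finL by (intro sum.mono_neutral_left) (auto simp: label_prob_def)
  have int_le: "(\<integral>x. g x \<partial>\<nu>) \<le> (\<Sum>c\<in>I. label_prob c * g (y c)) + 1"
  proof -
    let ?h = "\<lambda>x. \<Sum>c\<in>?L. indicator (label_set c) x * (g (y c) + 1)"
    have inth: "integrable \<nu> (\<lambda>x. indicator (label_set c) x * (g (y c) + 1))" if "c \<in> ?L" for c
      using label_set_sets[OF that] sets.Int_space_eq2[OF label_set_sets[OF that]]
      by (simp add: integrable_indicator_iff less_top[symmetric])
    have "(\<integral>x. g x \<partial>\<nu>) \<le> (\<integral>x. ?h x \<partial>\<nu>)"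
    proof (rule integral_mono[OF intg])
      show "integrable \<nu> ?h" using inth by (rule Bochner_Integration.integrable_sum)
      fix x assume "x \<in> space \<nu>"
      then have x: "x \<in> X" by simp
      have mem: "label n x \<in> ?L" using label_words[OF x] .
      have "?h x = (\<Sum>c\<in>?L. if c = label n x then g (y c) + 1 else 0)"
        using x by (intro sum.cong refl) (auto simp: label_set_def words_over_def indicator_def)
      also have "\<dots> = g (y (label n x)) + 1" using mem finL by (simp add: sum.delta)
      finally show "g x \<le> ?h x" using y(2)[of x "label n x"] x by (simp add: label_set_def)
    qed
    also have "\<dots> = (\<Sum>c\<in>?L. \<integral>x. indicator (label_set c) x * (g (y c) + 1) \<partial>\<nu>)"
      using inth by (rule Bochner_Integration.integral_sum)
    also have "\<dots> = (\<Sum>c\<in>?L. label_prob c * (g (y c) + 1))"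
      by (intro sum.cong refl) (simp add: label_prob_def Int_absorb2 label_set_def)
    also have "\<dots> = (\<Sum>c\<in>?L. label_prob c * g (y c)) + 1"
      using sum_label_prob by (simp add: algebra_simps sum.distrib)
    finally show ?thesis unfolding to_I .
  qed
  have sumI: "(\<Sum>c\<in>I. label_prob c) = 1" using to_I[of "\<lambda>_. 1"] sum_label_prob by simp
  have "(\<Sum>c\<in>I. label_prob c * g (y c)) - (\<Sum>c\<in>I. label_prob c * ln (label_prob c)) \<le> ln (\<Sum>c\<in>I. exp (g (y c)))"
    using finI sumI label_prob_nonneg by (intro gibbs_inequality) auto
  then have gibbs: "label_entropy n + (\<integral>x. g x \<partial>\<nu>) \<le> 1 + ln (\<Sum>c\<in>I. exp (g (y c)))"
    using int_le unfolding to_I label_entropy_def by linarith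
  \<comment> \<open>The approximate labels depend on the word alone, so they can be computed at its
    representative.\<close>
  define d where "d w = map (\<lambda>i. \<psi> ((shift ^^ i) (rep w))) [0..<n]" for w
  define \<phi> where "\<phi> c w = exp (- (\<beta> * (\<Sum>i<n. if c ! i = d w ! i then 0 else 1)))" for c w
  define a where "a w = nw t w * exp (block_sum b l k w)" for w
  have a0: "a w \<ge> 0" for w unfolding a_def by (simp add: nw_nonneg)
  have term_le: "exp (g (y c)) \<le> exp (t * B) * (a (prefix_word N (y c)) * \<phi> c (prefix_word N (y c)))" if c: "c \<in> I" for c
  proof -
    have yc: "y c \<in> X" "label n (y c) = c" using y(1)[of c] c by (auto simp: I_def label_set_def words_over_def)
    let ?w = "prefix_word N (y c)"
    have ad: "adm ?w" "?w \<noteq> []" using adm_prefix_word[OF yc(1)] Nn by (auto simp: prefix_word_def)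
    have rw: "rep ?w \<in> X" "prefix_word N (rep ?w) = ?w" using rep[OF ad(1)] by auto
    have "indicator E ((shift ^^ i) (y c)) = (if c ! i = d ?w ! i then 0 else (1::real))" if i: "i < n" for i
    proof -
      have 1: "cell ((shift ^^ i) (y c)) = c ! i" using yc(2) i by (metis nth_label)
      have "prefix_word m ((shift ^^ i) (y c)) = prefix_word m ((shift ^^ i) (rep ?w))"
      proof -
        have "prefix_word m ((shift ^^ i) z) = take m (drop i (prefix_word N z))" for z
          using i Nn by (simp add: drop_prefix_word take_prefix_word)
        then show ?thesis using rw(2) by simp
      qed
      then have 2: "\<psi> ((shift ^^ i) (y c)) = d ?w ! i"
        using psi(2)[OF shift_closed[OF yc(1)] shift_closed[OF rw(1)]] i by (simp add: d_def)
      show ?thesis using shift_closed[OF yc(1), of i] 1 2 by (simp add: E_def indicator_def)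
    qed
    then have mis: "mis (y c) = (\<Sum>i<n. if c ! i = d ?w ! i then 0 else 1)" unfolding mis_def by simp
    have "\<bar>f N (y c) - word_pot ?w\<bar> \<le> B" by (rule word_pot_prefix[OF Nn(1) yc(1)])
    then have "t * f N (y c) \<le> t * (word_pot ?w + B)" using t by (intro mult_left_mono) auto
    then have "g (y c) \<le> t * B + ((t * word_pot ?w - real N * press t) + block_sum b l k ?w
       + - (\<beta> * (\<Sum>i<n. if c ! i = d ?w ! i then 0 else 1)))"
      unfolding g_def mis by (simp add: algebra_simps)
    then have "exp (g (y c)) \<le> exp (t * B + ((t * word_pot ?w - real N * press t) + block_sum b l k ?w
       + - (\<beta> * (\<Sum>i<n. if c ! i = d ?w ! i then 0 else 1))))" by (simp only: exp_le_cancel_iff)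
    also have "\<dots> = exp (t * B) * (exp (t * word_pot ?w - real N * press t) * exp (block_sum b l k ?w)
       * exp (- (\<beta> * (\<Sum>i<n. if c ! i = d ?w ! i then 0 else 1))))" by (simp only: exp_add)
    also have "\<dots> = exp (t * B) * (a ?w * \<phi> c ?w)"
      unfolding a_def \<phi>_def nw_eq[OF ad] by simp
    finally show ?thesis .
  qed
  obtain N' where N': "N' \<ge> N0" "(\<lambda>c. prefix_word N (y c)) ` I \<subseteq> bounded_words N N'"
    by (rule finite_words_bounded[of "(\<lambda>c. prefix_word N (y c)) ` I" N N0]) (use finI in auto)
  let ?W = "bounded_words N N'"
  have "(\<Sum>c\<in>I. exp (g (y c))) \<le> (\<Sum>c\<in>I. exp (t * B) * (a (prefix_word N (y c)) * \<phi> c (prefix_word N (y c))))"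
    by (rule sum_mono[OF term_le])
  \<comment> \<open>The word of the representing point is one term of the sum over all words. After
    this enlargement the sums over words and labels can be exchanged.\<close>
  also have "\<dots> \<le> (\<Sum>c\<in>I. exp (t * B) * (\<Sum>w\<in>?W. a w * \<phi> c w))"
    using N'(2) a0 by (intro sum_mono mult_left_mono member_le_sum) (auto simp: \<phi>_def)
  also have "\<dots> \<le> (\<Sum>c\<in>?L. exp (t * B) * (\<Sum>w\<in>?W. a w * \<phi> c w))"
    using finL a0 unfolding I_def by (intro sum_mono2) (auto simp: \<phi>_def intro!: sum_nonneg mult_nonneg_nonneg)
  also have "\<dots> = exp (t * B) * (\<Sum>w\<in>?W. a w * (\<Sum>c\<in>?L. \<phi> c w))"
    unfolding sum_distrib_left[symmetric] by (subst sum.swap) (simp add: sum_distrib_left)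
  also have "\<dots> \<le> exp (t * B) * (\<Sum>w\<in>?W. a w * exp (real n * (real (card \<xi>) * exp (- \<beta>))))"
  proof (rule mult_left_mono, rule sum_mono)
    fix w
    show "a w * (\<Sum>c\<in>?L. \<phi> c w) \<le> a w * exp (real n * (real (card \<xi>) * exp (- \<beta>)))"
    proof (cases "adm w")
      case True
      then have "rep w \<in> X" using rep by blast
      then have "d w \<in> ?L" using psi(1) shift_closed by (auto simp: d_def words_over_def)
      from sum_words_over_mismatch[OF finite_xi this, of \<beta>] a0[of w] show ?thesis
        unfolding \<phi>_def by (intro mult_left_mono)
    next
      case False
      then show ?thesis by (simp add: a_def nw_not_adm)
    qed
  qed simp
  also have "\<dots> = exp (t * B) * (exp (real n * (real (card \<xi>) * exp (- \<beta>))) * (\<Sum>w\<in>?W. a w))"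
    by (simp only: sum_distrib_right[symmetric] mult.commute)
  also have "\<dots> \<le> exp (t * B) * (exp (real n * (real (card \<xi>) * exp (- \<beta>))) * (K * exp (real k * \<kappa>)))"
    using N0[OF N'(1)] unfolding a_def N_def by (intro mult_left_mono) auto
  finally have Sle: "(\<Sum>c\<in>I. exp (g (y c))) \<le> exp (t * B) * (exp (real n * (real (card \<xi>) * exp (- \<beta>))) * (K * exp (real k * \<kappa>)))" .
  have Ine: "I \<noteq> {}" using sumI by auto
  have "ln (\<Sum>c\<in>I. exp (g (y c))) \<le> ln (exp (t * B) * (exp (real n * (real (card \<xi>) * exp (- \<beta>))) * (K * exp (real k * \<kappa>))))"
    using Sle Ine finI K by (intro ln_mono sum_pos) auto
  also have "\<dots> = t * B + (real n * (real (card \<xi>) * exp (- \<beta>)) + (ln K + real k * \<kappa>))"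
    using K by (simp add: ln_mult)
  finally have "label_entropy n \<le> 1 + t * B + ln K + real k * \<kappa> + real n * (real (card \<xi>) * exp (- \<beta>)) - (\<integral>x. g x \<partial>\<nu>)"
    using gibbs by linarith
  moreover have "t * (\<integral>x. f N x \<partial>\<nu>) \<ge> t * (real N * mean - C)"
    using asymptotic_mean_eq(2)[OF int Nn(1)] t by (intro mult_left_mono) (auto simp: abs_le_iff)
  moreover have "\<beta> * (real n * measure \<nu> E) \<le> \<beta> * (real n * \<delta>)"
    using bad \<beta> unfolding E_def by (intro mult_left_mono) auto
  ultimately have "label_entropy n \<le> 1 + t * B + ln K + real k * \<kappa> + real n * (real (card \<xi>) * exp (- \<beta>))
     - (t * (real N * mean - C) - real N * press t + real k * \<gamma> - \<beta> * (real n * \<delta>))"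
    unfolding integral_g by linarith
  also have "\<dots> = 1 + t * B + ln K + t * C + real k * \<kappa> - real k * \<gamma> - real N * (t * mean - press t)
     + real n * (\<beta> * \<delta> + real (card \<xi>) * exp (- \<beta>))" by (simp add: algebra_simps)
  finally show ?thesis unfolding n_def N_def \<gamma>_def .
qed

text \<open>The step inequality divided by \<open>k * l - m\<close> as \<open>k\<close> tends to
  infinity: the additive constants and the loss of \<open>m\<close> labels disappear.\<close>

lemma block_variational:
  assumes int: "integrable \<nu> (f 1)" and t: "t \<ge> 0" and l: "l \<ge> 1" and b: "\<And>w. \<bar>b w\<bar> \<le> R"
    and K: "K > 0" and bound: "\<And>k. \<exists>N0. \<forall>N\<ge>N0. (\<Sum>w\<in>bounded_words (k * l) N. nw t w * exp (block_sum b l k w)) \<le> K * exp (real k * \<kappa>)"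
  shows "partition_ks_entropy \<nu> shift \<xi> + t * mean + (\<integral>x. b (prefix_word l x) \<partial>\<nu>) / real l \<le> press t + \<kappa> / real l"
proof -
  define \<gamma> where "\<gamma> = (\<integral>x. b (prefix_word l x) \<partial>\<nu>)"
  define r where "r = real (card \<xi>)"
  have r: "r > 0" unfolding r_def using finite_xi xi_nonempty by (simp add: card_gt_0_iff)
  have main: "partition_ks_entropy \<nu> shift \<xi> \<le> \<kappa> / real l - \<gamma> / real l - (t * mean - press t) + e" if e: "e > 0" for e
  proof -
    \<comment> \<open>The order matters: \<open>\<beta>\<close> first makes the entropy of the
      mismatches at most \<open>e / 2\<close>, then \<open>\<delta>\<close> makes the expected
      penalty \<open>\<beta> * \<delta>\<close> equal to \<open>e / 2\<close>.\<close>
    obtain \<beta> where \<beta>: "\<beta> > 0" "r * exp (- \<beta>) \<le> e / 2"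
    proof -
      have "r * exp (- max 1 (- ln (e / (2 * r)))) \<le> r * exp (ln (e / (2 * r)))" using r by (intro mult_left_mono) auto
      also have "\<dots> = e / 2" using e r by simp
      finally show ?thesis by (intro that[of "max 1 (- ln (e / (2 * r)))"]) auto
    qed
    define \<delta> where "\<delta> = e / (2 * \<beta>)"
    have \<delta>: "\<delta> > 0" "\<beta> * \<delta> = e / 2" unfolding \<delta>_def using e \<beta> by auto
    obtain m \<psi> where psi: "\<forall>x\<in>X. \<psi> x \<in> \<xi>"
      "\<forall>x\<in>X. \<forall>y\<in>X. prefix_word m x = prefix_word m y \<longrightarrow> \<psi> x = \<psi> y"
      "{x \<in> X. cell x \<noteq> \<psi> x} \<in> sets \<nu>" "measure \<nu> {x \<in> X. cell x \<noteq> \<psi> x} < \<delta>"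
      using cell_approx[OF \<delta>(1)] by blast
    define A where "A = 1 + t * B + ln K + t * C"
    define s where "s = \<kappa> / real l - \<gamma> / real l - (t * mean - press t)"
    have step: "label_entropy (k * l - m) / real (k * l - m) \<le> A / real (k * l - m) + (s + s * (real m / real (k * l - m))) + e"
      if k: "k \<ge> m + 1" for k
    proof -
      have "k \<le> k * l" using l by simp
      then have kl: "m < k * l" using k by linarith
      obtain N0 where N0: "\<And>N. N \<ge> N0 \<Longrightarrow> (\<Sum>w\<in>bounded_words (k * l) N. nw t w * exp (block_sum b l k w)) \<le> K * exp (real k * \<kappa>)"
        using bound[of k] by blast
      have "label_entropy (k * l - m) \<le> A + real k * \<kappa> - real k * \<gamma> - real (k * l) * (t * mean - press t)
          + real (k * l - m) * (\<beta> * \<delta> + r * exp (- \<beta>))"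
        unfolding A_def \<gamma>_def r_def
        by (rule block_variational_step[where \<psi> = \<psi>, OF int t l b K N0 _ _ psi(3) less_imp_le[OF psi(4)] less_imp_le[OF \<beta>(1)] kl])
          (use psi(1,2) in blast)+
      also have "real (k * l - m) * (\<beta> * \<delta> + r * exp (- \<beta>)) \<le> real (k * l - m) * e"
        using \<delta>(2) \<beta>(2) by (intro mult_left_mono) auto
      also have "A + real k * \<kappa> - real k * \<gamma> - real (k * l) * (t * mean - press t) = A + real (k * l) * s"
        unfolding s_def using l by (simp add: field_simps)
      also have "real (k * l) = real (k * l - m) + real m" using kl by (subst of_nat_diff) auto
      finally have "label_entropy (k * l - m) \<le> A + (real (k * l - m) + real m) * s + real (k * l - m) * e" by simp
      moreover have "0 < k * l - m" using kl by simp
      then have "real (k * l - m) > 0" by (simp only: of_nat_0_less_iff)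
      moreover have "x / y \<le> A / y + (s + s * (real m / y)) + e"
        if "x \<le> A + (y + real m) * s + y * e" "y > 0" for x y :: real
        using that by (simp add: field_simps)
      ultimately show ?thesis by blast
    qed
    have sub: "filterlim (\<lambda>k. k * l - m) at_top sequentially"
      unfolding filterlim_at_top
    proof
      fix Z :: nat
      show "\<forall>\<^sub>F k in sequentially. Z \<le> k * l - m"
        using eventually_ge_at_top[of "Z + m"]
      proof eventually_elim
        case (elim k)
        have "k \<le> k * l" using l by simp
        then show ?case using elim by linarith
      qed
    qed
    have l1: "(\<lambda>k. label_entropy (k * l - m) / real (k * l - m)) \<longlonglongrightarrow> partition_ks_entropy \<nu> shift \<xi>"
      by (rule filterlim_compose[OF label_entropy_tendsto sub])
    have l2: "(\<lambda>k. A / real (k * l - m) + (s + s * (real m / real (k * l - m))) + e) \<longlonglongrightarrow> 0 + (s + s * 0) + e"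
      by (intro tendsto_intros filterlim_compose[OF lim_const_over_n sub])
    have "partition_ks_entropy \<nu> shift \<xi> \<le> 0 + (s + s * 0) + e"
      by (rule LIMSEQ_le[OF l1 l2]) (use step in blast)
    then show ?thesis by (simp add: s_def)
  qed
  have "partition_ks_entropy \<nu> shift \<xi> \<le> \<kappa> / real l - \<gamma> / real l - (t * mean - press t)"
    by (rule field_le_epsilon) (use main in blast)
  then show ?thesis unfolding \<gamma>_def by simp
qed

end

section \<open>Gibbs bounds for equilibrium states\<close>

context cms_potential
begin

definition word_bound :: "real \<Rightarrow> real \<Rightarrow> bool" where
  "word_bound t K \<longleftrightarrow> K \<ge> 1 \<and> (\<forall>n N. (\<Sum>w\<in>bounded_words n N. nw t w) \<le> K)"

lemma exists_word_bound:
  assumes "t \<ge> 1"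
  shows "\<exists>K. word_bound t K"
proof -
  obtain K where "K \<ge> 1" "\<And>s n N. 1 \<le> s \<Longrightarrow> s \<le> t \<Longrightarrow> press t \<le> press s \<Longrightarrow> press s \<le> press t \<Longrightarrow>
     (\<Sum>w\<in>bounded_words n N. nw s w) \<le> K"
    by (fact word_sum_bound[OF assms])
  then have "word_bound t K" using assms unfolding word_bound_def by simp
  then show ?thesis ..
qed

lemma nw_le_word_bound:
  assumes "word_bound t K"
  shows "nw t w \<le> K"
proof -
  obtain N where "{w} \<subseteq> bounded_words (length w) N"
    by (rule finite_words_bounded[of "{w}" "length w" 0]) auto
  then have "nw t w \<le> (\<Sum>w\<in>bounded_words (length w) N. nw t w)"
    by (intro member_le_sum) (auto simp: nw_nonneg)
  then show ?thesis using assms unfolding word_bound_def by (meson order_trans)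
qed

lemma block_sum_zero: "block_sum (\<lambda>_. 0) l k w = 0"
  using abs_block_sum_le[of "\<lambda>_. 0" 0 l k w] by simp

end

context partitioned_measure
begin

text \<open>The block function 0, for which bounded word sums mean growth rate
  \<open>\<kappa> = 0\<close>.\<close>

lemma variational_inequality:
  assumes "integrable \<nu> (f 1)" "t \<ge> 1"
  shows "partition_ks_entropy \<nu> shift \<xi> + t * mean \<le> press t"
proof -
  obtain K where K: "word_bound t K" using exists_word_bound[OF assms(2)] by blast
  have "partition_ks_entropy \<nu> shift \<xi> + t * mean + (\<integral>x. (\<lambda>_. 0) (prefix_word 1 x) \<partial>\<nu>) / real 1 \<le> press t + 0 / real 1"
    using assms K unfolding word_bound_def
    by (intro block_variational[where R = 0 and K = K]) (auto simp: block_sum_zero)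
  then show ?thesis by simp
qed

end

context invariant_measure
begin

text \<open>The supremum defining entropy need not be attained, and entropies of different measures
  can only be compared partition by partition. Together with \<open>variational_inequality\<close>
  this says, for \<open>t \<ge> 1\<close>, that entropy plus \<open>t\<close> times the mean equals
  the pressure.\<close>

definition near_equilibrium :: "real \<Rightarrow> bool" where
  "near_equilibrium t \<longleftrightarrow> integrable \<nu> (f 1) \<and>
     (\<forall>e>0. \<exists>\<xi>. finite_measurable_partition \<nu> \<xi> \<and> press t - e < partition_ks_entropy \<nu> shift \<xi> + t * mean)"

text \<open>A measure that almost attains the pressure leaves no room in the variational inequality,
  so the integral of \<open>b\<close> is at most the growth \<open>ln (1 + q * K)\<close> per block
  that \<open>b\<close> causes in the word sums. \<open>Nmin\<close> admits hypotheses that hold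
  only when the truncated alphabet contains certain words.\<close>

lemma block_integral_le:
  assumes eq: "near_equilibrium t" and t: "t \<ge> 1" and K: "word_bound t K" and l: "l \<ge> 1"
    and b: "\<And>w. \<bar>b w\<bar> \<le> R" and q: "q \<ge> 0"
    and step: "\<And>N x z. N \<ge> Nmin \<Longrightarrow> set x \<subseteq> {..<N} \<Longrightarrow> set z \<subseteq> {..<N} \<Longrightarrow>
      (\<Sum>y\<in>bounded_words l N. nw t (x @ y @ z) * exp (b y))
        \<le> (\<Sum>y\<in>bounded_words l N. nw t (x @ y @ z)) + q * (nw t x * nw t z)"
  shows "(\<integral>x. b (prefix_word l x) \<partial>\<nu>) \<le> q * K"
proof -
  define \<kappa> where "\<kappa> = ln (1 + q * K)"
  have K1: "K \<ge> 1" "\<And>n N. (\<Sum>w\<in>bounded_words n N. nw t w) \<le> K" using K unfolding word_bound_def by auto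
  have qK: "q * K \<ge> 0" using q K1 by simp
  have int: "integrable \<nu> (f 1)" using eq unfolding near_equilibrium_def by simp
  have bound: "\<exists>N0. \<forall>N\<ge>N0. (\<Sum>w\<in>bounded_words (k * l) N. nw t w * exp (block_sum b l k w)) \<le> K * exp (real k * \<kappa>)" for k
  proof (intro exI allI impI)
    fix N assume "N \<ge> Nmin"
    then have "(\<Sum>w\<in>bounded_words (k * l) N. nw t w * exp (block_sum b l k w)) \<le> K * (1 + q * K) ^ k"
      using K1 q step by (intro block_word_sum_bound) auto
    also have "(1 + q * K) ^ k = exp (real k * \<kappa>)" unfolding \<kappa>_def using qK by (simp add: exp_of_nat_mult)
    finally show "(\<Sum>w\<in>bounded_words (k * l) N. nw t w * exp (block_sum b l k w)) \<le> K * exp (real k * \<kappa>)" .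
  qed
  have "(\<integral>x. b (prefix_word l x) \<partial>\<nu>) / real l \<le> \<kappa> / real l + e" if e: "e > 0" for e
  proof -
    obtain \<xi> where xi: "finite_measurable_partition \<nu> \<xi>" "press t - e < partition_ks_entropy \<nu> shift \<xi> + t * mean"
      using eq e unfolding near_equilibrium_def by blast
    interpret partitioned_measure M f C B \<nu> \<xi> by unfold_locales (rule xi(1))
    have "partition_ks_entropy \<nu> shift \<xi> + t * mean + (\<integral>x. b (prefix_word l x) \<partial>\<nu>) / real l \<le> press t + \<kappa> / real l"
      using t K1 by (intro block_variational[OF int _ l b _ bound]) auto
    then show ?thesis using xi(2) by simp
  qed
  then have "(\<integral>x. b (prefix_word l x) \<partial>\<nu>) / real l \<le> \<kappa> / real l" by (rule field_le_epsilon)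
  then have "(\<integral>x. b (prefix_word l x) \<partial>\<nu>) \<le> \<kappa>" using l by (simp add: divide_le_cancel)
  also have "\<kappa> \<le> q * K" unfolding \<kappa>_def using qK ln_add_one_self_le_self by simp
  finally show ?thesis .
qed

lemma integral_prefix_indicator:
  "(\<integral>x. (if prefix_word (length u) x = u then 1 else 0 :: real) \<partial>\<nu>) = measure \<nu> (cylinder M u)"
proof -
  have "(\<integral>x. (if prefix_word (length u) x = u then 1 else 0 :: real) \<partial>\<nu>) = (\<integral>x. indicator (cylinder M u) x \<partial>\<nu>)"
    by (intro Bochner_Integration.integral_cong) (auto simp: cylinder_iff)
  then show ?thesis using cylinder_sets_nu[of u] sets.Int_space_eq2[OF cylinder_sets_nu[of u]] by simp
qed

text \<open>The perturbation is the indicator of \<open>u\<close>. In one block it adds at most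
  \<open>(exp 1 - 1) * nw t (x @ u @ z)\<close>; two concatenations cost
  \<open>exp (2 * (t * D))\<close>, and the factor 2 bounds \<open>exp 1 - 1\<close>.\<close>

lemma gibbs_upper:
  assumes eq: "near_equilibrium t" and t: "t \<ge> 1" and K: "word_bound t K" and u: "u \<noteq> []"
  shows "measure \<nu> (cylinder M u) \<le> 2 * exp (2 * (t * D)) * K * nw t u"
proof -
  let ?l = "length u"
  define b where "b w = (if w = u then 1 else 0 :: real)" for w
  define q where "q = 2 * exp (2 * (t * D)) * nw t u"
  have "(\<integral>x. b (prefix_word ?l x) \<partial>\<nu>) \<le> q * K"
  proof (rule block_integral_le[OF eq t K])
    show "?l \<ge> 1" using u by (simp add: Suc_le_eq)
    show "\<bar>b w\<bar> \<le> 1" for w by (simp add: b_def)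
    show "q \<ge> 0" unfolding q_def by (simp add: nw_nonneg)
    fix N x z
    have "(\<Sum>y\<in>bounded_words ?l N. nw t (x @ y @ z) * exp (b y))
        = (\<Sum>y\<in>bounded_words ?l N. nw t (x @ y @ z) + (if y = u then nw t (x @ u @ z) * (exp 1 - 1) else 0))"
      by (intro sum.cong refl) (auto simp: b_def algebra_simps)
    also have "\<dots> = (\<Sum>y\<in>bounded_words ?l N. nw t (x @ y @ z))
        + (if u \<in> bounded_words ?l N then nw t (x @ u @ z) * (exp 1 - 1) else 0)"
      by (simp add: sum.distrib sum.delta)
    also have "(if u \<in> bounded_words ?l N then nw t (x @ u @ z) * (exp 1 - 1) else 0) \<le> q * (nw t x * nw t z)"
    proof -
      have e1: "exp 1 \<le> (3::real)" by (rule exp_le)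
      have "nw t (x @ u @ z) * (exp 1 - 1) \<le> (exp (2 * (t * D)) * (nw t x * nw t u * nw t z)) * 2"
        using nw_append3_le[of t x u z] t e1 by (intro mult_mono) (auto simp: nw_nonneg)
      also have "\<dots> = q * (nw t x * nw t z)" unfolding q_def by simp
      finally show ?thesis unfolding q_def by (simp add: nw_nonneg)
    qed
    finally show "(\<Sum>y\<in>bounded_words ?l N. nw t (x @ y @ z) * exp (b y))
       \<le> (\<Sum>y\<in>bounded_words ?l N. nw t (x @ y @ z)) + q * (nw t x * nw t z)" by simp
  qed
  then show ?thesis using integral_prefix_indicator[of u] unfolding b_def q_def by (simp add: mult_ac)
qed

lemma letter_set_determined: "determined M 1 {x \<in> X. P (x 0)}"
  unfolding determined_def by (auto simp: prefix_word_def)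

lemma letter_tail_small:
  assumes "e > 0"
  shows "\<exists>m. measure \<nu> {x \<in> X. m \<le> x 0} < e"
proof -
  have "(\<lambda>m. measure \<nu> {x \<in> X. m \<le> x 0}) \<longlonglongrightarrow> measure \<nu> (\<Inter>m. {x \<in> X. m \<le> x 0})"
    using determined_sets_nu[OF letter_set_determined]
    by (intro finite_Lim_measure_decseq) (auto simp: decseq_def)
  also have "(\<Inter>m. {x \<in> X. m \<le> x 0}) = {}" by (auto) (meson not_less_eq_eq)
  finally have "(\<lambda>m. measure \<nu> {x \<in> X. m \<le> x 0}) \<longlonglongrightarrow> 0" by simp
  from order_tendstoD(2)[OF this assms] show ?thesis by (auto simp: eventually_sequentially)
qed

lemma letter_end_measure:
  "measure \<nu> {x \<in> X. P (x n)} = measure \<nu> {x \<in> X. P (x 0)}"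
proof -
  have "{x \<in> X. P (x n)} = (shift ^^ n) -` {x \<in> X. P (x 0)} \<inter> X"
    using shift_closed by (auto simp: shift_funpow)
  then show ?thesis using measure_shift[OF determined_sets_nu[OF letter_set_determined[of P]], of n] by simp
qed

end

section \<open>Windows with a prescribed word between fixed end letters\<close>

context cms_potential
begin

text \<open>Words leading from an end letter in \<open>E\<close> to the first letter of the
  prescribed word, and from its last letter to an end letter in \<open>E\<close>. One common length
  puts the prescribed word at the same position in every window.\<close>

lemma bridge_words:
  assumes E: "finite E" and F: "finite F"
  obtains k g h where "k \<ge> 1"
    "\<And>e a. e \<in> E \<Longrightarrow> a \<in> F \<Longrightarrow> adm (g e a) \<and> length (g e a) = k \<and> hd (g e a) = e \<and> M (last (g e a)) a = 1"
    "\<And>a e. a \<in> F \<Longrightarrow> e \<in> E \<Longrightarrow> adm (h a e) \<and> length (h a e) = k \<and> M a (hd (h a e)) = 1 \<and> last (h a e) = e"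
proof -
  obtain n1 where n1: "\<And>n e e'. n \<ge> n1 \<Longrightarrow> e \<in> E \<Longrightarrow> e' \<in> F \<Longrightarrow>
    \<exists>w. adm w \<and> w \<noteq> [] \<and> length w = n \<and> hd w = e \<and> M (last w) e' = 1"
    by (fact connecting_paths[OF E F])
  obtain n2 where n2: "\<And>n e e'. n \<ge> n2 \<Longrightarrow> e \<in> F \<Longrightarrow> e' \<in> E \<Longrightarrow>
    \<exists>w. adm w \<and> w \<noteq> [] \<and> length w = n \<and> hd w = e \<and> M (last w) e' = 1"
    by (fact connecting_paths[OF F E])
  define k where "k = Max {n1, n2, 1}"
  have k: "k \<ge> n1" "k \<ge> n2" "k \<ge> 1" unfolding k_def by auto
  have "\<forall>e\<in>E. \<forall>a\<in>F. \<exists>w. adm w \<and> length w = k \<and> hd w = e \<and> M (last w) a = 1" using n1[OF k(1)] by blast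
  then obtain g where g: "\<And>e a. e \<in> E \<Longrightarrow> a \<in> F \<Longrightarrow> adm (g e a) \<and> length (g e a) = k \<and> hd (g e a) = e \<and> M (last (g e a)) a = 1"
    by metis
  have "\<exists>v. adm v \<and> length v = k \<and> M a (hd v) = 1 \<and> last v = e" if ae: "a \<in> F" "e \<in> E" for a e
  proof -
    obtain w where w: "adm w" "w \<noteq> []" "length w = k" "hd w = a" "M (last w) e = 1" using n2[OF k(2) ae] by blast
    have "adm (w @ [e])" using w by (simp add: adm_append)
    moreover have "w @ [e] = [a] @ (tl w @ [e])" using w by (cases w) auto
    ultimately have "adm ([a] @ (tl w @ [e]))" by simp
    then have "adm (tl w @ [e])" "M a (hd (tl w @ [e])) = 1" unfolding adm_append[of "[a]"] by auto
    moreover have "length (tl w @ [e]) = k" using w by (cases w) auto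
    ultimately show ?thesis by (intro exI[of _ "tl w @ [e]"]) simp
  qed
  then obtain h where h: "\<And>a e. a \<in> F \<Longrightarrow> e \<in> E \<Longrightarrow> adm (h a e) \<and> length (h a e) = k \<and> M a (hd (h a e)) = 1 \<and> last (h a e) = e"
    by metis
  show ?thesis by (rule that[OF k(3) g h])
qed

text \<open>Whether a window fits between \<open>x\<close> and \<open>z\<close> depends on its end
  letters alone, so \<open>y0\<close> fits as soon as any window does. Its weight shows that windows
  with property \<open>U\<close> have a share of at least \<open>2 * \<rho>\<close>. Multiplying
  their weights by \<open>exp (- 1) \<le> 1 / 2\<close> thus removes a share of at least
  \<open>\<rho>\<close>, which makes up for the factor \<open>1 / (1 - \<rho>)\<close>.\<close>

lemma bridge_step:
  assumes t: "t \<ge> 0" and K: "word_bound t K"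
    and y0: "y0 \<in> bounded_words l N" "adm y0" "hd y0 = e" "last y0 = e'" "U y0" "y0 \<noteq> []"
    and w0: "exp (- (2 * (t * D))) * c0\<^sup>2 * p \<le> nw t y0"
    and \<rho>: "0 \<le> \<rho>" "\<rho> \<le> 1 / 2" "\<rho> = exp (- (6 * (t * D))) * c0\<^sup>2 * p / (2 * K)"
  shows "(\<Sum>y\<in>{y \<in> bounded_words l N. (hd y, last y) = (e, e')}. nw t (x @ y @ z) * exp ((if U y then - 1 else 0) - ln (1 - \<rho>)))
      \<le> (\<Sum>y\<in>{y \<in> bounded_words l N. (hd y, last y) = (e, e')}. nw t (x @ y @ z))"
proof -
  let ?S = "{y \<in> bounded_words l N. (hd y, last y) = (e, e')}"
  have l: "length y0 = l" "l > 0" using y0 by (auto simp: words_over_def)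
  have K1: "K \<ge> 1" "(\<Sum>w\<in>bounded_words l N. nw t w) \<le> K" using K unfolding word_bound_def by auto
  define A where "A = (\<Sum>y\<in>?S. nw t (x @ y @ z))"
  define A' where "A' = (\<Sum>y\<in>{y \<in> ?S. U y}. nw t (x @ y @ z))"
  have fin: "finite ?S" by simp
  have half: "\<rho> * A \<le> A' / 2"
  proof (cases "\<exists>y\<in>?S. adm (x @ y @ z)")
    case False
    then have "A = 0" unfolding A_def by (intro sum.neutral) (auto simp: nw_not_adm)
    moreover have "A' \<ge> 0" unfolding A'_def by (intro sum_nonneg nw_nonneg)
    ultimately show ?thesis by simp
  next
    case True
    then obtain y where y: "y \<in> ?S" "adm (x @ y @ z)" by blast
    have ne: "y \<noteq> []" using y l by (auto simp: words_over_def)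
    have ad0: "adm (x @ y0 @ z)" using y ne y0 by (auto simp: adm_append)
    have "A \<le> (\<Sum>y\<in>?S. exp (2 * (t * D)) * (nw t x * nw t y * nw t z))"
      unfolding A_def by (intro sum_mono nw_append3_le t)
    also have "\<dots> \<le> (\<Sum>y\<in>bounded_words l N. exp (2 * (t * D)) * (nw t x * nw t y * nw t z))"
      by (intro sum_mono2) (auto simp: nw_nonneg)
    also have "\<dots> = (exp (2 * (t * D)) * (nw t x * nw t z)) * (\<Sum>y\<in>bounded_words l N. nw t y)"
      unfolding sum_distrib_left by (intro sum.cong refl) (simp only: mult_ac)
    also have "\<dots> \<le> (exp (2 * (t * D)) * (nw t x * nw t z)) * K"
      using K1 by (intro mult_left_mono) (auto simp: nw_nonneg)
    finally have A: "A \<le> exp (2 * (t * D)) * (nw t x * nw t z) * K" .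
    have "nw t (x @ y0 @ z) \<le> A'"
      unfolding A'_def using y0 fin by (intro member_le_sum) (auto simp: nw_nonneg)
    moreover have "exp (- (2 * (t * D))) * (nw t x * nw t y0 * nw t z) \<le> nw t (x @ y0 @ z)"
      by (rule nw_append3_ge[OF t ad0])
    moreover have "exp (- (2 * (t * D))) * (nw t x * (exp (- (2 * (t * D))) * c0\<^sup>2 * p) * nw t z)
       \<le> exp (- (2 * (t * D))) * (nw t x * nw t y0 * nw t z)"
      using w0 by (intro mult_left_mono mult_right_mono) (auto simp: nw_nonneg)
    ultimately have A': "exp (- (2 * (t * D))) * (nw t x * (exp (- (2 * (t * D))) * c0\<^sup>2 * p) * nw t z) \<le> A'" by linarith
    \<comment> \<open>The 6 in the exponent of \<open>\<rho>\<close>: two concatenations in the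
      upper bound for all windows, two for placing \<open>y0\<close> between \<open>x\<close> and
      \<open>z\<close>, two inside \<open>y0\<close>.\<close>
    have "\<rho> * A \<le> \<rho> * (exp (2 * (t * D)) * (nw t x * nw t z) * K)" using A \<rho>(1) by (rule mult_left_mono)
    also have "\<dots> = (exp (- (6 * (t * D))) * exp (2 * (t * D))) * (nw t x * c0\<^sup>2 * p * nw t z) / 2"
      unfolding \<rho>(3) using K1 by simp
    also have "exp (- (6 * (t * D))) * exp (2 * (t * D)) = exp (- (2 * (t * D))) * exp (- (2 * (t * D)))"
      by (simp add: mult_exp_exp)
    also have "\<dots> * (nw t x * c0\<^sup>2 * p * nw t z) / 2 = exp (- (2 * (t * D))) * (nw t x * (exp (- (2 * (t * D))) * c0\<^sup>2 * p) * nw t z) / 2"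
      by (simp only: mult_ac)
    also have "\<dots> \<le> A' / 2" using A' by (intro divide_right_mono) auto
    finally show ?thesis .
  qed
  have e1: "exp (- 1) \<le> (1 / 2 :: real)"
  proof -
    have "2 \<le> exp (1::real)" using exp_ge_add_one_self[of "1::real"] by simp
    then show ?thesis by (simp add: exp_minus field_simps)
  qed
  have "(\<Sum>y\<in>?S. nw t (x @ y @ z) * exp ((if U y then - 1 else 0) - ln (1 - \<rho>)))
      \<le> (\<Sum>y\<in>?S. (nw t (x @ y @ z) - (if U y then nw t (x @ y @ z) / 2 else 0)) / (1 - \<rho>))"
  proof (rule sum_mono)
    fix y
    have "exp ((if U y then - 1 else 0) - ln (1 - \<rho>)) = exp (if U y then - 1 else 0) / (1 - \<rho>)"
      using \<rho>(2) by (simp add: exp_diff)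
    moreover have "nw t (x @ y @ z) * exp (if U y then - 1 else 0) \<le> nw t (x @ y @ z) - (if U y then nw t (x @ y @ z) / 2 else 0)"
      using mult_left_mono[OF e1 nw_nonneg[of t "x @ y @ z"]] by auto
    ultimately show "nw t (x @ y @ z) * exp ((if U y then - 1 else 0) - ln (1 - \<rho>))
        \<le> (nw t (x @ y @ z) - (if U y then nw t (x @ y @ z) / 2 else 0)) / (1 - \<rho>)"
      using \<rho>(2) by (simp add: divide_right_mono)
  qed
  also have "\<dots> = (A - A' / 2) / (1 - \<rho>)"
  proof -
    have "(\<Sum>y\<in>?S. if U y then nw t (x @ y @ z) / 2 else 0) = A' / 2"
      unfolding A'_def sum_divide_distrib using fin by (intro sum.mono_neutral_cong_right) auto
    then show ?thesis unfolding A_def by (simp add: sum_divide_distrib[symmetric] sum_subtractf)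
  qed
  also have "\<dots> \<le> A" using half \<rho>(2) by (simp add: field_simps)
  finally show "(\<Sum>y\<in>?S. nw t (x @ y @ z) * exp ((if U y then - 1 else 0) - ln (1 - \<rho>))) \<le> (\<Sum>y\<in>?S. nw t (x @ y @ z))"
    unfolding A_def .
qed

end

context invariant_measure
begin

text \<open>Under the reference weights, a window whose end letters lie in \<open>E\<close> contains the word \<open>u\<close>
  with conditional probability at least \<open>\<rho>\<close>, a constant multiple of the weight of \<open>u\<close>. Penalising
  each occurrence of \<open>u\<close> while rewarding each good window by \<open>- ln (1 - \<rho>)\<close> therefore does not
  increase the word sums.\<close>

lemma gibbs_lower:
  assumes eq: "near_equilibrium t" and t: "t \<ge> 1" and F: "finite F"
  shows "\<exists>c>0. \<forall>u. u \<noteq> [] \<longrightarrow> hd u \<in> F \<longrightarrow> last u \<in> F \<longrightarrow> c * nw t u \<le> measure \<nu> (cylinder M u)"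
proof -
  obtain K where K: "word_bound t K" using exists_word_bound[OF t] by blast
  have K1: "K \<ge> 1" using K unfolding word_bound_def by simp
  \<comment> \<open>Each end of a window leaves \<open>E\<close> with probability below
    \<open>1 / 4\<close>, so a window of any length has both ends in \<open>E\<close> with
    probability at least \<open>1 / 2\<close>.\<close>
  obtain m where m: "measure \<nu> {x \<in> X. m \<le> x 0} < 1 / 4" using letter_tail_small[of "1/4"] by auto
  define E where "E = {..<m}"
  have E: "finite E" unfolding E_def by simp
  obtain k g h where k: "k \<ge> 1"
    and g: "\<And>e a. e \<in> E \<Longrightarrow> a \<in> F \<Longrightarrow> adm (g e a) \<and> length (g e a) = k \<and> hd (g e a) = e \<and> M (last (g e a)) a = 1"
    and h: "\<And>a e. a \<in> F \<Longrightarrow> e \<in> E \<Longrightarrow> adm (h a e) \<and> length (h a e) = k \<and> M a (hd (h a e)) = 1 \<and> last (h a e) = e"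
    by (fact bridge_words[OF E F])
  \<comment> \<open>The weights of all connecting words. The added 1 keeps the set nonempty and
    yields \<open>c0 \<le> 1\<close>, which enters the bound
    \<open>\<rho> \<le> 1 / 2\<close>.\<close>
  define S where "S = insert 1 ((\<lambda>(e, a). nw t (g e a)) ` (E \<times> F) \<union> (\<lambda>(e, a). nw t (h a e)) ` (E \<times> F))"
  define c0 where "c0 = Min S"
  have finS: "finite S" unfolding S_def using E F by simp
  have "c0 \<in> S" unfolding c0_def using finS by (intro Min_in) (auto simp: S_def)
  then have c0_pos: "c0 > 0" unfolding S_def using nw_pos g h by auto
  have c0_1: "c0 \<le> 1" unfolding c0_def using finS by (intro Min_le) (auto simp: S_def)
  have c0_g: "c0 \<le> nw t (g e a)" "c0 \<le> nw t (h a e)" if "e \<in> E" "a \<in> F" for e a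
    unfolding c0_def using finS that by (auto intro!: Min_le simp: S_def)
  define c where "c = exp (- (6 * (t * D))) * c0\<^sup>2 / (2 * K) / 2"
  have c: "c > 0" unfolding c_def using c0_pos K1 by simp
  have "c * nw t u \<le> measure \<nu> (cylinder M u)" if u: "u \<noteq> []" "hd u \<in> F" "last u \<in> F" for u
  proof (cases "adm u")
    case False
    then show ?thesis by (simp add: nw_not_adm)
  next
    case True
    define l where "l = k + length u + k"
    define U where "U y \<longleftrightarrow> take (length u) (drop k y) = u" for y
    define y0 where "y0 e e' = g e (hd u) @ u @ h (last u) e'" for e e'
    have y0: "length (y0 e e') = l" "adm (y0 e e')" "hd (y0 e e') = e" "last (y0 e e') = e'" "U (y0 e e')" "y0 e e' \<noteq> []"
      "exp (- (2 * (t * D))) * c0\<^sup>2 * nw t u \<le> nw t (y0 e e')" if ee: "e \<in> E" "e' \<in> E" for e e'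
    proof -
      note G = g[OF ee(1) u(2)] and H = h[OF u(3) ee(2)]
      have ne: "g e (hd u) \<noteq> []" "h (last u) e' \<noteq> []" using G H k by auto
      show "length (y0 e e') = l" "hd (y0 e e') = e" "last (y0 e e') = e'" "U (y0 e e')" "y0 e e' \<noteq> []"
        using G H ne u(1) by (auto simp: y0_def l_def U_def)
      show ad: "adm (y0 e e')" using G H ne u(1) True by (auto simp: y0_def adm_append)
      have "c0\<^sup>2 * nw t u = c0 * nw t u * c0" by (simp add: power2_eq_square)
      also have "\<dots> \<le> nw t (g e (hd u)) * nw t u * nw t (h (last u) e')"
        using c0_g ee u c0_pos by (intro mult_mono) (auto simp: nw_nonneg)
      finally have "exp (- (2 * (t * D))) * (c0\<^sup>2 * nw t u)
          \<le> exp (- (2 * (t * D))) * (nw t (g e (hd u)) * nw t u * nw t (h (last u) e'))" by (intro mult_left_mono) auto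
      also have "\<dots> \<le> nw t (y0 e e')" using nw_append3_ge[of t "g e (hd u)" u "h (last u) e'"] ad t unfolding y0_def by simp
      finally show "exp (- (2 * (t * D))) * c0\<^sup>2 * nw t u \<le> nw t (y0 e e')" by (simp add: mult.assoc)
    qed
    obtain N0 where N0: "(\<lambda>(e, e'). y0 e e') ` (E \<times> E) \<subseteq> bounded_words l N0"
      by (rule finite_words_bounded[of "(\<lambda>(e, e'). y0 e e') ` (E \<times> E)" l 0]) (use E y0(1) in auto)
    define \<rho> where "\<rho> = exp (- (6 * (t * D))) * c0\<^sup>2 * nw t u / (2 * K)"
    have p: "0 \<le> nw t u" "nw t u \<le> K" using nw_nonneg nw_le_word_bound[OF K] by auto
    have t0: "t \<ge> 0" using t by simp
    have rho: "0 \<le> \<rho>" "\<rho> \<le> 1 / 2"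
    proof -
      have "exp (- (6 * (t * D))) * c0\<^sup>2 \<le> 1 * 1" using t0 D_nonneg c0_pos c0_1 by (intro mult_mono) (auto simp: power_le_one)
      then have "exp (- (6 * (t * D))) * c0\<^sup>2 * nw t u \<le> 1 * K" using p by (intro mult_mono) auto
      then show "\<rho> \<le> 1 / 2" unfolding \<rho>_def using K1 by (simp add: field_simps)
      show "0 \<le> \<rho>" unfolding \<rho>_def using p K1 by simp
    qed
    define \<beta> where "\<beta> = - ln (1 - \<rho>)"
    have beta: "\<rho> \<le> \<beta>" "0 \<le> \<beta>"
      using ln_le_minus_one[of "1 - \<rho>"] rho unfolding \<beta>_def by auto
    define good where "good y \<longleftrightarrow> hd y \<in> E \<and> last y \<in> E" for y :: "nat list"
    define b where "b y = (if U y then - 1 else 0) + (if good y then \<beta> else 0)" for y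
    \<comment> \<open>Here \<open>q = 0\<close>: the perturbed sums do not grow, so the expected
      reward for good windows is at most the mass of the cylinder of \<open>u\<close>.\<close>
    have "(\<integral>x. b (prefix_word l x) \<partial>\<nu>) \<le> 0 * K"
    proof (rule block_integral_le[OF eq t K, where R = "1 + \<beta>" and Nmin = N0])
      show "l \<ge> 1" unfolding l_def using k by simp
      show "\<bar>b w\<bar> \<le> 1 + \<beta>" for w unfolding b_def using beta by auto
      fix N x z assume N: "N0 \<le> N"
      let ?S = "\<lambda>p. {y \<in> bounded_words l N. (hd y, last y) = p}"
      \<comment> \<open>Windows are grouped by their two end letters. For ends in \<open>E\<close>
        the bridge step applies; for other ends there is no reward and \<open>b\<close> is
        nonpositive.\<close>
      have grp: "(\<Sum>y\<in>bounded_words l N. H y) = (\<Sum>p\<in>(\<lambda>y. (hd y, last y)) ` bounded_words l N. \<Sum>y\<in>?S p. H y)" for H :: "nat list \<Rightarrow> real"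
        by (rule sum.group[symmetric]) auto
      have "(\<Sum>y\<in>bounded_words l N. nw t (x @ y @ z) * exp (b y)) \<le> (\<Sum>y\<in>bounded_words l N. nw t (x @ y @ z))"
        unfolding grp
      proof (rule sum_mono)
        fix p assume "p \<in> (\<lambda>y. (hd y, last y)) ` bounded_words l N"
        obtain e e' where pe: "p = (e, e')" by (cases p)
        show "(\<Sum>y\<in>?S p. nw t (x @ y @ z) * exp (b y)) \<le> (\<Sum>y\<in>?S p. nw t (x @ y @ z))"
        proof (cases "e \<in> E \<and> e' \<in> E")
          case False
          then have "b y \<le> 0" if "y \<in> ?S p" for y using that unfolding b_def good_def pe by auto
          then show ?thesis using nw_nonneg by (intro sum_mono) (auto intro!: mult_left_le)
        next
          case ee: True
          have mem: "y0 e e' \<in> bounded_words l N"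
            using N0 ee bounded_words_mono[OF N, of l] by auto
          have "(\<Sum>y\<in>?S p. nw t (x @ y @ z) * exp (b y))
             = (\<Sum>y\<in>?S p. nw t (x @ y @ z) * exp ((if U y then - 1 else 0) - ln (1 - \<rho>)))"
            using ee by (intro sum.cong refl) (auto simp: b_def good_def \<beta>_def pe)
          also have "\<dots> \<le> (\<Sum>y\<in>?S p. nw t (x @ y @ z))"
            unfolding pe using ee y0
            by (intro bridge_step[OF t0 K mem _ _ _ _ _ _ rho \<rho>_def]) auto
          finally show ?thesis .
        qed
      qed
      then show "(\<Sum>y\<in>bounded_words l N. nw t (x @ y @ z) * exp (b y))
        \<le> (\<Sum>y\<in>bounded_words l N. nw t (x @ y @ z)) + 0 * (nw t x * nw t z)" by simp
    qed simp
    moreover have "(\<integral>x. b (prefix_word l x) \<partial>\<nu>)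
       = - measure \<nu> (cylinder M u) + \<beta> * measure \<nu> {x \<in> X. x 0 \<in> E \<and> x (l - 1) \<in> E}"
    proof -
      let ?A = "(shift ^^ k) -` cylinder M u \<inter> X" and ?G = "{x \<in> X. x 0 \<in> E \<and> x (l - 1) \<in> E}"
      have A: "?A \<in> sets \<nu>" using measurable_sets[OF funpow_shift_measurable_nu cylinder_sets_nu, of k u] by simp
      have G: "?G \<in> sets \<nu>"
      proof -
        have B: "{x \<in> X. x 0 \<in> E} \<in> sets \<nu>" by (rule determined_sets_nu[OF letter_set_determined])
        have "?G = {x \<in> X. x 0 \<in> E} \<inter> ((shift ^^ (l - 1)) -` {x \<in> X. x 0 \<in> E} \<inter> X)"
          using shift_closed by (auto simp: shift_funpow)
        moreover have "(shift ^^ (l - 1)) -` {x \<in> X. x 0 \<in> E} \<inter> X \<in> sets \<nu>"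
          using measurable_sets[OF funpow_shift_measurable_nu B, of "l - 1"] by simp
        ultimately show ?thesis using B by simp
      qed
      have 1: "U (prefix_word l x) \<longleftrightarrow> x \<in> ?A" if "x \<in> X" for x
        using that shift_closed[OF that, of k]
        by (simp add: U_def l_def drop_prefix_word take_prefix_word cylinder_iff)
      have 2: "good (prefix_word l x) \<longleftrightarrow> x \<in> ?G" if "x \<in> X" for x
      proof -
        have "prefix_word l x \<noteq> []" unfolding l_def using k by (auto simp: prefix_word_def)
        then show ?thesis using that k unfolding good_def l_def
          by (simp add: hd_conv_nth last_conv_nth)
      qed
      have "(\<integral>x. b (prefix_word l x) \<partial>\<nu>) = (\<integral>x. - indicator ?A x + \<beta> * indicator ?G x \<partial>\<nu>)"
        unfolding b_def using 1 2 by (intro Bochner_Integration.integral_cong) (auto simp: indicator_def)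
      also have "\<dots> = - measure \<nu> ?A + \<beta> * measure \<nu> ?G"
        using A G sets.Int_space_eq2[OF A] sets.Int_space_eq2[OF G]
        by (simp add: integrable_indicator_iff less_top[symmetric])
      also have "measure \<nu> ?A = measure \<nu> (cylinder M u)" by (rule measure_shift[OF cylinder_sets_nu])
      finally show ?thesis .
    qed
    moreover have "measure \<nu> {x \<in> X. x 0 \<in> E \<and> x (l - 1) \<in> E} \<ge> 1 / 2"
    proof -
      let ?B = "{x \<in> X. m \<le> x 0}" and ?B' = "{x \<in> X. m \<le> x (l - 1)}"
      have B: "?B \<in> sets \<nu>" using determined_sets_nu[OF letter_set_determined] .
      have "?B' = (shift ^^ (l - 1)) -` ?B \<inter> X" using shift_closed by (auto simp: shift_funpow)
      then have B': "?B' \<in> sets \<nu>" using measurable_sets[OF funpow_shift_measurable_nu B, of "l - 1"] by simp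
      have "{x \<in> X. x 0 \<in> E \<and> x (l - 1) \<in> E} = space \<nu> - (?B \<union> ?B')" unfolding E_def by auto
      then have "measure \<nu> {x \<in> X. x 0 \<in> E \<and> x (l - 1) \<in> E} = 1 - measure \<nu> (?B \<union> ?B')"
        using prob_compl[of "?B \<union> ?B'"] B B' by simp
      moreover have "measure \<nu> (?B \<union> ?B') \<le> measure \<nu> ?B + measure \<nu> ?B'" by (rule measure_Un_le[OF B B'])
      moreover have "measure \<nu> ?B' = measure \<nu> ?B" by (rule letter_end_measure)
      ultimately show ?thesis using m by linarith
    qed
    then have "\<rho> * (1 / 2) \<le> \<beta> * measure \<nu> {x \<in> X. x 0 \<in> E \<and> x (l - 1) \<in> E}" using beta rho by (intro mult_mono) auto
    ultimately have "\<rho> / 2 \<le> measure \<nu> (cylinder M u)" by simp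
    then show ?thesis unfolding c_def \<rho>_def by (simp add: field_simps)
  qed
  then show ?thesis using c by blast
qed

end

section \<open>Ergodicity of equilibrium states\<close>

text \<open>The set is a countable disjoint union of cylinders of length \<open>n\<close>, so the
  comparison adds up.\<close>

lemma measure_determined_le:
  assumes "invariant_measure M f C B \<nu>" "invariant_measure M f C B \<nu>'"
    and V: "determined M n V" and c: "c \<ge> 0"
    and le: "\<And>u. u \<in> prefix_word n ` V \<Longrightarrow> measure \<nu> (cylinder M u) \<le> c * measure \<nu>' (cylinder M u)"
  shows "measure \<nu> V \<le> c * measure \<nu>' V"
proof -
  interpret a: invariant_measure M f C B \<nu> by fact
  interpret b: invariant_measure M f C B \<nu>' by fact
  let ?I = "prefix_word n ` V"
  have V_eq: "V = (\<Union>u\<in>?I. cylinder M u)"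
  proof (intro equalityI subsetI)
    fix x assume x: "x \<in> V"
    then have "x \<in> cylinder M (prefix_word n x)" using V unfolding determined_def by (auto simp: a.cylinder_iff)
    then show "x \<in> (\<Union>u\<in>?I. cylinder M u)" using x by blast
  next
    fix x assume "x \<in> (\<Union>u\<in>?I. cylinder M u)"
    then obtain y where y: "y \<in> V" "x \<in> markov_shift M" "prefix_word n x = prefix_word n y"
      by (auto simp: a.cylinder_iff)
    then show "x \<in> V" using V unfolding determined_def by blast
  qed
  have disj: "disjoint_family_on (cylinder M) ?I"
    by (auto simp: disjoint_family_on_def a.cylinder_iff)
  have em: "emeasure \<mu> V = (\<integral>\<^sup>+u. emeasure \<mu> (cylinder M u) \<partial>count_space ?I)"
    if "\<And>u. cylinder M u \<in> sets \<mu>" for \<mu> :: "(nat \<Rightarrow> nat) measure"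
    using that disj by (subst V_eq, intro emeasure_UN_countable) auto
  have "emeasure \<nu> V = (\<integral>\<^sup>+u. emeasure \<nu> (cylinder M u) \<partial>count_space ?I)"
    by (rule em[OF a.cylinder_sets_nu])
  also have "\<dots> \<le> (\<integral>\<^sup>+u. ennreal c * emeasure \<nu>' (cylinder M u) \<partial>count_space ?I)"
  proof (rule nn_integral_mono)
    fix u assume "u \<in> space (count_space ?I)"
    then have "measure \<nu> (cylinder M u) \<le> c * measure \<nu>' (cylinder M u)" using le by simp
    then show "emeasure \<nu> (cylinder M u) \<le> ennreal c * emeasure \<nu>' (cylinder M u)"
      unfolding a.emeasure_eq_measure b.emeasure_eq_measure using c by (simp add: ennreal_mult[symmetric] ennreal_leI)
  qed
  also have "\<dots> = ennreal c * emeasure \<nu>' V"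
    by (subst em[OF b.cylinder_sets_nu]) (simp add: nn_integral_cmult)
  finally show ?thesis
    unfolding a.emeasure_eq_measure b.emeasure_eq_measure using c by (simp add: ennreal_mult[symmetric])
qed

text \<open>Summed over a partition this says that the entropy of a mixture exceeds the mixture of
  the entropies by at most the entropy of the weights.\<close>

lemma xlnx_mixture_le:
  fixes x y p q :: real
  assumes "x \<ge> 0" "y \<ge> 0" "p > 0" "q > 0"
  shows "- ((p * x + q * y) * ln (p * x + q * y))
    \<le> p * (- (x * ln x)) + q * (- (y * ln y)) - p * x * ln p - q * y * ln q"
proof -
  have sub: "- ((u + v) * ln (u + v)) \<le> - (u * ln u) - v * ln v" if "u \<ge> 0" "v \<ge> 0" for u v :: real
  proof (cases "u = 0 \<or> v = 0")
    case False
    then have uv: "u > 0" "v > 0" using that by auto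
    have "u * ln u \<le> u * ln (u + v)" "v * ln v \<le> v * ln (u + v)"
      using uv by (auto intro!: mult_left_mono)
    then show ?thesis by (simp add: algebra_simps)
  qed auto
  have expand: "p * x * ln (p * x) = p * (x * ln x) + p * x * ln p" if "x \<ge> 0" "p > 0" for p x :: real
  proof (cases "x = 0")
    case False
    then show ?thesis using that by (simp add: ln_mult algebra_simps)
  qed simp
  show ?thesis using sub[of "p * x" "q * y"] expand[of x p] expand[of y q] assms by simp
qed

section \<open>Conditioning on an invariant set\<close>

context invariant_measure
begin

lemma component_invariant:
  assumes A: "A \<in> sets \<nu>" and inv: "shift -` A \<inter> X = A" and pos: "measure \<nu> A > 0"
  shows "invariant_measure M f C B (uniform_measure \<nu> A)"
    and "S \<in> sets \<nu> \<Longrightarrow> measure (uniform_measure \<nu> A) S = measure \<nu> (A \<inter> S) / measure \<nu> A"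
proof -
  have em: "emeasure \<nu> A \<noteq> 0" "emeasure \<nu> A \<noteq> \<infinity>" using pos by (auto simp: emeasure_eq_measure)
  have "uniform_measure \<nu> A \<in> invariant_measures M"
    unfolding invariant_measures_def
  proof (intro CollectI conjI ballI)
    show "prob_space (uniform_measure \<nu> A)" by (rule prob_space_uniform_measure[OF em])
    show "sets (uniform_measure \<nu> A) = sets (shift_borel M)" by (simp add: sets_nu)
    fix S assume "S \<in> sets (uniform_measure \<nu> A)"
    then have S: "S \<in> sets \<nu>" by simp
    have pre: "shift -` S \<inter> X \<in> sets \<nu>" using measurable_sets[OF shift_measurable_nu S] by simp
    have "A \<inter> (shift -` S \<inter> X) = shift -` (A \<inter> S) \<inter> X" using inv by auto
    moreover have "emeasure \<nu> (shift -` (A \<inter> S) \<inter> X) = emeasure \<nu> (A \<inter> S)"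
    proof -
      have "\<forall>Z\<in>sets \<nu>. emeasure \<nu> (shift -` Z \<inter> X) = emeasure \<nu> Z"
        using invariant unfolding invariant_measures_def by simp
      then show ?thesis using sets.Int[OF A S] by blast
    qed
    ultimately show "emeasure (uniform_measure \<nu> A) (shift -` S \<inter> space (uniform_measure \<nu> A)) = emeasure (uniform_measure \<nu> A) S"
      using A S pre by simp
  qed
  then show "invariant_measure M f C B (uniform_measure \<nu> A)" by unfold_locales
  show "S \<in> sets \<nu> \<Longrightarrow> measure (uniform_measure \<nu> A) S = measure \<nu> (A \<inter> S) / measure \<nu> A"
    by (rule measure_uniform_measure[OF em])
qed

lemma component_integral:
  fixes g :: "(nat \<Rightarrow> nat) \<Rightarrow> real"
  assumes A: "A \<in> sets \<nu>" and pos: "measure \<nu> A > 0" and g: "integrable \<nu> g"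
  shows "integrable (uniform_measure \<nu> A) g"
    and "(\<integral>x. g x \<partial>uniform_measure \<nu> A) = (\<integral>x. indicator A x * g x \<partial>\<nu>) / measure \<nu> A"
proof -
  have d: "uniform_measure \<nu> A = density \<nu> (\<lambda>x. ennreal (indicator A x / measure \<nu> A))"
    unfolding uniform_measure_def emeasure_eq_measure using pos
    by (intro arg_cong[where f = "density \<nu>"] ext) (auto simp: divide_ennreal ennreal_indicator[symmetric])
  have i: "integrable \<nu> (\<lambda>x. indicator A x * g x)"
    using integrable_mult_indicator[OF A g] by simp
  have eq: "(indicator A x / measure \<nu> A) *\<^sub>R g x = (indicator A x * g x) / measure \<nu> A" for x by simp
  show "integrable (uniform_measure \<nu> A) g"
    unfolding d using A g i pos by (subst integrable_density) (auto simp: eq)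
  show "(\<integral>x. g x \<partial>uniform_measure \<nu> A) = (\<integral>x. indicator A x * g x \<partial>\<nu>) / measure \<nu> A"
    unfolding d using A g pos by (subst integral_density) (auto simp: eq)
qed

text \<open>The measure is a convex combination of its two components. The mean is affine, and the
  entropy of a partition is at most the corresponding combination, the excess in
  \<open>xlnx_mixture_le\<close> vanishing after division by \<open>n\<close>. As the other
  component cannot exceed the pressure, a deficit below \<open>p * e\<close> of the whole leaves a
  deficit below \<open>e\<close> for a component of weight \<open>p\<close>.\<close>

lemma near_equilibrium_component:
  assumes eq: "near_equilibrium t" and t: "t \<ge> 1"
    and A: "A \<in> sets \<nu>" and inv: "shift -` A \<inter> X = A" and p: "0 < measure \<nu> A" "measure \<nu> A < 1"
  shows "invariant_measure.near_equilibrium M f (uniform_measure \<nu> A) t"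
proof -
  define A' where "A' = X - A"
  have AX: "A \<subseteq> X" using sets.sets_into_space[OF A] by simp
  have A': "A' \<in> sets \<nu>" unfolding A'_def using A sets.top[of \<nu>] by auto
  have inv': "shift -` A' \<inter> X = A'" unfolding A'_def using inv shift_closed1 by auto
  define p q where "p = measure \<nu> A" and "q = measure \<nu> A'"
  have q: "q = 1 - p" unfolding p_def q_def A'_def using prob_compl[OF A] by simp
  have pq: "p > 0" "q > 0" "p + q = 1" using assms(5,6) q unfolding p_def by auto
  have pos: "0 < measure \<nu> A" "0 < measure \<nu> A'" using pq unfolding p_def q_def by auto
  define \<nu>1 \<nu>2 where "\<nu>1 = uniform_measure \<nu> A" and "\<nu>2 = uniform_measure \<nu> A'"
  interpret a: invariant_measure M f C B \<nu>1 unfolding \<nu>1_def by (rule component_invariant(1)[OF A inv pos(1)])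
  interpret b: invariant_measure M f C B \<nu>2 unfolding \<nu>2_def by (rule component_invariant(1)[OF A' inv' pos(2)])
  have int: "integrable \<nu> (f 1)" using eq unfolding near_equilibrium_def by simp
  have int1: "integrable \<nu>1 (f 1)" unfolding \<nu>1_def by (rule component_integral(1)[OF A pos(1) int])
  have int2: "integrable \<nu>2 (f 1)" unfolding \<nu>2_def by (rule component_integral(1)[OF A' pos(2) int])
  have split_measure: "measure \<nu> S = p * measure \<nu>1 S + q * measure \<nu>2 S" if S: "S \<in> sets \<nu>" for S
  proof -
    have "p * measure \<nu>1 S = measure \<nu> (A \<inter> S)" "q * measure \<nu>2 S = measure \<nu> (A' \<inter> S)"
      unfolding \<nu>1_def \<nu>2_def using component_invariant(2)[OF A inv pos(1) S] component_invariant(2)[OF A' inv' pos(2) S] pos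
      by (auto simp: p_def q_def)
    moreover have "measure \<nu> ((A \<inter> S) \<union> (A' \<inter> S)) = measure \<nu> (A \<inter> S) + measure \<nu> (A' \<inter> S)"
      using A A' S by (intro finite_measure_Union) (auto simp: A'_def)
    moreover have "(A \<inter> S) \<union> (A' \<inter> S) = S" using sets.sets_into_space[OF S] unfolding A'_def by auto
    ultimately show ?thesis by simp
  qed
  have split_integral: "(\<integral>x. g x \<partial>\<nu>) = p * (\<integral>x. g x \<partial>\<nu>1) + q * (\<integral>x. g x \<partial>\<nu>2)" if g: "integrable \<nu> g" for g :: "(nat \<Rightarrow> nat) \<Rightarrow> real"
  proof -
    have "p * (\<integral>x. g x \<partial>\<nu>1) = (\<integral>x. indicator A x * g x \<partial>\<nu>)" "q * (\<integral>x. g x \<partial>\<nu>2) = (\<integral>x. indicator A' x * g x \<partial>\<nu>)"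
      unfolding \<nu>1_def \<nu>2_def using component_integral(2)[OF A pos(1) g] component_integral(2)[OF A' pos(2) g] pos
      by (auto simp: p_def q_def)
    moreover have "integrable \<nu> (\<lambda>x. indicator A x * g x)" "integrable \<nu> (\<lambda>x. indicator A' x * g x)"
      using integrable_mult_indicator[OF A g] integrable_mult_indicator[OF A' g] by auto
    moreover have "(\<integral>x. g x \<partial>\<nu>) = (\<integral>x. indicator A x * g x + indicator A' x * g x \<partial>\<nu>)"
      using AX by (intro Bochner_Integration.integral_cong) (auto simp: A'_def indicator_def)
    ultimately show ?thesis by simp
  qed
  have mean_eq: "mean = p * a.mean + q * b.mean"
  proof -
    \<comment> \<open>The integral of \<open>f n\<close> is affine in the measure, and each mean is
      known from it up to \<open>C / n\<close>; as \<open>p + q = 1\<close>, the errors add up to at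
      most \<open>2 * C / n\<close> for every \<open>n\<close>.\<close>
    have "\<bar>mean - (p * a.mean + q * b.mean)\<bar> * real n \<le> 2 * C" if n: "n \<ge> 1" for n
    proof -
      have i: "(\<integral>x. f n x \<partial>\<nu>) = p * (\<integral>x. f n x \<partial>\<nu>1) + q * (\<integral>x. f n x \<partial>\<nu>2)"
        by (rule split_integral[OF integrable_potential[OF int n]])
      have pC: "p * C + q * C = C" using pq(3) by (metis distrib_right mult_1)
      have "(\<integral>x. f n x \<partial>\<nu>1) - real n * a.mean \<le> C" "- C \<le> (\<integral>x. f n x \<partial>\<nu>1) - real n * a.mean"
        "(\<integral>x. f n x \<partial>\<nu>2) - real n * b.mean \<le> C" "- C \<le> (\<integral>x. f n x \<partial>\<nu>2) - real n * b.mean"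
        using a.asymptotic_mean_eq(2)[OF int1 n] b.asymptotic_mean_eq(2)[OF int2 n] by (auto simp: abs_le_iff)
      then have "p * ((\<integral>x. f n x \<partial>\<nu>1) - real n * a.mean) \<le> p * C" "p * (- C) \<le> p * ((\<integral>x. f n x \<partial>\<nu>1) - real n * a.mean)"
        "q * ((\<integral>x. f n x \<partial>\<nu>2) - real n * b.mean) \<le> q * C" "q * (- C) \<le> q * ((\<integral>x. f n x \<partial>\<nu>2) - real n * b.mean)"
        using pq(1,2) by (blast intro: mult_left_mono less_imp_le)+
      then have "\<bar>p * ((\<integral>x. f n x \<partial>\<nu>1) - real n * a.mean) + q * ((\<integral>x. f n x \<partial>\<nu>2) - real n * b.mean)\<bar> \<le> C"
        using pC unfolding mult_minus_right by (simp only: abs_le_iff) linarith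
      moreover have "\<bar>(\<integral>x. f n x \<partial>\<nu>) - real n * mean\<bar> \<le> C" by (rule asymptotic_mean_eq(2)[OF int n])
      moreover have "real n * (mean - (p * a.mean + q * b.mean)) =
         (p * ((\<integral>x. f n x \<partial>\<nu>1) - real n * a.mean) + q * ((\<integral>x. f n x \<partial>\<nu>2) - real n * b.mean))
         - ((\<integral>x. f n x \<partial>\<nu>) - real n * mean)"
        unfolding i by (simp add: algebra_simps)
      ultimately have "\<bar>real n * (mean - (p * a.mean + q * b.mean))\<bar> \<le> 2 * C" by linarith
      then show ?thesis by (simp add: abs_mult mult.commute)
    qed
    then have "\<bar>mean - (p * a.mean + q * b.mean)\<bar> \<le> 2 * C / real n" if "n \<ge> 1" for n
      using that by (simp add: field_simps)
    then have "\<bar>mean - (p * a.mean + q * b.mean)\<bar> \<le> 0"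
      by (intro LIMSEQ_le_const[OF lim_const_over_n[of "2 * C"]]) blast
    then show ?thesis by simp
  qed
  have ent: "partition_ks_entropy \<nu> shift \<xi> \<le> p * partition_ks_entropy \<nu>1 shift \<xi> + q * partition_ks_entropy \<nu>2 shift \<xi>"
    and fin1: "finite_measurable_partition \<nu>1 \<xi>" and fin2: "finite_measurable_partition \<nu>2 \<xi>"
    if xi: "finite_measurable_partition \<nu> \<xi>" for \<xi>
  proof -
    show fin1: "finite_measurable_partition \<nu>1 \<xi>" and fin2: "finite_measurable_partition \<nu>2 \<xi>"
      using xi unfolding finite_measurable_partition_def \<nu>1_def \<nu>2_def by simp_all
    interpret P: partitioned_measure M f C B \<nu> \<xi> by unfold_locales (rule xi)
    interpret Pa: partitioned_measure M f C B \<nu>1 \<xi> by unfold_locales (rule fin1)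
    interpret Pb: partitioned_measure M f C B \<nu>2 \<xi> by unfold_locales (rule fin2)
    define c where "c = - (p * ln p) - q * ln q"
    have le: "P.label_entropy n \<le> p * Pa.label_entropy n + q * Pb.label_entropy n + c" for n
    proof -
      have "- (P.label_prob w * ln (P.label_prob w)) \<le> p * (- (Pa.label_prob w * ln (Pa.label_prob w)))
          + q * (- (Pb.label_prob w * ln (Pb.label_prob w))) - p * Pa.label_prob w * ln p - q * Pb.label_prob w * ln q"
        if w: "w \<in> words_over \<xi> n" for w
      proof -
        have "P.label_prob w = p * Pa.label_prob w + q * Pb.label_prob w"
          unfolding P.label_prob_def Pa.label_prob_def Pb.label_prob_def by (rule split_measure[OF P.label_set_sets[OF w]])
        then show ?thesis using xlnx_mixture_le[OF Pa.label_prob_nonneg Pb.label_prob_nonneg pq(1,2)] by simp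
      qed
      then have "P.label_entropy n \<le> (\<Sum>w\<in>words_over \<xi> n. p * (- (Pa.label_prob w * ln (Pa.label_prob w)))
          + q * (- (Pb.label_prob w * ln (Pb.label_prob w))) - p * Pa.label_prob w * ln p - q * Pb.label_prob w * ln q)"
        unfolding P.label_entropy_def sum_negf[symmetric] by (rule sum_mono)
      also have "\<dots> = p * Pa.label_entropy n + q * Pb.label_entropy n
          - p * ln p * (\<Sum>w\<in>words_over \<xi> n. Pa.label_prob w) - q * ln q * (\<Sum>w\<in>words_over \<xi> n. Pb.label_prob w)"
        unfolding Pa.label_entropy_def Pb.label_entropy_def
        by (simp add: sum.distrib sum_subtractf sum_distrib_left sum_negf mult_ac)
      also have "\<dots> = p * Pa.label_entropy n + q * Pb.label_entropy n + c"
        unfolding c_def Pa.sum_label_prob Pb.sum_label_prob by simp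
      finally show ?thesis .
    qed
    have "(\<lambda>n. p * (Pa.label_entropy n / real n) + q * (Pb.label_entropy n / real n) + c / real n)
       \<longlonglongrightarrow> p * partition_ks_entropy \<nu>1 shift \<xi> + q * partition_ks_entropy \<nu>2 shift \<xi> + 0"
      by (intro tendsto_intros Pa.label_entropy_tendsto Pb.label_entropy_tendsto lim_const_over_n)
    moreover have "P.label_entropy n / real n \<le> p * (Pa.label_entropy n / real n) + q * (Pb.label_entropy n / real n) + c / real n" for n
      using divide_right_mono[OF le[of n], of "real n"] by (simp add: add_divide_distrib)
    ultimately show "partition_ks_entropy \<nu> shift \<xi> \<le> p * partition_ks_entropy \<nu>1 shift \<xi> + q * partition_ks_entropy \<nu>2 shift \<xi>"
      using LIMSEQ_le[OF P.label_entropy_tendsto] by simp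
  qed
  have "a.near_equilibrium t"
    unfolding a.near_equilibrium_def
  proof (intro conjI allI impI int1)
    fix e :: real assume e: "e > 0"
    then have "p * e > 0" using pq by simp
    then obtain \<xi> where xi: "finite_measurable_partition \<nu> \<xi>" "press t - p * e < partition_ks_entropy \<nu> shift \<xi> + t * mean"
      using eq unfolding near_equilibrium_def by blast
    interpret Pb: partitioned_measure M f C B \<nu>2 \<xi> by unfold_locales (rule fin2[OF xi(1)])
    have "q * (partition_ks_entropy \<nu>2 shift \<xi> + t * b.mean) \<le> q * press t"
      using Pb.variational_inequality[OF int2 t] pq by (intro mult_left_mono) auto
    then have "press t - p * e < p * (partition_ks_entropy \<nu>1 shift \<xi> + t * a.mean) + q * press t"
      using xi(2) ent[OF xi(1)] unfolding mean_eq by (simp add: algebra_simps)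
    moreover have "q * press t = press t - p * press t" using pq(3) by (simp add: q algebra_simps)
    ultimately have "p * (press t - e) < p * (partition_ks_entropy \<nu>1 shift \<xi> + t * a.mean)"
      by (simp add: algebra_simps)
    then have "press t - e < partition_ks_entropy \<nu>1 shift \<xi> + t * a.mean" using pq by simp
    then show "\<exists>\<xi>. finite_measurable_partition \<nu>1 \<xi> \<and> press t - e < partition_ks_entropy \<nu>1 shift \<xi> + t * a.mean"
      using fin1[OF xi(1)] by blast
  qed
  then show ?thesis unfolding \<nu>1_def .
qed

text \<open>Both components of a nontrivial invariant set would satisfy the two-sided Gibbs bounds,
  hence be comparable on all cylinders with end letters in a fixed finite set.\<close>

lemma near_equilibrium_ergodic:
  assumes eq: "near_equilibrium t" and t: "t \<ge> 1"
    and A: "A \<in> sets \<nu>" and inv: "shift -` A \<inter> X = A"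
  shows "measure \<nu> A = 0 \<or> measure \<nu> A = 1"
proof (rule ccontr)
  assume "\<not> ?thesis"
  then have p: "0 < measure \<nu> A" "measure \<nu> A < 1" using prob_le_1[of A] measure_nonneg[of \<nu> A] by (auto simp: less_le)
  define A' where "A' = X - A"
  have A': "A' \<in> sets \<nu>" unfolding A'_def using A sets.top[of \<nu>] by auto
  have inv': "shift -` A' \<inter> X = A'" unfolding A'_def using inv shift_closed1 by auto
  have q: "measure \<nu> A' = 1 - measure \<nu> A" unfolding A'_def using prob_compl[OF A] by simp
  have p': "0 < measure \<nu> A'" "measure \<nu> A' < 1" using p q by auto
  define \<nu>1 \<nu>2 where "\<nu>1 = uniform_measure \<nu> A" and "\<nu>2 = uniform_measure \<nu> A'"
  have inv1: "invariant_measure M f C B \<nu>1" unfolding \<nu>1_def by (rule component_invariant(1)[OF A inv p(1)])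
  have inv2: "invariant_measure M f C B \<nu>2" unfolding \<nu>2_def by (rule component_invariant(1)[OF A' inv' p'(1)])
  interpret a: invariant_measure M f C B \<nu>1 by (rule inv1)
  interpret b: invariant_measure M f C B \<nu>2 by (rule inv2)
  have eq1: "a.near_equilibrium t" unfolding \<nu>1_def by (rule near_equilibrium_component[OF eq t A inv p])
  have eq2: "b.near_equilibrium t" unfolding \<nu>2_def by (rule near_equilibrium_component[OF eq t A' inv' p'])
  obtain K where K: "word_bound t K" using exists_word_bound[OF t] by blast
  have K1: "K \<ge> 1" using K unfolding word_bound_def by simp
  obtain m where m: "measure \<nu>1 {x \<in> X. m \<le> x 0} < 1 / 4" using a.letter_tail_small[of "1/4"] by auto
  have "finite {..<m}" by simp
  from b.gibbs_lower[OF eq2 t this] obtain c where c: "c > 0"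
    "\<And>u. u \<noteq> [] \<Longrightarrow> hd u < m \<Longrightarrow> last u < m \<Longrightarrow> c * nw t u \<le> measure \<nu>2 (cylinder M u)" by auto
  define k where "k = 2 * exp (2 * (t * D)) * K / c"
  have k: "k > 0" unfolding k_def using K1 c by simp
  \<comment> \<open>The approximating set \<open>U\<close> then has mass at least
    \<open>7 / 8\<close> for the first component and at most \<open>1 / (8 * k)\<close> for the
    second. Comparison leaves at most \<open>1 / 8\<close> for the first component on
    \<open>V\<close>, and the points lost at the two ends have mass below \<open>1 / 4\<close> each,
    which cannot add up to \<open>7 / 8\<close>.\<close>
  define e where "e = min (measure \<nu> A / 8) (measure \<nu> A' / (8 * k))"
  have e: "e > 0" unfolding e_def using p p' k by simp
  obtain n0 U where U0: "determined M n0 U" and U: "measure \<nu> ((A - U) \<union> (U - A)) < e"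
    using approx_determined[OF A e] by blast
  \<comment> \<open>A positive length is needed in order to speak of end letters.\<close>
  define n where "n = Suc n0"
  have det: "determined M n U" unfolding n_def by (rule determined_mono[OF U0]) simp
  have Us: "U \<in> sets \<nu>" by (rule determined_sets_nu[OF det])
  have n: "n \<ge> 1" unfolding n_def by simp
  have U1: "measure \<nu>1 U \<ge> 7 / 8"
  proof -
    have "measure \<nu> A \<le> measure \<nu> ((A \<inter> U) \<union> ((A - U) \<union> (U - A)))"
      using A Us by (intro finite_measure_mono) auto
    also have "\<dots> \<le> measure \<nu> (A \<inter> U) + measure \<nu> ((A - U) \<union> (U - A))" using A Us by (intro measure_Un_le) auto
    finally have "measure \<nu> (A \<inter> U) \<ge> 7 / 8 * measure \<nu> A" using U unfolding e_def by simp
    then show ?thesis unfolding \<nu>1_def component_invariant(2)[OF A inv p(1) Us] using p by (simp add: field_simps)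
  qed
  have U2: "measure \<nu>2 U \<le> 1 / (8 * k)"
  proof -
    have "measure \<nu> (A' \<inter> U) \<le> measure \<nu> ((A - U) \<union> (U - A))"
      using A Us by (intro finite_measure_mono) (auto simp: A'_def)
    also have "\<dots> \<le> measure \<nu> A' / (8 * k)" using U unfolding e_def by simp
    finally show ?thesis unfolding \<nu>2_def component_invariant(2)[OF A' inv' p'(1) Us] using p' k by (simp add: field_simps)
  qed
  define V where "V = {x \<in> U. x 0 < m \<and> x (n - 1) < m}"
  have detV: "determined M n V"
    unfolding determined_def
  proof (intro conjI ballI impI)
    show "V \<subseteq> X" using det unfolding V_def determined_def by auto
    fix x y assume xy: "x \<in> X" "y \<in> X" and pxy: "prefix_word n x = prefix_word n y"
    have "x \<in> U \<longleftrightarrow> y \<in> U" using det xy pxy unfolding determined_def by blast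
    moreover have "x 0 = y 0" "x (n - 1) = y (n - 1)"
      using nth_prefix_word[of 0 n x] nth_prefix_word[of 0 n y] nth_prefix_word[of "n - 1" n x] nth_prefix_word[of "n - 1" n y] pxy n
      by auto
    ultimately show "x \<in> V \<longleftrightarrow> y \<in> V" unfolding V_def by simp
  qed
  have "measure \<nu>1 V \<le> k * measure \<nu>2 V"
  proof (rule measure_determined_le[OF inv1 inv2 detV])
    show "k \<ge> 0" using k by simp
    fix u assume "u \<in> prefix_word n ` V"
    then obtain x where x: "x \<in> V" "u = prefix_word n x" by auto
    have ne: "u \<noteq> []" using x(2) n by (auto simp: prefix_word_def)
    have ends: "hd u < m" "last u < m" using x ne n unfolding V_def by (auto simp: hd_conv_nth last_conv_nth)
    have "measure \<nu>1 (cylinder M u) \<le> 2 * exp (2 * (t * D)) * K * nw t u" by (rule a.gibbs_upper[OF eq1 t K ne])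
    also have "\<dots> = k * (c * nw t u)" unfolding k_def using c by simp
    also have "\<dots> \<le> k * measure \<nu>2 (cylinder M u)" using c(2)[OF ne ends] k by (intro mult_left_mono) auto
    finally show "measure \<nu>1 (cylinder M u) \<le> k * measure \<nu>2 (cylinder M u)" .
  qed
  also have "\<dots> \<le> k * measure \<nu>2 U"
    using k Us by (intro mult_left_mono b.finite_measure_mono) (auto simp: V_def \<nu>2_def)
  also have "\<dots> \<le> k * (1 / (8 * k))" using U2 k by (intro mult_left_mono) auto
  also have "\<dots> = 1 / 8" using k by simp
  finally have V1: "measure \<nu>1 V \<le> 1 / 8" .
  let ?B = "{x \<in> X. m \<le> x 0}" and ?B' = "{x \<in> X. m \<le> x (n - 1)}"
  have B: "?B \<in> sets \<nu>1" using a.determined_sets_nu[OF a.letter_set_determined] .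
  have "?B' = (shift ^^ (n - 1)) -` ?B \<inter> X" using shift_closed by (auto simp: shift_funpow)
  then have B': "?B' \<in> sets \<nu>1" using measurable_sets[OF a.funpow_shift_measurable_nu B, of "n - 1"] by simp
  have Vs: "V \<in> sets \<nu>1" by (rule a.determined_sets_nu[OF detV])
  have "U \<subseteq> X" using det unfolding determined_def by blast
  then have "measure \<nu>1 U \<le> measure \<nu>1 (V \<union> (?B \<union> ?B'))"
    using B B' Vs by (intro a.finite_measure_mono) (auto simp: V_def)
  also have "\<dots> \<le> measure \<nu>1 V + measure \<nu>1 (?B \<union> ?B')" using B B' Vs by (intro measure_Un_le) auto
  also have "measure \<nu>1 (?B \<union> ?B') \<le> measure \<nu>1 ?B + measure \<nu>1 ?B'" by (rule measure_Un_le[OF B B'])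
  also have "measure \<nu>1 ?B' = measure \<nu>1 ?B" by (rule a.letter_end_measure)
  finally show False using U1 V1 m by simp
qed

end

section \<open>The ergodic theorem for ergodic shift-invariant measures\<close>

context invariant_measure
begin

definition birkhoff_sum :: "((nat \<Rightarrow> nat) \<Rightarrow> real) \<Rightarrow> nat \<Rightarrow> (nat \<Rightarrow> nat) \<Rightarrow> real" where
  "birkhoff_sum g n x = (\<Sum>i<n. g ((shift ^^ i) x))"

text \<open>The maximum of the Birkhoff sums of lengths 0 to \<open>n\<close>, written as the
  recursion that the maximal inequality uses.\<close>

fun maximal_sum :: "((nat \<Rightarrow> nat) \<Rightarrow> real) \<Rightarrow> nat \<Rightarrow> (nat \<Rightarrow> nat) \<Rightarrow> real" where
  "maximal_sum g 0 x = 0"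
| "maximal_sum g (Suc n) x = max 0 (g x + maximal_sum g n (shift x))"

lemma birkhoff_sum_Suc: "birkhoff_sum g (Suc n) x = g x + birkhoff_sum g n (shift x)"
  unfolding birkhoff_sum_def sum.lessThan_Suc_shift by (simp add: funpow_swap1)

lemma birkhoff_sum_measurable:
  assumes g: "g \<in> borel_measurable \<nu>"
  shows "birkhoff_sum g n \<in> borel_measurable \<nu>"
  unfolding birkhoff_sum_def
  by (intro borel_measurable_sum measurable_compose[OF funpow_shift_measurable_nu g])

lemma maximal_sum_measurable:
  assumes g: "g \<in> borel_measurable \<nu>"
  shows "maximal_sum g n \<in> borel_measurable \<nu>"
proof (induction n)
  case (Suc n)
  have "(\<lambda>x. maximal_sum g n (shift x)) \<in> borel_measurable \<nu>"
    by (rule measurable_compose[OF shift_measurable_nu Suc])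
  then show ?case using g by simp
qed simp

lemma maximal_sum_nonneg: "maximal_sum g n x \<ge> 0"
  by (cases n) auto

lemma maximal_sum_mono: "maximal_sum g n x \<le> maximal_sum g (Suc n) x"
proof (induction n arbitrary: x)
  case (Suc n)
  show ?case using Suc[of "shift x"] by (simp add: max.coboundedI2)
qed simp

lemma maximal_sum_bound:
  assumes "\<And>x. x \<in> X \<Longrightarrow> \<bar>g x\<bar> \<le> R" "x \<in> X"
  shows "\<bar>maximal_sum g n x\<bar> \<le> real n * R"
  using assms(2)
proof (induction n arbitrary: x)
  case (Suc n)
  have "\<bar>maximal_sum g n (shift x)\<bar> \<le> real n * R" using Suc shift_closed1 by blast
  moreover have "\<bar>g x\<bar> \<le> R" by (rule assms(1)[OF Suc(2)])
  ultimately show ?case by (simp add: algebra_simps abs_le_iff)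
qed simp

lemma birkhoff_le_maximal: "birkhoff_sum g n x \<le> maximal_sum g n x"
proof (induction n arbitrary: x)
  case (Suc n)
  show ?case unfolding birkhoff_sum_Suc using Suc[of "shift x"] by simp
qed (simp add: birkhoff_sum_def)

text \<open>Garsia's proof of the maximal ergodic theorem. Where the maximal sum \<open>M\<close> is
  positive, the recursion gives \<open>M x - M (shift x) \<le> g x\<close>; elsewhere the left side
  is nonpositive. By invariance its integral is 0.\<close>

lemma integral_maximal_nonneg:
  assumes g: "g \<in> borel_measurable \<nu>" and R: "\<And>x. x \<in> X \<Longrightarrow> \<bar>g x\<bar> \<le> R"
  shows "0 \<le> (\<integral>x. indicator {x \<in> X. maximal_sum g n x > 0} x * g x \<partial>\<nu>)"
proof -
  let ?M = "maximal_sum g n"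
  note M = maximal_sum_measurable[OF g, of n]
  have intM: "integrable \<nu> ?M"
    by (rule integrable_const_bound[of _ "real n * R"]) (use M maximal_sum_bound[OF R] in auto)
  have E: "{x \<in> X. ?M x > 0} \<in> sets \<nu>"
    using M measurable_sets[OF M, of "{0<..}"] by (simp add: vimage_def Int_def conj_commute)
  have intg: "integrable \<nu> g" by (rule integrable_const_bound[of _ R]) (use g R in auto)
  have "0 = (\<integral>x. ?M x - ?M ((shift ^^ 1) x) \<partial>\<nu>)"
    using intM integrable_shift[OF intM, of 1] integral_shift[OF M, of 1] by simp
  also have "\<dots> \<le> (\<integral>x. indicator {x \<in> X. ?M x > 0} x * g x \<partial>\<nu>)"
  proof (rule integral_mono)
    show "integrable \<nu> (\<lambda>x. ?M x - ?M ((shift ^^ 1) x))" using intM integrable_shift[OF intM, of 1] by simp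
    show "integrable \<nu> (\<lambda>x. indicator {x \<in> X. ?M x > 0} x * g x)"
      using integrable_mult_indicator[OF E intg] by simp
    fix x assume "x \<in> space \<nu>"
    then have x: "x \<in> X" by simp
    show "?M x - ?M ((shift ^^ 1) x) \<le> indicator {x \<in> X. ?M x > 0} x * g x"
    proof (cases "?M x > 0")
      case True
      then obtain k where n: "n = Suc k" by (cases n) auto
      have "?M x = g x + maximal_sum g k (shift x)" using True unfolding n by auto
      moreover have "maximal_sum g k (shift x) \<le> ?M (shift x)" unfolding n by (rule maximal_sum_mono)
      ultimately show ?thesis using True x by simp
    next
      case False
      then show ?thesis using maximal_sum_nonneg[of g n "shift x"] maximal_sum_nonneg[of g n x] by simp
    qed
  qed
  finally show ?thesis .
qed

text \<open>The sets on which the maximal sum of length \<open>n\<close> is positive increase to a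
  set of full measure, so the maximal inequality passes to the limit.\<close>

lemma integral_nonneg_of_maximal:
  assumes g: "g \<in> borel_measurable \<nu>" and R: "\<And>x. x \<in> X \<Longrightarrow> \<bar>g x\<bar> \<le> R"
    and pos: "AE x in \<nu>. \<exists>n. birkhoff_sum g n x > 0"
  shows "0 \<le> (\<integral>x. g x \<partial>\<nu>)"
proof -
  let ?E = "\<lambda>n. {x \<in> X. maximal_sum g n x > 0}"
  have E: "?E n \<in> sets \<nu>" for n
    using measurable_sets[OF maximal_sum_measurable[OF g], of "{0<..}"] by (simp add: vimage_def Int_def conj_commute)
  have mono: "n \<le> m \<Longrightarrow> maximal_sum g n x \<le> maximal_sum g m x" for n m x
    by (rule lift_Suc_mono_le[of "\<lambda>n. maximal_sum g n x"]) (rule maximal_sum_mono)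
  have "(\<lambda>n. \<integral>x. indicator (?E n) x * g x \<partial>\<nu>) \<longlonglongrightarrow> (\<integral>x. g x \<partial>\<nu>)"
  proof (rule integral_dominated_convergence[where w = "\<lambda>_. \<bar>R\<bar>"])
    show "AE x in \<nu>. (\<lambda>n. indicator (?E n) x * g x) \<longlonglongrightarrow> g x"
      using pos AE_space
    proof eventually_elim
      case (elim x)
      then obtain k where "birkhoff_sum g k x > 0" by blast
      then have k: "maximal_sum g k x > 0" using birkhoff_le_maximal[of g k x] by linarith
      have "\<forall>\<^sub>F n in sequentially. indicator (?E n) x * g x = g x"
        using eventually_ge_at_top[of k]
      proof eventually_elim
        case (elim n)
        then show ?case using mono[of k n x] k \<open>x \<in> space \<nu>\<close> by simp
      qed
      then show ?case by (rule tendsto_eventually)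
    qed
    show "AE x in \<nu>. norm (indicator (?E n) x * g x) \<le> \<bar>R\<bar>" for n
    proof (rule AE_I2)
      fix x assume "x \<in> space \<nu>"
      then have "\<bar>g x\<bar> \<le> R" using R by simp
      then show "norm (indicator (?E n) x * g x) \<le> \<bar>R\<bar>" by (auto simp: indicator_def abs_mult)
    qed
  qed (use g E in auto)
  then show ?thesis by (rule LIMSEQ_le_const) (use integral_maximal_nonneg[OF g R] in auto)
qed

text \<open>The upper limit of the averages is larger than \<open>c\<close>. The margins
  \<open>1 / real (Suc j)\<close> make this a countable combination of measurable
  conditions.\<close>

definition exceeds :: "((nat \<Rightarrow> nat) \<Rightarrow> real) \<Rightarrow> real \<Rightarrow> (nat \<Rightarrow> nat) \<Rightarrow> bool" where
  "exceeds g c x \<longleftrightarrow> (\<exists>j::nat. \<forall>N. \<exists>n\<ge>N. birkhoff_sum g n x > (c + 1 / real (Suc j)) * real n)"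

text \<open>Passing between \<open>x\<close> and \<open>shift x\<close> changes the sum by at most
  \<open>R\<close> and the length by one. For long sums both changes are absorbed by replacing the
  margin \<open>1 / real (Suc j)\<close> by the next smaller one.\<close>

lemma exceeds_shift:
  assumes R: "\<And>x. x \<in> X \<Longrightarrow> \<bar>g x\<bar> \<le> R" and x: "x \<in> X"
  shows "exceeds g c (shift x) \<longleftrightarrow> exceeds g c x"
proof
  have gap: "1 / real (Suc j) - 1 / real (Suc (Suc j)) > 0" for j
    using divide_strict_left_mono[of "real (Suc j)" "real (Suc (Suc j))" 1] by simp
  have alg: "y * (a - b) = (c + a) * y - (c + b) * y" for y a b :: real by (simp add: algebra_simps)
  have aux: "v < y" if "R - a < d" "d = u - v" "w = u + a" "w < g x + y" for a d u v w y
    using that R[OF x] by (simp add: abs_le_iff)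
  have gx: "- R \<le> g x" "g x \<le> R" using R[OF x] by (auto simp: abs_le_iff)
  {
    assume "exceeds g c (shift x)"
    then obtain j where j: "\<And>N. \<exists>n\<ge>N. birkhoff_sum g n (shift x) > (c + 1 / real (Suc j)) * real n"
      unfolding exceeds_def by blast
    let ?d = "1 / real (Suc j) - 1 / real (Suc (Suc j))"
    obtain L where L: "real L > (R + \<bar>c + 1 / real (Suc (Suc j))\<bar>) / ?d" using reals_Archimedean2 by blast
    have "\<exists>n\<ge>N. birkhoff_sum g n x > (c + 1 / real (Suc (Suc j))) * real n" for N
    proof -
      obtain n where n: "n \<ge> max N L" "birkhoff_sum g n (shift x) > (c + 1 / real (Suc j)) * real n" using j by blast
      have "real L * ?d > R + \<bar>c + 1 / real (Suc (Suc j))\<bar>" using L gap[of j] by (simp add: pos_divide_less_eq)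
      moreover have "real L * ?d \<le> real n * ?d" using n gap[of j] by (intro mult_right_mono) auto
      ultimately have "real n * ?d > R + (c + 1 / real (Suc (Suc j)))" by linarith
      moreover have "real n * ?d = (c + 1 / real (Suc j)) * real n - (c + 1 / real (Suc (Suc j))) * real n"
        by (rule alg)
      ultimately have "birkhoff_sum g (Suc n) x > (c + 1 / real (Suc (Suc j))) * real n + (c + 1 / real (Suc (Suc j)))"
        unfolding birkhoff_sum_Suc using n(2) gx by linarith
      moreover have "y * real n + y = y * real (Suc n)" for y by (simp add: algebra_simps)
      ultimately have "birkhoff_sum g (Suc n) x > (c + 1 / real (Suc (Suc j))) * real (Suc n)" by (simp only:)
      moreover have "N \<le> Suc n" using n(1) by simp
      ultimately show ?thesis by blast
    qed
    then show "exceeds g c x" unfolding exceeds_def by blast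
  }
  {
    assume "exceeds g c x"
    then obtain j where j: "\<And>N. \<exists>n\<ge>N. birkhoff_sum g n x > (c + 1 / real (Suc j)) * real n"
      unfolding exceeds_def by blast
    let ?d = "1 / real (Suc j) - 1 / real (Suc (Suc j))"
    obtain L where L: "real L > (R + \<bar>c + 1 / real (Suc j)\<bar>) / ?d" using reals_Archimedean2 by blast
    have "\<exists>n\<ge>N. birkhoff_sum g n (shift x) > (c + 1 / real (Suc (Suc j))) * real n" for N
    proof -
      obtain n' where n': "n' \<ge> Suc (max N L)" "birkhoff_sum g n' x > (c + 1 / real (Suc j)) * real n'" using j by blast
      then obtain n where n: "n' = Suc n" "n \<ge> max N L" by (cases n') auto
      have "real L * ?d > R + \<bar>c + 1 / real (Suc j)\<bar>" using L gap[of j] by (simp add: pos_divide_less_eq)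
      moreover have "real L * ?d \<le> real n * ?d" using n gap[of j] by (intro mult_right_mono) auto
      ultimately have "real n * ?d > R - (c + 1 / real (Suc j))" by linarith
      moreover have "real n * ?d = (c + 1 / real (Suc j)) * real n - (c + 1 / real (Suc (Suc j))) * real n"
        by (rule alg)
      moreover have "(c + 1 / real (Suc j)) * real n' = (c + 1 / real (Suc j)) * real n + (c + 1 / real (Suc j))"
        unfolding n(1) of_nat_Suc distrib_left by simp
      moreover have "g x + birkhoff_sum g n (shift x) > (c + 1 / real (Suc j)) * real n'"
        using n'(2) unfolding n(1) birkhoff_sum_Suc .
      ultimately have "birkhoff_sum g n (shift x) > (c + 1 / real (Suc (Suc j))) * real n"
        by (rule aux)
      then show ?thesis using n(2) by auto
    qed
    then show "exceeds g c (shift x)" unfolding exceeds_def by blast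
  }
qed

text \<open>The set of exceeding points is invariant. If it had full measure, almost every point
  would have a positive Birkhoff sum of \<open>g - c\<close>, and the maximal inequality would make
  the integral of \<open>g\<close> at least \<open>c\<close>.\<close>

lemma ergodic_not_exceeds:
  assumes ergodic: "\<And>A. A \<in> sets \<nu> \<Longrightarrow> shift -` A \<inter> X = A \<Longrightarrow> measure \<nu> A = 0 \<or> measure \<nu> A = 1"
    and g: "g \<in> borel_measurable \<nu>" and R: "\<And>x. x \<in> X \<Longrightarrow> \<bar>g x\<bar> \<le> R" and c: "(\<integral>x. g x \<partial>\<nu>) < c"
  shows "AE x in \<nu>. \<not> exceeds g c x"
proof -
  define A where "A = {x \<in> X. exceeds g c x}"
  have "{x \<in> space \<nu>. \<exists>j::nat. \<forall>N. \<exists>n. n \<ge> N \<and> birkhoff_sum g n x > (c + 1 / real (Suc j)) * real n} \<in> sets \<nu>"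
    by (intro sets.sets_Collect_countable_Ex sets.sets_Collect_countable_All sets.sets_Collect_conj
        sets.sets_Collect_const borel_measurable_less borel_measurable_const birkhoff_sum_measurable g)
  then have A: "A \<in> sets \<nu>" unfolding A_def exceeds_def space_nu .
  have inv: "shift -` A \<inter> X = A" unfolding A_def using exceeds_shift[OF R] shift_closed1 by auto
  have "measure \<nu> A \<noteq> 1"
  proof
    assume "measure \<nu> A = 1"
    then have "AE x in \<nu>. x \<in> A" using prob_eq_1[OF A] by simp
    then have ae: "AE x in \<nu>. \<exists>n. birkhoff_sum (\<lambda>x. g x - c) n x > 0"
    proof eventually_elim
      case (elim x)
      then obtain j where j: "\<forall>N. \<exists>n\<ge>N. birkhoff_sum g n x > (c + 1 / real (Suc j)) * real n"
        unfolding A_def exceeds_def by blast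
      from spec[OF j, of 1] obtain n where n: "n \<ge> 1" "birkhoff_sum g n x > (c + 1 / real (Suc j)) * real n" by blast
      have "c * real n \<le> (c + 1 / real (Suc j)) * real n" by (intro mult_right_mono) auto
      then have "birkhoff_sum (\<lambda>x. g x - c) n x > 0" using n(2)
        by (simp add: birkhoff_sum_def sum_subtractf mult.commute)
      then show ?case ..
    qed
    have R': "\<bar>g x - c\<bar> \<le> R + \<bar>c\<bar>" if "x \<in> X" for x using R[OF that] by linarith
    have "0 \<le> (\<integral>x. g x - c \<partial>\<nu>)"
      by (rule integral_nonneg_of_maximal[OF _ R' ae]) (use g in auto)
    moreover have "integrable \<nu> g" by (rule integrable_const_bound[of _ R]) (use g R in auto)
    ultimately show False using c by (simp add: prob_space)
  qed
  then have "measure \<nu> A = 0" using ergodic[OF A inv] by blast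
  then have "AE x in \<nu>. x \<notin> A" using prob_eq_0[OF A] by simp
  then show ?thesis using AE_space by eventually_elim (simp add: A_def)
qed

lemma birkhoff_upper:
  assumes ergodic: "\<And>A. A \<in> sets \<nu> \<Longrightarrow> shift -` A \<inter> X = A \<Longrightarrow> measure \<nu> A = 0 \<or> measure \<nu> A = 1"
    and g: "g \<in> borel_measurable \<nu>" and R: "\<And>x. x \<in> X \<Longrightarrow> \<bar>g x\<bar> \<le> R"
  shows "AE x in \<nu>. \<forall>e>0. \<forall>\<^sub>F n in sequentially. birkhoff_sum g n x / real n \<le> (\<integral>x. g x \<partial>\<nu>) + e"
proof -
  have "AE x in \<nu>. \<forall>i::nat. \<not> exceeds g ((\<integral>x. g x \<partial>\<nu>) + 1 / real (Suc i)) x"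
    unfolding AE_all_countable by (intro allI ergodic_not_exceeds[OF ergodic g R]) auto
  then show ?thesis
  proof eventually_elim
    case (elim x)
    show ?case
    proof (intro allI impI)
      fix e :: real assume "e > 0"
      then have "e / 2 > 0" by simp
      then obtain i where i: "1 / real (Suc i) < e / 2" using nat_approx_posE by blast
      have "\<not> (\<forall>N. \<exists>n\<ge>N. birkhoff_sum g n x > ((\<integral>x. g x \<partial>\<nu>) + 1 / real (Suc i) + 1 / real (Suc i)) * real n)"
        using elim[rule_format, of i] unfolding exceeds_def by blast
      then obtain N where N: "\<And>n. n \<ge> N \<Longrightarrow> birkhoff_sum g n x \<le> ((\<integral>x. g x \<partial>\<nu>) + 1 / real (Suc i) + 1 / real (Suc i)) * real n"
        by (metis not_less)
      show "\<forall>\<^sub>F n in sequentially. birkhoff_sum g n x / real n \<le> (\<integral>x. g x \<partial>\<nu>) + e"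
        using eventually_ge_at_top[of "max N 1"]
      proof eventually_elim
        case (elim n)
        then have "birkhoff_sum g n x / real n \<le> (\<integral>x. g x \<partial>\<nu>) + 1 / real (Suc i) + 1 / real (Suc i)"
          using N[of n] by (simp add: pos_divide_le_eq)
        then show ?case using i by linarith
      qed
    qed
  qed
qed

text \<open>The upper bound for \<open>g\<close> and for \<open>- g\<close> gives convergence almost
  everywhere, and boundedness gives convergence in mean. Only the latter can be carried to another
  measure by comparing masses of cylinders.\<close>

lemma birkhoff_L1:
  assumes ergodic: "\<And>A. A \<in> sets \<nu> \<Longrightarrow> shift -` A \<inter> X = A \<Longrightarrow> measure \<nu> A = 0 \<or> measure \<nu> A = 1"
    and g: "g \<in> borel_measurable \<nu>" and R: "\<And>x. x \<in> X \<Longrightarrow> \<bar>g x\<bar> \<le> R"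
  shows "(\<lambda>n. \<integral>x. \<bar>birkhoff_sum g n x / real n - (\<integral>x. g x \<partial>\<nu>)\<bar> \<partial>\<nu>) \<longlonglongrightarrow> 0"
proof -
  let ?m = "\<integral>x. g x \<partial>\<nu>"
  have R0: "R \<ge> 0" using R not_empty by fastforce
  have intg: "integrable \<nu> g" by (rule integrable_const_bound[of _ R]) (use g R in auto)
  have up: "AE x in \<nu>. \<forall>e>0. \<forall>\<^sub>F n in sequentially. birkhoff_sum g n x / real n \<le> ?m + e"
    by (rule birkhoff_upper[OF ergodic g R])
  have "AE x in \<nu>. \<forall>e>0. \<forall>\<^sub>F n in sequentially. birkhoff_sum (\<lambda>x. - g x) n x / real n \<le> (\<integral>x. - g x \<partial>\<nu>) + e"
    by (rule birkhoff_upper[OF ergodic _ ]) (use g R in auto)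
  moreover have "birkhoff_sum (\<lambda>x. - g x) n x / real n = - (birkhoff_sum g n x / real n)" for n x
    by (simp add: birkhoff_sum_def sum_negf)
  ultimately have lo: "AE x in \<nu>. \<forall>e>0. \<forall>\<^sub>F n in sequentially. - (birkhoff_sum g n x / real n) \<le> - ?m + e"
    using intg by simp
  have "(\<lambda>n. \<integral>x. \<bar>birkhoff_sum g n x / real n - ?m\<bar> \<partial>\<nu>) \<longlonglongrightarrow> (\<integral>x. 0 \<partial>\<nu>)"
  proof (rule integral_dominated_convergence[where w = "\<lambda>_. R + \<bar>?m\<bar>"])
    show "AE x in \<nu>. (\<lambda>n. \<bar>birkhoff_sum g n x / real n - ?m\<bar>) \<longlonglongrightarrow> 0"
      using up lo
    proof eventually_elim
      case (elim x)
      have "(\<lambda>n. birkhoff_sum g n x / real n) \<longlonglongrightarrow> ?m"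
      proof (rule tendstoI)
        fix e :: real assume "e > 0"
        then have e: "e / 2 > 0" by simp
        have "\<forall>\<^sub>F n in sequentially. birkhoff_sum g n x / real n \<le> ?m + e / 2"
          "\<forall>\<^sub>F n in sequentially. - (birkhoff_sum g n x / real n) \<le> - ?m + e / 2" using elim e by blast+
        then show "\<forall>\<^sub>F n in sequentially. dist (birkhoff_sum g n x / real n) ?m < e"
        proof eventually_elim
          case (elim n)
          then show ?case using \<open>e > 0\<close> unfolding dist_real_def by linarith
        qed
      qed
      from tendsto_rabs[OF tendsto_diff[OF this tendsto_const[of ?m]]] show ?case by simp
    qed
    show "AE x in \<nu>. norm \<bar>birkhoff_sum g n x / real n - ?m\<bar> \<le> R + \<bar>?m\<bar>" for n
    proof (rule AE_I2)
      fix x assume "x \<in> space \<nu>"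
      then have x: "x \<in> X" by simp
      have "\<bar>birkhoff_sum g n x\<bar> \<le> (\<Sum>i<n. \<bar>g ((shift ^^ i) x)\<bar>)" unfolding birkhoff_sum_def by (rule sum_abs)
      also have "\<dots> \<le> (\<Sum>i<n. R)" using R shift_closed[OF x] by (intro sum_mono) auto
      finally have "\<bar>birkhoff_sum g n x\<bar> \<le> real n * R" by simp
      then have "\<bar>birkhoff_sum g n x / real n\<bar> \<le> R" using R0 by (cases "n = 0") (auto simp: field_simps)
      then show "norm \<bar>birkhoff_sum g n x / real n - ?m\<bar> \<le> R + \<bar>?m\<bar>" unfolding real_norm_def by linarith
    qed
  qed (use birkhoff_sum_measurable[OF g] in auto)
  then show ?thesis by simp
qed

end

section \<open>Equilibrium states at different temperatures\<close>

context cms_potential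
begin

lemma word_pot_le_sum_letters:
  assumes "adm w" "w \<noteq> []"
  shows "word_pot w \<le> sum_list (map (\<lambda>i. word_pot [i]) w) + real (length w - 1) * D"
  using assms
proof (induction w)
  case (Cons i w)
  show ?case
  proof (cases "w = []")
    case False
    have "adm ([i] @ w)" using Cons by simp
    then have ad: "adm w" and le: "\<bar>word_pot ([i] @ w) - (word_pot [i] + word_pot w)\<bar> \<le> D"
      using adm_append[of "[i]" w] word_pot_append[of "[i]" w] False by auto
    have "word_pot (i # w) \<le> word_pot [i] + word_pot w + D" using le by (simp add: abs_le_iff)
    moreover have len: "length (i # w) - 1 = Suc (length w - 1)" using False by (cases w) auto
    have "real (length (i # w) - 1) * D = real (length w - 1) * D + D"
      unfolding len of_nat_Suc distrib_right by simp
    ultimately show ?thesis using Cons(1)[OF ad False] by (simp only: list.map sum_list.Cons)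
  qed simp
qed simp

lemma sum_list_letters_le:
  assumes "\<And>i. i \<in> set w \<Longrightarrow> word_pot [i] \<le> r"
  shows "sum_list (map (\<lambda>i. word_pot [i]) w) \<le> real (length w) * r"
  using assms
proof (induction w)
  case (Cons i w)
  then have "word_pot [i] \<le> r" "sum_list (map (\<lambda>i. word_pot [i]) w) \<le> real (length w) * r" by auto
  then show ?case by (simp add: algebra_simps)
qed simp

text \<open>A path from 0 through \<open>i\<close> back to 0 is cut at its last letter below
  \<open>m\<close> before \<open>i\<close> and at its first letter below \<open>m\<close> after
  \<open>i\<close>.\<close>

lemma excursion:
  assumes m: "m > 0"
  obtains e e' x x' where "e < m" "e' < m" "\<forall>j\<in>set x. m \<le> j" "\<forall>j\<in>set x'. m \<le> j" "adm ([e] @ x @ [i] @ x' @ [e'])"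
proof -
  obtain k where "\<And>n. n \<ge> k \<Longrightarrow> \<exists>w. adm w \<and> w \<noteq> [] \<and> length w = n \<and> hd w = 0 \<and> M (last w) i = 1"
    by (fact connecting_path)
  from this[OF order_refl] obtain u where u: "adm u" "u \<noteq> []" "hd u = 0" "M (last u) i = 1" by auto
  obtain k' where "\<And>n. n \<ge> k' \<Longrightarrow> \<exists>w. adm w \<and> w \<noteq> [] \<and> length w = n \<and> hd w = i \<and> M (last w) 0 = 1"
    by (fact connecting_path)
  from this[OF order_refl] obtain v where v: "adm v" "v \<noteq> []" "hd v = i" "M (last v) 0 = 1" by auto
  have "adm (v @ [0])" using v by (simp add: adm_append)
  moreover have "v @ [0] = [i] @ (tl v @ [0])" using v by (cases v) auto
  ultimately have w: "adm ([i] @ (tl v @ [0]))" by simp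
  have "adm (u @ [i] @ (tl v @ [0]))" using u w by (auto simp: adm_append[of u])
  moreover have "0 \<in> set u" using u(2,3) hd_in_set[of u] by simp
  then have "\<exists>j\<in>set u. j < m" using m by blast
  from split_list_last_prop[OF this] obtain u1 e x
    where ux: "u = u1 @ e # x" "e < m" "\<forall>z\<in>set x. \<not> z < m" by blast
  moreover have "\<exists>j\<in>set (tl v @ [0]). j < m" using m by auto
  from split_list_first_prop[OF this] obtain x' e' v1
    where vx: "tl v @ [0] = x' @ e' # v1" "e' < m" "\<forall>z\<in>set x'. \<not> z < m" by blast
  ultimately have "adm (u1 @ ([e] @ x @ [i] @ x' @ [e']) @ v1)" by simp
  then have "adm ([e] @ x @ [i] @ x' @ [e'])" using adm_append by blast
  then show ?thesis using ux vx by (intro that) auto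
qed

end

context invariant_measure
begin

text \<open>A common equilibrium state forces the potential of every word of length \<open>n\<close> with ends in
  a finite set to be at least \<open>n * \<gamma>\<close> up to a constant. An excursion through a letter of very low
  potential violates this.\<close>

lemma no_common_equilibrium:
  assumes s: "1 \<le> s" "s < t" and eqs: "near_equilibrium s" and eqt: "near_equilibrium t"
  shows False
proof -
  have t: "t \<ge> 1" using s by simp
  obtain K where K: "word_bound t K" using exists_word_bound[OF t] by blast
  have K1: "K \<ge> 1" using K unfolding word_bound_def by simp
  define k where "k = 2 * exp (2 * (t * D)) * K"
  have k: "k > 0" unfolding k_def using K1 by simp
  \<comment> \<open>The slope of the pressure between the two temperatures: comparing the lower
    bound at \<open>s\<close> with the upper bound at \<open>t\<close> bounds
    \<open>(t - s) * word_pot u\<close> below by \<open>length u * (press t - press s)\<close> up to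
    a constant.\<close>
  define \<gamma> where "\<gamma> = (press t - press s) / (t - s)"
  \<comment> \<open>A letter with potential at most \<open>- R0\<close> contributes at most
    \<open>\<gamma>\<close> even after paying \<open>D\<close> for its concatenation, so the lengths
    of the two excursion parts do not matter.\<close>
  define R0 where "R0 = max 0 (D - \<gamma>)"
  obtain N where N: "\<And>i. i \<ge> N \<Longrightarrow> word_pot [i] \<le> - R0" by (fact letter_pot_neg)
  define m where "m = Suc N"
  have m: "m > 0" "\<And>i. i \<ge> m \<Longrightarrow> word_pot [i] \<le> - R0" unfolding m_def using N by auto
  have "finite {..<m}" by simp
  from gibbs_lower[OF eqs s(1) this] obtain c where c: "c > 0"
    "\<And>u. u \<noteq> [] \<Longrightarrow> hd u < m \<Longrightarrow> last u < m \<Longrightarrow> c * nw s u \<le> measure \<nu> (cylinder M u)" by auto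
  define \<kappa> where "\<kappa> = ln (c / k) / (t - s)"
  have lower: "real (length u) * \<gamma> + \<kappa> \<le> word_pot u" if u: "adm u" "u \<noteq> []" "hd u < m" "last u < m" for u
  proof -
    have "c * nw s u \<le> measure \<nu> (cylinder M u)" using c u by blast
    also have "\<dots> \<le> k * nw t u" unfolding k_def by (rule gibbs_upper[OF eqt t K u(2)])
    finally have "c / k * nw s u \<le> nw t u" using k by (simp add: field_simps)
    then have "ln (c / k * nw s u) \<le> ln (nw t u)" using c(1) k nw_pos[OF u(1)] by (intro ln_mono mult_pos_pos) auto
    then have "ln (c / k) + (s * word_pot u - real (length u) * press s) \<le> t * word_pot u - real (length u) * press t"
      using c(1) k nw_pos[OF u(1), of s] ln_mult[of "c / k" "nw s u"] by (simp add: nw_eq[OF u(1,2)])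
    then have "ln (c / k) + real (length u) * (press t - press s) \<le> (t - s) * word_pot u" by (simp add: algebra_simps)
    then have "(ln (c / k) + real (length u) * (press t - press s)) / (t - s) \<le> word_pot u"
      using s by (simp add: field_simps)
    then show ?thesis unfolding \<gamma>_def \<kappa>_def by (simp add: add_divide_distrib add.commute)
  qed
  obtain S where S: "S \<ge> 0" "\<And>i. word_pot [i] \<le> S" by (fact letter_pot_bounded)
  \<comment> \<open>The two bounds for the excursion give
    \<open>R \<le> 2 * S + 2 * D - 3 * \<gamma> - \<kappa>\<close>; the final 1 makes this
    false.\<close>
  define R where "R = 2 * S + 2 * D - 3 * \<gamma> - \<kappa> + 1"
  obtain i where i: "word_pot [i] \<le> - R" using letter_pot_neg[of R] by blast
  obtain e e' x x' where ex: "e < m" "e' < m" "\<forall>j\<in>set x. m \<le> j" "\<forall>j\<in>set x'. m \<le> j"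
    "adm ([e] @ x @ [i] @ x' @ [e'])" by (fact excursion[OF m(1), of i])
  let ?u = "[e] @ x @ [i] @ x' @ [e']"
  define r where "r = real (length x) + real (length x')"
  have len: "real (length ?u) = r + 3" "real (length ?u - 1) = r + 2" unfolding r_def by auto
  have "sum_list (map (\<lambda>i. word_pot [i]) x) \<le> real (length x) * (- R0)"
    "sum_list (map (\<lambda>i. word_pot [i]) x') \<le> real (length x') * (- R0)"
    using m(2) ex(3,4) by (intro sum_list_letters_le; blast)+
  then have "sum_list (map (\<lambda>i. word_pot [i]) ?u) \<le> 2 * S - R - r * R0"
    using S(2)[of e] S(2)[of e'] i unfolding r_def by (simp add: algebra_simps)
  then have "word_pot ?u \<le> 2 * S - R - r * R0 + (r + 2) * D"
    using word_pot_le_sum_letters[OF ex(5)] unfolding len by simp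
  moreover have "(r + 3) * \<gamma> + \<kappa> \<le> word_pot ?u" using lower[OF ex(5)] ex(1,2) unfolding len by simp
  moreover have "r * (D - \<gamma>) \<le> r * R0" unfolding R0_def r_def by (intro mult_left_mono) auto
  ultimately show False unfolding R_def by (simp add: algebra_simps)
qed

end

section \<open>Pressure and means along a family of equilibrium states\<close>

locale equilibrium_family = cms_potential +
  fixes \<mu> :: "real \<Rightarrow> (nat \<Rightarrow> nat) measure"
  assumes equilibrium: "\<And>t. t > 1 \<Longrightarrow> equilibrium_state M f t (\<mu> t)"
begin

lemma mu_invariant: "t > 1 \<Longrightarrow> invariant_measure M f C B (\<mu> t)"
  using equilibrium unfolding equilibrium_state_def by unfold_locales blast

definition lyap :: "real \<Rightarrow> real" where "lyap t = invariant_measure.mean f (\<mu> t)"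

text \<open>The entropy solved from the equilibrium identity; it is real by construction, and
  equality with \<open>ks_entropy\<close> follows once the mean is known to be finite.\<close>

definition ent :: "real \<Rightarrow> real" where "ent t = press t - t * lyap t"

lemma mu_integrable:
  assumes "t > 1"
  shows "integrable (\<mu> t) (f 1)"
proof -
  interpret invariant_measure M f C B "\<mu> t" by (rule mu_invariant[OF assms])
  show ?thesis using integrable_of_asymptotic_mean equilibrium[OF assms] unfolding equilibrium_state_def by blast
qed

lemma mu_mean: "t > 1 \<Longrightarrow> asymptotic_mean f (\<mu> t) = ereal (lyap t)"
  unfolding lyap_def by (rule invariant_measure.asymptotic_mean_eq(1)[OF mu_invariant mu_integrable])

lemma mu_entropy:
  assumes "t > 1"
  shows "ks_entropy (\<mu> t) shift = ereal (ent t)"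
proof -
  have "gurevich_pressure M (scale_potential t f) = ks_entropy (\<mu> t) shift + ereal t * asymptotic_mean f (\<mu> t)"
    using equilibrium[OF assms] unfolding equilibrium_state_def by blast
  then have "ereal (press t) = ks_entropy (\<mu> t) shift + ereal (t * lyap t)"
    using pressure(1)[of t] mu_mean assms by simp
  then show ?thesis unfolding ent_def by (cases "ks_entropy (\<mu> t) shift") auto
qed

lemma mu_near_equilibrium:
  assumes "t > 1"
  shows "invariant_measure.near_equilibrium M f (\<mu> t) t"
proof -
  interpret invariant_measure M f C B "\<mu> t" by (rule mu_invariant[OF assms])
  show ?thesis unfolding near_equilibrium_def
  proof (intro conjI allI impI mu_integrable[OF assms])
    fix e :: real assume "e > 0"
    then have "ereal (ent t - e) < ks_entropy (\<mu> t) shift" unfolding mu_entropy[OF assms] by simp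
    then obtain \<xi> where "finite_measurable_partition (\<mu> t) \<xi>" "ent t - e < partition_ks_entropy (\<mu> t) shift \<xi>"
      unfolding ks_entropy_def less_SUP_iff by auto
    then show "\<exists>\<xi>. finite_measurable_partition (\<mu> t) \<xi> \<and> press t - e < partition_ks_entropy (\<mu> t) shift \<xi> + t * mean"
      unfolding ent_def lyap_def by (intro exI[of _ \<xi>]) auto
  qed
qed

text \<open>The equilibrium state at \<open>t\<close> is a competitor in the variational inequality
  at \<open>s\<close>.\<close>

lemma subgradient:
  assumes "t > 1" "s > 1"
  shows "press t + (s - t) * lyap t \<le> press s"
proof -
  interpret invariant_measure M f C B "\<mu> t" by (rule mu_invariant[OF assms(1)])
  have "ks_entropy (\<mu> t) shift \<le> ereal (press s - s * lyap t)"
    unfolding ks_entropy_def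
  proof (rule SUP_least)
    fix \<xi> assume "\<xi> \<in> {\<xi>. finite_measurable_partition (\<mu> t) \<xi>}"
    then interpret partitioned_measure M f C B "\<mu> t" \<xi> by unfold_locales simp
    show "ereal (partition_ks_entropy (\<mu> t) shift \<xi>) \<le> ereal (press s - s * lyap t)"
      using variational_inequality[OF mu_integrable[OF assms(1)], of s] assms unfolding lyap_def by simp
  qed
  then show ?thesis unfolding mu_entropy[OF assms(1)] ent_def by (simp add: algebra_simps)
qed

lemma lyap_mono:
  assumes "1 < s" "s < t"
  shows "lyap s \<le> lyap t"
proof -
  have "(t - s) * lyap s \<le> (t - s) * lyap t"
    using subgradient[of s t] subgradient[of t s] assms by (simp add: algebra_simps)
  then show ?thesis using assms by simp
qed

text \<open>With equal means the two subgradient inequalities become equalities. The equilibrium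
  state at \<open>s\<close> then attains the pressure at \<open>t\<close> as well, which is
  excluded.\<close>

lemma lyap_strict_mono:
  assumes "1 < s" "s < t"
  shows "lyap s < lyap t"
proof (rule ccontr)
  assume "\<not> ?thesis"
  then have eq: "lyap t = lyap s" using lyap_mono[OF assms] by simp
  have t: "t > 1" using assms by simp
  have pt: "press t = press s + (t - s) * lyap s"
    using subgradient[OF assms(1) t] subgradient[OF t assms(1)] eq by (simp add: algebra_simps)
  interpret invariant_measure M f C B "\<mu> s" by (rule mu_invariant[OF assms(1)])
  note near = mu_near_equilibrium[OF assms(1)]
  have "near_equilibrium t" unfolding near_equilibrium_def
  proof (intro conjI allI impI mu_integrable[OF assms(1)])
    fix e :: real assume "e > 0"
    then obtain \<xi> where "finite_measurable_partition (\<mu> s) \<xi>" "press s - e < partition_ks_entropy (\<mu> s) shift \<xi> + s * mean"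
      using near unfolding near_equilibrium_def by blast
    then show "\<exists>\<xi>. finite_measurable_partition (\<mu> s) \<xi> \<and> press t - e < partition_ks_entropy (\<mu> s) shift \<xi> + t * mean"
      unfolding pt lyap_def by (intro exI[of _ \<xi>]) (simp add: algebra_simps)
  qed
  then show False using no_common_equilibrium[OF _ assms(2) near] assms by simp
qed

text \<open>The mean is monotone, hence bounded near \<open>s\<close>, and the subgradient
  inequality makes the pressure Lipschitz there. This supplies the two-sided pressure bounds that
  the uniform word sum bound requires, before continuity of the mean is available.\<close>

lemma local_bounds:
  assumes s: "s > 1"
  obtains d K Pm where "d > 0" "s - d > 1" "\<And>t. \<bar>t - s\<bar> \<le> d \<Longrightarrow> word_bound t K" "\<And>t. \<bar>t - s\<bar> \<le> d \<Longrightarrow> Pm \<le> press t"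
    "(press \<longlongrightarrow> press s) (at s)"
proof -
  define d where "d = (s - 1) / 2"
  have d: "d > 0" "s - d > 1" unfolding d_def using s by (auto simp: field_simps)
  define A where "A = max \<bar>lyap (s - d)\<bar> \<bar>lyap (s + d)\<bar>"
  have A0: "A \<ge> 0" unfolding A_def by simp
  have lyap_A: "\<bar>lyap t\<bar> \<le> A" if "\<bar>t - s\<bar> \<le> d" for t
  proof -
    have "lyap (s - d) \<le> lyap t" using lyap_mono[of "s - d" t] d that by (cases "s - d = t") auto
    moreover have "lyap t \<le> lyap (s + d)" using lyap_mono[of t "s + d"] d that by (cases "t = s + d") auto
    ultimately show ?thesis unfolding A_def by (auto simp: abs_le_iff le_max_iff_disj)
  qed
  have lip: "\<bar>press t - press s\<bar> \<le> A * \<bar>t - s\<bar>" if t: "\<bar>t - s\<bar> \<le> d" for t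
  proof -
    have t1: "t > 1" using t d by linarith
    have "press s - press t \<le> (s - t) * lyap s" using subgradient[OF s t1] by (simp add: algebra_simps)
    also have "\<dots> \<le> \<bar>s - t\<bar> * \<bar>lyap s\<bar>" by (metis abs_ge_self abs_mult)
    also have "\<dots> \<le> \<bar>s - t\<bar> * A" using lyap_A[of s] d by (intro mult_left_mono) auto
    finally have 1: "press s - press t \<le> A * \<bar>t - s\<bar>" by (simp add: abs_minus_commute mult.commute)
    have "press t - press s \<le> (t - s) * lyap t" using subgradient[OF t1 s] by (simp add: algebra_simps)
    also have "\<dots> \<le> \<bar>t - s\<bar> * \<bar>lyap t\<bar>" by (metis abs_ge_self abs_mult)
    also have "\<dots> \<le> \<bar>t - s\<bar> * A" using lyap_A[OF t] by (intro mult_left_mono) auto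
    finally show ?thesis using 1 by (simp add: abs_le_iff mult.commute)
  qed
  have range: "press s - A * d \<le> press t \<and> press t \<le> press s + A * d" if t: "\<bar>t - s\<bar> \<le> d" for t
  proof -
    have "A * \<bar>t - s\<bar> \<le> A * d" using t A0 by (intro mult_left_mono) auto
    then show ?thesis using lip[OF t] by (auto simp: abs_le_iff)
  qed
  have sd: "s + d \<ge> 1" using s d by simp
  obtain K where K: "K \<ge> 1" "\<And>t n N. 1 \<le> t \<Longrightarrow> t \<le> s + d \<Longrightarrow> press s - A * d \<le> press t \<Longrightarrow> press t \<le> press s + A * d \<Longrightarrow>
     (\<Sum>w\<in>bounded_words n N. nw t w) \<le> K"
    by (fact word_sum_bound[OF sd])
  have "word_bound t K" if t: "\<bar>t - s\<bar> \<le> d" for t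
  proof -
    have "1 \<le> t" "t \<le> s + d" using t d by linarith+
    then show ?thesis unfolding word_bound_def using K range[OF t] by blast
  qed
  moreover have "press s - A * d \<le> press t" if "\<bar>t - s\<bar> \<le> d" for t using range[OF that] by blast
  moreover have "(press \<longlongrightarrow> press s) (at s)"
  proof (rule Lim_null[THEN iffD2], rule Lim_null_comparison)
    show "\<forall>\<^sub>F t in at s. norm (press t - press s) \<le> A * \<bar>t - s\<bar>"
      unfolding eventually_at using d lip by (intro exI[of _ d]) (auto simp: dist_real_def)
    have "((\<lambda>t. A * \<bar>t - s\<bar>) \<longlongrightarrow> A * \<bar>s - s\<bar>) (at s)" by (intro tendsto_intros)
    then show "((\<lambda>t. A * \<bar>t - s\<bar>) \<longlongrightarrow> 0) (at s)" by simp
  qed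
  ultimately show ?thesis using that d by blast
qed

end

section \<open>Integrals of functions of the first letter\<close>

context invariant_measure
begin

lemma letter_nn_integral:
  "(\<integral>\<^sup>+x. q (x 0) \<partial>\<nu>) = (\<Sum>i. q i * emeasure \<nu> (cylinder M [i]))"
proof -
  have "(\<integral>\<^sup>+x. q (x 0) \<partial>\<nu>) = (\<integral>\<^sup>+x. (\<Sum>i. q i * indicator (cylinder M [i]) x) \<partial>\<nu>)"
  proof (rule nn_integral_cong)
    fix x assume "x \<in> space \<nu>"
    then have "(\<Sum>i. q i * indicator (cylinder M [i]) x) = (\<Sum>i\<in>{x 0}. q i * indicator (cylinder M [i]) x)"
      by (intro suminf_finite) (auto simp: cylinder_def indicator_def)
    then show "q (x 0) = (\<Sum>i. q i * indicator (cylinder M [i]) x)"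
      using \<open>x \<in> space \<nu>\<close> by (simp add: cylinder_def indicator_def)
  qed
  also have "\<dots> = (\<Sum>i. q i * emeasure \<nu> (cylinder M [i]))"
    using cylinder_sets_nu by (subst nn_integral_suminf) (auto simp: nn_integral_cmult_indicator)
  finally show ?thesis .
qed

text \<open>The upper Gibbs bound gives the cylinder of \<open>i\<close> a mass of order
  \<open>exp (t * word_pot [i])\<close>. One factor \<open>exp (word_pot [i])\<close> keeps the
  series summable, and the remaining \<open>exp ((t - 1) * word_pot [i])\<close> compensates the
  growth of \<open>q\<close>.\<close>

lemma letter_integral_bound:
  assumes eq: "near_equilibrium t" and t: "t \<ge> 1" and K: "word_bound t K" and P: "Pm \<le> press t"
    and q: "\<And>i. q i \<ge> 0" and \<eta>: "\<And>i. q i * exp ((t - 1) * word_pot [i]) \<le> \<eta>"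
  shows "(\<integral>\<^sup>+x. ennreal (q (x 0)) \<partial>\<nu>)
    \<le> ennreal (2 * exp (2 * (t * D)) * K * exp (- Pm) * \<eta> * (\<Sum>i. exp (word_pot [i])))"
proof -
  define A where "A = 2 * exp (2 * (t * D)) * K * exp (- Pm)"
  have K1: "K \<ge> 1" using K unfolding word_bound_def by simp
  have A: "A \<ge> 0" unfolding A_def using K1 by simp
  have \<eta>0: "\<eta> \<ge> 0" using \<eta>[of 0] q[of 0] by (meson exp_ge_zero mult_nonneg_nonneg order_trans)
  have le: "q i * measure \<nu> (cylinder M [i]) \<le> A * \<eta> * exp (word_pot [i])" for i
  proof -
    have "measure \<nu> (cylinder M [i]) \<le> 2 * exp (2 * (t * D)) * K * nw t [i]" by (rule gibbs_upper[OF eq t K]) simp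
    also have "nw t [i] \<le> exp (- Pm) * (exp ((t - 1) * word_pot [i]) * exp (word_pot [i]))"
    proof -
      have "t * word_pot [i] - press t \<le> - Pm + ((t - 1) * word_pot [i] + word_pot [i])" using P by (simp add: algebra_simps)
      then show ?thesis by (simp add: nw_eq mult_exp_exp)
    qed
    finally have "measure \<nu> (cylinder M [i]) \<le> A * (exp ((t - 1) * word_pot [i]) * exp (word_pot [i]))"
      unfolding A_def using K1 by (simp add: mult_left_mono mult.assoc)
    then have "q i * measure \<nu> (cylinder M [i]) \<le> q i * (A * (exp ((t - 1) * word_pot [i]) * exp (word_pot [i])))"
      using q by (rule mult_left_mono)
    also have "\<dots> = (A * exp (word_pot [i])) * (q i * exp ((t - 1) * word_pot [i]))" by (simp only: mult_ac)
    also have "\<dots> \<le> (A * exp (word_pot [i])) * \<eta>" using \<eta>[of i] A by (intro mult_left_mono) auto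
    finally show ?thesis by (simp only: mult_ac)
  qed
  have "(\<integral>\<^sup>+x. ennreal (q (x 0)) \<partial>\<nu>) = (\<Sum>i. ennreal (q i) * emeasure \<nu> (cylinder M [i]))"
    by (rule letter_nn_integral)
  also have "\<dots> \<le> (\<Sum>i. ennreal (A * \<eta> * exp (word_pot [i])))"
  proof (intro suminf_le)
    fix i
    show "ennreal (q i) * emeasure \<nu> (cylinder M [i]) \<le> ennreal (A * \<eta> * exp (word_pot [i]))"
      using le[of i] q by (simp add: emeasure_eq_measure ennreal_mult[symmetric] ennreal_leI)
  qed auto
  also have "\<dots> = ennreal (\<Sum>i. A * \<eta> * exp (word_pot [i]))"
    using A \<eta>0 summable_mult[OF summable_letters, of "A * \<eta>"] by (intro suminf_ennreal2) auto
  also have "(\<Sum>i. A * \<eta> * exp (word_pot [i])) = A * \<eta> * (\<Sum>i. exp (word_pot [i]))"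
    by (rule suminf_mult[OF summable_letters])
  finally show ?thesis unfolding A_def .
qed

end

section \<open>Continuity in the temperature\<close>

lemma exp_decay_small:
  assumes "(0::real) < a" "e > 0" "A \<ge> 0"
  obtains R where "R \<ge> 0" "A * exp (- (a * R)) < e"
proof -
  define R where "R = A / e / a"
  have "1 + A / e \<le> exp (a * R)" using exp_ge_add_one_self[of "A / e"] assms unfolding R_def by simp
  then have "e + A \<le> e * exp (a * R)" using assms by (simp add: field_simps)
  then have "A * exp (- (a * R)) < e" using assms by (simp add: exp_minus field_simps)
  moreover have "R \<ge> 0" unfolding R_def using assms by simp
  ultimately show ?thesis using that by blast
qed

section \<open>Truncation of the potential from below\<close>

context cms_potential
begin

lemma potential_lower_bound:
  assumes "n \<ge> 1" "x \<in> X"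
  shows "(\<Sum>i<n. word_pot [x i] - (B + C)) \<le> f n x"
  using assms(1)
proof (induction n rule: nat_induct_at_least)
  case base
  have "\<bar>f 1 x - word_pot [x 0]\<bar> \<le> B"
    using word_pot_prefix[of 1 x] assms(2) by (simp add: prefix_word_1)
  then show ?case using C_nonneg by (simp add: abs_le_iff)
next
  case (Suc n)
  have y: "(shift ^^ n) x \<in> X" by (rule shift_closed[OF assms(2)])
  have "\<bar>f 1 ((shift ^^ n) x) - word_pot [x n]\<bar> \<le> B"
    using word_pot_prefix[of 1 "(shift ^^ n) x"] y by (simp add: prefix_word_1 shift_funpow)
  moreover have "\<bar>f (n + 1) x - (f n x + f 1 ((shift ^^ n) x))\<bar> \<le> C"
    using Suc assms(2) by (intro almost_add) auto
  ultimately show ?case using Suc by (simp add: abs_le_iff)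
qed

text \<open>Splitting \<open>f n\<close> into letters costs at most \<open>B + C\<close> for each
  letter. If \<open>f n\<close> falls below the truncation level, the deficit is therefore covered
  by the letters with potential below \<open>- R\<close>.\<close>

lemma truncation_error_le:
  assumes "n \<ge> 1" "x \<in> X"
  shows "max (f n x) (- (real n * (R + B + C))) - f n x \<le> (\<Sum>i<n. max 0 (- R - word_pot [x i]))"
proof -
  have "- (real n * (R + B + C)) - f n x \<le> (\<Sum>i<n. - R - word_pot [x i])"
    using potential_lower_bound[OF assms] by (simp add: sum_subtractf algebra_simps)
  also have "\<dots> \<le> (\<Sum>i<n. max 0 (- R - word_pot [x i]))" by (intro sum_mono) auto
  finally have "- (real n * (R + B + C)) - f n x \<le> (\<Sum>i<n. max 0 (- R - word_pot [x i]))" .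
  moreover have "0 \<le> (\<Sum>i<n. max 0 (- R - word_pot [x i]))" by (intro sum_nonneg) auto
  ultimately show ?thesis by (simp add: max_def)
qed

end

context invariant_measure
begin

lemma sum_cylinders:
  assumes W: "finite W" "\<And>u. u \<in> W \<Longrightarrow> length u = n"
  shows "(\<Sum>u\<in>W. h u * measure \<nu> (cylinder M u)) = (\<integral>x. (if prefix_word n x \<in> W then h (prefix_word n x) else 0) \<partial>\<nu>)"
proof -
  have int: "integrable \<nu> (\<lambda>x. h u * indicator (cylinder M u) x)" for u
    using cylinder_sets_nu sets.Int_space_eq2[OF cylinder_sets_nu] by (simp add: integrable_indicator_iff less_top[symmetric])
  have "(\<integral>x. (if prefix_word n x \<in> W then h (prefix_word n x) else 0) \<partial>\<nu>)
      = (\<integral>x. (\<Sum>u\<in>W. h u * indicator (cylinder M u) x) \<partial>\<nu>)"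
  proof (rule Bochner_Integration.integral_cong[OF refl])
    fix x assume "x \<in> space \<nu>"
    then have x: "x \<in> X" by simp
    have "(\<Sum>u\<in>W. h u * indicator (cylinder M u) x) = (\<Sum>u\<in>W. if u = prefix_word n x then h u else 0)"
      using x W(2) by (intro sum.cong refl) (auto simp: cylinder_iff indicator_def)
    then show "(if prefix_word n x \<in> W then h (prefix_word n x) else 0) = (\<Sum>u\<in>W. h u * indicator (cylinder M u) x)"
      using W(1) by (simp add: sum.delta')
  qed
  also have "\<dots> = (\<Sum>u\<in>W. \<integral>x. h u * indicator (cylinder M u) x \<partial>\<nu>)"
    using int by (intro Bochner_Integration.integral_sum)
  also have "\<dots> = (\<Sum>u\<in>W. h u * measure \<nu> (cylinder M u))"
    using sets.Int_space_eq2[OF cylinder_sets_nu] by (intro sum.cong refl) simp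
  finally show ?thesis by simp
qed

lemma nn_integral_letter_shift:
  "(\<integral>\<^sup>+x. q (x i) \<partial>\<nu>) = (\<integral>\<^sup>+x. q (x 0) \<partial>\<nu>)"
proof -
  have m: "(\<lambda>x. q (x 0)) \<in> borel_measurable \<nu>"
  proof -
    have "(\<lambda>x. q (hd (prefix_word 1 x))) \<in> borel_measurable \<nu>"
      by (rule measurable_compose[OF prefix_word_measurable_nu]) simp
    then show ?thesis by (simp add: prefix_word_1)
  qed
  have "(\<integral>\<^sup>+x. q (x 0) \<partial>distr \<nu> \<nu> (shift ^^ i)) = (\<integral>\<^sup>+x. q ((shift ^^ i) x 0) \<partial>\<nu>)"
    by (rule nn_integral_distr[OF funpow_shift_measurable_nu]) (use m in simp)
  then show ?thesis by (simp add: distr_funpow_shift shift_funpow)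
qed

text \<open>By invariance the expected deficit is the same at each of the \<open>n\<close>
  positions.\<close>

lemma truncation_integral_le:
  assumes int: "integrable \<nu> (f 1)" and n: "n \<ge> 1"
    and bound: "(\<integral>\<^sup>+x. ennreal (max 0 (- R - word_pot [x 0])) \<partial>\<nu>) \<le> ennreal e" and e: "e \<ge> 0"
  shows "\<bar>(\<integral>x. max (f n x) (- (real n * (R + B + C))) \<partial>\<nu>) - (\<integral>x. f n x \<partial>\<nu>)\<bar> \<le> real n * e"
proof -
  let ?T = "\<lambda>x. max (f n x) (- (real n * (R + B + C)))"
  note intf = integrable_potential[OF int n]
  have intT: "integrable \<nu> ?T" using intf by simp
  have "ennreal (\<integral>x. ?T x - f n x \<partial>\<nu>) = (\<integral>\<^sup>+x. ennreal (?T x - f n x) \<partial>\<nu>)"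
    using intf intT by (intro nn_integral_eq_integral[symmetric]) auto
  also have "\<dots> \<le> (\<integral>\<^sup>+x. (\<Sum>i<n. ennreal (max 0 (- R - word_pot [x i]))) \<partial>\<nu>)"
  proof (rule nn_integral_mono)
    fix x assume "x \<in> space \<nu>"
    then have "?T x - f n x \<le> (\<Sum>i<n. max 0 (- R - word_pot [x i]))" using truncation_error_le[OF n] by simp
    from ennreal_leI[OF this] show "ennreal (?T x - f n x) \<le> (\<Sum>i<n. ennreal (max 0 (- R - word_pot [x i])))"
      by (subst sum_ennreal) auto
  qed
  also have "\<dots> = (\<Sum>i<n. \<integral>\<^sup>+x. ennreal (max 0 (- R - word_pot [x i])) \<partial>\<nu>)"
  proof (rule nn_integral_sum)
    fix i
    have "(\<lambda>x. ennreal (max 0 (- R - word_pot [prefix_word (Suc i) x ! i]))) \<in> borel_measurable \<nu>"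
      by (rule measurable_compose[OF prefix_word_measurable_nu]) simp
    then show "(\<lambda>x. ennreal (max 0 (- R - word_pot [x i]))) \<in> borel_measurable \<nu>" by simp
  qed
  also have "\<dots> \<le> (\<Sum>i<n. ennreal e)"
  proof (rule sum_mono)
    fix i
    show "(\<integral>\<^sup>+x. ennreal (max 0 (- R - word_pot [x i])) \<partial>\<nu>) \<le> ennreal e"
      using bound unfolding nn_integral_letter_shift[of "\<lambda>j. ennreal (max 0 (- R - word_pot [j]))" i] .
  qed
  also have "\<dots> = ennreal (real n * e)" using e by (simp add: ennreal_mult ennreal_of_nat_eq_real_of_nat)
  finally have "(\<integral>x. ?T x - f n x \<partial>\<nu>) \<le> real n * e" using e by (simp add: ennreal_le_iff)
  moreover have "0 \<le> (\<integral>x. ?T x - f n x \<partial>\<nu>)" by (intro integral_nonneg_AE) auto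
  ultimately show ?thesis using intf intT by simp
qed

end

section \<open>Bounds uniform in the temperature and convergence\<close>

context equilibrium_family
begin

text \<open>The two uses of the upper Gibbs bound, in a form that can hold with the same constants
  for all \<open>t\<close> near \<open>s\<close>. The test functions vanish at letters of positive
  potential, so that the exponent \<open>t - 1\<close> can be lowered to a common
  \<open>a\<close>.\<close>

definition gibbs_dominated :: "real \<Rightarrow> real \<Rightarrow> real \<Rightarrow> real \<Rightarrow> bool" where
  "gibbs_dominated k A a t \<longleftrightarrow> (\<forall>u. u \<noteq> [] \<longrightarrow> measure (\<mu> t) (cylinder M u) \<le> k * nw t u) \<and>
      (\<forall>q \<eta>. (\<forall>i. 0 \<le> q i) \<longrightarrow> (\<forall>i. word_pot [i] > 0 \<longrightarrow> q i = 0) \<longrightarrow> (\<forall>i. q i * exp (a * word_pot [i]) \<le> \<eta>) \<longrightarrow>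
        (\<integral>\<^sup>+x. ennreal (q (x 0)) \<partial>\<mu> t) \<le> ennreal (A * \<eta>))"

text \<open>With \<open>t0 = s - d\<close>, each \<open>t\<close> within \<open>d\<close> of
  \<open>s\<close> satisfies \<open>(t - 1) * word_pot [i] \<le> (t0 - 1) * word_pot [i]\<close> at
  letters of nonpositive potential. The filter \<open>nhds s\<close> includes \<open>s\<close>
  itself, so the bounds also hold for the limit measure.\<close>

lemma uniform_bounds:
  assumes s: "s > 1"
  obtains A k t0 where "A \<ge> 0" "k > 0" "t0 > 1"
    "\<forall>\<^sub>F t in nhds s. t > 1 \<and> gibbs_dominated k A (t0 - 1) t"
proof -
  obtain d K Pm where d: "d > 0" "s - d > 1" and K: "\<And>t. \<bar>t - s\<bar> \<le> d \<Longrightarrow> word_bound t K"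
    and Pm: "\<And>t. \<bar>t - s\<bar> \<le> d \<Longrightarrow> Pm \<le> press t" and "(press \<longlongrightarrow> press s) (at s)"
    by (fact local_bounds[OF s])
  have K1: "K \<ge> 1" using K[of s] d unfolding word_bound_def by simp
  define k where "k = 2 * exp (2 * ((s + d) * D)) * K"
  define T where "T = (\<Sum>i. exp (word_pot [i]))"
  have T: "T \<ge> 0" unfolding T_def by (intro suminf_nonneg summable_letters) auto
  define A where "A = k * exp (- Pm) * T"
  have k: "k > 0" unfolding k_def using K1 by simp
  have A: "A \<ge> 0" unfolding A_def using k T by simp
  have main: "t > 1 \<and> gibbs_dominated k A (s - d - 1) t" if t: "\<bar>t - s\<bar> \<le> d" for t
    unfolding gibbs_dominated_def
  proof (intro conjI allI impI)
    show t1: "t > 1" using t d by linarith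
    interpret invariant_measure M f C B "\<mu> t" by (rule mu_invariant[OF t1])
    note near = mu_near_equilibrium[OF t1]
    have "t * D \<le> (s + d) * D" using t D_nonneg by (intro mult_right_mono) auto
    then have kt: "2 * exp (2 * (t * D)) * K \<le> k" unfolding k_def using K1 by (intro mult_right_mono mult_left_mono) auto
    show "measure (\<mu> t) (cylinder M u) \<le> k * nw t u" if "u \<noteq> []" for u
      using gibbs_upper[OF near _ K[OF t] that] t1 mult_right_mono[OF kt nw_nonneg[of t u]] by simp
    fix q :: "nat \<Rightarrow> real" and \<eta>
    assume q0: "\<forall>i. 0 \<le> q i" and qp: "\<forall>i. word_pot [i] > 0 \<longrightarrow> q i = 0"
      and qe: "\<forall>i. q i * exp ((s - d - 1) * word_pot [i]) \<le> \<eta>"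
    have \<eta>: "\<eta> \<ge> 0" using qe[rule_format, of 0] q0[rule_format, of 0] by (meson exp_ge_zero mult_nonneg_nonneg order_trans)
    have "q i * exp ((t - 1) * word_pot [i]) \<le> \<eta>" for i
    proof (cases "word_pot [i] > 0")
      case False
      have "0 \<le> (t - (s - d)) * (- word_pot [i])" using False t by (intro mult_nonneg_nonneg) auto
      then have "(t - 1) * word_pot [i] \<le> (s - d - 1) * word_pot [i]" by (simp add: algebra_simps)
      then have "q i * exp ((t - 1) * word_pot [i]) \<le> q i * exp ((s - d - 1) * word_pot [i])"
        using q0 by (intro mult_left_mono) auto
      then show ?thesis using qe by (meson order_trans)
    qed (use qp \<eta> in simp)
    then have "(\<integral>\<^sup>+x. ennreal (q (x 0)) \<partial>\<mu> t) \<le> ennreal (2 * exp (2 * (t * D)) * K * exp (- Pm) * \<eta> * (\<Sum>i. exp (word_pot [i])))"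
      using t1 q0 by (intro letter_integral_bound[OF near _ K[OF t] Pm[OF t]]) auto
    also have "\<dots> \<le> ennreal (A * \<eta>)"
    proof (rule ennreal_leI)
      have "2 * exp (2 * (t * D)) * K * (exp (- Pm) * \<eta> * T) \<le> k * (exp (- Pm) * \<eta> * T)"
        using kt \<eta> T by (intro mult_right_mono) auto
      then show "2 * exp (2 * (t * D)) * K * exp (- Pm) * \<eta> * (\<Sum>i. exp (word_pot [i])) \<le> A * \<eta>"
        unfolding A_def T_def[symmetric] by (simp only: mult_ac)
    qed
    finally show "(\<integral>\<^sup>+x. ennreal (q (x 0)) \<partial>\<mu> t) \<le> ennreal (A * \<eta>)" .
  qed
  show ?thesis
  proof (rule that[OF A k d(2)])
    show "\<forall>\<^sub>F t in nhds s. t > 1 \<and> gibbs_dominated k A (s - d - 1) t"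
      unfolding eventually_nhds_metric using main d(1)
      by (intro exI[of _ d] conjI allI impI main) (auto simp: dist_real_def)
  qed
qed

text \<open>Tightness near \<open>s\<close>: the test function is the indicator of the letters from
  \<open>m\<close> on, where \<open>exp ((t0 - 1) * word_pot [i])\<close> is small.\<close>

lemma uniform_letter_tail:
  assumes s: "s > 1" and e: "e > 0"
  shows "\<exists>m\<ge>m0. \<forall>\<^sub>F t in nhds s. measure (\<mu> t) {x \<in> X. m \<le> x 0} < e"
proof -
  obtain A k t0 where A: "A \<ge> 0" "k > 0" "t0 > 1" and ev: "\<forall>\<^sub>F t in nhds s. t > 1 \<and> gibbs_dominated k A (t0 - 1) t" by (fact uniform_bounds[OF s])
  have t00: "t0 - 1 > 0" using A by simp
  obtain R where R: "R \<ge> 0" "A * exp (- ((t0 - 1) * R)) < e" by (fact exp_decay_small[OF t00 e A(1)])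
  obtain N where N: "\<And>i. i \<ge> N \<Longrightarrow> word_pot [i] \<le> - R" by (fact letter_pot_neg)
  define m where "m = max N m0"
  define q where "q i = (if m \<le> i then 1 else 0 :: real)" for i
  have q: "\<forall>i. 0 \<le> q i" "\<forall>i. word_pot [i] > 0 \<longrightarrow> q i = 0" "\<forall>i. q i * exp ((t0 - 1) * word_pot [i]) \<le> exp (- ((t0 - 1) * R))"
  proof -
    show "\<forall>i. 0 \<le> q i" unfolding q_def by simp
    show "\<forall>i. word_pot [i] > 0 \<longrightarrow> q i = 0"
    proof (intro allI impI)
      fix i assume "word_pot [i] > 0"
      then have "\<not> m \<le> i" using N[of i] R(1) unfolding m_def by force
      then show "q i = 0" unfolding q_def by simp
    qed
    show "\<forall>i. q i * exp ((t0 - 1) * word_pot [i]) \<le> exp (- ((t0 - 1) * R))"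
    proof
      fix i
      show "q i * exp ((t0 - 1) * word_pot [i]) \<le> exp (- ((t0 - 1) * R))"
      proof (cases "m \<le> i")
        case True
        then have "word_pot [i] \<le> - R" using N unfolding m_def by simp
        then have "(t0 - 1) * word_pot [i] \<le> (t0 - 1) * (- R)" using t00 by (intro mult_left_mono) auto
        then show ?thesis using True unfolding q_def by simp
      qed (simp add: q_def)
    qed
  qed
  have "\<forall>\<^sub>F t in nhds s. measure (\<mu> t) {x \<in> X. m \<le> x 0} < e"
    using ev
  proof eventually_elim
    case (elim t)
    then interpret invariant_measure M f C B "\<mu> t" using mu_invariant by blast
    have S: "{x \<in> X. m \<le> x 0} \<in> sets (\<mu> t)" by (rule determined_sets_nu[OF letter_set_determined])
    have "ennreal (measure (\<mu> t) {x \<in> X. m \<le> x 0}) = (\<integral>\<^sup>+x. indicator {x \<in> X. m \<le> x 0} x \<partial>\<mu> t)"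
      using S by (simp add: emeasure_eq_measure)
    also have "\<dots> = (\<integral>\<^sup>+x. ennreal (q (x 0)) \<partial>\<mu> t)"
      by (intro nn_integral_cong) (auto simp: q_def indicator_def)
    also have "\<dots> \<le> ennreal (A * exp (- ((t0 - 1) * R)))" using elim q unfolding gibbs_dominated_def by blast
    finally have "measure (\<mu> t) {x \<in> X. m \<le> x 0} \<le> A * exp (- ((t0 - 1) * R))" using A(1) by simp
    then show ?case using R(2) by simp
  qed
  moreover have "m \<ge> m0" unfolding m_def by simp
  ultimately show ?thesis by blast
qed

text \<open>For the excess \<open>y = - R - word_pot [i]\<close> the elementary bound
  \<open>y * exp (- (a * y)) \<le> 1 / a\<close> leaves the factor \<open>exp (- (a * R))\<close>,
  which is small for large \<open>R\<close>.\<close>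

lemma uniform_integrability:
  assumes s: "s > 1" and e: "e > 0"
  shows "\<exists>R. \<forall>\<^sub>F t in nhds s. (\<integral>\<^sup>+x. ennreal (max 0 (- R - word_pot [x 0])) \<partial>\<mu> t) \<le> ennreal e"
proof -
  obtain A k t0 where A: "A \<ge> 0" "k > 0" "t0 > 1" and ev: "\<forall>\<^sub>F t in nhds s. t > 1 \<and> gibbs_dominated k A (t0 - 1) t" by (fact uniform_bounds[OF s])
  define a where "a = t0 - 1"
  have a: "a > 0" unfolding a_def using A by simp
  have "A / a \<ge> 0" using A(1) a by simp
  then obtain R where R: "R \<ge> 0" "A / a * exp (- (a * R)) < e" by (rule exp_decay_small[OF a e])
  define q where "q i = max 0 (- R - word_pot [i])" for i
  have q: "\<forall>i. 0 \<le> q i" "\<forall>i. word_pot [i] > 0 \<longrightarrow> q i = 0" "\<forall>i. q i * exp ((t0 - 1) * word_pot [i]) \<le> exp (- (a * R)) / a"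
  proof -
    show "\<forall>i. 0 \<le> q i" unfolding q_def by simp
    show "\<forall>i. word_pot [i] > 0 \<longrightarrow> q i = 0" unfolding q_def using R(1) by auto
    show "\<forall>i. q i * exp ((t0 - 1) * word_pot [i]) \<le> exp (- (a * R)) / a"
    proof
      fix i
      show "q i * exp ((t0 - 1) * word_pot [i]) \<le> exp (- (a * R)) / a"
      proof (cases "- R - word_pot [i] > 0")
        case True
        define y where "y = - R - word_pot [i]"
        have y: "y > 0" "q i = y" "word_pot [i] = - y - R" unfolding y_def q_def using True by auto
        have "1 + a * y \<le> exp (a * y)" by (rule exp_ge_add_one_self)
        then have "a * y \<le> exp (a * y)" by linarith
        then have "a * y * exp (- (a * y)) \<le> 1" by (simp add: exp_minus field_simps)
        then have "y * exp (- (a * y)) \<le> 1 / a" using a by (simp add: field_simps)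
        then have "y * exp (- (a * y)) * exp (- (a * R)) \<le> 1 / a * exp (- (a * R))" by (rule mult_right_mono) simp
        moreover have "exp ((t0 - 1) * word_pot [i]) = exp (- (a * y)) * exp (- (a * R))"
          unfolding y(3) a_def by (simp add: mult_exp_exp algebra_simps)
        ultimately show ?thesis unfolding y(2) by (simp add: mult.assoc)
      qed (use a in \<open>simp add: q_def\<close>)
    qed
  qed
  have "\<forall>\<^sub>F t in nhds s. (\<integral>\<^sup>+x. ennreal (max 0 (- R - word_pot [x 0])) \<partial>\<mu> t) \<le> ennreal e"
    using ev
  proof eventually_elim
    case (elim t)
    then have "(\<integral>\<^sup>+x. ennreal (q (x 0)) \<partial>\<mu> t) \<le> ennreal (A * (exp (- (a * R)) / a))" using q unfolding gibbs_dominated_def by blast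
    also have "\<dots> \<le> ennreal e" using R(2) by (intro ennreal_leI) (simp add: field_simps)
    finally show ?case unfolding q_def .
  qed
  then show ?thesis by blast
qed

lemma nw_tendsto:
  assumes s: "s > 1"
  shows "((\<lambda>t. nw t u) \<longlongrightarrow> nw s u) (at s)"
proof (cases "adm u \<and> u \<noteq> []")
  case True
  obtain d K Pm where "d > 0" "s - d > 1" "\<And>t. \<bar>t - s\<bar> \<le> d \<Longrightarrow> word_bound t K"
    "\<And>t. \<bar>t - s\<bar> \<le> d \<Longrightarrow> Pm \<le> press t" and p: "(press \<longlongrightarrow> press s) (at s)"
    by (fact local_bounds[OF s])
  have "((\<lambda>t. exp (t * word_pot u - real (length u) * press t)) \<longlongrightarrow> exp (s * word_pot u - real (length u) * press s)) (at s)"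
    by (intro tendsto_intros p)
  then show ?thesis using True by (simp add: nw_eq)
next
  case False
  then show ?thesis by (cases "adm u") (auto simp: nw_not_adm)
qed

lemma eventually_at_nhds: "\<forall>\<^sub>F t in nhds s. P t \<Longrightarrow> \<forall>\<^sub>F t in at s. P t" for s :: real
  by (simp add: eventually_at_filter eventually_mono)

lemma eventually_at_gt: "c < s \<Longrightarrow> \<forall>\<^sub>F t in at s. c < t" for c s :: real
  by (rule order_tendstoD(1)[OF tendsto_ident_at])

text \<open>The Birkhoff averages of a cylinder are nearly constant under \<open>\<mu> s\<close>; the upper Gibbs bound
  at \<open>t\<close> and the lower one at \<open>s\<close> transport this to \<open>\<mu> t\<close> for \<open>t\<close> near \<open>s\<close>.\<close>

lemma cylinder_tendsto:
  assumes s: "s > 1"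
  shows "((\<lambda>t. measure (\<mu> t) (cylinder M w)) \<longlongrightarrow> measure (\<mu> s) (cylinder M w)) (at s)"
proof (rule tendstoI)
  fix e :: real assume e: "e > 0"
  interpret S: invariant_measure M f C B "\<mu> s" by (rule mu_invariant[OF s])
  note near = mu_near_equilibrium[OF s]
  have s1: "s \<ge> 1" using s by simp
  obtain A k t0 where k: "A \<ge> 0" "k > 0" "t0 > 1" and ev: "\<forall>\<^sub>F t in nhds s. t > 1 \<and> gibbs_dominated k A (t0 - 1) t" by (fact uniform_bounds[OF s])
  obtain m1 where m1: "\<forall>\<^sub>F t in nhds s. measure (\<mu> t) {x \<in> X. m1 \<le> x 0} < e / 8"
    using uniform_letter_tail[OF s, of "e / 8" 0] e by auto
  have "finite {..<m1}" by simp
  from S.gibbs_lower[OF near s1 this] obtain c where c: "c > 0"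
    "\<And>u. u \<noteq> [] \<Longrightarrow> hd u < m1 \<Longrightarrow> last u < m1 \<Longrightarrow> c * nw s u \<le> measure (\<mu> s) (cylinder M u)" by auto
  define p where "p = measure (\<mu> s) (cylinder M w)"
  define g where "g = (indicator (cylinder M w) :: (nat \<Rightarrow> nat) \<Rightarrow> real)"
  \<comment> \<open>The Birkhoff averages of \<open>g\<close> have integral
    \<open>measure (\<mu> t) (cylinder M w)\<close> under \<open>\<mu> t\<close>, so the integral of
    \<open>G n\<close> bounds the distance of this mass from \<open>p\<close>.\<close>
  define G where "G n x = \<bar>S.birkhoff_sum g n x / real n - p\<bar>" for n x
  have gm: "g \<in> borel_measurable (\<mu> t)" if "t > 1" for t
    unfolding g_def using invariant_measure.cylinder_sets_nu[OF mu_invariant[OF that]] by (intro borel_measurable_indicator)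
  have gp: "(\<integral>x. g x \<partial>\<mu> s) = p" unfolding g_def p_def using sets.Int_space_eq2[OF S.cylinder_sets_nu[of w]] by simp
  have "(\<lambda>n. \<integral>x. \<bar>S.birkhoff_sum g n x / real n - (\<integral>x. g x \<partial>\<mu> s)\<bar> \<partial>\<mu> s) \<longlonglongrightarrow> 0"
    by (rule S.birkhoff_L1[where R = 1]) (use S.near_equilibrium_ergodic[OF near s1] gm[OF s] in \<open>auto simp: g_def indicator_def\<close>)
  then have "(\<lambda>n. \<integral>x. G n x \<partial>\<mu> s) \<longlonglongrightarrow> 0" unfolding gp G_def .
  \<comment> \<open>The passage from \<open>\<mu> s\<close> to \<open>\<mu> t\<close> multiplies by
    \<open>2 * k / c\<close>, so that \<open>e / 4\<close> remains.\<close>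
  moreover have "0 < e * c / (8 * k)" using e c k by simp
  ultimately have "\<forall>\<^sub>F n in sequentially. (\<integral>x. G n x \<partial>\<mu> s) < e * c / (8 * k)" by (rule order_tendstoD(2))
  then obtain n0 where "\<And>n. n \<ge> n0 \<Longrightarrow> (\<integral>x. G n x \<partial>\<mu> s) < e * c / (8 * k)" by (auto simp: eventually_sequentially)
  then obtain n where n: "n \<ge> 1" "(\<integral>x. G n x \<partial>\<mu> s) < e * c / (8 * k)" by (meson max.cobounded1 max.cobounded2)
  define N where "N = n + length w"
  have N: "N \<ge> 1" unfolding N_def using n by simp
  have eN: "e / (8 * real N) > 0" using e N by simp
  \<comment> \<open>Two cutoffs break a circle. The constant \<open>c\<close> depends on the cutoff
    \<open>m1\<close> for the end letters, and the length \<open>N\<close> depends on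
    \<open>c\<close>. The cutoff \<open>m2\<close> for all \<open>N\<close> letters comes
    afterwards; it serves only to make the set of words finite.\<close>
  obtain m2 where m2: "m2 \<ge> m1" "\<forall>\<^sub>F t in nhds s. measure (\<mu> t) {x \<in> X. m2 \<le> x 0} < e / (8 * real N)"
    using uniform_letter_tail[OF s eN, of m1] by auto
  have p01: "0 \<le> p" "p \<le> 1" unfolding p_def by auto
  have avg01: "0 \<le> S.birkhoff_sum g n x / real n" "S.birkhoff_sum g n x / real n \<le> 1" for x
  proof -
    have "S.birkhoff_sum g n x \<le> (\<Sum>i<n. 1)" unfolding S.birkhoff_sum_def g_def by (intro sum_mono) (auto simp: indicator_def)
    then show "S.birkhoff_sum g n x / real n \<le> 1" using n by simp
    show "0 \<le> S.birkhoff_sum g n x / real n"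
      unfolding S.birkhoff_sum_def g_def by (intro divide_nonneg_nonneg sum_nonneg) auto
  qed
  have G01: "0 \<le> G n x" "G n x \<le> 1" for x
    using avg01[of x] p01 unfolding G_def by (auto simp: abs_le_iff)
  define h where "h u = G n (rep u)" for u
  have Gh: "G n x = h (prefix_word N x)" if x: "x \<in> X" for x
  proof -
    let ?y = "rep (prefix_word N x)"
    have y: "?y \<in> X" "prefix_word N ?y = prefix_word N x" using rep[OF adm_prefix_word[OF x, of N]] by auto
    have "g ((shift ^^ i) x) = g ((shift ^^ i) ?y)" if i: "i < n" for i
    proof -
      have "prefix_word (length w) ((shift ^^ i) z) = take (length w) (drop i (prefix_word N z))" for z
        using i unfolding N_def by (simp add: drop_prefix_word take_prefix_word)
      then have "prefix_word (length w) ((shift ^^ i) x) = prefix_word (length w) ((shift ^^ i) ?y)" using y(2) by simp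
      then show ?thesis using shift_closed[OF x] shift_closed[OF y(1)] unfolding g_def
        by (simp add: indicator_def cylinder_iff)
    qed
    then show ?thesis unfolding h_def G_def S.birkhoff_sum_def by simp
  qed
  have h0: "h u \<ge> 0" for u unfolding h_def by (rule G01)
  define W where "W = {u \<in> bounded_words N m2. hd u < m1 \<and> last u < m1}"
  have W: "finite W" "\<And>u. u \<in> W \<Longrightarrow> length u = N" unfolding W_def by simp (simp add: words_over_def)
  have Wne: "u \<noteq> []" if "u \<in> W" for u using W(2)[OF that] N by auto
  have Gm: "integrable (\<mu> s) (G n)"
  proof (rule S.integrable_const_bound[of _ 1])
    show "G n \<in> borel_measurable (\<mu> s)" unfolding G_def using S.birkhoff_sum_measurable[OF gm[OF s]] by simp
  qed (use G01 in auto)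
  have S_eq: "(\<Sum>u\<in>W. h u * measure (\<mu> s) (cylinder M u)) = (\<integral>x. (if prefix_word N x \<in> W then h (prefix_word N x) else 0) \<partial>\<mu> s)"
    by (rule S.sum_cylinders) (use W in auto)
  have S_sum: "(\<Sum>u\<in>W. h u * measure (\<mu> s) (cylinder M u)) \<le> (\<integral>x. G n x \<partial>\<mu> s)"
    unfolding S_eq
  proof (rule integral_mono[OF _ Gm])
    have "\<bar>if u \<in> W then h u else 0\<bar> \<le> 1" for u using G01[of "rep u"] by (auto simp: h_def)
    then show "integrable (\<mu> s) (\<lambda>x. if prefix_word N x \<in> W then h (prefix_word N x) else 0)"
      by (rule S.integrable_prefix_fun)
    fix x assume "x \<in> space (\<mu> s)"
    then have "x \<in> X" by simp
    then show "(if prefix_word N x \<in> W then h (prefix_word N x) else 0) \<le> G n x" using Gh h0 by simp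
  qed
  have "\<forall>\<^sub>F t in at s. \<forall>u\<in>W. nw t u \<le> 2 * nw s u"
    unfolding eventually_ball_finite_distrib[OF W(1)]
  proof
    fix u assume "u \<in> W"
    show "\<forall>\<^sub>F t in at s. nw t u \<le> 2 * nw s u"
    proof (cases "adm u")
      case True
      then have "nw s u < 2 * nw s u" using nw_pos by simp
      from order_tendstoD(2)[OF nw_tendsto[OF s] this] show ?thesis by eventually_elim simp
    qed (simp add: nw_not_adm)
  qed
  then show "\<forall>\<^sub>F t in at s. dist (measure (\<mu> t) (cylinder M w)) (measure (\<mu> s) (cylinder M w)) < e"
    using eventually_at_nhds[OF ev] eventually_at_nhds[OF m1] eventually_at_nhds[OF m2(2)]
  proof eventually_elim
    case (elim t)
    then have t: "t > 1" by blast
    interpret T: invariant_measure M f C B "\<mu> t" by (rule mu_invariant[OF t])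
    have intg: "integrable (\<mu> t) g" by (rule T.integrable_const_bound[of _ 1]) (use gm[OF t] in \<open>auto simp: g_def indicator_def\<close>)
    have int_avg: "(\<integral>x. T.birkhoff_sum g n x / real n \<partial>\<mu> t) = measure (\<mu> t) (cylinder M w)"
    proof -
      have "(\<integral>x. T.birkhoff_sum g n x \<partial>\<mu> t) = (\<Sum>i<n. \<integral>x. g ((shift ^^ i) x) \<partial>\<mu> t)"
        unfolding T.birkhoff_sum_def using T.integrable_shift[OF intg] by (intro Bochner_Integration.integral_sum)
      also have "\<dots> = real n * (\<integral>x. g x \<partial>\<mu> t)" using T.integral_shift[OF gm[OF t]] by simp
      also have "(\<integral>x. g x \<partial>\<mu> t) = measure (\<mu> t) (cylinder M w)"
        unfolding g_def using sets.Int_space_eq2[OF T.cylinder_sets_nu[of w]] by simp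
      finally show ?thesis using n by simp
    qed
    have int_b: "integrable (\<mu> t) (\<lambda>x. T.birkhoff_sum g n x / real n)"
      unfolding T.birkhoff_sum_def using T.integrable_shift[OF intg] by simp
    have "measure (\<mu> t) (cylinder M w) - p = (\<integral>x. T.birkhoff_sum g n x / real n - p \<partial>\<mu> t)"
      using int_b int_avg by (simp add: T.prob_space)
    then have 1: "\<bar>measure (\<mu> t) (cylinder M w) - p\<bar> \<le> (\<integral>x. G n x \<partial>\<mu> t)"
      unfolding G_def using integral_abs_bound by simp
    let ?B1 = "{x \<in> X. m1 \<le> x 0}" and ?B2 = "{x \<in> X. m1 \<le> x (N - 1)}"
    let ?I = "\<lambda>x. if prefix_word N x \<in> W then h (prefix_word N x) else 0"
    have Bs: "{x \<in> X. m \<le> x j} \<in> sets (\<mu> t)" for m j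
    proof -
      have "{x \<in> X. m \<le> x j} = (shift ^^ j) -` {x \<in> X. m \<le> x 0} \<inter> X" using shift_closed by (auto simp: shift_funpow)
      then show ?thesis
        using measurable_sets[OF T.funpow_shift_measurable_nu T.determined_sets_nu[OF T.letter_set_determined], of j "\<lambda>i. m \<le> i"] by simp
    qed
    have intB: "integrable (\<mu> t) (indicator {x \<in> X. m \<le> x j} :: _ \<Rightarrow> real)" for m j
      using Bs sets.Int_space_eq2[OF Bs] by (simp add: integrable_indicator_iff less_top[symmetric])
    have integB: "(\<integral>x. indicator {x \<in> X. m \<le> x j} x \<partial>\<mu> t) = measure (\<mu> t) {x \<in> X. m \<le> x 0}" for m j
      using sets.Int_space_eq2[OF Bs] T.letter_end_measure[of "\<lambda>i. m \<le> i" j] by simp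
    have "\<bar>if u \<in> W then h u else 0\<bar> \<le> 1" for u using G01[of "rep u"] by (auto simp: h_def)
    then have intI: "integrable (\<mu> t) ?I" by (rule T.integrable_prefix_fun)
    have "(\<integral>x. G n x \<partial>\<mu> t) \<le> (\<integral>x. ?I x + (indicator ?B1 x + (indicator ?B2 x + (\<Sum>j<N. indicator {x \<in> X. m2 \<le> x j} x))) \<partial>\<mu> t)"
    proof (rule integral_mono)
      show "integrable (\<mu> t) (G n)"
      proof (rule T.integrable_const_bound[of _ 1])
        show "G n \<in> borel_measurable (\<mu> t)" unfolding G_def using T.birkhoff_sum_measurable[OF gm[OF t]] by simp
      qed (use G01 in auto)
      show "integrable (\<mu> t) (\<lambda>x. ?I x + (indicator ?B1 x + (indicator ?B2 x + (\<Sum>j<N. indicator {x \<in> X. m2 \<le> x j} x))))"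
        using intI intB by (intro Bochner_Integration.integrable_add Bochner_Integration.integrable_sum) auto
      fix x assume "x \<in> space (\<mu> t)"
      then have x: "x \<in> X" by simp
      have s0: "0 \<le> (\<Sum>j<N. indicator {x \<in> X. m2 \<le> x j} x :: real)" by (intro sum_nonneg) auto
      have I0: "0 \<le> ?I x" using h0 by simp
      show "G n x \<le> ?I x + (indicator ?B1 x + (indicator ?B2 x + (\<Sum>j<N. indicator {x \<in> X. m2 \<le> x j} x)))"
      proof (cases "prefix_word N x \<in> W")
        case True
        have "G n x = ?I x" using True Gh[OF x] by simp
        then show ?thesis using s0 by simp
      next
        case False
        have ne: "prefix_word N x \<noteq> []" using N by (auto simp: prefix_word_def)
        have ends: "hd (prefix_word N x) = x 0" "last (prefix_word N x) = x (N - 1)"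
          using ne N by (auto simp: hd_conv_nth last_conv_nth)
        consider "m1 \<le> x 0" | "m1 \<le> x (N - 1)" | j where "j < N" "m2 \<le> x j"
          using False ends unfolding W_def words_over_def prefix_word_def by (fastforce simp: not_less)
        then show ?thesis
        proof cases
          case 1
          then have "indicator ?B1 x = (1::real)" using x by simp
          then show ?thesis using s0 I0 G01(2)[of x] indicator_pos_le[of ?B2 x, where 'a = real] by linarith
        next
          case 2
          then have "indicator ?B2 x = (1::real)" using x by simp
          then show ?thesis using s0 I0 G01(2)[of x] indicator_pos_le[of ?B1 x, where 'a = real] by linarith
        next
          case 3
          have "indicator {x \<in> X. m2 \<le> x j} x \<le> (\<Sum>j<N. indicator {x \<in> X. m2 \<le> x j} x :: real)"
            using 3 by (intro member_le_sum) auto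
          then have "(1::real) \<le> (\<Sum>j<N. indicator {x \<in> X. m2 \<le> x j} x)" using 3 x by simp
          then show ?thesis using I0 G01(2)[of x] indicator_pos_le[of ?B1 x, where 'a = real] indicator_pos_le[of ?B2 x, where 'a = real] by linarith
        qed
      qed
    qed
    also have "\<dots> = (\<integral>x. ?I x \<partial>\<mu> t) + (measure (\<mu> t) ?B1 + (measure (\<mu> t) ?B1 + real N * measure (\<mu> t) {x \<in> X. m2 \<le> x 0}))"
      using intI intB integB by simp
    also have "(\<integral>x. ?I x \<partial>\<mu> t) = (\<Sum>u\<in>W. h u * measure (\<mu> t) (cylinder M u))"
      by (rule T.sum_cylinders[OF W, symmetric])
    finally have 2: "(\<integral>x. G n x \<partial>\<mu> t) \<le> (\<Sum>u\<in>W. h u * measure (\<mu> t) (cylinder M u))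
       + (measure (\<mu> t) ?B1 + (measure (\<mu> t) ?B1 + real N * measure (\<mu> t) {x \<in> X. m2 \<le> x 0}))" .
    have "(\<Sum>u\<in>W. h u * measure (\<mu> t) (cylinder M u)) \<le> (\<Sum>u\<in>W. (2 * k / c) * (h u * measure (\<mu> s) (cylinder M u)))"
    proof (rule sum_mono)
      fix u assume u: "u \<in> W"
      have "measure (\<mu> t) (cylinder M u) \<le> k * nw t u" using elim Wne[OF u] unfolding gibbs_dominated_def by blast
      also have "\<dots> \<le> k * (2 * nw s u)" using elim u k by (intro mult_left_mono) auto
      also have "\<dots> = (2 * k / c) * (c * nw s u)" using c by simp
      also have "\<dots> \<le> (2 * k / c) * measure (\<mu> s) (cylinder M u)"
        using c(2)[of u] Wne[OF u] u k c(1) by (intro mult_left_mono) (auto simp: W_def)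
      finally have "h u * measure (\<mu> t) (cylinder M u) \<le> h u * ((2 * k / c) * measure (\<mu> s) (cylinder M u))"
        using h0 by (rule mult_left_mono)
      then show "h u * measure (\<mu> t) (cylinder M u) \<le> (2 * k / c) * (h u * measure (\<mu> s) (cylinder M u))"
        by (simp only: mult_ac)
    qed
    also have "\<dots> = (2 * k / c) * (\<Sum>u\<in>W. h u * measure (\<mu> s) (cylinder M u))" by (simp add: sum_distrib_left)
    also have "\<dots> \<le> (2 * k / c) * (e * c / (8 * k))" using S_sum n(2) k c by (intro mult_left_mono) auto
    also have "\<dots> = e / 4" using k c by simp
    finally have 3: "(\<Sum>u\<in>W. h u * measure (\<mu> t) (cylinder M u)) \<le> e / 4" .
    have "real N * measure (\<mu> t) {x \<in> X. m2 \<le> x 0} \<le> real N * (e / (8 * real N))" using elim by (intro mult_left_mono) auto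
    also have "\<dots> = e / 8" using N by simp
    finally have "\<bar>measure (\<mu> t) (cylinder M w) - p\<bar> < e" using 1 2 3 elim(3) e by linarith
    then show ?case unfolding p_def dist_real_def .
  qed
qed

text \<open>The nonnegative function \<open>g + R\<close> is approximated from below by its infima
  over cylinders of length \<open>n\<close>, then by finitely many of these cylinders. The integrals
  of the resulting finite combinations with nonnegative coefficients converge, which gives one half
  of weak convergence.\<close>

lemma weak_lower:
  assumes s: "s > 1" and cont: "continuous_map (shift_topology M) euclideanreal g"
    and R: "\<And>x. x \<in> X \<Longrightarrow> \<bar>g x\<bar> \<le> R" and e: "e > 0"
  shows "\<forall>\<^sub>F t in at s. (\<integral>x. g x \<partial>\<mu> s) - e < (\<integral>x. g x \<partial>\<mu> t)"
proof -
  interpret S: invariant_measure M f C B "\<mu> s" by (rule mu_invariant[OF s])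
  define g0 where "g0 x = g x + R" for x
  have g0: "0 \<le> g0 x" "g0 x \<le> 2 * R" if "x \<in> X" for x using R[OF that] unfolding g0_def by (auto simp: abs_le_iff)
  have R0: "R \<ge> 0" using R S.not_empty by fastforce
  have gm: "g0 \<in> borel_measurable (\<mu> t)" if "t > 1" for t
    using invariant_measure.measurable_nu[OF mu_invariant[OF that] continuous_map_measurable[OF cont]] unfolding g0_def by simp
  \<comment> \<open>The value 0 replaces the infimum over the empty cylinder of an inadmissible
    word.\<close>
  define h where "h u = (if adm u then Inf (g0 ` cylinder M u) else 0)" for u
  have bdd: "bdd_below (g0 ` cylinder M u)" for u
    using g0 by (intro bdd_belowI[of _ 0]) (auto simp: cylinder_def)
  have h0: "0 \<le> h u" for u
  proof (cases "adm u")
    case True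
    then have "cylinder M u \<noteq> {}" using adm_nonempty by blast
    then have "0 \<le> Inf (g0 ` cylinder M u)" using g0 by (intro cINF_greatest) (auto simp: cylinder_def)
    then show ?thesis using True by (simp add: h_def)
  qed (simp add: h_def)
  have h_le: "h (prefix_word n x) \<le> g0 x" if x: "x \<in> X" for n x
    unfolding h_def using adm_prefix_word[OF x, of n] x bdd by (auto intro!: cINF_lower simp: cylinder_iff)
  have h_abs: "\<bar>h u\<bar> \<le> 2 * R" for u
  proof (cases "adm u")
    case True
    have "h u \<le> g0 (rep u)" using h_le[of "rep u" "length u"] rep[OF True] by simp
    then show ?thesis using h0[of u] g0(2)[of "rep u"] rep[OF True] by simp
  qed (use R0 in \<open>simp add: h_def\<close>)
  have h_lim: "(\<lambda>n. h (prefix_word n x)) \<longlonglongrightarrow> g0 x" if x: "x \<in> X" for x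
  proof (rule tendstoI)
    fix \<epsilon> :: real assume \<epsilon>: "\<epsilon> > 0"
    have "openin (shift_topology M) {y \<in> X. g y \<in> {g x - \<epsilon> / 2<..}}"
      using openin_continuous_map_preimage[OF cont, of "{g x - \<epsilon> / 2<..}"] by simp
    moreover have "x \<in> {y \<in> X. g y \<in> {g x - \<epsilon> / 2<..}}" using x \<epsilon> by simp
    ultimately obtain k where k: "cylinder M (prefix_word k x) \<subseteq> {y \<in> X. g y \<in> {g x - \<epsilon> / 2<..}}"
      using openin_contains_cylinder by blast
    show "\<forall>\<^sub>F n in sequentially. dist (h (prefix_word n x)) (g0 x) < \<epsilon>"
      using eventually_ge_at_top[of k]
    proof eventually_elim
      case (elim n)
      have xc: "x \<in> cylinder M (prefix_word n x)" using x by (simp add: cylinder_iff)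
      have "g0 x - \<epsilon> / 2 \<le> g0 y" if "y \<in> cylinder M (prefix_word n x)" for y
      proof -
        have "y \<in> X" "prefix_word n y = prefix_word n x" using that by (auto simp: cylinder_iff)
        then have "y \<in> cylinder M (prefix_word k x)" using prefix_word_eq_mono[OF _ elim, of y x] by (simp add: cylinder_iff)
        then show ?thesis using k unfolding g0_def by auto
      qed
      then have "g0 x - \<epsilon> / 2 \<le> h (prefix_word n x)"
        unfolding h_def using adm_prefix_word[OF x, of n] xc by (auto intro!: cINF_greatest)
      then show ?case using h_le[OF x, of n] \<epsilon> unfolding dist_real_def by simp
    qed
  qed
  have "(\<lambda>n. \<integral>x. h (prefix_word n x) \<partial>\<mu> s) \<longlonglongrightarrow> (\<integral>x. g0 x \<partial>\<mu> s)"
    by (rule integral_dominated_convergence[where w = "\<lambda>_. 2 * R"])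
       (use h_abs h_lim gm[OF s] S.prefix_fun_borel in \<open>auto intro!: AE_I2\<close>)
  moreover have "(\<integral>x. g0 x \<partial>\<mu> s) - e / 2 < (\<integral>x. g0 x \<partial>\<mu> s)" using e by simp
  ultimately have "\<forall>\<^sub>F n in sequentially. (\<integral>x. g0 x \<partial>\<mu> s) - e / 2 < (\<integral>x. h (prefix_word n x) \<partial>\<mu> s)"
    by (rule order_tendstoD(1))
  then obtain n where n: "(\<integral>x. g0 x \<partial>\<mu> s) - e / 2 < (\<integral>x. h (prefix_word n x) \<partial>\<mu> s)"
    by (auto simp: eventually_sequentially)
  let ?W = "bounded_words n"
  have "(\<lambda>N. \<integral>x. (if prefix_word n x \<in> ?W N then h (prefix_word n x) else 0) \<partial>\<mu> s) \<longlonglongrightarrow> (\<integral>x. h (prefix_word n x) \<partial>\<mu> s)"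
  proof (rule integral_dominated_convergence[where w = "\<lambda>_. 2 * R"])
    show "AE x in \<mu> s. (\<lambda>N. if prefix_word n x \<in> ?W N then h (prefix_word n x) else 0) \<longlonglongrightarrow> h (prefix_word n x)"
    proof (rule AE_I2)
      fix x
      obtain N0 where N0: "{prefix_word n x} \<subseteq> ?W N0"
        by (rule finite_words_bounded[of "{prefix_word n x}" n 0]) auto
      have "\<forall>\<^sub>F N in sequentially. (if prefix_word n x \<in> ?W N then h (prefix_word n x) else 0) = h (prefix_word n x)"
        using eventually_ge_at_top[of N0]
      proof eventually_elim
        case (elim N)
        then show ?case using N0 bounded_words_mono[OF elim, of n] by auto
      qed
      then show "(\<lambda>N. if prefix_word n x \<in> ?W N then h (prefix_word n x) else 0) \<longlonglongrightarrow> h (prefix_word n x)"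
        by (rule tendsto_eventually)
    qed
    show "AE x in \<mu> s. norm (if prefix_word n x \<in> ?W N then h (prefix_word n x) else 0) \<le> 2 * R" for N
      using h_abs R0 by (intro AE_I2) auto
    show "(\<lambda>x. if prefix_word n x \<in> ?W N then h (prefix_word n x) else 0) \<in> borel_measurable (\<mu> s)" for N
      by (rule S.prefix_fun_borel[of "\<lambda>u. if u \<in> ?W N then h u else 0"])
  qed (use S.prefix_fun_borel in auto)
  from order_tendstoD(1)[OF this n]
  obtain N where N: "(\<integral>x. g0 x \<partial>\<mu> s) - e / 2 < (\<integral>x. (if prefix_word n x \<in> ?W N then h (prefix_word n x) else 0) \<partial>\<mu> s)"
    by (auto simp: eventually_sequentially)
  have W: "finite (?W N)" "\<And>u. u \<in> ?W N \<Longrightarrow> length u = n" by simp (simp add: words_over_def)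
  have S_eq: "(\<Sum>u\<in>?W N. h u * measure (\<mu> s) (cylinder M u))
      = (\<integral>x. (if prefix_word n x \<in> ?W N then h (prefix_word n x) else 0) \<partial>\<mu> s)"
    by (rule S.sum_cylinders) (use W in auto)
  have "((\<lambda>t. \<Sum>u\<in>?W N. h u * measure (\<mu> t) (cylinder M u)) \<longlongrightarrow> (\<Sum>u\<in>?W N. h u * measure (\<mu> s) (cylinder M u))) (at s)"
    by (intro tendsto_intros cylinder_tendsto[OF s])
  from order_tendstoD(1)[OF this, of "(\<integral>x. g0 x \<partial>\<mu> s) - e / 2"]
  have "\<forall>\<^sub>F t in at s. (\<integral>x. g0 x \<partial>\<mu> s) - e / 2 < (\<Sum>u\<in>?W N. h u * measure (\<mu> t) (cylinder M u))"
    using N S_eq by simp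
  moreover have "\<forall>\<^sub>F t in at s. t > 1"
    using eventually_at_gt[OF s] .
  ultimately show ?thesis
  proof eventually_elim
    case (elim t)
    interpret T: invariant_measure M f C B "\<mu> t" by (rule mu_invariant[OF elim(2)])
    have intg: "integrable (\<mu> t) g0"
      by (rule T.integrable_const_bound[of _ "2 * R"]) (use g0 gm[OF elim(2)] in auto)
    have intS: "integrable (\<mu> s) g0"
      by (rule S.integrable_const_bound[of _ "2 * R"]) (use g0 gm[OF s] in auto)
    have eq: "g = (\<lambda>x. g0 x - R)" unfolding g0_def by simp
    have T_eq: "(\<Sum>u\<in>?W N. h u * measure (\<mu> t) (cylinder M u))
        = (\<integral>x. (if prefix_word n x \<in> ?W N then h (prefix_word n x) else 0) \<partial>\<mu> t)"
      by (rule T.sum_cylinders) (use W in auto)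
    have "(\<Sum>u\<in>?W N. h u * measure (\<mu> t) (cylinder M u)) \<le> (\<integral>x. g0 x \<partial>\<mu> t)"
      unfolding T_eq
    proof (rule integral_mono[OF _ intg])
      have "\<bar>if u \<in> ?W N then h u else 0\<bar> \<le> 2 * R" for u using h_abs R0 by simp
      then show "integrable (\<mu> t) (\<lambda>x. if prefix_word n x \<in> ?W N then h (prefix_word n x) else 0)"
        by (rule T.integrable_prefix_fun)
      fix x assume "x \<in> space (\<mu> t)"
      then show "(if prefix_word n x \<in> ?W N then h (prefix_word n x) else 0) \<le> g0 x"
        using h_le[of x n] g0(1)[of x] by simp
    qed
    then have "(\<integral>x. g0 x \<partial>\<mu> s) - e / 2 < (\<integral>x. g0 x \<partial>\<mu> t)" using elim(1) by simp
    then show ?case unfolding eq using intg intS e by (simp add: S.prob_space T.prob_space)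
  qed
qed

lemma weak_tendsto:
  assumes s: "s > 1" and cont: "continuous_map (shift_topology M) euclideanreal g"
    and R: "\<And>x. x \<in> X \<Longrightarrow> \<bar>g x\<bar> \<le> R"
  shows "((\<lambda>t. \<integral>x. g x \<partial>\<mu> t) \<longlongrightarrow> (\<integral>x. g x \<partial>\<mu> s)) (at s)"
proof (rule tendstoI)
  fix e :: real assume e: "e > 0"
  have "continuous_map (shift_topology M) euclideanreal (\<lambda>x. - g x)" using cont by (rule continuous_map_minus)
  then have "\<forall>\<^sub>F t in at s. (\<integral>x. - g x \<partial>\<mu> s) - e < (\<integral>x. - g x \<partial>\<mu> t)"
    by (rule weak_lower[OF s _ _ e]) (use R in simp)
  moreover have "\<forall>\<^sub>F t in at s. (\<integral>x. g x \<partial>\<mu> s) - e < (\<integral>x. g x \<partial>\<mu> t)"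
    by (rule weak_lower[OF s cont R e])
  ultimately show "\<forall>\<^sub>F t in at s. dist (\<integral>x. g x \<partial>\<mu> t) (\<integral>x. g x \<partial>\<mu> s) < e"
    by eventually_elim (simp add: dist_real_def abs_less_iff)
qed

text \<open>Unbounded below, \<open>f n\<close> is no test function for weak convergence; its
  truncations are, and by uniform integrability their error is small for all \<open>t\<close> near
  \<open>s\<close>, including \<open>s\<close>.\<close>

lemma integral_potential_tendsto:
  assumes s: "s > 1" and n: "n \<ge> 1"
  shows "((\<lambda>t. \<integral>x. f n x \<partial>\<mu> t) \<longlongrightarrow> (\<integral>x. f n x \<partial>\<mu> s)) (at s)"
proof (rule tendstoI)
  fix e :: real assume e: "e > 0"
  define \<epsilon> where "\<epsilon> = e / (3 * real n)"
  have \<epsilon>: "\<epsilon> > 0" unfolding \<epsilon>_def using e n by simp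
  obtain R where R: "\<forall>\<^sub>F t in nhds s. (\<integral>\<^sup>+x. ennreal (max 0 (- R - word_pot [x 0])) \<partial>\<mu> t) \<le> ennreal \<epsilon>"
    using uniform_integrability[OF s \<epsilon>] by blast
  define T where "T x = max (f n x) (- (real n * (R + B + C)))" for x
  have err: "\<bar>(\<integral>x. T x \<partial>\<mu> t) - (\<integral>x. f n x \<partial>\<mu> t)\<bar> \<le> e / 3"
    if t: "t > 1" and b: "(\<integral>\<^sup>+x. ennreal (max 0 (- R - word_pot [x 0])) \<partial>\<mu> t) \<le> ennreal \<epsilon>" for t
  proof -
    interpret invariant_measure M f C B "\<mu> t" by (rule mu_invariant[OF t])
    have "real n * \<epsilon> = e / 3" unfolding \<epsilon>_def using n by simp
    then show ?thesis using truncation_integral_le[OF mu_integrable[OF t] n b] \<epsilon> unfolding T_def by simp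
  qed
  obtain c where c: "\<forall>x\<in>X. f (Suc (n - 1)) x \<le> c" using potential_upper_bound by blast
  have "continuous_map (shift_topology M) euclideanreal T"
    unfolding T_def using continuous n unfolding continuous_potential_def
    by (intro continuous_map_real_max) auto
  moreover have "\<bar>T x\<bar> \<le> \<bar>c\<bar> + \<bar>real n * (R + B + C)\<bar>" if "x \<in> X" for x
    using c[rule_format, OF that] n unfolding T_def by (auto simp: max_def abs_if)
  ultimately have "((\<lambda>t. \<integral>x. T x \<partial>\<mu> t) \<longlongrightarrow> (\<integral>x. T x \<partial>\<mu> s)) (at s)" by (rule weak_tendsto[OF s])
  then have "\<forall>\<^sub>F t in at s. dist (\<integral>x. T x \<partial>\<mu> t) (\<integral>x. T x \<partial>\<mu> s) < e / 3" using e by (intro tendstoD) auto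
  moreover have "\<forall>\<^sub>F t in at s. t > 1" using eventually_at_gt[OF s] .
  ultimately show "\<forall>\<^sub>F t in at s. dist (\<integral>x. f n x \<partial>\<mu> t) (\<integral>x. f n x \<partial>\<mu> s) < e"
    using eventually_at_nhds[OF R]
  proof eventually_elim
    case (elim t)
    have "\<bar>(\<integral>x. T x \<partial>\<mu> t) - (\<integral>x. f n x \<partial>\<mu> t)\<bar> \<le> e / 3" by (rule err[OF elim(2,3)])
    moreover have "\<bar>(\<integral>x. T x \<partial>\<mu> s) - (\<integral>x. f n x \<partial>\<mu> s)\<bar> \<le> e / 3"
      by (rule err[OF s eventually_nhds_x_imp_x[OF R]])
    ultimately show ?case using elim(1) unfolding dist_real_def by linarith
  qed
qed

text \<open>The functions \<open>(\<integral>x. f n x \<partial>\<mu> t) / n\<close> differ from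
  \<open>lyap t\<close> by at most \<open>C / n\<close>, uniformly in \<open>t\<close>, so
  continuity passes to the limit.\<close>

lemma lyap_tendsto:
  assumes s: "s > 1"
  shows "(lyap \<longlongrightarrow> lyap s) (at s)"
proof (rule tendstoI)
  fix e :: real assume e: "e > 0"
  obtain n0 :: nat where n0: "real n0 > 3 * C / e" using reals_Archimedean2 by blast
  define n where "n = Suc n0"
  have n: "n \<ge> 1" "C / real n < e / 3"
  proof -
    have "3 * C < e * real n0" using n0 e by (simp add: field_simps)
    also have "\<dots> \<le> e * real n" unfolding n_def using e by simp
    finally show "C / real n < e / 3" unfolding n_def using e by (simp add: field_simps)
    show "n \<ge> 1" unfolding n_def by simp
  qed
  have err: "\<bar>(\<integral>x. f n x \<partial>\<mu> t) / real n - lyap t\<bar> \<le> C / real n" if t: "t > 1" for t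
  proof -
    have "\<bar>(\<integral>x. f n x \<partial>\<mu> t) - real n * lyap t\<bar> \<le> C"
      unfolding lyap_def by (rule invariant_measure.asymptotic_mean_eq(2)[OF mu_invariant[OF t] mu_integrable[OF t] n(1)])
    moreover have "(\<integral>x. f n x \<partial>\<mu> t) / real n - lyap t = ((\<integral>x. f n x \<partial>\<mu> t) - real n * lyap t) / real n"
      using n by (simp add: field_simps)
    ultimately show ?thesis using n by (simp add: abs_divide divide_right_mono)
  qed
  have "((\<lambda>t. (\<integral>x. f n x \<partial>\<mu> t) / real n) \<longlongrightarrow> (\<integral>x. f n x \<partial>\<mu> s) / real n) (at s)"
    by (intro tendsto_intros integral_potential_tendsto[OF s n(1)]) (use n in simp)
  then have "\<forall>\<^sub>F t in at s. dist ((\<integral>x. f n x \<partial>\<mu> t) / real n) ((\<integral>x. f n x \<partial>\<mu> s) / real n) < e / 3"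
    using e by (intro tendstoD) auto
  moreover have "\<forall>\<^sub>F t in at s. t > 1" using eventually_at_gt[OF s] .
  ultimately show "\<forall>\<^sub>F t in at s. dist (lyap t) (lyap s) < e"
  proof eventually_elim
    case (elim t)
    then show ?case using err[OF elim(2)] err[OF s] n(2) unfolding dist_real_def by linarith
  qed
qed

text \<open>The subgradients at \<open>s\<close> and \<open>t\<close> enclose the difference
  quotient between \<open>lyap s\<close> and \<open>lyap t\<close>, and the latter converges to the
  former.\<close>

lemma press_derivative:
  assumes s: "s > 1"
  shows "(press has_real_derivative lyap s) (at s)"
  unfolding has_field_derivative_iff
proof (rule Lim_null[THEN iffD2], rule Lim_null_comparison)
  show "\<forall>\<^sub>F t in at s. norm ((press t - press s) / (t - s) - lyap s) \<le> \<bar>lyap t - lyap s\<bar>"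
    using eventually_at_gt[OF s] eventually_neq_at_within[of s s UNIV]
  proof eventually_elim
    case (elim t)
    have 1: "press s + (t - s) * lyap s \<le> press t" "press t + (s - t) * lyap t \<le> press s"
      using subgradient[OF s elim(1)] subgradient[OF elim(1) s] by auto
    show ?case
    proof (cases "t > s")
      case True
      then have "lyap s \<le> (press t - press s) / (t - s)" "(press t - press s) / (t - s) \<le> lyap t"
        using 1 by (simp_all add: field_simps)
      then show ?thesis by simp
    next
      case False
      then have "t < s" using elim by simp
      then have "lyap t \<le> (press t - press s) / (t - s)" "(press t - press s) / (t - s) \<le> lyap s"
        using 1 by (simp_all add: field_simps)
      then show ?thesis by simp
    qed
  qed
  have "((\<lambda>t. \<bar>lyap t - lyap s\<bar>) \<longlongrightarrow> \<bar>lyap s - lyap s\<bar>) (at s)" by (intro tendsto_intros lyap_tendsto[OF s])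
  then show "((\<lambda>t. \<bar>lyap t - lyap s\<bar>) \<longlongrightarrow> 0) (at s)" by simp
qed

section \<open>Strict convexity of the pressure and decrease of the entropy\<close>

lemma lyap_continuous: "continuous_on {1<..} lyap"
  by (intro continuous_at_imp_continuous_on) (auto simp: isCont_def intro: lyap_tendsto)

text \<open>Strictness comes from an intermediate point: the subgradient at \<open>z\<close> is used
  up to the midpoint and the one at the midpoint from there on, and the means at the two points
  differ.\<close>

lemma press_strict_subgradient:
  assumes "x > 1" "z > 1" "x \<noteq> z"
  shows "press z + (x - z) * lyap z < press x"
proof -
  define m where "m = (x + z) / 2"
  have m: "m > 1" unfolding m_def using assms by simp
  have "press z + (m - z) * lyap z \<le> press m" "press m + (x - m) * lyap m \<le> press x"
    using subgradient m assms by auto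
  moreover have "(x - m) * lyap z < (x - m) * lyap m"
  proof (cases "z < x")
    case True
    then have "z < m" "m < x" unfolding m_def by auto
    then show ?thesis using lyap_strict_mono[of z m] assms by simp
  next
    case False
    then have "m < z" "x < m" using assms unfolding m_def by auto
    then show ?thesis using lyap_strict_mono[of m z] m by simp
  qed
  ultimately show ?thesis by (simp add: algebra_simps)
qed

text \<open>Two strict supporting inequalities at the intermediate point, averaged with weights
  \<open>u\<close> and \<open>v\<close>; the linear terms cancel.\<close>

lemma press_strictly_convex: "strictly_convex_on {1<..} press"
  unfolding strictly_convex_on_def
proof (intro conjI ballI allI impI)
  show "convex {1::real<..}" by (rule convex_real_interval)
  fix x y u v :: real
  assume xy: "x \<in> {1<..}" "y \<in> {1<..}" and uv: "x \<noteq> y \<and> 0 < u \<and> 0 < v \<and> u + v = 1"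
  define z where "z = u * x + v * y"
  have v: "v = 1 - u" using uv by simp
  have zx: "x - z = v * (x - y)" "y - z = u * (y - x)" unfolding z_def v by (auto simp: algebra_simps)
  have "u * 1 + v * 1 < u * x + v * y" using xy uv by (intro add_strict_mono mult_strict_left_mono) auto
  then have z: "z > 1" using uv unfolding z_def by simp
  have ne: "x \<noteq> z" "y \<noteq> z" using zx uv by auto
  have "u * (press z + (x - z) * lyap z) < u * press x" "v * (press z + (y - z) * lyap z) < v * press y"
    using press_strict_subgradient[of x z] press_strict_subgradient[of y z] xy z ne uv by auto
  moreover have "u * (press z + (x - z) * lyap z) + v * (press z + (y - z) * lyap z) = press z"
    unfolding zx v by (simp add: algebra_simps)
  ultimately show "press (u * x + v * y) < u * press x + v * press y" unfolding z_def by linarith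
qed

text \<open>The subgradient inequality reads \<open>ent t \<le> press s - s * lyap t\<close>, and
  the mean at \<open>t\<close> is larger than the one at \<open>s\<close>.\<close>

lemma ent_strict_antimono:
  assumes "1 < s" "s < t"
  shows "ent t < ent s"
proof -
  have "press t + (s - t) * lyap t \<le> press s" using subgradient[of t s] assms by simp
  moreover have "s * lyap s < s * lyap t" using lyap_strict_mono[OF assms] assms by simp
  ultimately show ?thesis unfolding ent_def by (simp add: algebra_simps)
qed

end

theorem theorem1p2:
  fixes M :: "nat \<Rightarrow> nat \<Rightarrow> nat"
    and f :: potential
    and \<mu> :: "real \<Rightarrow> (nat \<Rightarrow> nat) measure"
  assumes "transition_matrix M"
    and "topologically_mixing M"
    and "continuous_potential M f"
    and "almost_additive M f"
    and "summable_potential M f"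
    and "bounded_variation M f"
    and "\<And>t. t > 1 \<Longrightarrow> equilibrium_state M f t (\<mu> t)"
  shows "\<exists>P L H :: real \<Rightarrow> real.
    (\<forall>t>1. gurevich_pressure M (scale_potential t f) = ereal (P t) \<and>
           asymptotic_mean f (\<mu> t) = ereal (L t) \<and>
           ks_entropy (\<mu> t) shift = ereal (H t)) \<and>
    (P C1_differentiable_on {1<..} \<and> strictly_convex_on {1<..} P \<and>
     (\<forall>t>1. (P has_real_derivative L t) (at t))) \<and>
    (continuous_on {1<..} (\<lambda>t. - L t) \<and> strict_antimono_on {1<..} (\<lambda>t. - L t) \<and>
     continuous_on {1<..} H \<and> strict_antimono_on {1<..} H \<and>
     (\<forall>s>1. weak_limit M \<mu> (\<mu> s) (at s within {1<..})))"
proof -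
  obtain C where C: "C \<ge> 0" "\<And>n m x. n \<ge> 1 \<Longrightarrow> m \<ge> 1 \<Longrightarrow> x \<in> markov_shift M \<Longrightarrow>
      f n x + f m ((shift ^^ n) x) - C \<le> f (n + m) x \<and> f (n + m) x \<le> f n x + f m ((shift ^^ n) x) + C"
    using assms(4) unfolding almost_additive_def by blast
  obtain B where B: "B \<ge> 0" "\<And>n x y. n \<ge> 1 \<Longrightarrow> x \<in> markov_shift M \<Longrightarrow> y \<in> markov_shift M \<Longrightarrow>
      (\<forall>i<n. x i = y i) \<Longrightarrow> \<bar>f n x - f n y\<bar> \<le> B"
    using assms(6) unfolding bounded_variation_def by blast
  interpret equilibrium_family M f C B \<mu>
  proof unfold_locales
    show "\<bar>f (n + m) x - (f n x + f m ((shift ^^ n) x))\<bar> \<le> C"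
      if "n \<ge> 1" "m \<ge> 1" "x \<in> markov_shift M" for n m x
      using C(2)[OF that] by (simp add: abs_le_iff)
  qed (use assms C(1) B in auto)
  have deriv: "\<forall>t>1. (press has_real_derivative lyap t) (at t)" using press_derivative by blast
  have C1: "press C1_differentiable_on {1<..}"
    unfolding C1_differentiable_on_def
    using deriv lyap_continuous by (intro exI[of _ lyap]) (auto simp: has_real_derivative_iff_has_vector_derivative)
  have "continuous_on {1<..} press"
    using deriv by (intro continuous_at_imp_continuous_on) (auto dest: DERIV_isCont)
  then have cont_ent: "continuous_on {1<..} ent"
    unfolding ent_def by (intro continuous_intros lyap_continuous)
  have weak: "weak_limit M \<mu> (\<mu> s) (at s within {1<..})" if "s > 1" for s
    unfolding weak_limit_def
  proof (intro allI impI)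
    fix g assume g: "continuous_map (shift_topology M) euclideanreal g \<and> bounded (g ` markov_shift M)"
    then obtain R where R: "\<And>x. x \<in> X \<Longrightarrow> \<bar>g x\<bar> \<le> R" unfolding bounded_iff by auto
    have "at s within {1<..} = at s" using that by (intro at_within_open) auto
    then show "((\<lambda>t. \<integral>x. g x \<partial>\<mu> t) \<longlongrightarrow> (\<integral>x. g x \<partial>\<mu> s)) (at s within {1<..})"
      using weak_tendsto[OF that conjunct1[OF g] R] by simp
  qed
  show ?thesis
    using pressure(1) mu_mean mu_entropy C1 press_strictly_convex deriv cont_ent weak
      continuous_on_minus[OF lyap_continuous] lyap_strict_mono ent_strict_antimono
    by (intro exI[of _ press] exI[of _ lyap] exI[of _ ent]) (auto intro!: monotone_onI)
qed

end
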